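(* Let $M>0$, $K=[-M,M]$, and let $u_0\in L^1(\mathbb{R})\cap L^\infty(\mathbb{R})$ with $|u_0|\le M$. Let $f\in C^1(\mathbb{R},\mathbb{R})$, $a=f'$, and assume that the degeneracy $p$ of $f$ on $K$ is finite, with $$0<\inf_{u,v\in K,\,u\neq v}\frac{|a(u)-a(v)|}{|u-v|^p},$$ and set $s=1/p$. Let $u$ be the unique entropy solution on $]0,+\infty[_t\times\mathbb{R}_x$ of $$\partial_tu+\partial_xf(u)=0,\qquad u(0,x)=u_0(x),$$ and let $b$ be the inverse function of $a$ on $a(K)$. If there exists $q>0$ such that $$0<\inf_{U\in a(K),\,U\ne a(0)}\frac{|b(U)|}{|U-a(0)|^q},$$ then there exists $C>0$ such that, for all $t>0$ and almost all $x\in\mathbb{R}$, $$|u(t,x)|\le\frac{C}{t^{d}},\qquad d=\frac{s}{1+q}.$$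
   Context: The degeneracy of $f$ on an interval $K$ is the lowest real number $p$, if it exists, such that $0<\inf_{u,v\in K,\,u\ne v}\frac{|a(u)-a(v)|}{|u-v|^p}$ with $a=f'$; if no such real $p$ exists, $p=+\infty$. This condition forces $a$ to be strictly monotone on $K$, so $a:K\to a(K)$ is invertible. Entropy solution means the usual (Kruzhkov) entropy solution of the scalar conservation law. *)

theory Defs
  imports "HOL-Analysis.Analysis"
begin

section \<open>Degeneracy of a flux\<close>

text \<open>
  Only meaningful when \<open>K\<close> has at least two points: then the infimum ranges over a nonempty
  set of nonnegative reals.
\<close>

definition degeneracy_inf :: "(real \<Rightarrow> real) \<Rightarrow> real set \<Rightarrow> real \<Rightarrow> real" where
  "degeneracy_inf f K p =
     (INF (u, v) \<in> {(u, v). u \<in> K \<and> v \<in> K \<and> u \<noteq> v}.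
        \<bar>deriv f u - deriv f v\<bar> / \<bar>u - v\<bar> powr p)"

definition degeneracy :: "(real \<Rightarrow> real) \<Rightarrow> real set \<Rightarrow> ereal" where
  "degeneracy f K =
     (if \<exists>p. 0 < degeneracy_inf f K p \<and> (\<forall>p'. 0 < degeneracy_inf f K p' \<longrightarrow> p \<le> p')
      then ereal (LEAST p. 0 < degeneracy_inf f K p)
      else \<infinity>)"

section \<open>Entropy solutions\<close>

text \<open>
  In the next definition \<open>D i j\<close> is the mixed partial derivative of order \<open>i\<close> in the first
  and \<open>j\<close> in the second variable.
\<close>

definition smooth_plane :: "(real \<times> real \<Rightarrow> real) \<Rightarrow> bool" where
  "smooth_plane \<phi> \<longleftrightarrow>
     (\<exists>D :: nat \<Rightarrow> nat \<Rightarrow> real \<times> real \<Rightarrow> real.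
        D 0 0 = \<phi> \<and>
        (\<forall>i j z. (D i j has_derivative
                   (\<lambda>h. fst h * D (Suc i) j z + snd h * D i (Suc j) z)) (at z)))"

definition test_function :: "(real \<times> real) set \<Rightarrow> (real \<times> real \<Rightarrow> real) \<Rightarrow> bool" where
  "test_function \<Omega> \<phi> \<longleftrightarrow>
     smooth_plane \<phi> \<and> compact (closure {z. \<phi> z \<noteq> 0}) \<and> closure {z. \<phi> z \<noteq> 0} \<subseteq> \<Omega>"

definition kruzhkov_inequality ::
  "(real \<Rightarrow> real) \<Rightarrow> (real \<Rightarrow> real \<Rightarrow> real) \<Rightarrow> real \<Rightarrow> (real \<times> real \<Rightarrow> real) \<Rightarrow> bool" where
  "kruzhkov_inequality f u k \<phi> \<longleftrightarrow>
     0 \<le> (LINT z:{0<..} \<times> UNIV|lebesgue.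
            (case z of (t, x) \<Rightarrow>
               \<bar>u t x - k\<bar> * deriv (\<lambda>\<tau>. \<phi> (\<tau>, x)) t
               + sgn (u t x - k) * (f (u t x) - f k) * deriv (\<lambda>\<xi>. \<phi> (t, \<xi>)) x))"

text \<open>
  Kruzhkov entropy solutions of \<open>\<partial>\<^sub>t u + \<partial>\<^sub>x f(u) = 0\<close>, \<open>u(0, \<cdot>) = u\<^sub>0\<close>, in
  \<open>L\<^sup>\<infinity>(]0,\<infinity>[ \<times> \<real>)\<close>. The function \<open>u\<close> is the representative that is continuous
  in time with values in \<open>L\<^sup>1\<close>-loc, so that \<open>u t\<close> is determined almost everywhere for every
  \<open>t > 0\<close>, and the initial datum is attained in \<open>L\<^sup>1\<close>-loc as \<open>t\<close> tends to \<open>0\<close>. Values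
  \<open>u t x\<close> with \<open>t \<le> 0\<close> are irrelevant.
\<close>

definition entropy_solution ::
  "(real \<Rightarrow> real) \<Rightarrow> (real \<Rightarrow> real) \<Rightarrow> (real \<Rightarrow> real \<Rightarrow> real) \<Rightarrow> bool" where
  "entropy_solution f u0 u \<longleftrightarrow>
     (\<lambda>(t, x). u t x) \<in> borel_measurable (lebesgue_on ({0<..} \<times> UNIV)) \<and>
     (\<exists>B. AE (t, x) in lebesgue_on ({0<..} \<times> UNIV). \<bar>u t x\<bar> \<le> B) \<and>
     (\<forall>t>0. \<forall>R. set_integrable lebesgue {-R..R} (u t)) \<and>
     (\<forall>t>0. \<forall>R. ((\<lambda>\<tau>. LINT x:{-R..R}|lebesgue. \<bar>u \<tau> x - u t x\<bar>) \<longlongrightarrow> 0) (at t)) \<and>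
     (\<forall>R. ((\<lambda>\<tau>. LINT x:{-R..R}|lebesgue. \<bar>u \<tau> x - u0 x\<bar>) \<longlongrightarrow> 0) (at_right 0)) \<and>
     (\<forall>k \<phi>. test_function ({0<..} \<times> UNIV) \<phi> \<and> (\<forall>z. 0 \<le> \<phi> z) \<longrightarrow>
        kruzhkov_inequality f u k \<phi>)"

end

theory Submission
  imports Defs
begin

text \<open>
  Replacing \<open>u\<close> by \<open>- u\<close> and \<open>f\<close> by \<open>\<lambda>y. - f (- y)\<close> if necessary, \<open>a\<close> is increasing and \<open>f\<close> is convex on
  \<open>K\<close>. Let \<open>U\<close> be the potential of the solution, \<open>\<partial>\<^sub>x U = u\<close> and \<open>\<partial>\<^sub>t U = - f(u)\<close>. Kruzhkov's
  inequalities imply that \<open>U\<close> is a viscosity supersolution of \<open>\<partial>\<^sub>t U + f(\<partial>\<^sub>x U) = 0\<close>. Comparison with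
  backward fans and, for the easy inequality, Fenchel's inequality give the Hopf-Lax formula
  \<open>U(T,X) = inf\<^sub>y U(0,y) + T H((X - y)/T)\<close> with the convex conjugate \<open>H\<close> of \<open>f\<close> on \<open>K\<close>. As \<open>U(0,\<cdot>)\<close> is bounded
  by the mass of \<open>u\<^sub>0\<close>, an almost optimal \<open>y\<close> and its slope \<open>V = (X - y)/T\<close> satisfy
  \<open>H(V) - H(a(0)) \<le> C/T\<close>. The hypothesis on \<open>b\<close> means that \<open>H(V) - H(a(0))\<close> is at least a multiple of
  \<open>\<bar>V - a(0)\<bar>\<close> to the power \<open>1 + q\<close>, so \<open>\<bar>V - a(0)\<bar>\<close> is at most a multiple of \<open>T\<close> to the power
  \<open>- 1/(1 + q)\<close>. Moving \<open>X\<close> with \<open>y\<close> fixed bounds the slope of \<open>U(T,\<cdot>)\<close>, that is \<open>u(T,\<cdot>)\<close>, by the values of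
  the inverse \<open>b = H'\<close> of \<open>a\<close> near \<open>V\<close>, which the degeneracy condition makes smaller than a multiple of
  \<open>\<bar>V - a(0)\<bar>\<close> to the power \<open>s\<close>.
\<close>

section \<open>A smooth bump function\<close>

text \<open>The supersolution argument tests with functions built from the solution itself, namely
  squares of positive parts, which are only continuously differentiable. Kruzhkov's inequalities are
  given for smooth functions and are therefore extended by mollification; this is what the bump
  function serves. Convexity of the flux is known on \<open>K\<close> only, whereas an entropy
  solution comes with an unspecified bound, so a maximum principle has to put the values of
  \<open>u\<close> in \<open>K\<close> before any conjugate is used. The slices of \<open>u\<close>
  are given for every time but are tied to the function on the half plane only almost everywhere;
  hence the equation is first derived on slices, the potential is built from these, and its gradient
  is used only after averaging in \<open>x\<close>. The bound for \<open>H(V) - H(a(0))\<close>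
  comes from comparing the almost optimal \<open>y\<close> with the competitor
  \<open>X - T a(0)\<close>, whose slope is exactly \<open>a(0)\<close>: the initial potentials cost
  twice the mass, and division by \<open>T\<close> gives the rate.\<close>

fun bump_poly :: "nat \<Rightarrow> real poly" where
  "bump_poly 0 = 1"
| "bump_poly (Suc n) =
     (let s = [:0, 1, -1:]; P = bump_poly n in
        pderiv P * s ^ 2 - of_nat (2 * n) * s * pderiv s * P + P * pderiv s)"

text \<open>
  \<open>bump_deriv n\<close> is the \<open>n\<close>-th derivative of \<open>exp (- 1 / s)\<close>, \<open>s = x (1 - x)\<close>, on \<open>]0,1[\<close>:
  differentiating \<open>P s\<^sup>-\<^sup>2\<^sup>n exp (- 1 / s)\<close> produces the recursion of \<open>bump_poly\<close>.
\<close>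

definition bump_deriv :: "nat \<Rightarrow> real \<Rightarrow> real" where
  "bump_deriv n x =
     (if 0 < x \<and> x < 1
      then poly (bump_poly n) x / (x * (1 - x)) ^ (2 * n) * exp (- 1 / (x * (1 - x))) else 0)"

lemma bump_deriv_eq_0: "x \<le> 0 \<or> 1 \<le> x \<Longrightarrow> bump_deriv n x = 0"
  by (auto simp: bump_deriv_def)

text \<open>The term of order \<open>m\<close> in the series of \<open>exp (1 / s)\<close> is a
  lower bound for the sum; take reciprocals. Thus the exponential beats every power of
  \<open>s\<close>.\<close>

lemma exp_minus_inverse_le:
  fixes s :: real
  assumes "0 < s"
  shows "exp (- 1 / s) \<le> fact m * s ^ m"
proof -
  have "(1 / s) ^ m / fact m \<le> exp (1 / s)"
  proof -
    have "(\<Sum>n\<in>{m}. (1 / s) ^ n /\<^sub>R fact n) \<le> (\<Sum>n. (1 / s) ^ n /\<^sub>R fact n)"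
      by (rule sum_le_suminf) (use assms summable_exp_generic[of "1 / s"] in auto)
    then show ?thesis by (simp add: exp_def field_simps)
  qed
  then have "1 / (fact m * s ^ m) \<le> exp (1 / s)"
    by (simp add: power_divide mult.commute)
  then have "inverse (exp (1 / s)) \<le> inverse (1 / (fact m * s ^ m))"
    using assms by (intro le_imp_inverse_le) auto
  then show ?thesis
    by (simp add: exp_minus)
qed

text \<open>With \<open>s = x * (1 - x)\<close>, the factor \<open>exp (- 1 / s)\<close> absorbs the
  pole of order \<open>2 * n\<close> and two further powers, so that \<open>s ^ 2\<close> remains.
  This is quadratic decay at both ends, which is all that differentiability there requires.\<close>

lemma bump_deriv_bound:
  obtains C where "\<And>x. \<bar>bump_deriv n x\<bar> \<le> C * x ^ 2" "\<And>x. \<bar>bump_deriv n x\<bar> \<le> C * (x - 1) ^ 2"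
proof -
  have "compact ((\<lambda>x. poly (bump_poly n) x) ` {0..1})"
    by (intro compact_continuous_image continuous_intros) auto
  then obtain A where A: "\<And>x. x \<in> {0..1} \<Longrightarrow> \<bar>poly (bump_poly n) x\<bar> \<le> A"
    using bounded_iff compact_imp_bounded by (metis image_eqI real_norm_def)
  have A0: "A \<ge> 0" using A[of 0] by fastforce
  define C where "C = A * fact (2 * n + 2)"
  have main: "\<bar>bump_deriv n x\<bar> \<le> C * (x * (1 - x)) ^ 2" for x
  proof (cases "0 < x \<and> x < 1")
    case True
    define s where "s = x * (1 - x)"
    have s: "s > 0" using True by (simp add: s_def)
    have "\<bar>bump_deriv n x\<bar> = \<bar>poly (bump_poly n) x\<bar> / s ^ (2 * n) * exp (- 1 / s)"
      using True s by (simp add: bump_deriv_def s_def abs_mult)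
    also have "\<dots> \<le> A / s ^ (2 * n) * (fact (2 * n + 2) * s ^ (2 * n + 2))"
      using A[of x] True s A0
      by (intro mult_mono divide_right_mono exp_minus_inverse_le) auto
    also have "\<dots> = C * s ^ 2"
      using s by (simp add: C_def power_add power2_eq_square)
    finally show ?thesis by (simp add: s_def)
  next
    case False
    then have "bump_deriv n x = 0" by (auto simp: bump_deriv_eq_0)
    then show ?thesis using A0 by (simp add: C_def)
  qed
  have zero: "bump_deriv n x = 0" if "\<not> (0 < x \<and> x < 1)" for x
    using that by (auto simp: bump_deriv_eq_0)
  have C0: "C \<ge> 0" using A0 by (simp add: C_def)
  show thesis
  proof
    fix x
    show "\<bar>bump_deriv n x\<bar> \<le> C * x ^ 2"
    proof (cases "0 < x \<and> x < 1")
      case True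
      then have "(x * (1 - x)) ^ 2 \<le> x ^ 2"
        by (intro power_mono) (auto simp: mult_left_le)
      then show ?thesis using main[of x] C0 by (meson mult_left_mono order_trans)
    qed (use zero C0 in auto)
    show "\<bar>bump_deriv n x\<bar> \<le> C * (x - 1) ^ 2"
    proof (cases "0 < x \<and> x < 1")
      case True
      then have "(x * (1 - x)) ^ 2 \<le> (1 - x) ^ 2"
        by (intro power_mono) (auto simp: mult_left_le_one_le)
      then have "(x * (1 - x)) ^ 2 \<le> (x - 1) ^ 2" by (simp add: power2_commute)
      then show ?thesis using main[of x] C0 by (meson mult_left_mono order_trans)
    qed (use zero C0 in auto)
  qed
qed

text \<open>The bound forces \<open>g c = 0\<close> and difference quotients of size
  \<open>C * \<bar>h\<bar>\<close>. It settles differentiability at points where functions are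
  glued, and later for Taylor remainders.\<close>

lemma has_derivative_zero_of_quadratic_bound:
  fixes g :: "real \<Rightarrow> real"
  assumes "\<And>x. \<bar>g x\<bar> \<le> C * (x - c) ^ 2"
  shows "(g has_real_derivative 0) (at c)"
proof -
  have "g c = 0" using assms[of c] by simp
  have "((\<lambda>h. g (c + h) / h) \<longlongrightarrow> 0) (at 0)"
  proof (rule Lim_null_comparison)
    show "\<forall>\<^sub>F h in at 0. norm (g (c + h) / h) \<le> C * \<bar>h\<bar>"
      unfolding eventually_at
    proof (intro exI[of _ 1] conjI ballI impI)
      fix h :: real assume "h \<noteq> 0 \<and> dist h 0 < 1"
      then show "norm (g (c + h) / h) \<le> C * \<bar>h\<bar>"
        using assms[of "c + h"] by (simp add: divide_simps power2_eq_square abs_mult mult.assoc)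
    qed auto
    show "((\<lambda>h. C * \<bar>h\<bar>) \<longlongrightarrow> 0) (at 0)"
      by (auto intro!: tendsto_eq_intros)
  qed
  then show ?thesis
    by (simp add: DERIV_def \<open>g c = 0\<close>)
qed

lemma bump_deriv_has_derivative: "(bump_deriv n has_real_derivative bump_deriv (Suc n) x) (at x)"
proof -
  consider "0 < x \<and> x < 1" | "x = 0" | "x = 1" | "x < 0 \<or> x > 1" by linarith
  then show ?thesis
  proof cases
    case 1
    define s where "s = x * (1 - x)"
    have s: "s > 0" using 1 by (simp add: s_def)
    define p where "p = poly (bump_poly n) x"
    define p' where "p' = poly (pderiv (bump_poly n)) x"
    let ?f = "\<lambda>x. poly (bump_poly n) x * inverse ((x * (1 - x)) ^ (2 * n)) * exp (- inverse (x * (1 - x)))"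
    have ne: "x * (1 - x) \<noteq> 0" using s unfolding s_def by linarith
    have ds: "((\<lambda>x. x * (1 - x)) has_real_derivative (1 - 2 * x)) (at x)"
      by (auto intro!: derivative_eq_intros)
    have di: "((\<lambda>x. inverse (x * (1 - x))) has_real_derivative - ((1 - 2 * x) / s ^ 2)) (at x)"
      using DERIV_inverse_fun[OF ds ne] by (simp add: s_def divide_inverse power2_eq_square algebra_simps)
    have dpw: "((\<lambda>x. inverse (x * (1 - x)) ^ (2 * n)) has_real_derivative
        (of_nat (2 * n) * (- ((1 - 2 * x) / s ^ 2) * inverse s ^ (2 * n - 1)))) (at x)"
      using DERIV_power[OF di, of "2 * n"] by (simp add: s_def)
    have dpe: "((\<lambda>x. exp (- inverse (x * (1 - x)))) has_real_derivative
        exp (- inverse s) * ((1 - 2 * x) / s ^ 2)) (at x)"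
      using DERIV_chain2[OF DERIV_exp DERIV_minus[OF di]] by (simp add: s_def)
    have dpp: "(poly (bump_poly n) has_real_derivative p') (at x)"
      unfolding p'_def by (rule poly_DERIV)
    define F' where "F' = (p' * inverse s ^ (2 * n) +
        (of_nat (2 * n) * (- ((1 - 2 * x) / s ^ 2) * inverse s ^ (2 * n - 1))) * p) * exp (- inverse s)
        + (exp (- inverse s) * ((1 - 2 * x) / s ^ 2)) * (p * inverse s ^ (2 * n))"
    have D: "((\<lambda>x. poly (bump_poly n) x * inverse (x * (1 - x)) ^ (2 * n) * exp (- inverse (x * (1 - x))))
        has_real_derivative F') (at x)"
      using DERIV_mult[OF DERIV_mult[OF dpp dpw] dpe] unfolding F'_def p_def s_def by simp
    \<comment> \<open>For \<open>n = 0\<close> the exponent \<open>2 * n - 1\<close> is truncated to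
      0; the factor \<open>2 * n\<close> then kills both sides.\<close>
    have pw: "of_nat (2 * n) * inverse s ^ (2 * n - 1) = of_nat (2 * n) * (inverse s ^ (2 * n) * s)"
      using s by (cases n) auto
    have "F' = (p' * s ^ 2 - of_nat (2 * n) * s * (1 - 2 * x) * p + p * (1 - 2 * x))
                  * inverse s ^ (2 * n) / s ^ 2 * exp (- inverse s)"
    proof -
      have "F' = exp (- inverse s) * (p' * inverse s ^ (2 * n)
            - (of_nat (2 * n) * inverse s ^ (2 * n - 1)) * ((1 - 2 * x) / s ^ 2) * p
            + ((1 - 2 * x) / s ^ 2) * (p * inverse s ^ (2 * n)))"
        unfolding F'_def by (simp add: algebra_simps)
      also have "\<dots> = exp (- inverse s) * inverse s ^ (2 * n) * (p'
            - of_nat (2 * n) * s * ((1 - 2 * x) / s ^ 2) * p + ((1 - 2 * x) / s ^ 2) * p)"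
        unfolding pw by (simp add: algebra_simps)
      also have "p' - of_nat (2 * n) * s * ((1 - 2 * x) / s ^ 2) * p + ((1 - 2 * x) / s ^ 2) * p
         = (p' * s ^ 2 - of_nat (2 * n) * s * (1 - 2 * x) * p + p * (1 - 2 * x)) / s ^ 2"
        using s by (simp add: divide_simps)
      finally show ?thesis by simp
    qed
    also have "\<dots> = bump_deriv (Suc n) x"
    proof -
      have "poly (bump_poly (Suc n)) x = p' * s ^ 2 - of_nat (2 * n) * s * (1 - 2 * x) * p + p * (1 - 2 * x)"
      proof -
        have ps: "poly [:0, 1, - 1:] x = s" by (simp add: s_def algebra_simps)
        have pds: "poly (pderiv [:0, 1, - 1:]) x = 1 - 2 * x" by (simp add: pderiv_pCons)
        have oc: "poly (of_nat m) x = of_nat m" for m by (simp add: of_nat_poly)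
        show ?thesis
          unfolding bump_poly.simps Let_def poly_add poly_diff poly_mult poly_power ps pds oc
          by (simp add: p_def p'_def)
      qed
      then show ?thesis
        using 1 s by (simp add: bump_deriv_def s_def[symmetric] divide_inverse power_inverse power_add power2_eq_square)
    qed
    finally have F': "F' = bump_deriv (Suc n) x" .
    show ?thesis
      using D unfolding F'
    proof (rule has_field_derivative_transform_within_open[where S = "{0<..<1}"])
      fix y :: real assume "y \<in> {0<..<1}"
      then show "poly (bump_poly n) y * inverse (y * (1 - y)) ^ (2 * n) * exp (- inverse (y * (1 - y))) = bump_deriv n y"
        by (simp add: bump_deriv_def divide_inverse power_inverse power_mult_distrib)
    qed (use 1 in auto)
  next
    case 2
    obtain C where C: "\<And>x. \<bar>bump_deriv n x\<bar> \<le> C * (x - 0) ^ 2"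
      using bump_deriv_bound[of n] by (metis diff_zero)
    have "bump_deriv (Suc n) 0 = 0" by (rule bump_deriv_eq_0) simp
    then show ?thesis
      using has_derivative_zero_of_quadratic_bound[OF C] unfolding 2 by simp
  next
    case 3
    obtain C where C: "\<And>x. \<bar>bump_deriv n x\<bar> \<le> C * (x - 1) ^ 2"
      using bump_deriv_bound[of n] by (metis diff_zero)
    have "bump_deriv (Suc n) 1 = 0" by (rule bump_deriv_eq_0) simp
    then show ?thesis
      using has_derivative_zero_of_quadratic_bound[OF C] unfolding 3 by simp
  next
    case 4
    have "bump_deriv (Suc n) x = 0" using 4 by (intro bump_deriv_eq_0) auto
    then have "((\<lambda>x. 0) has_real_derivative bump_deriv (Suc n) x) (at x)"
      by (simp del: bump_poly.simps)
    then show ?thesis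
      by (rule has_field_derivative_transform_within_open[where S = "{..<0} \<union> {1<..}"])
         (use 4 in \<open>auto simp: bump_deriv_eq_0\<close>)
  qed
qed

text \<open>The index counts derivatives: \<open>kern 0\<close> is a probability density on the unit
  interval. \<open>smooth_plane\<close> asks for all mixed derivatives at once, hence a whole
  family.\<close>

definition kern :: "nat \<Rightarrow> real \<Rightarrow> real" where
  "kern n x = bump_deriv n x / integral {0..1} (bump_deriv 0)"

lemma bump_deriv_continuous: "continuous_on A (bump_deriv n)"
  by (meson DERIV_isCont bump_deriv_has_derivative continuous_at_imp_continuous_on)

lemma bump_deriv_0_nonneg: "0 \<le> bump_deriv 0 x"
  by (simp add: bump_deriv_def)

lemma integral_bump_pos: "0 < integral {0..1} (bump_deriv 0)"
proof -
  have i: "bump_deriv 0 integrable_on {0..1}"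
    by (rule integrable_continuous_real[OF bump_deriv_continuous])
  have "integral {0..1} (bump_deriv 0) \<noteq> 0"
  proof
    assume "integral {0..1} (bump_deriv 0) = 0"
    then have "(bump_deriv 0 has_integral 0) (cbox 0 1)"
      using i by (metis has_integral_integral interval_cbox)
    then have "bump_deriv 0 (1/2) = 0"
      by (rule has_integral_0_cbox_imp_0[rotated 2])
         (auto simp: bump_deriv_continuous bump_deriv_0_nonneg)
    then show False by (simp add: bump_deriv_def)
  qed
  moreover have "0 \<le> integral {0..1} (bump_deriv 0)"
    by (rule integral_nonneg[OF i]) (simp add: bump_deriv_0_nonneg)
  ultimately show ?thesis by linarith
qed

lemma kern_has_derivative: "(kern n has_real_derivative kern (Suc n) x) (at x)"
  unfolding kern_def using integral_bump_pos
  by (auto intro!: derivative_eq_intros bump_deriv_has_derivative)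

lemma kern_has_derivative_chain [derivative_intros]:
  "(g has_real_derivative g') (at x within S) \<Longrightarrow>
   ((\<lambda>x. kern n (g x)) has_real_derivative kern (Suc n) (g x) * g') (at x within S)"
  by (rule DERIV_chain2[OF kern_has_derivative])

lemma kern_continuous [continuous_intros]:
  "continuous_on A g \<Longrightarrow> continuous_on A (\<lambda>x. kern n (g x))"
  by (rule continuous_on_compose2[of UNIV "kern n"])
     (auto intro!: continuous_at_imp_continuous_on DERIV_isCont kern_has_derivative)

lemma kern_measurable [measurable]: "kern n \<in> borel_measurable borel"
  by (intro borel_measurable_continuous_onI continuous_intros)

lemma kern_eq_0: "x \<le> 0 \<or> 1 \<le> x \<Longrightarrow> kern n x = 0"
  by (auto simp: kern_def bump_deriv_eq_0)

lemma kern_nonzeroD: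
  assumes "kern n x \<noteq> 0"
  shows "0 < x" "x < 1"
  using assms kern_eq_0[of x n] by force+

lemma kern_0_nonneg: "0 \<le> kern 0 x"
  using integral_bump_pos by (simp add: kern_def bump_deriv_0_nonneg)

lemma kern_bounded: "\<exists>C\<ge>0. \<forall>x. \<bar>kern n x\<bar> \<le> C"
proof -
  have "compact (kern n ` {0..1})"
    by (intro compact_continuous_image continuous_intros) auto
  then obtain A where A: "\<And>x. x \<in> {0..1} \<Longrightarrow> \<bar>kern n x\<bar> \<le> A"
    using bounded_iff compact_imp_bounded by (metis image_eqI real_norm_def)
  have A0: "A \<ge> 0" using A[of 0] by fastforce
  then have "\<bar>kern n x\<bar> \<le> A" for x
    using A[of x] kern_eq_0[of x n] by (cases "0 \<le> x \<and> x \<le> 1") (auto simp: not_le)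
  then show ?thesis using A0 by blast
qed

lemma kern_integrable: "integrable lborel (kern n)"
proof -
  have "integrable lborel (\<lambda>x. indicator {0..1} x *\<^sub>R kern n x)"
    by (rule borel_integrable_compact) (auto intro!: continuous_intros)
  then show ?thesis
    by (rule Bochner_Integration.integrable_cong[THEN iffD1, rotated -1])
       (auto simp: indicator_def dest: kern_nonzeroD)
qed

lemma kern_0_integral: "integral\<^sup>L lborel (kern 0) = 1"
proof -
  have "set_integrable lborel {0..1} (kern 0)"
    unfolding set_integrable_def by (rule borel_integrable_compact) (auto intro!: continuous_intros)
  then have "(LINT x:{0..1}|lborel. kern 0 x) = integral {0..1} (kern 0)"
    by (rule set_borel_integral_eq_integral)
  moreover have "(LINT x:{0..1}|lborel. kern 0 x) = integral\<^sup>L lborel (kern 0)"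
    unfolding set_lebesgue_integral_def
    by (rule Bochner_Integration.integral_cong) (auto simp: indicator_def dest: kern_nonzeroD)
  moreover have "integral {0..1} (kern 0) = 1"
    using integral_bump_pos unfolding kern_def by simp
  ultimately show ?thesis by simp
qed

text \<open>A smooth step from 0 to 1 across the unit interval. Rescaled, it is the cut-off in time
  and the smoothed Heaviside function behind the potential.\<close>

definition cum :: "real \<Rightarrow> real" where
  "cum x = integral {0..x} (kern 0)"

lemma cum_eq_0: "x \<le> 0 \<Longrightarrow> cum x = 0"
  by (cases "x = 0") (auto simp: cum_def)

lemma cum_has_derivative: "(cum has_real_derivative kern 0 x) (at x)"
proof (cases "x < 0")
  case True
  then have "((\<lambda>x. 0) has_real_derivative kern 0 x) (at x)"
    by (simp add: kern_eq_0)
  then show ?thesis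
    by (rule has_field_derivative_transform_within_open[where S = "{..<0}"])
       (use True in \<open>auto simp: cum_eq_0\<close>)
next
  case False
  have i: "kern 0 integrable_on A" if "A = {a..b}" for A a b
    unfolding that by (rule integrable_continuous_real) (intro continuous_intros)
  have z: "integral {-1..0} (kern 0) = 0"
    using integral_cong[of "{-1..0}" "kern 0" "\<lambda>_. 0"] by (simp add: kern_eq_0)
  \<comment> \<open>Starting the integral at \<open>- 1\<close> makes 0 an interior point, so that
    the fundamental theorem gives a two-sided derivative there as well.\<close>
  have e: "cum y = integral {-1..y} (kern 0)" if "y > -1" for y
  proof (cases "y \<ge> 0")
    case True
    then show ?thesis
      using Henstock_Kurzweil_Integration.integral_combine[where a = "-1" and c = 0 and b = y and f = "kern 0"] i z by (simp add: cum_def)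
  next
    case False
    then have "integral {-1..y} (kern 0) = 0"
      using integral_cong[of "{-1..y}" "kern 0" "\<lambda>_. 0"] by (simp add: kern_eq_0)
    then show ?thesis using False by (simp add: cum_eq_0)
  qed
  have "((\<lambda>y. integral {-1..y} (kern 0)) has_real_derivative kern 0 x) (at x within {-1..x+1})"
    by (rule integral_has_real_derivative) (use False in \<open>auto intro!: continuous_intros\<close>)
  then have "((\<lambda>y. integral {-1..y} (kern 0)) has_real_derivative kern 0 x) (at x)"
    using False by (subst (asm) at_within_interior) auto
  then show ?thesis
    by (rule has_field_derivative_transform_within_open[where S = "{-1<..}"])
       (use False e in auto)
qed

lemma cum_has_derivative_chain [derivative_intros]:
  "(g has_real_derivative g') (at x within S) \<Longrightarrow>
   ((\<lambda>x. cum (g x)) has_real_derivative kern 0 (g x) * g') (at x within S)"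
  by (rule DERIV_chain2[OF cum_has_derivative])

lemma cum_continuous [continuous_intros]:
  "continuous_on A g \<Longrightarrow> continuous_on A (\<lambda>x. cum (g x))"
  by (rule continuous_on_compose2[of UNIV "cum"])
     (auto intro!: continuous_at_imp_continuous_on DERIV_isCont cum_has_derivative)

lemma cum_measurable [measurable]: "cum \<in> borel_measurable borel"
  by (intro borel_measurable_continuous_onI continuous_intros)

lemma cum_mono: "x \<le> y \<Longrightarrow> cum x \<le> cum y"
  by (rule DERIV_nonneg_imp_nondecreasing[of x y cum])
     (use cum_has_derivative kern_0_nonneg in blast)+

lemma cum_eq_1: "1 \<le> x \<Longrightarrow> cum x = 1"
proof -
  assume x: "1 \<le> x"
  have "set_integrable lborel {0..x} (kern 0)"
    unfolding set_integrable_def by (rule borel_integrable_compact) (auto intro!: continuous_intros)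
  then have "(LINT y:{0..x}|lborel. kern 0 y) = cum x"
    unfolding cum_def by (rule set_borel_integral_eq_integral)
  moreover have "(LINT y:{0..x}|lborel. kern 0 y) = integral\<^sup>L lborel (kern 0)"
    unfolding set_lebesgue_integral_def
    by (rule Bochner_Integration.integral_cong) (use x in \<open>auto simp: indicator_def dest: kern_nonzeroD\<close>)
  ultimately show ?thesis by (simp add: kern_0_integral)
qed

lemma cum_bounds: "0 \<le> cum x" "cum x \<le> 1"
  using cum_mono[of "min x 0" x] cum_mono[of x "max x 1"]
  by (simp_all add: cum_eq_0 cum_eq_1)

section \<open>Continuously differentiable test functions\<close>

text \<open>Two points at distance below 1 lie either both in the compact ball of radius
  \<open>R + 1\<close> or both where \<open>g\<close> vanishes.\<close>

lemma continuous_vanishing_imp_uniformly_continuous: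
  fixes g :: "'a::euclidean_space \<Rightarrow> real"
  assumes "continuous_on UNIV g" and "\<And>z. R < norm z \<Longrightarrow> g z = 0"
  shows "uniformly_continuous_on UNIV g"
  unfolding uniformly_continuous_on_def
proof (intro allI impI)
  fix e :: real assume e: "0 < e"
  have "uniformly_continuous_on (cball 0 (R + 1)) g"
    by (rule compact_uniformly_continuous) (use assms(1) continuous_on_subset in auto)
  then obtain d where d: "d > 0"
    "\<And>x y. x \<in> cball 0 (R + 1) \<Longrightarrow> y \<in> cball 0 (R + 1) \<Longrightarrow> dist y x < d \<Longrightarrow> dist (g y) (g x) < e"
    using e unfolding uniformly_continuous_on_def by metis
  show "\<exists>d>0. \<forall>x\<in>UNIV. \<forall>x'\<in>UNIV. dist x' x < d \<longrightarrow> dist (g x') (g x) < e"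
  proof (intro exI[of _ "min d 1"] conjI ballI impI)
    fix x y :: 'a assume xy: "dist y x < min d 1"
    have tri: "norm x \<le> norm y + 1" "norm y \<le> norm x + 1"
      using xy norm_triangle_sub[of x y] norm_triangle_sub[of y x]
      by (auto simp: dist_norm norm_minus_commute)
    show "dist (g y) (g x) < e"
    proof (cases "norm x > R \<and> norm y > R")
      case True
      then show ?thesis using assms(2) e by simp
    next
      case False
      then have "norm x \<le> R + 1" "norm y \<le> R + 1" using tri by auto
      then show ?thesis using d(2)[of x y] xy by simp
    qed
  qed (use d in auto)
qed

section \<open>Convolution on the plane\<close>

lemma integral_lborel_reflect:
  fixes g :: "'a::euclidean_space \<Rightarrow> real"
  assumes [measurable]: "g \<in> borel_measurable borel"
  shows "(LINT w|lborel. g (z - w)) = (LINT w|lborel. g w)"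
proof -
  have "(lborel :: 'a measure) = distr lborel borel (\<lambda>w. z - w)"
    using lborel_affine[of "-1" z] by (simp add: density_1)
  then have "(LINT w|lborel. g w) = (LINT w|distr lborel borel (\<lambda>w. z - w). g w)"
    by simp
  also have "\<dots> = (LINT w|lborel. g (z - w))"
    by (rule integral_distr) auto
  finally show ?thesis by simp
qed

lemma integrable_bounded_mult:
  fixes g k :: "'a \<Rightarrow> real"
  assumes "integrable M k" "g \<in> borel_measurable M" "\<And>z. \<bar>g z\<bar> \<le> C"
  shows "integrable M (\<lambda>z. g z * k z)"
proof (rule Bochner_Integration.integrable_bound)
  show "integrable M (\<lambda>z. C * k z)" using assms(1) by simp
  have "\<bar>g z * k z\<bar> \<le> \<bar>C * k z\<bar>" for z
    using assms(3)[of z] by (simp add: abs_mult mult_right_mono)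
  then show "AE z in M. norm (g z * k z) \<le> norm (C * k z)" by simp
qed (use assms in measurable)

lemma has_derivative_imp_continuous_on_UNIV:
  assumes "\<And>z. (g has_derivative g' z) (at z)"
  shows "continuous_on UNIV g"
  by (rule has_derivative_continuous_on[of _ _ g']) (use assms in \<open>auto intro: has_derivative_at_withinI\<close>)

text \<open>
  Applied to a mollifier it shows that the convolution is smooth; applied to a test function it
  shows that the first derivatives of the convolution converge.
\<close>

lemma convolution_has_derivative:
  fixes g gt gx k :: "real \<times> real \<Rightarrow> real"
  assumes D: "\<And>z. (g has_derivative (\<lambda>h. fst h * gt z + snd h * gx z)) (at z)"
    and ut: "uniformly_continuous_on UNIV gt" and ux: "uniformly_continuous_on UNIV gx"
    and bg: "\<And>z. \<bar>g z\<bar> \<le> C" and bt: "\<And>z. \<bar>gt z\<bar> \<le> C" and bx: "\<And>z. \<bar>gx z\<bar> \<le> C"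
    and k: "integrable lborel k"
  shows "((\<lambda>z. LINT w|lborel. g (z - w) * k w) has_derivative
     (\<lambda>h. fst h * (LINT w|lborel. gt (z - w) * k w) + snd h * (LINT w|lborel. gx (z - w) * k w))) (at z)"
proof -
  have cg: "continuous_on UNIV g"
    by (rule has_derivative_imp_continuous_on_UNIV[OF D])
  have [measurable]: "g \<in> borel_measurable borel" "gt \<in> borel_measurable borel" "gx \<in> borel_measurable borel"
    using cg ut ux uniformly_continuous_imp_continuous by (auto intro: borel_measurable_continuous_onI)
  have ig: "integrable lborel (\<lambda>w. g (y - w) * k w)" for y
    by (rule integrable_bounded_mult[OF k]) (auto intro: bg)
  have it: "integrable lborel (\<lambda>w. gt (y - w) * k w)" for y
    by (rule integrable_bounded_mult[OF k]) (auto intro: bt)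
  have ix: "integrable lborel (\<lambda>w. gx (y - w) * k w)" for y
    by (rule integrable_bounded_mult[OF k]) (auto intro: bx)
  show ?thesis
    unfolding has_derivative_at_alt
  proof (intro conjI allI impI)
    show "bounded_linear (\<lambda>h. fst h * (LINT w|lborel. gt (z - w) * k w) + snd h * (LINT w|lborel. gx (z - w) * k w))"
      by (intro bounded_linear_add bounded_linear_mult_left[THEN bounded_linear_compose]
          bounded_linear_fst bounded_linear_snd)
    fix e :: real assume e: "0 < e"
    define N where "N = (LINT w|lborel. \<bar>k w\<bar>)"
    have N: "N \<ge> 0" by (simp add: N_def)
    define e' where "e' = e / (2 * (N + 1))"
    have e': "e' > 0" using e N by (simp add: e'_def)
    obtain d1 where d1: "d1 > 0" "\<And>x y. dist y x < d1 \<Longrightarrow> dist (gt y) (gt x) < e'"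
      using ut e' unfolding uniformly_continuous_on_def by (metis UNIV_I)
    obtain d2 where d2: "d2 > 0" "\<And>x y. dist y x < d2 \<Longrightarrow> dist (gx y) (gx x) < e'"
      using ux e' unfolding uniformly_continuous_on_def by (metis UNIV_I)
    define d where "d = min d1 d2"
    \<comment> \<open>The linearisation error is bounded uniformly in the base point, because the
      gradient is uniformly continuous; the bound therefore survives integration against
      \<open>k\<close>.\<close>
    have main: "\<bar>g (y + h) - g y - (fst h * gt y + snd h * gx y)\<bar> \<le> norm h * (2 * e')"
      if "norm h < d" for y h
    proof -
      have "norm (g (y + h) - g y - (\<lambda>h. fst h * gt y + snd h * gx y) (y + h - y)) \<le> norm (y + h - y) * (2 * e')"
      proof (rule differentiable_bound_linearization[where S = "ball y d" and f' = "\<lambda>z h. fst h * gt z + snd h * gx z"])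
        fix t :: real assume "t \<in> {0..1}"
        then have "norm (t *\<^sub>R h) \<le> norm h" by (simp add: mult_left_le_one_le)
        then show "y + t *\<^sub>R (y + h - y) \<in> ball y d"
          using that by (simp add: dist_norm)
      next
        fix x assume "x \<in> ball y d"
        show "(g has_derivative (\<lambda>h. fst h * gt x + snd h * gx x)) (at x within ball y d)"
          by (rule has_derivative_at_withinI[OF D])
      next
        show "y \<in> ball y d" using that by (smt (verit) centre_in_ball norm_ge_zero)
      next
        fix x assume x: "x \<in> ball y d"
        have a: "\<bar>gt x - gt y\<bar> \<le> e'" "\<bar>gx x - gx y\<bar> \<le> e'"
          using x d1(2)[of x y] d2(2)[of x y] by (auto simp: d_def dist_commute dist_real_def)
        show "onorm ((\<lambda>h. fst h * gt x + snd h * gx x) - (\<lambda>h. fst h * gt y + snd h * gx y)) \<le> 2 * e'"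
        proof (rule onorm_bound)
          fix h :: "real \<times> real"
          have "norm (((\<lambda>h. fst h * gt x + snd h * gx x) - (\<lambda>h. fst h * gt y + snd h * gx y)) h)
             = \<bar>fst h * (gt x - gt y) + snd h * (gx x - gx y)\<bar>"
            by (simp add: algebra_simps)
          also have "\<dots> \<le> \<bar>fst h\<bar> * \<bar>gt x - gt y\<bar> + \<bar>snd h\<bar> * \<bar>gx x - gx y\<bar>"
            by (metis abs_mult abs_triangle_ineq)
          also have "\<dots> \<le> norm h * e' + norm h * e'"
            using a norm_fst_le[of "fst h" "snd h"] norm_snd_le[of "snd h" "fst h"]
            by (intro add_mono mult_mono) (auto simp: real_norm_def)
          finally show "norm (((\<lambda>h. fst h * gt x + snd h * gx x) - (\<lambda>h. fst h * gt y + snd h * gx y)) h)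
             \<le> 2 * e' * norm h" by (simp add: algebra_simps)
        qed (use e' in auto)
      qed
      then show ?thesis by simp
    qed
    show "\<exists>d>0. \<forall>y. norm (y - z) < d \<longrightarrow>
        norm ((LINT w|lborel. g (y - w) * k w) - (LINT w|lborel. g (z - w) * k w) -
          (fst (y - z) * (LINT w|lborel. gt (z - w) * k w) + snd (y - z) * (LINT w|lborel. gx (z - w) * k w)))
        \<le> e * norm (y - z)"
    proof (intro exI[of _ d] conjI allI impI)
      fix y assume y: "norm (y - z) < d"
      let ?R = "\<lambda>w. g (y - w) - g (z - w) - (fst (y - z) * gt (z - w) + snd (y - z) * gx (z - w))"
      have "(LINT w|lborel. g (y - w) * k w) - (LINT w|lborel. g (z - w) * k w) -
          (fst (y - z) * (LINT w|lborel. gt (z - w) * k w) + snd (y - z) * (LINT w|lborel. gx (z - w) * k w))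
          = (LINT w|lborel. g (y - w) * k w - g (z - w) * k w
              - (fst (y - z) * (gt (z - w) * k w) + snd (y - z) * (gx (z - w) * k w)))"
        by (simp add: ig it ix)
      also have "\<dots> = (LINT w|lborel. ?R w * k w)"
        by (rule Bochner_Integration.integral_cong) (auto simp: algebra_simps)
      finally have eq: "(LINT w|lborel. g (y - w) * k w) - (LINT w|lborel. g (z - w) * k w) -
          (fst (y - z) * (LINT w|lborel. gt (z - w) * k w) + snd (y - z) * (LINT w|lborel. gx (z - w) * k w))
          = (LINT w|lborel. ?R w * k w)" .
      have "norm (LINT w|lborel. ?R w * k w) \<le> (LINT w|lborel. norm (y - z) * (2 * e') * \<bar>k w\<bar>)"
      proof (rule Bochner_Integration.integral_norm_bound_integral)
        have "integrable lborel (\<lambda>w. g (y - w) * k w - g (z - w) * k w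
              - (fst (y - z) * (gt (z - w) * k w) + snd (y - z) * (gx (z - w) * k w)))"
          by (intro Bochner_Integration.integrable_diff Bochner_Integration.integrable_add integrable_mult_right ig it ix)
        then show "integrable lborel (\<lambda>w. ?R w * k w)"
          by (rule Bochner_Integration.integrable_cong[THEN iffD1, rotated -1]) (auto simp: algebra_simps)
        show "integrable lborel (\<lambda>w. norm (y - z) * (2 * e') * \<bar>k w\<bar>)" using k by simp
        fix w
        show "norm (?R w * k w) \<le> norm (y - z) * (2 * e') * \<bar>k w\<bar>"
          using main[OF y, of "z - w"] by (simp add: abs_mult mult_right_mono)
      qed
      also have "\<dots> = norm (y - z) * (2 * e' * N)" by (simp add: N_def)
      also have "\<dots> \<le> norm (y - z) * e"
        using e N by (intro mult_left_mono) (auto simp: e'_def field_simps)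
      finally show "norm ((LINT w|lborel. g (y - w) * k w) - (LINT w|lborel. g (z - w) * k w) -
          (fst (y - z) * (LINT w|lborel. gt (z - w) * k w) + snd (y - z) * (LINT w|lborel. gx (z - w) * k w)))
        \<le> e * norm (y - z)" unfolding eq by (simp add: mult.commute)
    qed (use d1 d2 in \<open>auto simp: d_def\<close>)
  qed
qed

lemma integral_lborel_product:
  fixes g h :: "real \<Rightarrow> real"
  assumes "integrable lborel g" "integrable lborel h"
  shows "integrable lborel (\<lambda>z :: real \<times> real. g (fst z) * h (snd z))"
    and "(LINT z|lborel. g (fst z) * h (snd z)) = integral\<^sup>L lborel g * integral\<^sup>L lborel h"
proof -
  have [measurable]: "g \<in> borel_measurable borel" "h \<in> borel_measurable borel"
    using assms by auto
  have *: "integrable (lborel \<Otimes>\<^sub>M lborel) (\<lambda>z. g (fst z) * h (snd z))"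
    using assms by (intro lborel_pair.Fubini_integrable) (auto simp: abs_mult)
  then show "integrable lborel (\<lambda>z :: real \<times> real. g (fst z) * h (snd z))"
    by (simp add: lborel_prod)
  show "(LINT z|lborel. g (fst z) * h (snd z)) = integral\<^sup>L lborel g * integral\<^sup>L lborel h"
    using lborel_pair.integral_fst'[OF *] by (simp add: lborel_prod)
qed

text \<open>The gradient is carried along as two functions, which spares \<open>deriv\<close> in the
  integrals. The class admits squared positive parts, and its support condition means compact
  support at positive times.\<close>

definition C1_test ::
  "(real \<times> real \<Rightarrow> real) \<Rightarrow> (real \<times> real \<Rightarrow> real) \<Rightarrow> (real \<times> real \<Rightarrow> real) \<Rightarrow> bool" where
  "C1_test \<psi> \<psi>t \<psi>x \<longleftrightarrow>
     (\<forall>z. (\<psi> has_derivative (\<lambda>h. fst h * \<psi>t z + snd h * \<psi>x z)) (at z)) \<and>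
     continuous_on UNIV \<psi>t \<and> continuous_on UNIV \<psi>x \<and> (\<forall>z. 0 \<le> \<psi> z) \<and>
     (\<exists>s>0. \<exists>R. \<forall>z. \<psi> z \<noteq> 0 \<longrightarrow> s \<le> fst z \<and> norm z \<le> R)"

lemma has_derivative_plane_unique:
  assumes "(\<psi> has_derivative (\<lambda>h :: real \<times> real. fst h * a + snd h * b)) (at z)"
    and "(\<psi> has_derivative (\<lambda>h. fst h * c + snd h * d)) (at z)"
  shows "a = c" "b = (d :: real)"
proof -
  have "(\<lambda>h :: real \<times> real. fst h * a + snd h * b) = (\<lambda>h. fst h * c + snd h * d)"
    using has_derivative_unique assms by blast
  from fun_cong[OF this, of "(1, 0)"] fun_cong[OF this, of "(0, 1)"]
  show "a = c" "b = d" by auto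
qed

lemma has_derivative_plane_partials:
  assumes "(\<psi> has_derivative (\<lambda>h :: real \<times> real. fst h * a + snd h * b)) (at (t, x))"
  shows "((\<lambda>\<tau>. \<psi> (\<tau>, x)) has_real_derivative a) (at t)"
    and "((\<lambda>\<xi>. \<psi> (t, \<xi>)) has_real_derivative b) (at x)"
proof -
  have 1: "((\<lambda>\<tau>. (\<tau>, x)) has_derivative (\<lambda>h. (h, 0))) (at t)"
    by (auto intro!: derivative_eq_intros)
  have 2: "((\<lambda>\<xi>. (t, \<xi>)) has_derivative (\<lambda>h. (0, h))) (at x)"
    by (auto intro!: derivative_eq_intros)
  show "((\<lambda>\<tau>. \<psi> (\<tau>, x)) has_real_derivative a) (at t)"
    unfolding has_field_derivative_def
    by (rule has_derivative_eq_rhs[OF has_derivative_compose[OF 1 assms]]) (auto simp: fun_eq_iff)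
  show "((\<lambda>\<xi>. \<psi> (t, \<xi>)) has_real_derivative b) (at x)"
    unfolding has_field_derivative_def
    by (rule has_derivative_eq_rhs[OF has_derivative_compose[OF 2 assms]]) (auto simp: fun_eq_iff)
qed

text \<open>Off the closed set described by \<open>s\<close> and \<open>R\<close> the function is
  zero on an open set, so its gradient vanishes there too.\<close>

lemma C1_test_support:
  assumes "C1_test \<psi> \<psi>t \<psi>x"
  obtains s R where "0 < s" "\<And>z. \<not> (s \<le> fst z \<and> norm z \<le> R) \<Longrightarrow> \<psi> z = 0 \<and> \<psi>t z = 0 \<and> \<psi>x z = 0"
proof -
  obtain s R where sR: "s > 0" "\<And>z. \<psi> z \<noteq> 0 \<Longrightarrow> s \<le> fst z \<and> norm z \<le> R"
    using assms unfolding C1_test_def by blast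
  show thesis
  proof
    fix z :: "real \<times> real" assume z: "\<not> (s \<le> fst z \<and> norm z \<le> R)"
    let ?O = "{z :: real \<times> real. fst z < s} \<union> {z. R < norm z}"
    have o: "open ?O" by (intro open_Un open_Collect_less continuous_intros)
    have "(\<psi> has_derivative (\<lambda>h. fst h * 0 + snd h * 0)) (at z)"
    proof (rule has_derivative_transform_within_open[OF _ o])
      show "((\<lambda>z. 0) has_derivative (\<lambda>h. fst h * 0 + snd h * 0)) (at z)" by simp
      show "z \<in> ?O" using z by auto
      show "0 = \<psi> y" if "y \<in> ?O" for y using sR(2)[of y] that by (cases "\<psi> y = 0") auto
    qed
    moreover have "(\<psi> has_derivative (\<lambda>h. fst h * \<psi>t z + snd h * \<psi>x z)) (at z)"
      using assms unfolding C1_test_def by blast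
    ultimately show "\<psi> z = 0 \<and> \<psi>t z = 0 \<and> \<psi>x z = 0"
      using has_derivative_plane_unique[of \<psi> 0 0 z "\<psi>t z" "\<psi>x z"] sR(2)[of z] z by auto
  qed (rule sR)
qed

lemma continuous_vanishing_imp_bounded:
  fixes g :: "'a::euclidean_space \<Rightarrow> real"
  assumes "continuous_on UNIV g" and "\<And>z. R < norm z \<Longrightarrow> g z = 0"
  obtains C where "0 \<le> C" "\<And>z. \<bar>g z\<bar> \<le> C"
proof -
  have "compact (g ` cball 0 R)"
    by (intro compact_continuous_image continuous_on_subset[OF assms(1)]) auto
  then obtain A where A: "\<And>z. z \<in> cball 0 R \<Longrightarrow> \<bar>g z\<bar> \<le> A"
    using bounded_iff compact_imp_bounded by (metis image_eqI real_norm_def)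
  have "\<bar>g z\<bar> \<le> max A 0" for z
    using A[of z] assms(2)[of z] by (cases "norm z \<le> R") auto
  then show thesis using that[of "max A 0"] by simp
qed

lemma continuous_vanishing_imp_integrable:
  fixes g :: "'a::euclidean_space \<Rightarrow> real"
  assumes "continuous_on UNIV g" and "\<And>z. R < norm z \<Longrightarrow> g z = 0"
  shows "integrable lborel g"
proof -
  have "integrable lborel (\<lambda>x. indicator (cball 0 R) x *\<^sub>R g x)"
    by (rule borel_integrable_compact) (auto intro!: continuous_on_subset[OF assms(1)])
  then show ?thesis
    by (rule Bochner_Integration.integrable_cong[THEN iffD1, rotated -1])
       (use assms(2) in \<open>force simp: indicator_def\<close>)+
qed

text \<open>
  Supported in \<open>[0,\<epsilon>]\<^sup>2\<close> and not centred at the origin, so that convolution moves supports to the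
  right and keeps them inside \<open>t > 0\<close>.
\<close>

definition mollifier :: "real \<Rightarrow> nat \<Rightarrow> nat \<Rightarrow> real \<times> real \<Rightarrow> real" where
  "mollifier \<epsilon> i j z = (kern i (fst z / \<epsilon>) / \<epsilon> ^ Suc i) * (kern j (snd z / \<epsilon>) / \<epsilon> ^ Suc j)"

lemma mollifier_has_derivative:
  assumes "\<epsilon> > 0"
  shows "(mollifier \<epsilon> i j has_derivative
     (\<lambda>h. fst h * mollifier \<epsilon> (Suc i) j z + snd h * mollifier \<epsilon> i (Suc j) z)) (at z)"
proof -
  have one: "((\<lambda>x. kern n (x / \<epsilon>) / \<epsilon> ^ Suc n) has_real_derivative kern (Suc n) (x / \<epsilon>) / \<epsilon> ^ Suc (Suc n)) (at x)"
    for n x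
    using assms by (auto intro!: derivative_eq_intros)
  have "((\<lambda>z. (kern i (fst z / \<epsilon>) / \<epsilon> ^ Suc i) * (kern j (snd z / \<epsilon>) / \<epsilon> ^ Suc j)) has_derivative
      (\<lambda>h. (kern i (fst z / \<epsilon>) / \<epsilon> ^ Suc i) * (snd h * (kern (Suc j) (snd z / \<epsilon>) / \<epsilon> ^ Suc (Suc j)))
        + (fst h * (kern (Suc i) (fst z / \<epsilon>) / \<epsilon> ^ Suc (Suc i))) * (kern j (snd z / \<epsilon>) / \<epsilon> ^ Suc j))) (at z)"
    by (intro has_derivative_mult DERIV_compose_FDERIV[OF one] has_derivative_fst has_derivative_snd has_derivative_ident)
  then show ?thesis
    unfolding mollifier_def[abs_def] by (rule has_derivative_eq_rhs) (simp only: mult_ac add_ac)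
qed

lemma mollifier_support:
  assumes "\<epsilon> > 0" "mollifier \<epsilon> i j z \<noteq> 0"
  shows "0 < fst z \<and> fst z < \<epsilon>" "0 < snd z \<and> snd z < \<epsilon>" "norm z \<le> 2 * \<epsilon>"
proof -
  show f: "0 < fst z \<and> fst z < \<epsilon>" and s: "0 < snd z \<and> snd z < \<epsilon>"
    using assms kern_nonzeroD[of i "fst z / \<epsilon>"] kern_nonzeroD[of j "snd z / \<epsilon>"]
    by (auto simp: mollifier_def zero_less_divide_iff divide_less_eq)
  show "norm z \<le> 2 * \<epsilon>"
    using f s norm_Pair_le[of "fst z" "snd z"] by simp
qed

lemma mollifier_integral:
  assumes "\<epsilon> > 0"
  shows "integral\<^sup>L lborel (mollifier \<epsilon> 0 0) = 1"
proof -
  have i: "integrable lborel (\<lambda>x. kern 0 (x / \<epsilon>) / \<epsilon>)"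
    using lborel_integrable_real_affine[OF kern_integrable[of 0], of "1 / \<epsilon>" 0] assms by simp
  have "(LINT x|lborel. kern 0 (x / \<epsilon>) / \<epsilon>) = 1"
    using lborel_integral_real_affine[of "1 / \<epsilon>" "kern 0" 0] assms kern_0_integral
    by (simp add: field_simps)
  moreover have "mollifier \<epsilon> 0 0 = (\<lambda>z. (kern 0 (fst z / \<epsilon>) / \<epsilon>) * (kern 0 (snd z / \<epsilon>) / \<epsilon>))"
    by (simp add: mollifier_def fun_eq_iff)
  ultimately show ?thesis
    using integral_lborel_product(2)[OF i i] by (simp only: mult_1)
qed

text \<open>Convolve with \<open>mollifier \<epsilon> 0 0\<close>. Differentiating the mollifier
  shows smoothness, differentiating \<open>\<psi>\<close> shows uniform closeness of the gradients,
  and uniqueness of derivatives identifies the two expressions. One radius serves all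
  \<open>e\<close>, which turns uniform closeness into closeness of integrals.\<close>

lemma C1_test_approx:
  assumes "C1_test \<psi> \<psi>t \<psi>x"
  obtains R where "\<And>e. e > 0 \<Longrightarrow> \<exists>\<phi> \<phi>t \<phi>x. test_function ({0<..} \<times> UNIV) \<phi> \<and> (\<forall>z. 0 \<le> \<phi> z)
      \<and> (\<forall>t x. deriv (\<lambda>\<tau>. \<phi> (\<tau>, x)) t = \<phi>t (t, x) \<and> deriv (\<lambda>\<xi>. \<phi> (t, \<xi>)) x = \<phi>x (t, x))
      \<and> continuous_on UNIV \<phi>t \<and> continuous_on UNIV \<phi>x
      \<and> (\<forall>z. \<bar>\<phi>t z - \<psi>t z\<bar> \<le> e \<and> \<bar>\<phi>x z - \<psi>x z\<bar> \<le> e)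
      \<and> (\<forall>z. R < norm z \<longrightarrow> \<phi>t z = 0 \<and> \<phi>x z = 0)"
proof -
  obtain s R where s: "s > 0"
    and supp: "\<And>z. \<not> (s \<le> fst z \<and> norm z \<le> R) \<Longrightarrow> \<psi> z = 0 \<and> \<psi>t z = 0 \<and> \<psi>x z = 0"
    using C1_test_support[OF assms] by blast
  have D: "(\<psi> has_derivative (\<lambda>h. fst h * \<psi>t z + snd h * \<psi>x z)) (at z)" for z
    using assms unfolding C1_test_def by blast
  have ct: "continuous_on UNIV \<psi>t" and cx: "continuous_on UNIV \<psi>x" and pos: "\<And>z. 0 \<le> \<psi> z"
    using assms unfolding C1_test_def by auto
  have c0: "continuous_on UNIV \<psi>"
    by (rule has_derivative_imp_continuous_on_UNIV[OF D])
  have v: "\<And>z. R < norm z \<Longrightarrow> \<psi> z = 0" "\<And>z. R < norm z \<Longrightarrow> \<psi>t z = 0" "\<And>z. R < norm z \<Longrightarrow> \<psi>x z = 0"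
    using supp by auto
  have ut: "uniformly_continuous_on UNIV \<psi>t" and ux: "uniformly_continuous_on UNIV \<psi>x"
    using continuous_vanishing_imp_uniformly_continuous ct cx v by blast+
  obtain C0 where C0: "\<And>z. \<bar>\<psi> z\<bar> \<le> C0"
    using continuous_vanishing_imp_bounded[OF c0 v(1)] by blast
  obtain Ct where Ct: "\<And>z. \<bar>\<psi>t z\<bar> \<le> Ct"
    using continuous_vanishing_imp_bounded[OF ct v(2)] by blast
  obtain Cx where Cx: "\<And>z. \<bar>\<psi>x z\<bar> \<le> Cx"
    using continuous_vanishing_imp_bounded[OF cx v(3)] by blast
  note C = C0 Ct Cx
  have ip: "integrable lborel \<psi>" "integrable lborel \<psi>t" "integrable lborel \<psi>x"
    using continuous_vanishing_imp_integrable c0 ct cx v by blast+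
  have [measurable]: "\<psi> \<in> borel_measurable borel" "\<psi>t \<in> borel_measurable borel" "\<psi>x \<in> borel_measurable borel"
    using c0 ct cx by (auto intro: borel_measurable_continuous_onI)
  show thesis
  proof (rule that[of "R + 2"])
    fix e :: real assume e: "e > 0"
    obtain d1 where d1: "d1 > 0" "\<And>x y. dist y x < d1 \<Longrightarrow> dist (\<psi>t y) (\<psi>t x) < e"
      using ut e unfolding uniformly_continuous_on_def by (metis UNIV_I)
    obtain d2 where d2: "d2 > 0" "\<And>x y. dist y x < d2 \<Longrightarrow> dist (\<psi>x y) (\<psi>x x) < e"
      using ux e unfolding uniformly_continuous_on_def by (metis UNIV_I)
    \<comment> \<open>\<open>mollifier_support\<close> bounds the support by
      \<open>2 * \<epsilon>\<close>; dividing by 3 keeps this below both moduli of continuity and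
      below 1.\<close>
    define \<epsilon> where "\<epsilon> = min (min d1 d2) 1 / 3"
    have \<epsilon>: "\<epsilon> > 0" "2 * \<epsilon> < d1" "2 * \<epsilon> < d2" "2 * \<epsilon> \<le> 1"
      using d1 d2 by (auto simp: \<epsilon>_def)
    let ?K = "mollifier \<epsilon>"
    have Kc: "continuous_on UNIV (?K i j)" for i j
      by (rule has_derivative_imp_continuous_on_UNIV[OF mollifier_has_derivative[OF \<epsilon>(1)]])
    have [measurable]: "?K i j \<in> borel_measurable borel" for i j
      using Kc by (auto intro: borel_measurable_continuous_onI)
    have Kv: "?K i j z = 0" if "2 * \<epsilon> < norm z" for i j z
      using mollifier_support(3)[OF \<epsilon>(1), of i j z] that by linarith
    have Ku: "uniformly_continuous_on UNIV (?K i j)" for i j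
      using continuous_vanishing_imp_uniformly_continuous[OF Kc Kv] .
    have Ki: "integrable lborel (?K i j)" for i j
      using continuous_vanishing_imp_integrable[OF Kc Kv] .
    have Kpos: "0 \<le> ?K 0 0 z" for z
      using \<epsilon> kern_0_nonneg by (simp add: mollifier_def)
    define D' where "D' i j z = (LINT w|lborel. ?K i j (z - w) * \<psi> w)" for i j z
    have comm: "(LINT w|lborel. g (z - w) * k w) = (LINT w|lborel. k (z - w) * g w)"
      if [measurable]: "g \<in> borel_measurable borel" "k \<in> borel_measurable borel" for g k :: "real \<times> real \<Rightarrow> real" and z
      using integral_lborel_reflect[of "\<lambda>w. g (z - w) * k w" z] by (simp add: mult.commute)
    have D'd: "(D' i j has_derivative (\<lambda>h. fst h * D' (Suc i) j z + snd h * D' i (Suc j) z)) (at z)" for i j z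
    proof -
      obtain A1 where A1: "\<And>z. \<bar>?K i j z\<bar> \<le> A1"
        using continuous_vanishing_imp_bounded[OF Kc Kv] by blast
      obtain A2 where A2: "\<And>z. \<bar>?K (Suc i) j z\<bar> \<le> A2"
        using continuous_vanishing_imp_bounded[OF Kc Kv] by blast
      obtain A3 where A3: "\<And>z. \<bar>?K i (Suc j) z\<bar> \<le> A3"
        using continuous_vanishing_imp_bounded[OF Kc Kv] by blast
      note A = A1 A2 A3
      define A where "A = max A1 (max A2 A3)"
      have AA: "\<And>z. \<bar>?K i j z\<bar> \<le> A" "\<And>z. \<bar>?K (Suc i) j z\<bar> \<le> A" "\<And>z. \<bar>?K i (Suc j) z\<bar> \<le> A"
        unfolding A_def le_max_iff_disj using A by blast+
      show ?thesis
        unfolding D'_def[abs_def]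
        by (rule convolution_has_derivative[OF mollifier_has_derivative[OF \<epsilon>(1)] Ku Ku AA ip(1)])
    qed
    define \<phi> where "\<phi> = D' 0 0"
    have sm: "smooth_plane \<phi>"
      unfolding smooth_plane_def \<phi>_def by (intro exI[of _ D'] conjI allI D'd) simp
    have \<phi>_alt: "\<phi> z = (LINT w|lborel. \<psi> (z - w) * ?K 0 0 w)" for z
      unfolding \<phi>_def D'_def by (rule comm[symmetric]) auto
    have \<phi>pos: "0 \<le> \<phi> z" for z
      unfolding \<phi>_alt using pos Kpos by (intro Bochner_Integration.integral_nonneg) auto
    \<comment> \<open>The mollifier lives at positive coordinates, so only points with
      \<open>fst w < fst z\<close> contribute: supports move to later times and keep their distance
      from \<open>t = 0\<close>.\<close>
    have \<phi>0: "D' i j z = 0" if "\<not> (s \<le> fst z \<and> norm z \<le> R + 1)" for i j z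
    proof -
      have "?K i j (z - w) * \<psi> w = 0" for w
      proof (cases "?K i j (z - w) = 0")
        case False
        from mollifier_support[OF \<epsilon>(1) False]
        have "fst w < fst z" "norm (z - w) \<le> 1" using \<epsilon> by auto
        then have "\<not> (s \<le> fst w \<and> norm w \<le> R)"
          using that norm_triangle_sub[of z w] by auto
        then show ?thesis using supp by simp
      qed simp
      then have "(\<lambda>w. ?K i j (z - w) * \<psi> w) = (\<lambda>w. 0)" by (rule ext)
      then show ?thesis by (simp only: D'_def Bochner_Integration.integral_zero)
    qed
    have supp\<phi>: "closure {z. \<phi> z \<noteq> 0} \<subseteq> {z. s \<le> fst z \<and> norm z \<le> R + 1}"
    proof (rule closure_minimal)
      show "{z. \<phi> z \<noteq> 0} \<subseteq> {z. s \<le> fst z \<and> norm z \<le> R + 1}"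
        using \<phi>0 unfolding \<phi>_def by blast
      show "closed {z :: real \<times> real. s \<le> fst z \<and> norm z \<le> R + 1}"
        by (intro closed_Collect_conj closed_Collect_le continuous_intros)
    qed
    have test: "test_function ({0<..} \<times> UNIV) \<phi>"
      unfolding test_function_def
    proof (intro conjI sm)
      have "bounded (closure {z. \<phi> z \<noteq> 0})"
        using supp\<phi> by (intro boundedI[of _ "R + 1"]) auto
      then show "compact (closure {z. \<phi> z \<noteq> 0})"
        by (simp add: compact_eq_bounded_closed)
      show "closure {z. \<phi> z \<noteq> 0} \<subseteq> {0<..} \<times> UNIV" using supp\<phi> s by force
    qed
    define \<phi>t \<phi>x where "\<phi>t = D' 1 0" and "\<phi>x = D' 0 1"
    have D\<phi>: "(\<phi> has_derivative (\<lambda>h. fst h * \<phi>t z + snd h * \<phi>x z)) (at z)" for z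
      using D'd[of 0 0 z] by (simp add: \<phi>_def \<phi>t_def \<phi>x_def)
    have cont: "continuous_on UNIV (D' i j)" for i j
      by (rule has_derivative_imp_continuous_on_UNIV[OF D'd])
    have dt: "deriv (\<lambda>\<tau>. \<phi> (\<tau>, x)) t = \<phi>t (t, x)" for t x
      by (rule DERIV_imp_deriv[OF has_derivative_plane_partials(1)[OF D\<phi>]])
    have dx: "deriv (\<lambda>\<xi>. \<phi> (t, \<xi>)) x = \<phi>x (t, x)" for t x
      by (rule DERIV_imp_deriv[OF has_derivative_plane_partials(2)[OF D\<phi>]])
    \<comment> \<open>The same convolution with the roles exchanged: now the derivatives fall on
      \<open>\<psi>\<close>.\<close>
    have D2: "(\<phi> has_derivative (\<lambda>h. fst h * (LINT w|lborel. \<psi>t (z - w) * ?K 0 0 w)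
        + snd h * (LINT w|lborel. \<psi>x (z - w) * ?K 0 0 w))) (at z)" for z
    proof -
      define A where "A = max C0 (max Ct Cx)"
      have AA: "\<And>z. \<bar>\<psi> z\<bar> \<le> A" "\<And>z. \<bar>\<psi>t z\<bar> \<le> A" "\<And>z. \<bar>\<psi>x z\<bar> \<le> A"
        unfolding A_def le_max_iff_disj using C by blast+
      have "\<phi> = (\<lambda>z. LINT w|lborel. \<psi> (z - w) * ?K 0 0 w)" using \<phi>_alt by blast
      then show ?thesis
        using convolution_has_derivative[OF D ut ux AA Ki] by simp
    qed
    have est: "\<bar>(LINT w|lborel. g (z - w) * ?K 0 0 w) - g z\<bar> \<le> e"
      if u: "\<And>x y. dist y x < 2 * \<epsilon> + \<delta> \<Longrightarrow> dist (g y) (g x) < e" "\<delta> > 0" and gb: "\<And>z. \<bar>g z\<bar> \<le> B"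
        and [measurable]: "g \<in> borel_measurable borel" for g :: "real \<times> real \<Rightarrow> real" and B \<delta> z
    proof -
      have i1: "integrable lborel (\<lambda>w. g (z - w) * ?K 0 0 w)"
        by (rule integrable_bounded_mult[OF Ki]) (auto intro: gb)
      have "(LINT w|lborel. g (z - w) * ?K 0 0 w) - g z
          = (LINT w|lborel. g (z - w) * ?K 0 0 w) - (LINT w|lborel. g z * ?K 0 0 w)"
        using mollifier_integral[OF \<epsilon>(1)] by simp
      also have "\<dots> = (LINT w|lborel. g (z - w) * ?K 0 0 w - g z * ?K 0 0 w)"
        by (rule Bochner_Integration.integral_diff[symmetric]) (use i1 Ki in auto)
      finally have eq: "(LINT w|lborel. g (z - w) * ?K 0 0 w) - g z = \<dots>" .
      have "norm (LINT w|lborel. g (z - w) * ?K 0 0 w - g z * ?K 0 0 w) \<le> (LINT w|lborel. e * ?K 0 0 w)"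
      proof (rule Bochner_Integration.integral_norm_bound_integral)
        fix w
        show "norm (g (z - w) * ?K 0 0 w - g z * ?K 0 0 w) \<le> e * ?K 0 0 w"
        proof (cases "?K 0 0 w = 0")
          case False
          then have "\<bar>g (z - w) - g z\<bar> \<le> e"
            using u(1)[of "z - w" z] u(2) mollifier_support(3)[OF \<epsilon>(1) False] by (simp add: dist_norm)
          then show ?thesis
            using Kpos[of w] by (simp add: left_diff_distrib[symmetric] abs_mult mult_right_mono)
        qed simp
      qed (use i1 Ki in auto)
      then show ?thesis unfolding eq using mollifier_integral[OF \<epsilon>(1)] by simp
    qed
    have et: "\<bar>\<phi>t z - \<psi>t z\<bar> \<le> e" for z
      using est[of "d1 - 2 * \<epsilon>" \<psi>t Ct z] d1 \<epsilon> C(2) has_derivative_plane_unique(1)[OF D\<phi> D2, of z] by simp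
    have ex: "\<bar>\<phi>x z - \<psi>x z\<bar> \<le> e" for z
      using est[of "d2 - 2 * \<epsilon>" \<psi>x Cx z] d2 \<epsilon> C(3) has_derivative_plane_unique(2)[OF D\<phi> D2, of z] by simp
    show "\<exists>\<phi> \<phi>t \<phi>x. test_function ({0<..} \<times> UNIV) \<phi> \<and> (\<forall>z. 0 \<le> \<phi> z)
      \<and> (\<forall>t x. deriv (\<lambda>\<tau>. \<phi> (\<tau>, x)) t = \<phi>t (t, x) \<and> deriv (\<lambda>\<xi>. \<phi> (t, \<xi>)) x = \<phi>x (t, x))
      \<and> continuous_on UNIV \<phi>t \<and> continuous_on UNIV \<phi>x
      \<and> (\<forall>z. \<bar>\<phi>t z - \<psi>t z\<bar> \<le> e \<and> \<bar>\<phi>x z - \<psi>x z\<bar> \<le> e)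
      \<and> (\<forall>z. R + 2 < norm z \<longrightarrow> \<phi>t z = 0 \<and> \<phi>x z = 0)"
      using test \<phi>pos dt dx et ex cont \<phi>0
      by (intro exI[of _ \<phi>] exI[of _ \<phi>t] exI[of _ \<phi>x]) (auto simp: \<phi>t_def \<phi>x_def)
  qed
qed

text \<open>By \<open>C1_test_approx\<close> the integrals for \<open>\<psi>\<close> and for a
  smooth approximation differ by at most \<open>2 * C * m * e\<close>, where \<open>m\<close> is the
  area of a disc that contains all supports.\<close>

lemma C1_test_integral_nonneg:
  fixes G1 G2 :: "real \<times> real \<Rightarrow> real"
  assumes T: "C1_test \<psi> \<psi>t \<psi>x"
    and [measurable]: "G1 \<in> borel_measurable borel" "G2 \<in> borel_measurable borel"
    and G: "\<And>z. \<bar>G1 z\<bar> \<le> C" "\<And>z. \<bar>G2 z\<bar> \<le> C"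
    and smooth: "\<And>\<phi>. test_function ({0<..} \<times> UNIV) \<phi> \<Longrightarrow> (\<And>z. 0 \<le> \<phi> z) \<Longrightarrow>
      0 \<le> (LINT z|lborel. G1 z * deriv (\<lambda>\<tau>. \<phi> (\<tau>, snd z)) (fst z) + G2 z * deriv (\<lambda>\<xi>. \<phi> (fst z, \<xi>)) (snd z))"
  shows "0 \<le> (LINT z|lborel. G1 z * \<psi>t z + G2 z * \<psi>x z)"
proof -
  obtain R where R: "\<And>e. e > 0 \<Longrightarrow> \<exists>\<phi> \<phi>t \<phi>x. test_function ({0<..} \<times> UNIV) \<phi> \<and> (\<forall>z. 0 \<le> \<phi> z)
      \<and> (\<forall>t x. deriv (\<lambda>\<tau>. \<phi> (\<tau>, x)) t = \<phi>t (t, x) \<and> deriv (\<lambda>\<xi>. \<phi> (t, \<xi>)) x = \<phi>x (t, x))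
      \<and> continuous_on UNIV \<phi>t \<and> continuous_on UNIV \<phi>x
      \<and> (\<forall>z. \<bar>\<phi>t z - \<psi>t z\<bar> \<le> e \<and> \<bar>\<phi>x z - \<psi>x z\<bar> \<le> e)
      \<and> (\<forall>z. R < norm z \<longrightarrow> \<phi>t z = 0 \<and> \<phi>x z = 0)"
    using C1_test_approx[OF T] by blast
  obtain s R0 where s: "s > 0"
    and supp: "\<And>z. \<not> (s \<le> fst z \<and> norm z \<le> R0) \<Longrightarrow> \<psi> z = 0 \<and> \<psi>t z = 0 \<and> \<psi>x z = 0"
    using C1_test_support[OF T] by blast
  have ct: "continuous_on UNIV \<psi>t" and cx: "continuous_on UNIV \<psi>x"
    using T unfolding C1_test_def by auto
  have ip: "integrable lborel \<psi>t" "integrable lborel \<psi>x"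
    by (rule continuous_vanishing_imp_integrable[of _ R0]; use ct cx supp in auto)+
  have C0: "C \<ge> 0" using G(1)[of undefined] by linarith
  define R' where "R' = max R R0"
  define m where "m = measure lborel (cball (0 :: real \<times> real) R')"
  let ?I = "LINT z|lborel. G1 z * \<psi>t z + G2 z * \<psi>x z"
  have iI: "integrable lborel (\<lambda>z. G1 z * \<psi>t z + G2 z * \<psi>x z)"
    by (intro Bochner_Integration.integrable_add integrable_bounded_mult[OF ip(1)] integrable_bounded_mult[OF ip(2)])
       (auto intro: G)
  have "- (2 * C * m) * e \<le> ?I" if e: "e > 0" for e
  proof -
    obtain \<phi> \<phi>t \<phi>x where \<phi>: "test_function ({0<..} \<times> UNIV) \<phi>" "\<And>z. 0 \<le> \<phi> z"
      "\<And>t x. deriv (\<lambda>\<tau>. \<phi> (\<tau>, x)) t = \<phi>t (t, x)" "\<And>t x. deriv (\<lambda>\<xi>. \<phi> (t, \<xi>)) x = \<phi>x (t, x)"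
      "continuous_on UNIV \<phi>t" "continuous_on UNIV \<phi>x"
      "\<And>z. \<bar>\<phi>t z - \<psi>t z\<bar> \<le> e" "\<And>z. \<bar>\<phi>x z - \<psi>x z\<bar> \<le> e"
      "\<And>z. R < norm z \<Longrightarrow> \<phi>t z = 0" "\<And>z. R < norm z \<Longrightarrow> \<phi>x z = 0"
      using R[OF e] by blast
    have ip': "integrable lborel \<phi>t" "integrable lborel \<phi>x"
      by (rule continuous_vanishing_imp_integrable[of _ R]; use \<phi> in auto)+
    have iJ: "integrable lborel (\<lambda>z. G1 z * \<phi>t z + G2 z * \<phi>x z)"
      by (intro Bochner_Integration.integrable_add integrable_bounded_mult[OF ip'(1)] integrable_bounded_mult[OF ip'(2)])
         (auto intro: G)
    have J: "0 \<le> (LINT z|lborel. G1 z * \<phi>t z + G2 z * \<phi>x z)"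
      using smooth[OF \<phi>(1,2)] by (simp add: \<phi>(3,4))
    have "norm ((LINT z|lborel. G1 z * \<phi>t z + G2 z * \<phi>x z) - ?I)
        = norm (LINT z|lborel. (G1 z * \<phi>t z + G2 z * \<phi>x z) - (G1 z * \<psi>t z + G2 z * \<psi>x z))"
      using iI iJ by simp
    also have "\<dots> \<le> (LINT z|lborel. indicator (cball (0 :: real \<times> real) R') z * (2 * C * e))"
    proof (rule Bochner_Integration.integral_norm_bound_integral)
      show "integrable lborel (\<lambda>z. indicator (cball (0 :: real \<times> real) R') z * (2 * C * e))"
        by (intro integrable_mult_left integrable_real_indicator) (use emeasure_lborel_cball_finite[of "0 :: real \<times> real" R', unfolded infinity_ennreal_def] in auto)
      fix z :: "real \<times> real"
      show "norm ((G1 z * \<phi>t z + G2 z * \<phi>x z) - (G1 z * \<psi>t z + G2 z * \<psi>x z)) \<le> indicator (cball 0 R') z * (2 * C * e)"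
      proof (cases "z \<in> cball 0 R'")
        case True
        have "norm ((G1 z * \<phi>t z + G2 z * \<phi>x z) - (G1 z * \<psi>t z + G2 z * \<psi>x z))
            = \<bar>G1 z * (\<phi>t z - \<psi>t z) + G2 z * (\<phi>x z - \<psi>x z)\<bar>" by (simp add: algebra_simps)
        also have "\<dots> \<le> \<bar>G1 z\<bar> * \<bar>\<phi>t z - \<psi>t z\<bar> + \<bar>G2 z\<bar> * \<bar>\<phi>x z - \<psi>x z\<bar>"
          by (metis abs_mult abs_triangle_ineq)
        also have "\<dots> \<le> C * e + C * e"
          using \<phi>(7,8)[of z] G[of z] C0 by (intro add_mono mult_mono) auto
        finally show ?thesis using True by simp
      next
        case False
        then have "R < norm z" "R0 < norm z" by (auto simp: R'_def)
        then show ?thesis using \<phi>(9,10)[of z] supp[of z] False by simp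
      qed
    qed (use iI iJ in auto)
    also have "\<dots> = 2 * C * e * m"
      by (simp add: m_def)
    finally show ?thesis using J by (simp add: algebra_simps)
  qed
  then have lim: "- ((2 * C * m) * e) \<le> ?I" if "e > 0" for e using that by fastforce
  show ?thesis
  proof (rule ccontr)
    assume neg: "\<not> 0 \<le> ?I"
    have m0: "m \<ge> 0" by (simp add: m_def)
    \<comment> \<open>The added 1 keeps the divisor positive. With \<open>e = - ?I / (2 * K)\<close>
      the error is at most half of the size of the supposed negative value.\<close>
    define K where "K = 2 * C * m + 1"
    have K: "K > 0" using C0 m0 by (simp add: K_def add_nonneg_pos)
    have "- ((2 * C * m) * (- ?I / (2 * K))) \<le> ?I"
      by (rule lim) (use neg K in \<open>auto simp: divide_neg_pos\<close>)
    moreover have "(2 * C * m) * (- ?I / (2 * K)) \<le> K * (- ?I / (2 * K))"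
      using neg K by (intro mult_right_mono) (auto simp: K_def divide_neg_pos divide_nonpos_pos)
    moreover have "K * (- ?I / (2 * K)) = - ?I / 2" using K by (simp add: field_simps)
    ultimately show False using neg by linarith
  qed
qed

section \<open>Regular representatives of entropy solutions\<close>

text \<open>
  \<open>v\<close> is a Borel representative on the half plane, needed for Fubini's theorem, and \<open>w t\<close> is a
  Borel representative of the slice at \<^emph>\<open>every\<close> time; the two can only be matched for almost every
  time. The slice \<open>w 0\<close> is the initial datum.
\<close>

locale entropy_flow =
  fixes f :: "real \<Rightarrow> real" and v :: "real \<times> real \<Rightarrow> real" and w :: "real \<Rightarrow> real \<Rightarrow> real" and B :: real
  assumes f_lipschitz: "\<And>R. \<exists>\<Lambda>\<ge>0. \<forall>x y. \<bar>x\<bar> \<le> R \<longrightarrow> \<bar>y\<bar> \<le> R \<longrightarrow> \<bar>f x - f y\<bar> \<le> \<Lambda> * \<bar>x - y\<bar>"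
    and f_continuous: "continuous_on UNIV f"
    and v_measurable [measurable]: "v \<in> borel_measurable borel"
    and v_bound: "\<And>z. \<bar>v z\<bar> \<le> B"
    and w_measurable [measurable]: "\<And>t. w t \<in> borel_measurable borel"
    and w_bound: "\<And>t x. \<bar>w t x\<bar> \<le> B"
    and w_eq_v: "AE t in lborel. 0 < t \<longrightarrow> w t = (\<lambda>x. v (t, x))"
    and w_continuous: "\<And>t R. 0 \<le> t \<Longrightarrow>
       ((\<lambda>\<tau>. LINT x:{-R..R}|lborel. \<bar>w \<tau> x - w t x\<bar>) \<longlongrightarrow> 0) (at t within {0..})"
    and entropy: "\<And>k \<psi> \<psi>t \<psi>x. C1_test \<psi> \<psi>t \<psi>x \<Longrightarrow>
       0 \<le> (LINT z|lborel. \<bar>v z - k\<bar> * \<psi>t z + sgn (v z - k) * (f (v z) - f k) * \<psi>x z)"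

section \<open>Borel representatives of an entropy solution\<close>

definition clip :: "real \<Rightarrow> real \<Rightarrow> real" where
  "clip B x = max (- B) (min B x)"

lemma clip_bound: "0 \<le> B \<Longrightarrow> \<bar>clip B x\<bar> \<le> B"
  by (auto simp: clip_def)

lemma clip_id: "\<bar>x\<bar> \<le> B \<Longrightarrow> clip B x = x"
  by (auto simp: clip_def)

lemma clip_nonexpansive: "\<bar>clip B x - clip B y\<bar> \<le> \<bar>x - y\<bar>"
  by (auto simp: clip_def max_def min_def)

lemma clip_measurable [measurable]: "clip B \<in> borel_measurable borel"
  unfolding clip_def by measurable

text \<open>Serves to approach a given time through times at which a property known for almost every
  time holds.\<close>

lemma AE_lborel_frequently:
  fixes t e :: real
  assumes "AE x in lborel. P x" "e > 0"
  obtains x where "P x" "t < x" "x < t + e"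
proof -
  have "\<not> (AE x in lborel. x \<notin> {t<..<t + e})"
  proof
    assume "AE x in lborel. x \<notin> {t<..<t + e}"
    then have "emeasure lborel {t<..<t + e} = 0"
      by (subst (asm) AE_iff_measurable[where N = "{t<..<t + e}"]) auto
    then show False using assms(2) by simp
  qed
  then have "\<exists>x. P x \<and> x \<in> {t<..<t + e}"
    using assms(1) by (metis (mono_tags, lifting) AE_mp AE_I2)
  then show thesis using that by auto
qed

lemma set_integrable_imp_measurable:
  assumes "\<And>R. set_integrable lebesgue {-R..R} (g :: real \<Rightarrow> real)"
  shows "g \<in> borel_measurable lebesgue"
proof (rule borel_measurable_LIMSEQ_real)
  show "(\<lambda>x. indicator {- real n..real n} x *\<^sub>R g x) \<in> borel_measurable lebesgue" for n
    using assms[of "real n"] unfolding set_integrable_def by (rule borel_measurable_integrable)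
  fix x :: real
  obtain N where N: "\<bar>x\<bar> \<le> real N" using real_arch_simple by blast
  have "\<forall>\<^sub>F n in sequentially. g x = indicator {- real n..real n} x *\<^sub>R g x"
    using eventually_ge_at_top[of N]
  proof eventually_elim
    case (elim n)
    then have "\<bar>x\<bar> \<le> real n" using N by linarith
    then show ?case by (auto simp: indicator_def)
  qed
  then show "(\<lambda>n. indicator {- real n..real n} x *\<^sub>R g x) \<longlonglongrightarrow> g x"
    by (rule tendsto_eventually[OF eventually_mono]) auto
qed

text \<open>At a good time \<open>\<tau>\<close> the excess of \<open>\<bar>u t x\<bar>\<close> over
  \<open>B\<close> is at most \<open>\<bar>u \<tau> x - u t x\<bar>\<close>, whose local integral
  tends to 0 as good times approach \<open>t\<close>. So a bound at almost every time becomes one at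
  every time.\<close>

lemma entropy_solution_slice_bound:
  assumes u: "entropy_solution f u0 u" and good: "AE \<tau> in lborel. 0 < \<tau> \<longrightarrow> (AE x in lborel. \<bar>u \<tau> x\<bar> \<le> B)"
    and t: "0 < t" and B: "0 \<le> B"
  shows "AE x in lborel. \<bar>u t x\<bar> \<le> B"
proof -
  have si: "\<And>\<tau> R. 0 < \<tau> \<Longrightarrow> set_integrable lebesgue {-R..R} (u \<tau>)"
    and lim: "\<And>R. ((\<lambda>\<tau>. LINT x:{-R..R}|lebesgue. \<bar>u \<tau> x - u t x\<bar>) \<longlongrightarrow> 0) (at t)"
    using u t unfolding entropy_solution_def by auto
  have meas [measurable]: "u \<tau> \<in> borel_measurable lebesgue" if "0 < \<tau>" for \<tau>
    using set_integrable_imp_measurable si[OF that] by blast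
  define h where "h x = max 0 (\<bar>u t x\<bar> - B)" for x
  have [measurable]: "h \<in> borel_measurable lebesgue"
    unfolding h_def using meas[OF t] by measurable
  have "AE x in lebesgue. x \<in> {-R..R} \<longrightarrow> h x = 0" for R
  proof -
    define I where "I = (LINT x:{-R..R}|lebesgue. h x)"
    have ih: "set_integrable lebesgue {-R..R} h"
    proof (rule set_integrable_bound[OF si[OF t]])
      show "set_borel_measurable lebesgue {- R..R} h"
        unfolding set_borel_measurable_def
        by (intro borel_measurable_scaleR borel_measurable_indicator \<open>h \<in> borel_measurable lebesgue\<close>) auto
    qed (use B in \<open>auto simp: h_def\<close>)
    have le: "I \<le> (LINT x:{-R..R}|lebesgue. \<bar>u \<tau> x - u t x\<bar>)"
      if \<tau>: "0 < \<tau>" "AE x in lborel. \<bar>u \<tau> x\<bar> \<le> B" for \<tau>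
      unfolding I_def
    proof (rule set_integral_mono_AE[OF ih])
      show "set_integrable lebesgue {- R..R} (\<lambda>x. \<bar>u \<tau> x - u t x\<bar>)"
        by (intro set_integrable_abs set_integral_diff si t \<tau>)
      show "AE x\<in>{- R..R} in lebesgue. h x \<le> \<bar>u \<tau> x - u t x\<bar>"
        using AE_completion[OF \<tau>(2)] by eventually_elim (auto simp: h_def)
    qed
    have "I \<le> 0"
    proof (rule ccontr)
      assume "\<not> I \<le> 0"
      then have "\<forall>\<^sub>F \<tau> in at t. (LINT x:{-R..R}|lebesgue. \<bar>u \<tau> x - u t x\<bar>) < I"
        using order_tendstoD(2)[OF lim[of R], of I] by simp
      then obtain d where d: "d > 0"
        "\<And>\<tau>. \<tau> \<noteq> t \<Longrightarrow> dist \<tau> t < d \<Longrightarrow> (LINT x:{-R..R}|lebesgue. \<bar>u \<tau> x - u t x\<bar>) < I"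
        unfolding eventually_at by auto
      obtain \<tau> where "0 < \<tau> \<longrightarrow> (AE x in lborel. \<bar>u \<tau> x\<bar> \<le> B)" "t < \<tau>" "\<tau> < t + d"
        using AE_lborel_frequently[OF good d(1)] by blast
      then show False using le[of \<tau>] d(2)[of \<tau>] t by (auto simp: dist_real_def)
    qed
    moreover have "I \<ge> 0" unfolding I_def set_lebesgue_integral_def
      by (rule Bochner_Integration.integral_nonneg) (simp add: h_def)
    ultimately have "(LINT x|lebesgue. indicator {-R..R} x *\<^sub>R h x) = 0"
      unfolding I_def set_lebesgue_integral_def by linarith
    then have "AE x in lebesgue. indicator {-R..R} x *\<^sub>R h x = 0"
      by (subst (asm) integral_nonneg_eq_0_iff_AE) (use ih in \<open>auto simp: set_integrable_def h_def\<close>)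
    then show ?thesis by eventually_elim (auto simp: indicator_def)
  qed
  then have "AE x in lebesgue. \<forall>n::nat. x \<in> {- real n..real n} \<longrightarrow> h x = 0"
    unfolding AE_all_countable by blast
  then have "AE x in lebesgue. \<bar>u t x\<bar> \<le> B"
  proof eventually_elim
    case (elim x)
    obtain N where N: "\<bar>x\<bar> \<le> real N" using real_arch_simple by blast
    then have "x \<in> {- real N..real N}" by (auto simp: abs_le_iff)
    then have "h x = 0" using elim by blast
    then show ?case by (simp add: h_def max_def split: if_splits)
  qed
  then show ?thesis by (simp add: AE_completion_iff)
qed

text \<open>Take a Borel function equal to \<open>u\<close> almost everywhere on the half plane and
  clip it to get \<open>v\<close>. By Fubini its slices are versions of \<open>u t\<close> for
  almost every time; at such times \<open>w t\<close> is taken to be this very slice, so that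
  \<open>w_eq_v\<close> is an equality of functions.\<close>

lemma entropy_solution_imp_entropy_flow:
  assumes u: "entropy_solution f u0 u"
    and f_lip: "\<And>R. \<exists>\<Lambda>\<ge>0. \<forall>x y. \<bar>x\<bar> \<le> R \<longrightarrow> \<bar>y\<bar> \<le> R \<longrightarrow> \<bar>f x - f y\<bar> \<le> \<Lambda> * \<bar>x - y\<bar>"
    and f_cont: "continuous_on UNIV f"
    and u0: "u0 \<in> borel_measurable lebesgue" "AE x in lebesgue. \<bar>u0 x\<bar> \<le> M" and M: "0 \<le> M"
  obtains v w B where "entropy_flow f v w B" "\<And>t. 0 < t \<Longrightarrow> AE x in lborel. u t x = w t x"
    "AE x in lborel. u0 x = w 0 x" "\<And>x. \<bar>w 0 x\<bar> \<le> M"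
proof -
  let ?S = "{0<..} \<times> UNIV :: (real \<times> real) set"
  have S [measurable]: "?S \<in> sets borel"
    by (intro borel_open open_Times) auto
  have [measurable]: "?S \<in> sets lebesgue" using S by simp
  have [measurable]: "f \<in> borel_measurable borel"
    using f_cont by (rule borel_measurable_continuous_onI)
  have meas: "(\<lambda>(t, x). u t x) \<in> borel_measurable (lebesgue_on ?S)"
    and si: "\<And>\<tau> R. 0 < \<tau> \<Longrightarrow> set_integrable lebesgue {-R..R} (u \<tau>)"
    and lim: "\<And>t R. 0 < t \<Longrightarrow> ((\<lambda>\<tau>. LINT x:{-R..R}|lebesgue. \<bar>u \<tau> x - u t x\<bar>) \<longlongrightarrow> 0) (at t)"
    and lim0: "\<And>R. ((\<lambda>\<tau>. LINT x:{-R..R}|lebesgue. \<bar>u \<tau> x - u0 x\<bar>) \<longlongrightarrow> 0) (at_right 0)"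
    and kr: "\<And>k \<phi>. test_function ?S \<phi> \<Longrightarrow> (\<And>z. 0 \<le> \<phi> z) \<Longrightarrow> kruzhkov_inequality f u k \<phi>"
    using u unfolding entropy_solution_def by auto
  obtain B1 where B1: "AE (t, x) in lebesgue_on ?S. \<bar>u t x\<bar> \<le> B1"
    using u unfolding entropy_solution_def by auto
  \<comment> \<open>Includes \<open>M\<close>, since the slice at time 0 is the initial datum and
    must obey the same bound.\<close>
  define B where "B = max \<bar>B1\<bar> M"
  have B: "B \<ge> 0" "B1 \<le> B" "M \<le> B" by (auto simp: B_def)
  have umeas [measurable]: "u \<tau> \<in> borel_measurable lebesgue" if "0 < \<tau>" for \<tau>
    using set_integrable_imp_measurable si[OF that] by blast
  define U where "U z = indicator ?S z *\<^sub>R u (fst z) (snd z)" for z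
  have [measurable]: "U \<in> borel_measurable lebesgue"
    using meas unfolding U_def[abs_def]
    by (subst (asm) borel_measurable_restrict_space_iff) (auto simp: case_prod_beta')
  obtain v0 where v0 [measurable]: "v0 \<in> borel_measurable lborel" and Uv0: "AE z in lborel. U z = v0 z"
    using completion_ex_borel_measurable_real[of U lborel] by auto
  define v where "v z = clip B (v0 z)" for z
  have [measurable]: "v \<in> borel_measurable borel"
    unfolding v_def using v0 by measurable
  have "AE z in lebesgue. z \<in> ?S \<longrightarrow> \<bar>u (fst z) (snd z)\<bar> \<le> B1"
    using B1 by (subst (asm) AE_restrict_space_iff) (auto simp: case_prod_beta')
  then have ub: "AE z in lborel. z \<in> ?S \<longrightarrow> \<bar>u (fst z) (snd z)\<bar> \<le> B1"
    by (simp add: AE_completion_iff)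
  have uv: "AE z in lborel. z \<in> ?S \<longrightarrow> u (fst z) (snd z) = v z"
    using ub Uv0
  proof eventually_elim
    case (elim z)
    then show ?case using clip_id[of "u (fst z) (snd z)" B] B by (auto simp: v_def U_def)
  qed
  have "AE t in lborel. AE x in lborel. (t, x) \<in> ?S \<longrightarrow> u (fst (t, x)) (snd (t, x)) = v (t, x)"
    by (rule lborel_pair.AE_pair) (use uv in \<open>unfold lborel_prod, simp\<close>)
  then have good: "AE t in lborel. 0 < t \<longrightarrow> (AE x in lborel. u t x = v (t, x))"
    by eventually_elim auto
  have vb: "\<bar>v z\<bar> \<le> B" for z by (simp add: v_def clip_bound B)
  have ub: "AE x in lborel. \<bar>u t x\<bar> \<le> B" if "0 < t" for t
  proof (rule entropy_solution_slice_bound[OF u _ that B(1)])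
    show "AE \<tau> in lborel. 0 < \<tau> \<longrightarrow> (AE x in lborel. \<bar>u \<tau> x\<bar> \<le> B)"
      using good
    proof eventually_elim
      case (elim t)
      show ?case
      proof
        assume "0 < t"
        then have "AE x in lborel. u t x = v (t, x)" using elim by blast
        then show "AE x in lborel. \<bar>u t x\<bar> \<le> B" by eventually_elim (use vb in auto)
      qed
    qed
  qed
  have ex: "\<exists>g. g \<in> borel_measurable borel \<and> (\<forall>x. \<bar>g x\<bar> \<le> B) \<and> (AE x in lborel. u t x = g x)
      \<and> ((AE x in lborel. u t x = v (t, x)) \<longrightarrow> g = (\<lambda>x. v (t, x)))" if t: "0 < t" for t
  proof (cases "AE x in lborel. u t x = v (t, x)")
    case True
    then show ?thesis using vb by (intro exI[of _ "\<lambda>x. v (t, x)"]) auto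
  next
    case False
    obtain g where [measurable]: "g \<in> borel_measurable lborel" and g: "AE x in lborel. u t x = g x"
      using completion_ex_borel_measurable_real[OF umeas[OF t]] by auto
    have "AE x in lborel. u t x = clip B (g x)"
      using g ub[OF t] by eventually_elim (auto simp: clip_id)
    then show ?thesis using False clip_bound[OF B(1)]
      by (intro exI[of _ "\<lambda>x. clip B (g x)"]) auto
  qed
  \<comment> \<open>The last conjunct forces the exact slice of \<open>v\<close> whenever that slice
    is a version of \<open>u t\<close>; at the other times any bounded Borel version will
    do.\<close>
  define wp where "wp t = (SOME g. g \<in> borel_measurable borel \<and> (\<forall>x. \<bar>g x\<bar> \<le> B) \<and> (AE x in lborel. u t x = g x)
      \<and> ((AE x in lborel. u t x = v (t, x)) \<longrightarrow> g = (\<lambda>x. v (t, x))))" for t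
  note wp = someI_ex[OF ex, folded wp_def]
  obtain g0 where g0 [measurable]: "g0 \<in> borel_measurable lborel" and g0e: "AE x in lborel. u0 x = g0 x"
    using completion_ex_borel_measurable_real[OF u0(1)] by auto
  define w where "w t = (if 0 < t then wp t else (\<lambda>x. clip M (g0 x)))" for t
  have w0e: "AE x in lborel. u0 x = w 0 x"
    using g0e u0(2) unfolding AE_completion_iff
    by eventually_elim (auto simp: w_def clip_id)
  have we: "AE x in lborel. u t x = w t x" if "0 < t" for t
    using wp[OF that] that by (simp add: w_def)
  have w_meas [measurable]: "w t \<in> borel_measurable borel" for t
    using wp[of t] g0 by (cases "0 < t") (auto simp: w_def)
  have set_eq: "(LINT x:{-R..R}|lebesgue. \<bar>g x - h x\<bar>) = (LINT x:{-R..R}|lborel. \<bar>g' x - h' x\<bar>)"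
    if [measurable]: "g \<in> borel_measurable lebesgue" "h \<in> borel_measurable lebesgue"
      "g' \<in> borel_measurable borel" "h' \<in> borel_measurable borel"
      and e: "AE x in lborel. g x = g' x" "AE x in lborel. h x = h' x"
    for g h g' h' :: "real \<Rightarrow> real" and R
  proof -
    have m: "(\<lambda>x. indicator {-R..R} x *\<^sub>R \<bar>g' x - h' x\<bar>) \<in> borel_measurable lborel"
      using that(3,4) by simp
    have i [measurable]: "(\<lambda>x :: real. x) \<in> borel_measurable lebesgue"
      by (rule measurable_completion) simp
    have "(LINT x:{-R..R}|lebesgue. \<bar>g x - h x\<bar>) = (LINT x:{-R..R}|lebesgue. \<bar>g' x - h' x\<bar>)"
      unfolding set_lebesgue_integral_def
    proof (rule integral_cong_AE)
      show "AE x in lebesgue. indicator {-R..R} x *\<^sub>R \<bar>g x - h x\<bar> = indicator {-R..R} x *\<^sub>R \<bar>g' x - h' x\<bar>"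
        using AE_completion[OF e(1)] AE_completion[OF e(2)] by eventually_elim simp
      show "(\<lambda>x. indicator {-R..R} x *\<^sub>R \<bar>g x - h x\<bar>) \<in> borel_measurable lebesgue"
        by measurable
    qed (rule measurable_completion[OF m])
    also have "\<dots> = (LINT x:{-R..R}|lborel. \<bar>g' x - h' x\<bar>)"
      unfolding set_lebesgue_integral_def by (rule integral_completion[OF m])
    finally show ?thesis .
  qed
  have flow: "entropy_flow f v w B"
  proof
    show "AE t in lborel. 0 < t \<longrightarrow> w t = (\<lambda>x. v (t, x))"
      using good by eventually_elim (use wp in \<open>auto simp: w_def\<close>)
    show "\<bar>w t x\<bar> \<le> B" for t x
      using wp[of t] clip_bound[OF M, of "g0 x"] B by (cases "0 < t") (auto simp: w_def)
  next
    fix t R :: real assume t: "0 \<le> t"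
    show "((\<lambda>\<tau>. LINT x:{-R..R}|lborel. \<bar>w \<tau> x - w t x\<bar>) \<longlongrightarrow> 0) (at t within {0..})"
    proof (cases "t = 0")
      case True
      have "{0..} - {0} = ({0<..} :: real set)" by auto
      then have "at t within {0..} = at_right t"
        unfolding True at_within_def by simp
      moreover have "((\<lambda>\<tau>. LINT x:{-R..R}|lborel. \<bar>w \<tau> x - w 0 x\<bar>) \<longlongrightarrow> 0) (at_right 0)"
      proof (rule Lim_transform_eventually[OF lim0[of R]])
        show "\<forall>\<^sub>F \<tau> in at_right 0. (LINT x:{-R..R}|lebesgue. \<bar>u \<tau> x - u0 x\<bar>) = (LINT x:{-R..R}|lborel. \<bar>w \<tau> x - w 0 x\<bar>)"
          using eventually_at_right_less[of 0]
          by eventually_elim (rule set_eq[OF umeas u0(1) w_meas w_meas we w0e])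
      qed
      ultimately show ?thesis using True by simp
    next
      case False
      then have t: "0 < t" using t by simp
      have "((\<lambda>\<tau>. LINT x:{-R..R}|lborel. \<bar>w \<tau> x - w t x\<bar>) \<longlongrightarrow> 0) (at t)"
      proof (rule Lim_transform_eventually[OF lim[OF t, of R]])
        have "\<forall>\<^sub>F \<tau> in at t. \<tau> \<in> {0<..}"
          by (rule topological_tendstoD[OF tendsto_ident_at]) (use t in auto)
        then show "\<forall>\<^sub>F \<tau> in at t. (LINT x:{-R..R}|lebesgue. \<bar>u \<tau> x - u t x\<bar>) = (LINT x:{-R..R}|lborel. \<bar>w \<tau> x - w t x\<bar>)"
          by eventually_elim (rule set_eq[OF umeas umeas w_meas w_meas we we]; use t in simp)
      qed
      then show ?thesis by (rule tendsto_within_subset) simp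
    qed
  next
    fix k and \<psi> \<psi>t \<psi>x :: "real \<times> real \<Rightarrow> real" assume T: "C1_test \<psi> \<psi>t \<psi>x"
    \<comment> \<open>The restriction to positive times is moved into the coefficients, so that the
      integral over the half plane becomes one over the plane.\<close>
    define G1 where "G1 z = indicator ?S z * \<bar>v z - k\<bar>" for z
    define G2 where "G2 z = indicator ?S z * (sgn (v z - k) * (f (v z) - f k))" for z
    have [measurable]: "G1 \<in> borel_measurable borel" "G2 \<in> borel_measurable borel"
      unfolding G1_def[abs_def] G2_def[abs_def] by measurable
    obtain \<Lambda> where \<Lambda>: "\<Lambda> \<ge> 0" "\<And>x y. \<bar>x\<bar> \<le> B + \<bar>k\<bar> \<Longrightarrow> \<bar>y\<bar> \<le> B + \<bar>k\<bar> \<Longrightarrow> \<bar>f x - f y\<bar> \<le> \<Lambda> * \<bar>x - y\<bar>"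
      using f_lip[of "B + \<bar>k\<bar>"] by blast
    define C where "C = (1 + \<Lambda>) * (B + \<bar>k\<bar>)"
    have vk: "\<bar>v z - k\<bar> \<le> B + \<bar>k\<bar>" for z using vb[of z] by linarith
    have C1: "\<bar>G1 z\<bar> \<le> C" for z
    proof -
      have "\<bar>G1 z\<bar> \<le> \<bar>v z - k\<bar>" by (auto simp: G1_def indicator_def)
      also have "\<dots> \<le> 1 * (B + \<bar>k\<bar>)" using vk by simp
      also have "\<dots> \<le> C" unfolding C_def using \<Lambda>(1) B by (intro mult_right_mono) auto
      finally show ?thesis .
    qed
    have C2: "\<bar>G2 z\<bar> \<le> C" for z
    proof -
      have "\<bar>G2 z\<bar> \<le> \<bar>f (v z) - f k\<bar>" by (auto simp: G2_def indicator_def abs_mult sgn_real_def)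
      also have "\<dots> \<le> \<Lambda> * \<bar>v z - k\<bar>" using \<Lambda>(2)[of "v z" k] vb[of z] B(1) by linarith
      also have "\<dots> \<le> \<Lambda> * (B + \<bar>k\<bar>)" using vk \<Lambda>(1) by (intro mult_left_mono) auto
      also have "\<dots> \<le> C" unfolding C_def using \<Lambda>(1) B by (intro mult_right_mono) auto
      finally show ?thesis .
    qed
    have "0 \<le> (LINT z|lborel. G1 z * \<psi>t z + G2 z * \<psi>x z)"
    proof (rule C1_test_integral_nonneg[OF T _ _ C1 C2])
      fix \<phi> :: "real \<times> real \<Rightarrow> real" assume \<phi>: "test_function ?S \<phi>" "\<And>z. 0 \<le> \<phi> z"
      obtain D where D: "D 0 0 = \<phi>"
        "\<And>i j z. (D i j has_derivative (\<lambda>h. fst h * D (Suc i) j z + snd h * D i (Suc j) z)) (at z)"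
        using \<phi>(1) unfolding test_function_def smooth_plane_def by blast
      have dt: "deriv (\<lambda>\<tau>. \<phi> (\<tau>, x)) t = D 1 0 (t, x)" for t x
        using DERIV_imp_deriv[OF has_derivative_plane_partials(1)[OF D(2)[of 0 0]]] by (simp add: D(1))
      have dx: "deriv (\<lambda>\<xi>. \<phi> (t, \<xi>)) x = D 0 1 (t, x)" for t x
        using DERIV_imp_deriv[OF has_derivative_plane_partials(2)[OF D(2)[of 0 0]]] by (simp add: D(1))
      have [measurable]: "D i j \<in> borel_measurable borel" for i j
        by (intro borel_measurable_continuous_onI has_derivative_imp_continuous_on_UNIV[OF D(2)])
      have [measurable]: "D i j \<in> borel_measurable lebesgue" for i j
        by (rule measurable_completion) simp
      have [measurable]: "G1 \<in> borel_measurable lebesgue" "G2 \<in> borel_measurable lebesgue"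
        by (rule measurable_completion; simp)+
      let ?F = "\<lambda>z. indicator ?S z *\<^sub>R (case z of (t, x) \<Rightarrow>
               \<bar>u t x - k\<bar> * deriv (\<lambda>\<tau>. \<phi> (\<tau>, x)) t
               + sgn (u t x - k) * (f (u t x) - f k) * deriv (\<lambda>\<xi>. \<phi> (t, \<xi>)) x)"
      have "?F = (\<lambda>z. indicator ?S z *\<^sub>R (\<bar>U z - k\<bar> * D 1 0 z + sgn (U z - k) * (f (U z) - f k) * D 0 1 z))"
        by (auto simp: fun_eq_iff dt dx U_def indicator_def)
      then have Fm: "?F \<in> borel_measurable lebesgue"
        by simp
      have "0 \<le> (LINT z|lebesgue. ?F z)"
        using kr[OF \<phi>, of k] unfolding kruzhkov_inequality_def set_lebesgue_integral_def .
      also have "(LINT z|lebesgue. ?F z) = (LINT z|lebesgue. G1 z * D 1 0 z + G2 z * D 0 1 z)"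
      proof (rule integral_cong_AE[OF Fm])
        show "AE z in lebesgue. ?F z = G1 z * D 1 0 z + G2 z * D 0 1 z"
          using AE_completion[OF uv]
          by eventually_elim (auto simp: G1_def G2_def dt dx indicator_def)
      qed measurable
      also have "\<dots> = (LINT z|lborel. G1 z * D 1 0 z + G2 z * D 0 1 z)"
        by (rule integral_completion) measurable
      finally show "0 \<le> (LINT z|lborel. G1 z * deriv (\<lambda>\<tau>. \<phi> (\<tau>, snd z)) (fst z) + G2 z * deriv (\<lambda>\<xi>. \<phi> (fst z, \<xi>)) (snd z))"
        by (simp add: dt dx)
    qed measurable
    also have "\<dots> = (LINT z|lborel. \<bar>v z - k\<bar> * \<psi>t z + sgn (v z - k) * (f (v z) - f k) * \<psi>x z)"
    proof (rule Bochner_Integration.integral_cong[OF refl])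
      fix z
      obtain s R where "0 < s" "\<And>z. \<not> (s \<le> fst z \<and> norm z \<le> R) \<Longrightarrow> \<psi> z = 0 \<and> \<psi>t z = 0 \<and> \<psi>x z = 0"
        using C1_test_support[OF T] by blast
      then show "G1 z * \<psi>t z + G2 z * \<psi>x z = \<bar>v z - k\<bar> * \<psi>t z + sgn (v z - k) * (f (v z) - f k) * \<psi>x z"
        by (cases "0 < fst z") (auto simp: G1_def G2_def indicator_def mem_Times_iff)
    qed
    finally show "0 \<le> (LINT z|lborel. \<bar>v z - k\<bar> * \<psi>t z + sgn (v z - k) * (f (v z) - f k) * \<psi>x z)" .
  qed (use f_lip f_cont vb in auto)
  show thesis
    by (rule that[OF flow we w0e]) (auto simp: w_def clip_bound M)
qed

section \<open>Maximum principle\<close>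

text \<open>Squaring removes the corner of the positive part and leaves exactly the regularity that
  \<open>C1_test\<close> asks for.\<close>

lemma pos_part_square_has_derivative:
  "((\<lambda>r. (max 0 r)\<^sup>2) has_real_derivative 2 * max 0 r) (at (r :: real))"
proof -
  consider "r > 0" | "r < 0" | "r = 0" by linarith
  then show ?thesis
  proof cases
    case 1
    have "((\<lambda>r. r\<^sup>2) has_real_derivative 2 * max 0 r) (at r)"
      using 1 by (auto intro!: derivative_eq_intros)
    then show ?thesis
      by (rule has_field_derivative_transform_within_open[where S = "{0<..}"]) (use 1 in auto)
  next
    case 2
    have "((\<lambda>r. 0) has_real_derivative 2 * max 0 r) (at r)" using 2 by simp
    then show ?thesis
      by (rule has_field_derivative_transform_within_open[where S = "{..<0}"]) (use 2 in auto)
  next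
    case 3
    have "((\<lambda>r :: real. (max 0 r)\<^sup>2) has_real_derivative 0) (at 0)"
    proof (rule has_derivative_zero_of_quadratic_bound[where C = 1])
      show "\<bar>(max 0 x)\<^sup>2\<bar> \<le> 1 * (x - 0)\<^sup>2" for x :: real
        by (auto simp: max_def)
    qed
    then show ?thesis using 3 by simp
  qed
qed

lemma C1_test_cont:
  assumes "C1_test \<psi> \<psi>t \<psi>x"
  shows "continuous_on UNIV \<psi>" "continuous_on UNIV \<psi>t" "continuous_on UNIV \<psi>x"
    and "integrable lborel \<psi>t" "integrable lborel \<psi>x"
proof -
  show c: "continuous_on UNIV \<psi>t" "continuous_on UNIV \<psi>x"
    using assms unfolding C1_test_def by auto
  show "continuous_on UNIV \<psi>"
    by (rule has_derivative_imp_continuous_on_UNIV) (use assms in \<open>auto simp: C1_test_def\<close>)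
  obtain s R where "0 < s" and supp: "\<And>z. \<not> (s \<le> fst z \<and> norm z \<le> R) \<Longrightarrow> \<psi> z = 0 \<and> \<psi>t z = 0 \<and> \<psi>x z = 0"
    using C1_test_support[OF assms] by blast
  show "integrable lborel \<psi>t" "integrable lborel \<psi>x"
    by (rule continuous_vanishing_imp_integrable[of _ R]; use c supp in auto)+
qed

lemma integral_derivative_compact_support:
  fixes g g' :: "real \<Rightarrow> real"
  assumes d: "\<And>x. (g has_real_derivative g' x) (at x)" and c: "continuous_on UNIV g'"
    and z: "\<And>x. R \<le> \<bar>x\<bar> \<Longrightarrow> g x = 0 \<and> g' x = 0"
  shows "(LINT x|lborel. g' x) = 0"
proof -
  define Q where "Q = max R 0"
  have "(LINT x|lborel. indicator {-Q..Q} x *\<^sub>R g' x) = g Q - g (- Q)"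
    by (rule integral_FTC_atLeastAtMost)
       (auto simp: Q_def has_real_derivative_iff_has_vector_derivative[symmetric]
         intro!: has_field_derivative_at_within d continuous_on_subset[OF c])
  moreover have "(\<lambda>x. indicator {-Q..Q} x *\<^sub>R g' x) = g'"
    using z by (force simp: indicator_def Q_def fun_eq_iff)
  ultimately show ?thesis using z[of Q] z[of "-Q"] by (simp add: Q_def)
qed

text \<open>Integrate first in the variable of differentiation. It allows constants to be added to
  entropies and to fluxes.\<close>

lemma C1_test_integral_zero:
  assumes T: "C1_test \<psi> \<psi>t \<psi>x"
  shows "(LINT z|lborel. \<psi>t z) = 0" "(LINT z|lborel. \<psi>x z) = 0"
proof -
  obtain s R where "0 < s" and supp: "\<And>z. \<not> (s \<le> fst z \<and> norm z \<le> R) \<Longrightarrow> \<psi> z = 0 \<and> \<psi>t z = 0 \<and> \<psi>x z = 0"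
    using C1_test_support[OF T] by blast
  have D: "(\<psi> has_derivative (\<lambda>h. fst h * \<psi>t z + snd h * \<psi>x z)) (at z)" for z
    using T unfolding C1_test_def by blast
  have big: "R < norm (t, x)" if "R + 1 \<le> \<bar>t\<bar> \<or> R + 1 \<le> \<bar>x\<bar>" for t x :: real
    using that norm_fst_le[of t x] norm_snd_le[of x t] by auto
  have z: "\<psi> (t, x) = 0 \<and> \<psi>t (t, x) = 0 \<and> \<psi>x (t, x) = 0" if "R + 1 \<le> \<bar>t\<bar> \<or> R + 1 \<le> \<bar>x\<bar>" for t x
    using supp[of "(t, x)"] big[OF that] by auto
  have ct: "continuous_on UNIV (\<lambda>t. \<psi>t (t, x))" "continuous_on UNIV (\<lambda>y. \<psi>x (t, y))" for t x
    by (rule continuous_on_compose2[OF C1_test_cont(2)[OF T]] continuous_on_compose2[OF C1_test_cont(3)[OF T]];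
        intro continuous_intros subset_UNIV)+
  have t0: "(LINT t|lborel. \<psi>t (t, x)) = 0" for x
    by (rule integral_derivative_compact_support[OF has_derivative_plane_partials(1)[OF D] ct(1), of "R + 1"])
       (use z in auto)
  have x0: "(LINT x|lborel. \<psi>x (t, x)) = 0" for t
    by (rule integral_derivative_compact_support[OF has_derivative_plane_partials(2)[OF D] ct(2), of "R + 1"])
       (use z in auto)
  have "integrable (lborel \<Otimes>\<^sub>M lborel) (case_prod (\<lambda>t x. \<psi>t (t, x)))"
    using C1_test_cont(4)[OF T] by (simp add: lborel_prod)
  from lborel_pair.integral_snd[OF this]
  show "(LINT z|lborel. \<psi>t z) = 0" by (simp add: t0 lborel_prod)
  have "integrable (lborel \<Otimes>\<^sub>M lborel) \<psi>x"
    using C1_test_cont(5)[OF T] by (simp add: lborel_prod)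
  from lborel_pair.integral_fst'[OF this]
  show "(LINT z|lborel. \<psi>x z) = 0" by (simp add: x0 lborel_prod)
qed

lemma measurable_fst_plane [measurable]: "fst \<in> borel_measurable (borel :: (real \<times> real) measure)"
  and measurable_snd_plane [measurable]: "snd \<in> borel_measurable (borel :: (real \<times> real) measure)"
  by (intro borel_measurable_continuous_onI continuous_intros)+

context entropy_flow
begin

lemma B_nonneg: "0 \<le> B"
  using v_bound[of undefined] by linarith

lemma f_measurable [measurable]: "f \<in> borel_measurable borel"
  using f_continuous by (rule borel_measurable_continuous_onI)

text \<open>Positive on a domain of dependence that shrinks at speed at least
  \<open>\<Lambda>\<close>; the root is a substitute for \<open>\<bar>x\<bar>\<close> that is smooth
  at 0 and has slope at most 1.\<close>

definition cone :: "real \<Rightarrow> real \<Rightarrow> real \<times> real \<Rightarrow> real" where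
  "cone \<Lambda> R z = max 0 (R - \<Lambda> * fst z - sqrt (1 + (snd z)\<^sup>2))"

text \<open>The time factor switches on between \<open>\<sigma>\<close> and
  \<open>2 * \<sigma>\<close>, which keeps the support away from \<open>t = 0\<close>; the condition
  on \<open>\<Lambda>\<close> bounds the cone in time by \<open>R\<close>.\<close>

lemma cone_test:
  assumes \<sigma>: "0 < \<sigma>" and \<Lambda>: "1 \<le> \<Lambda>"
  shows "C1_test (\<lambda>z. cum ((fst z - \<sigma>) / \<sigma>) * (cone \<Lambda> R z)\<^sup>2)
     (\<lambda>z. kern 0 ((fst z - \<sigma>) / \<sigma>) / \<sigma> * (cone \<Lambda> R z)\<^sup>2 - 2 * \<Lambda> * cum ((fst z - \<sigma>) / \<sigma>) * cone \<Lambda> R z)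
     (\<lambda>z. - 2 * cum ((fst z - \<sigma>) / \<sigma>) * cone \<Lambda> R z * (snd z / sqrt (1 + (snd z)\<^sup>2)))"
proof -
  have pos: "1 + (x :: real)\<^sup>2 > 0" for x by (simp add: add_pos_nonneg)
  have ds: "((\<lambda>x. sqrt (1 + x\<^sup>2)) has_real_derivative x / sqrt (1 + x\<^sup>2)) (at x)" for x :: real
  proof -
    have "((\<lambda>x. 1 + x\<^sup>2) has_real_derivative 2 * x) (at x)"
      by (auto intro!: derivative_eq_intros)
    from DERIV_chain2[OF DERIV_real_sqrt[OF pos[of x]] this]
    show ?thesis by (rule DERIV_cong) (simp add: inverse_eq_divide)
  qed
  have dc: "((\<lambda>z. (cone \<Lambda> R z)\<^sup>2) has_derivative
      (\<lambda>h. (- \<Lambda> * fst h - snd h * (snd z / sqrt (1 + (snd z)\<^sup>2))) * (2 * cone \<Lambda> R z))) (at z)" for z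
  proof -
    have "((\<lambda>z. R - \<Lambda> * fst z - sqrt (1 + (snd z)\<^sup>2)) has_derivative
        (\<lambda>h. 0 - \<Lambda> * fst h - snd h * (snd z / sqrt (1 + (snd z)\<^sup>2)))) (at z)"
      by (intro has_derivative_diff has_derivative_const has_derivative_mult_right has_derivative_fst
          has_derivative_snd has_derivative_ident DERIV_compose_FDERIV[OF ds])
    from DERIV_compose_FDERIV[OF pos_part_square_has_derivative this]
    show ?thesis unfolding cone_def by simp
  qed
  have d\<theta>: "((\<lambda>z :: real \<times> real. cum ((fst z - \<sigma>) / \<sigma>)) has_derivative
      (\<lambda>h. fst h * (kern 0 ((fst z - \<sigma>) / \<sigma>) / \<sigma>))) (at z)" for z
  proof -
    have "((\<lambda>t. cum ((t - \<sigma>) / \<sigma>)) has_real_derivative kern 0 ((t - \<sigma>) / \<sigma>) / \<sigma>) (at t)" for t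
      using \<sigma> by (auto intro!: derivative_eq_intros)
    then show ?thesis
      by (rule DERIV_compose_FDERIV) (intro has_derivative_fst has_derivative_ident)
  qed
  have cc: "continuous_on UNIV (cone \<Lambda> R)"
    unfolding cone_def by (intro continuous_intros)
  show ?thesis
    unfolding C1_test_def
  proof (intro conjI allI)
    fix z :: "real \<times> real"
    show "((\<lambda>z. cum ((fst z - \<sigma>) / \<sigma>) * (cone \<Lambda> R z)\<^sup>2) has_derivative
     (\<lambda>h. fst h * (kern 0 ((fst z - \<sigma>) / \<sigma>) / \<sigma> * (cone \<Lambda> R z)\<^sup>2 - 2 * \<Lambda> * cum ((fst z - \<sigma>) / \<sigma>) * cone \<Lambda> R z)
      + snd h * (- 2 * cum ((fst z - \<sigma>) / \<sigma>) * cone \<Lambda> R z * (snd z / sqrt (1 + (snd z)\<^sup>2))))) (at z)"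
      by (rule has_derivative_eq_rhs[OF has_derivative_mult[OF d\<theta> dc]]) (simp add: fun_eq_iff algebra_simps)
    show "0 \<le> cum ((fst z - \<sigma>) / \<sigma>) * (cone \<Lambda> R z)\<^sup>2" using cum_bounds by simp
  next
    show "\<exists>s>0. \<exists>R'. \<forall>z. cum ((fst z - \<sigma>) / \<sigma>) * (cone \<Lambda> R z)\<^sup>2 \<noteq> 0 \<longrightarrow> s \<le> fst z \<and> norm z \<le> R'"
    proof (rule exI[of _ \<sigma>], rule conjI[OF \<sigma>], rule exI[of _ "2 * \<bar>R\<bar>"], intro allI impI conjI)
      fix z assume nz: "cum ((fst z - \<sigma>) / \<sigma>) * (cone \<Lambda> R z)\<^sup>2 \<noteq> 0"
      have t: "\<sigma> \<le> fst z"
      proof (rule ccontr)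
        assume "\<not> \<sigma> \<le> fst z"
        then have "(fst z - \<sigma>) / \<sigma> \<le> 0" using \<sigma> by (simp add: divide_le_0_iff)
        then show False using nz cum_eq_0 by simp
      qed
      then show "\<sigma> \<le> fst z" .
      have "R - \<Lambda> * fst z - sqrt (1 + (snd z)\<^sup>2) > 0" using nz by (auto simp: cone_def max_def split: if_splits)
      moreover have "\<bar>snd z\<bar> \<le> sqrt (1 + (snd z)\<^sup>2)" by (rule real_le_rsqrt) simp
      moreover have "fst z \<le> \<Lambda> * fst z" using \<Lambda> t \<sigma> by simp
      ultimately have "\<bar>fst z\<bar> \<le> \<bar>R\<bar>" "\<bar>snd z\<bar> \<le> \<bar>R\<bar>" using t \<sigma> by linarith+
      then show "norm z \<le> 2 * \<bar>R\<bar>" using norm_Pair_le[of "fst z" "snd z"] by simp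
    qed
  qed (use \<sigma> pos in \<open>auto intro!: continuous_intros cc simp: less_imp_neq[symmetric]\<close>)
qed

lemma lipschitz_const:
  obtains \<Lambda> where "0 \<le> \<Lambda>" "\<And>x y. \<bar>x\<bar> \<le> R \<Longrightarrow> \<bar>y\<bar> \<le> R \<Longrightarrow> \<bar>f x - f y\<bar> \<le> \<Lambda> * \<bar>x - y\<bar>"
  using f_lipschitz[of R] by blast

lemma integrable_C1_test_mult:
  assumes T: "C1_test \<psi> \<psi>t \<psi>x" and "g \<in> borel_measurable borel" "\<And>z. \<bar>g z\<bar> \<le> C"
  shows "integrable lborel (\<lambda>z. g z * \<psi>t z)" "integrable lborel (\<lambda>z. g z * \<psi>x z)"
  using C1_test_cont(4,5)[OF T] assms(2,3) by (auto intro!: integrable_bounded_mult)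

text \<open>
  The inequalities for \<open>k = M\<close> and \<open>k = - M\<close> add up to one for \<open>2 (\<bar>v\<bar> - M)\<^sub>+\<close>, up to constants, which
  integrate to zero against derivatives of test functions.
\<close>

lemma excess_entropy:
  assumes T: "C1_test \<psi> \<psi>t \<psi>x" and M: "0 < M"
    and \<Lambda>: "\<And>x y. \<bar>x\<bar> \<le> max B M \<Longrightarrow> \<bar>y\<bar> \<le> max B M \<Longrightarrow> \<bar>f x - f y\<bar> \<le> \<Lambda> * \<bar>x - y\<bar>"
  shows "0 \<le> (LINT z|lborel. max 0 (\<bar>v z\<bar> - M) * (\<psi>t z + \<Lambda> * \<bar>\<psi>x z\<bar>))"
proof -
  define q where "q k z = sgn (v z - k) * (f (v z) - f k)" for k z
  have [measurable]: "q k \<in> borel_measurable borel" for k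
    unfolding q_def[abs_def] by measurable
  define P where "P z = max 0 (\<bar>v z\<bar> - M)" for z
  \<comment> \<open>Where \<open>\<bar>v z\<bar> \<le> M\<close>, the two entropy fluxes add up to
    \<open>f M - f (- M)\<close>. Subtracting this constant makes \<open>Q\<close> vanish there, so
    that \<open>Q\<close> can be bounded by the excess \<open>P\<close>.\<close>
  define Q where "Q z = q M z + q (- M) z - (f M - f (- M))" for z
  have [measurable]: "P \<in> borel_measurable borel" "Q \<in> borel_measurable borel"
    unfolding P_def[abs_def] Q_def[abs_def] by measurable
  have vM: "\<bar>v z\<bar> \<le> max B M" "\<bar>M\<bar> \<le> max B M" "\<bar>-M\<bar> \<le> max B M" for z
    using v_bound[of z] M by auto
  have \<Lambda>0: "0 \<le> \<Lambda>"
  proof -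
    have "0 \<le> \<Lambda> * (2 * M)"
      using order_trans[OF abs_ge_zero \<Lambda>[OF vM(2,3)]] M by simp
    then show ?thesis using M by (auto simp: zero_le_mult_iff)
  qed
  have QP: "\<bar>Q z\<bar> \<le> 2 * \<Lambda> * P z" for z
  proof -
    consider "v z > M" | "v z < - M" | "\<bar>v z\<bar> \<le> M" by linarith
    then show ?thesis
    proof cases
      case 1
      then have "Q z = 2 * (f (v z) - f M)" using M by (simp add: Q_def q_def)
      then show ?thesis using \<Lambda>[OF vM(1,2), of z] 1 M by (simp add: P_def abs_mult)
    next
      case 2
      then have "Q z = - 2 * (f (v z) - f (- M))" using M by (simp add: Q_def q_def)
      then show ?thesis using \<Lambda>[OF vM(1,3), of z] 2 M by (simp add: P_def abs_mult)
    next
      case 3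
      then have "Q z = 0" using M by (cases "v z = - M") (auto simp: Q_def q_def sgn_real_def)
      then show ?thesis using \<Lambda>0 by (simp add: P_def)
    qed
  qed
  have PB: "\<bar>P z\<bar> \<le> B" for z using v_bound[of z] M B_nonneg by (auto simp: P_def)
  have QB: "\<bar>Q z\<bar> \<le> 2 * \<Lambda> * B" for z
  proof -
    have "P z \<le> B" using PB[of z] by linarith
    then have "2 * \<Lambda> * P z \<le> 2 * \<Lambda> * B" using \<Lambda>0 by (intro mult_left_mono) auto
    then show ?thesis using QP[of z] by linarith
  qed
  have qB: "\<bar>q k z\<bar> \<le> \<Lambda> * (B + M)" if "k = M \<or> k = - M" for k z
  proof -
    have "\<bar>q k z\<bar> \<le> \<bar>f (v z) - f k\<bar>" by (auto simp: q_def abs_mult sgn_real_def)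
    also have "\<dots> \<le> \<Lambda> * \<bar>v z - k\<bar>" using that vM(1)[of z] vM(2,3) \<Lambda>[of "v z" k] by auto
    also have "\<dots> \<le> \<Lambda> * (B + M)" using that \<Lambda>0 M v_bound[of z] by (intro mult_left_mono) auto
    finally show ?thesis .
  qed
  have vkB: "\<bar>\<bar>v z - k\<bar>\<bar> \<le> B + \<bar>k\<bar>" for z k using v_bound[of z] by linarith
  note it = integrable_C1_test_mult[OF T]
  have iv: "integrable lborel (\<lambda>z. \<bar>v z - k\<bar> * \<psi>t z)" for k by (rule it(1)[OF _ vkB]) measurable
  have iq: "integrable lborel (\<lambda>z. q k z * \<psi>x z)" if "k = M \<or> k = - M" for k
    by (rule it(2)[OF _ qB[OF that]]) measurable
  note i0 = C1_test_cont(4,5)[OF T]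
  have e: "0 \<le> (LINT z|lborel. \<bar>v z - k\<bar> * \<psi>t z) + (LINT z|lborel. q k z * \<psi>x z)" if "k = M \<or> k = - M" for k
    using entropy[OF T, of k] iv[of k] iq[OF that] by (simp add: q_def)
  have P2: "2 * P z = \<bar>v z - M\<bar> + \<bar>v z - (- M)\<bar> - 2 * M" for z
    unfolding P_def using M by (auto simp: max_def abs_if split: if_splits)
  have A: "(LINT z|lborel. 2 * P z * \<psi>t z)
      = (LINT z|lborel. \<bar>v z - M\<bar> * \<psi>t z) + (LINT z|lborel. \<bar>v z - (- M)\<bar> * \<psi>t z) - (LINT z|lborel. 2 * M * \<psi>t z)"
    using iv[of M] iv[of "- M"] i0 unfolding P2 by (simp add: distrib_right left_diff_distrib)
  have Q2: "(LINT z|lborel. Q z * \<psi>x z)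
      = (LINT z|lborel. q M z * \<psi>x z) + (LINT z|lborel. q (- M) z * \<psi>x z) - (LINT z|lborel. (f M - f (- M)) * \<psi>x z)"
    using iq[of M] iq[of "- M"] i0 unfolding Q_def by (simp add: distrib_right left_diff_distrib)
  have iP: "integrable lborel (\<lambda>z. 2 * P z * \<psi>t z)"
    using it(1)[OF _ PB] by (simp add: mult.assoc)
  have iQ: "integrable lborel (\<lambda>z. Q z * \<psi>x z)"
    by (rule it(2)[OF _ QB]) measurable
  have iPx: "integrable lborel (\<lambda>z. P z * \<bar>\<psi>x z\<bar>)"
    using i0(2) by (intro integrable_bounded_mult[OF _ _ PB]) auto
  have "0 \<le> (LINT z|lborel. 2 * P z * \<psi>t z) + (LINT z|lborel. Q z * \<psi>x z)"
    unfolding A Q2 using e[of M] e[of "- M"] C1_test_integral_zero[OF T] by simp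
  also have "\<dots> = (LINT z|lborel. 2 * P z * \<psi>t z + Q z * \<psi>x z)"
    using iP iQ by simp
  also have "\<dots> \<le> (LINT z|lborel. 2 * (P z * (\<psi>t z + \<Lambda> * \<bar>\<psi>x z\<bar>)))"
  proof (rule integral_mono)
    have "integrable lborel (\<lambda>z. 2 * P z * \<psi>t z + 2 * \<Lambda> * (P z * \<bar>\<psi>x z\<bar>))"
      using iP iPx by (intro Bochner_Integration.integrable_add integrable_mult_right) auto
    then show "integrable lborel (\<lambda>z. 2 * (P z * (\<psi>t z + \<Lambda> * \<bar>\<psi>x z\<bar>)))"
      by (rule Bochner_Integration.integrable_cong[THEN iffD1, rotated -1]) (auto simp: algebra_simps)
    fix z
    have "Q z * \<psi>x z \<le> \<bar>Q z\<bar> * \<bar>\<psi>x z\<bar>" by (metis abs_ge_self abs_mult)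
    also have "\<dots> \<le> 2 * \<Lambda> * P z * \<bar>\<psi>x z\<bar>" using QP by (intro mult_right_mono) auto
    finally show "2 * P z * \<psi>t z + Q z * \<psi>x z \<le> 2 * (P z * (\<psi>t z + \<Lambda> * \<bar>\<psi>x z\<bar>))"
      by (simp add: algebra_simps)
  qed (use iP iQ in simp)
  finally show ?thesis by (simp add: P_def)
qed

text \<open>Test \<open>excess_entropy\<close> with the squared cone. The shrinking of the cone
  outweighs the transport through its sides, and the only positive contribution comes from a time
  layer near 0, where the excess over \<open>M\<close> is at most
  \<open>\<bar>w t x - w 0 x\<bar>\<close>.\<close>

lemma max_principle_cone:
  assumes M: "0 < M" and w0: "\<And>x. \<bar>w 0 x\<bar> \<le> M"
  obtains \<Lambda> where "1 \<le> \<Lambda>" "\<And>R. 0 \<le> R \<Longrightarrow> AE z in lborel. 0 < fst z \<longrightarrow> max 0 (\<bar>v z\<bar> - M) * cone \<Lambda> R z = 0"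
proof -
  obtain \<Lambda> where \<Lambda>: "0 \<le> \<Lambda>"
    "\<And>x y. \<bar>x\<bar> \<le> max B M \<Longrightarrow> \<bar>y\<bar> \<le> max B M \<Longrightarrow> \<bar>f x - f y\<bar> \<le> \<Lambda> * \<bar>x - y\<bar>"
    using lipschitz_const by blast
  \<comment> \<open>One more than the Lipschitz constant: the surplus leaves a negative term
    proportional to the cone, and this term carries the conclusion.\<close>
  define \<Lambda>' where "\<Lambda>' = \<Lambda> + 1"
  define P where "P z = max 0 (\<bar>v z\<bar> - M)" for z
  have [measurable]: "P \<in> borel_measurable borel" unfolding P_def[abs_def] by measurable
  have PB: "\<bar>P z\<bar> \<le> B" for z using v_bound[of z] M B_nonneg by (auto simp: P_def)
  have Pp: "0 \<le> P z" for z by (simp add: P_def)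
  have [measurable]: "cone l R \<in> borel_measurable borel" for l R
    unfolding cone_def[abs_def] by (intro borel_measurable_continuous_onI continuous_intros)
  have cp: "0 \<le> cone l R z" for l R z by (simp add: cone_def)
  have "AE z in lborel. 0 < fst z \<longrightarrow> P z * cone \<Lambda>' R z = 0" if R: "0 \<le> R" for R
  proof -
    have c: "1 \<le> \<Lambda>'" using \<Lambda> by (simp add: \<Lambda>'_def)
    have csupp: "\<bar>t\<bar> \<le> R \<and> \<bar>x\<bar> \<le> R" if "cone \<Lambda>' R (t, x) \<noteq> 0" "0 < t" for t x
    proof -
      have "R - \<Lambda>' * t - sqrt (1 + x\<^sup>2) > 0" using that by (auto simp: cone_def max_def split: if_splits)
      moreover have "\<bar>x\<bar> \<le> sqrt (1 + x\<^sup>2)" by (rule real_le_rsqrt) simp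
      moreover have "t \<le> \<Lambda>' * t" using c that by simp
      ultimately show ?thesis using that by linarith
    qed
    have cR: "cone \<Lambda>' R (t, x) \<le> R" if "0 < t" for t x
    proof -
      have "0 \<le> \<Lambda>' * t" using c that by simp
      moreover have "0 \<le> sqrt (1 + x\<^sup>2)" by (simp add: add_nonneg_nonneg)
      ultimately show ?thesis
        unfolding cone_def fst_conv snd_conv using R by (intro max.boundedI) linarith+
    qed
    \<comment> \<open>Here \<open>e\<close> bounds the local distance to the initial datum during
      the layer in which the cut-off switches on.\<close>
    have main: "(LINT z|lborel. P z * (cum ((fst z - \<sigma>) / \<sigma>) * cone \<Lambda>' R z)) \<le> R\<^sup>2 * e"
      if \<sigma>: "0 < \<sigma>" and L: "\<And>t. 0 < t \<Longrightarrow> t \<le> 2 * \<sigma> \<Longrightarrow> (LINT x:{-R..R}|lborel. \<bar>w t x - w 0 x\<bar>) \<le> e" for \<sigma> e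
    proof -
      let ?\<theta> = "\<lambda>t. cum ((t - \<sigma>) / \<sigma>)" and ?\<theta>' = "\<lambda>t. kern 0 ((t - \<sigma>) / \<sigma>) / \<sigma>"
      define \<psi>t where "\<psi>t z = ?\<theta>' (fst z) * (cone \<Lambda>' R z)\<^sup>2 - 2 * \<Lambda>' * ?\<theta> (fst z) * cone \<Lambda>' R z" for z
      define \<psi>x where "\<psi>x z = - 2 * ?\<theta> (fst z) * cone \<Lambda>' R z * (snd z / sqrt (1 + (snd z)\<^sup>2))" for z
      note T = cone_test[OF \<sigma> c, of R, folded \<psi>t_def[abs_def] \<psi>x_def[abs_def]]
      have xs: "\<bar>\<psi>x z\<bar> \<le> 2 * ?\<theta> (fst z) * cone \<Lambda>' R z" for z
      proof -
        have p: "0 < sqrt (1 + (snd z)\<^sup>2)" by (simp add: add_pos_nonneg)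
        have "\<bar>snd z\<bar> \<le> sqrt (1 + (snd z)\<^sup>2)" by (rule real_le_rsqrt) simp
        then have "\<bar>snd z / sqrt (1 + (snd z)\<^sup>2)\<bar> \<le> 1"
          using p by (simp add: divide_le_eq)
        then have "\<bar>2 * ?\<theta> (fst z) * cone \<Lambda>' R z\<bar> * \<bar>snd z / sqrt (1 + (snd z)\<^sup>2)\<bar> \<le> \<bar>2 * ?\<theta> (fst z) * cone \<Lambda>' R z\<bar> * 1"
          by (rule mult_left_mono) simp
        then show ?thesis using cum_bounds cp by (simp add: \<psi>x_def abs_mult)
      qed
      let ?A = "\<lambda>z. P z * (?\<theta>' (fst z) * (cone \<Lambda>' R z)\<^sup>2)"
      let ?C = "\<lambda>z. P z * (?\<theta> (fst z) * cone \<Lambda>' R z)"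
      have \<theta>p: "0 \<le> ?\<theta>' t" for t using \<sigma> kern_0_nonneg by simp
      have bt: "\<sigma> < t \<and> t < 2 * \<sigma>" if "?\<theta>' t \<noteq> 0" for t
        using kern_nonzeroD[of 0 "(t - \<sigma>) / \<sigma>"] that \<sigma> by (auto simp: zero_less_divide_iff divide_less_eq)
      obtain K where K: "0 \<le> K" "\<And>x. \<bar>kern 0 x\<bar> \<le> K" using kern_bounded by blast
      have box: "cone \<Lambda>' R z = 0 \<or> norm z \<le> 2 * R" if "0 < fst z" for z
        using csupp[of "fst z" "snd z"] norm_Pair_le[of "fst z" "snd z"] that
        by (cases "cone \<Lambda>' R z = 0") auto
      have ind: "integrable lborel (\<lambda>z. indicator (cball (0 :: real \<times> real) (2 * R)) z * (b :: real))" for b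
        by (intro integrable_mult_left integrable_real_indicator)
           (use emeasure_lborel_cball_finite[of "0 :: real \<times> real" "2 * R", unfolded infinity_ennreal_def] in auto)
      have iA: "integrable lborel ?A"
      proof (rule Bochner_Integration.integrable_bound[OF ind[of "B * (K / \<sigma> * R\<^sup>2)"]])
        show "AE z in lborel. norm (?A z) \<le> norm (indicator (cball 0 (2 * R)) z * (B * (K / \<sigma> * R\<^sup>2)))"
        proof (rule AE_I2)
          fix z :: "real \<times> real"
          show "norm (?A z) \<le> norm (indicator (cball 0 (2 * R)) z * (B * (K / \<sigma> * R\<^sup>2)))"
          proof (cases "?A z = 0")
            case False
            then have nz: "?\<theta>' (fst z) \<noteq> 0" "cone \<Lambda>' R z \<noteq> 0" by auto
            then have pz: "0 < fst z" using bt \<sigma> by force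
            have "z \<in> cball 0 (2 * R)" using box[OF pz] nz by simp
            moreover have "\<bar>?A z\<bar> \<le> B * (K / \<sigma> * R\<^sup>2)"
              unfolding abs_mult using PB[of z] K(2) \<sigma> cR[OF pz, of "snd z"] cp[of \<Lambda>' R z] B_nonneg K(1)
              by (intro mult_mono power_mono) (auto intro!: divide_right_mono power_mono)
            then have "\<bar>?A z\<bar> \<le> \<bar>B * (K / \<sigma> * R\<^sup>2)\<bar>" by (rule order_trans[OF _ abs_ge_self])
            ultimately show ?thesis by (simp only: real_norm_def indicator_simps(1) mult_1)
          qed (simp only: norm_zero norm_ge_zero)
        qed
      qed measurable
      have iC: "integrable lborel ?C"
      proof (rule Bochner_Integration.integrable_bound[OF ind[of "B * (1 * R)"]])
        show "AE z in lborel. norm (?C z) \<le> norm (indicator (cball 0 (2 * R)) z * (B * (1 * R)))"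
        proof (rule AE_I2)
          fix z :: "real \<times> real"
          show "norm (?C z) \<le> norm (indicator (cball 0 (2 * R)) z * (B * (1 * R)))"
          proof (cases "?C z = 0")
            case False
            then have nz: "?\<theta> (fst z) \<noteq> 0" "cone \<Lambda>' R z \<noteq> 0" by auto
            have pz: "0 < fst z"
            proof (rule ccontr)
              assume "\<not> 0 < fst z"
              then have "(fst z - \<sigma>) / \<sigma> \<le> 0" using \<sigma> by (simp add: divide_le_0_iff)
              then show False using nz cum_eq_0 by simp
            qed
            have "z \<in> cball 0 (2 * R)" using box[OF pz] nz by simp
            moreover have "\<bar>?C z\<bar> \<le> B * (1 * R)"
              unfolding abs_mult using PB[of z] \<sigma> cR[OF pz, of "snd z"] cp[of \<Lambda>' R z] B_nonneg cum_bounds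
              by (intro mult_mono) (auto)
            ultimately show ?thesis by simp
          qed (simp only: norm_zero norm_ge_zero)
        qed
      qed measurable
      have "0 \<le> (LINT z|lborel. P z * (\<psi>t z + \<Lambda> * \<bar>\<psi>x z\<bar>))"
        using excess_entropy[OF T M \<Lambda>(2)] by (simp add: P_def)
      also have "\<dots> \<le> (LINT z|lborel. ?A z - 2 * ?C z)"
      proof (rule integral_mono)
        show "integrable lborel (\<lambda>z. P z * (\<psi>t z + \<Lambda> * \<bar>\<psi>x z\<bar>))"
          using C1_test_cont(4,5)[OF T] by (intro integrable_bounded_mult[OF _ _ PB]) auto
        show "integrable lborel (\<lambda>z. ?A z - 2 * ?C z)" using iA iC by simp
        fix z
        have "\<psi>t z + \<Lambda> * \<bar>\<psi>x z\<bar> \<le> \<psi>t z + \<Lambda> * (2 * ?\<theta> (fst z) * cone \<Lambda>' R z)"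
          using xs[of z] \<Lambda>(1) by (intro add_left_mono mult_left_mono) auto
        also have "\<dots> = ?\<theta>' (fst z) * (cone \<Lambda>' R z)\<^sup>2 - 2 * (?\<theta> (fst z) * cone \<Lambda>' R z)"
          by (simp add: \<psi>t_def \<Lambda>'_def algebra_simps)
        finally have "P z * (\<psi>t z + \<Lambda> * \<bar>\<psi>x z\<bar>) \<le> P z * \<dots>" by (rule mult_left_mono[OF _ Pp])
        then show "P z * (\<psi>t z + \<Lambda> * \<bar>\<psi>x z\<bar>) \<le> ?A z - 2 * ?C z" by (simp add: algebra_simps)
      qed
      also have "\<dots> = (LINT z|lborel. ?A z) - 2 * (LINT z|lborel. ?C z)"
        using iA iC by simp
      finally have AC: "2 * (LINT z|lborel. ?C z) \<le> (LINT z|lborel. ?A z)" by simp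
      have e0: "0 \<le> e"
      proof -
        have "0 \<le> (LINT x:{-R..R}|lborel. \<bar>w \<sigma> x - w 0 x\<bar>)"
          unfolding set_lebesgue_integral_def by (rule Bochner_Integration.integral_nonneg) simp
        then show ?thesis using L[of \<sigma>] \<sigma> by simp
      qed
      have "integrable (lborel \<Otimes>\<^sub>M lborel) ?A" using iA by (simp add: lborel_prod)
      note fub = lborel_pair.integral_fst'[OF this] lborel_pair.integrable_fst'[OF this]
      have i\<theta>: "integrable lborel ?\<theta>'" "(LINT t|lborel. ?\<theta>' t) = 1"
      proof -
        have e: "(x - \<sigma>) / \<sigma> = - 1 + 1 / \<sigma> * x" for x using \<sigma> by (simp add: field_simps)
        show "integrable lborel ?\<theta>'"
          using lborel_integrable_real_affine[OF kern_integrable[of 0], of "1 / \<sigma>" "- 1"] \<sigma> unfolding e by simp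
        show "(LINT t|lborel. ?\<theta>' t) = 1"
          using lborel_integral_real_affine[of "1 / \<sigma>" "kern 0" "- 1"] \<sigma> kern_0_integral unfolding e
          by (simp add: field_simps)
      qed
      have "(LINT z|lborel. ?A z) = (LINT t|lborel. LINT x|lborel. ?A (t, x))"
        using fub(1)[symmetric] by (simp only: lborel_prod)
      also have "\<dots> \<le> (LINT t|lborel. ?\<theta>' t * (R\<^sup>2 * e))"
      proof (rule integral_mono_AE)
        show "AE t in lborel. (LINT x|lborel. ?A (t, x)) \<le> ?\<theta>' t * (R\<^sup>2 * e)"
          using w_eq_v
        proof eventually_elim
          case (elim t)
          show ?case
          proof (cases "?\<theta>' t = 0")
            case False
            then have t: "0 < t" "t \<le> 2 * \<sigma>" using bt[OF False] \<sigma> by auto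
            have wv: "v (t, x) = w t x" for x using elim t by simp
            have si: "set_integrable lborel {-R..R} (\<lambda>x. \<bar>w t x - w 0 x\<bar>)"
            proof (rule set_integrable_bound[where f = "\<lambda>_. 2 * B"])
              show "set_integrable lborel {- R..R} (\<lambda>_. 2 * B)"
                unfolding set_integrable_def by (intro integrable_scaleR_left integrable_real_indicator) (auto simp: emeasure_lborel_Icc_eq)
              show "AE x in lborel. x \<in> {-R..R} \<longrightarrow> norm \<bar>w t x - w 0 x\<bar> \<le> norm (2 * B)"
                using w_bound[of t] w_bound[of 0] B_nonneg by (intro AE_I2 impI) (smt (verit) real_norm_def)
            qed (simp add: set_borel_measurable_def)
            have "(LINT x|lborel. ?A (t, x)) \<le> (LINT x|lborel. ?\<theta>' t * (R\<^sup>2 * (indicator {-R..R} x *\<^sub>R \<bar>w t x - w 0 x\<bar>)))"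
            proof (rule integral_mono')
              show "integrable lborel (\<lambda>x. ?\<theta>' t * (R\<^sup>2 * (indicator {-R..R} x *\<^sub>R \<bar>w t x - w 0 x\<bar>)))"
                using si unfolding set_integrable_def by (intro integrable_mult_right)
              fix x
              show n: "0 \<le> ?\<theta>' t * (R\<^sup>2 * (indicator {-R..R} x *\<^sub>R \<bar>w t x - w 0 x\<bar>))"
                using \<theta>p[of t] by (intro mult_nonneg_nonneg) auto
              show "?A (t, x) \<le> ?\<theta>' t * (R\<^sup>2 * (indicator {-R..R} x *\<^sub>R \<bar>w t x - w 0 x\<bar>))"
              proof (cases "cone \<Lambda>' R (t, x) = 0")
                case True
                then have "?A (t, x) = 0" by simp
                then show ?thesis using n by (simp only:)
              next
                case False
                then have x: "x \<in> {-R..R}" using csupp[OF False t(1)] by auto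
                have "P (t, x) \<le> \<bar>w t x - w 0 x\<bar>" using w0[of x] by (auto simp: P_def wv)
                moreover have "(cone \<Lambda>' R (t, x))\<^sup>2 \<le> R\<^sup>2" using cR[OF t(1)] cp by (intro power_mono)
                ultimately have "P (t, x) * (cone \<Lambda>' R (t, x))\<^sup>2 \<le> \<bar>w t x - w 0 x\<bar> * R\<^sup>2"
                  by (intro mult_mono) (auto simp: Pp)
                from mult_left_mono[OF this \<theta>p[of t]]
                show ?thesis using x by (simp add: mult_ac)
              qed
            qed
            also have "\<dots> = ?\<theta>' t * (R\<^sup>2 * (LINT x:{-R..R}|lborel. \<bar>w t x - w 0 x\<bar>))"
              unfolding set_lebesgue_integral_def by simp
            also have "\<dots> \<le> ?\<theta>' t * (R\<^sup>2 * e)"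
              using L[OF t] \<theta>p[of t] by (intro mult_left_mono) auto
            finally show ?thesis .
          next
            case True
            have "?A (t, x) = 0" for x using True by (simp only: fst_conv mult_zero_left mult_zero_right)
            then show ?thesis
              by (simp only: True Bochner_Integration.integral_zero mult_zero_left order_refl)
          qed
        qed
        show "integrable lborel (\<lambda>t. LINT x|lborel. ?A (t, x))" using fub(2) .
        show "integrable lborel (\<lambda>t. ?\<theta>' t * (R\<^sup>2 * e))" using i\<theta> by (intro integrable_mult_left)
      qed
      also have "\<dots> = R\<^sup>2 * e" using i\<theta> by simp
      finally have "2 * (LINT z|lborel. ?C z) \<le> R\<^sup>2 * e" using AC by simp
      moreover have "0 \<le> R\<^sup>2 * e" using e0 by simp
      ultimately show ?thesis by linarith
    qed
    have zero: "AE z in lborel. \<tau> \<le> fst z \<longrightarrow> P z * cone \<Lambda>' R z = 0" if \<tau>: "0 < \<tau>" for \<tau>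
    proof -
      let ?G = "\<lambda>z :: real \<times> real. indicator {z. \<tau> \<le> fst z} z * (P z * cone \<Lambda>' R z)"
      have box: "cone \<Lambda>' R z = 0 \<or> norm z \<le> 2 * R" if "0 < fst z" for z
        using csupp[of "fst z" "snd z"] norm_Pair_le[of "fst z" "snd z"] that
        by (cases "cone \<Lambda>' R z = 0") auto
      have ind: "integrable lborel (\<lambda>z. indicator (cball (0 :: real \<times> real) (2 * R)) z * (b :: real))" for b
        by (intro integrable_mult_left integrable_real_indicator)
           (use emeasure_lborel_cball_finite[of "0 :: real \<times> real" "2 * R", unfolded infinity_ennreal_def] in auto)
      have [measurable]: "{z :: real \<times> real. \<tau> \<le> fst z} \<in> sets borel" by simp
      have dom: "integrable lborel (\<lambda>z. P z * (h z * cone \<Lambda>' R z))"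
        if [measurable]: "h \<in> borel_measurable borel" and h: "\<And>z. 0 \<le> h z \<and> h z \<le> 1" "\<And>z. fst z \<le> 0 \<Longrightarrow> h z = 0" for h
      proof (rule Bochner_Integration.integrable_bound[OF ind[of "B * (1 * R)"]])
        show "AE z in lborel. norm (P z * (h z * cone \<Lambda>' R z)) \<le> norm (indicator (cball 0 (2 * R)) z * (B * (1 * R)))"
        proof (rule AE_I2)
          fix z :: "real \<times> real"
          show "norm (P z * (h z * cone \<Lambda>' R z)) \<le> norm (indicator (cball 0 (2 * R)) z * (B * (1 * R)))"
          proof (cases "h z * cone \<Lambda>' R z = 0")
            case False
            then have pz: "0 < fst z" using h(2)[of z] by force
            have "z \<in> cball 0 (2 * R)" using box[OF pz] False by simp
            moreover have "\<bar>P z * (h z * cone \<Lambda>' R z)\<bar> \<le> B * (1 * R)"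
              unfolding abs_mult using PB[of z] cR[OF pz, of "snd z"] cp[of \<Lambda>' R z] B_nonneg h(1)[of z]
              by (intro mult_mono) auto
            ultimately show ?thesis by simp
          qed auto
        qed
      qed measurable
      have iG: "integrable lborel ?G"
      proof -
        have "integrable lborel (\<lambda>z. P z * (indicator {z. \<tau> \<le> fst z} z * cone \<Lambda>' R z))"
          by (rule dom) (use \<tau> in \<open>auto simp: indicator_def\<close>)
        then show ?thesis by (simp add: mult_ac)
      qed
      have le: "(LINT z|lborel. ?G z) \<le> R\<^sup>2 * e" if e: "0 < e" for e
      proof -
        have "\<forall>\<^sub>F t in at 0 within {0..}. (LINT x:{-R..R}|lborel. \<bar>w t x - w 0 x\<bar>) < e"
          using order_tendstoD(2)[OF w_continuous[of 0 R] e] by simp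
        then obtain d where d: "d > 0" "\<And>t. 0 < t \<Longrightarrow> t < d \<Longrightarrow> (LINT x:{-R..R}|lborel. \<bar>w t x - w 0 x\<bar>) < e"
          unfolding eventually_at by (auto simp: dist_real_def)
        \<comment> \<open>The layer from \<open>\<sigma>\<close> to \<open>2 * \<sigma>\<close> must
          end before \<open>d\<close>, and the cut-off must equal 1 from \<open>\<tau>\<close>
          on.\<close>
        define \<sigma> where "\<sigma> = min d \<tau> / 3"
        have \<sigma>: "0 < \<sigma>" "2 * \<sigma> < d" "2 * \<sigma> \<le> \<tau>" using d \<tau> by (auto simp: \<sigma>_def)
        have "(LINT z|lborel. ?G z) \<le> (LINT z|lborel. P z * (cum ((fst z - \<sigma>) / \<sigma>) * cone \<Lambda>' R z))"
        proof (rule integral_mono[OF iG])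
          show "integrable lborel (\<lambda>z. P z * (cum ((fst z - \<sigma>) / \<sigma>) * cone \<Lambda>' R z))"
          proof (rule dom)
            fix z :: "real \<times> real" assume "fst z \<le> 0"
            then have "(fst z - \<sigma>) / \<sigma> \<le> 0" using \<sigma> by (simp add: divide_le_0_iff)
            then show "cum ((fst z - \<sigma>) / \<sigma>) = 0" by (rule cum_eq_0)
          qed (use cum_bounds in auto)
          fix z
          show "?G z \<le> P z * (cum ((fst z - \<sigma>) / \<sigma>) * cone \<Lambda>' R z)"
          proof (cases "\<tau> \<le> fst z")
            case True
            then have "1 \<le> (fst z - \<sigma>) / \<sigma>" using \<sigma> by (simp add: le_divide_eq)
            then show ?thesis using True cum_eq_1 by simp
          next
            case False
            then show ?thesis using Pp cp cum_bounds by simp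
          qed
        qed
        also have "\<dots> \<le> R\<^sup>2 * e"
          by (rule main[OF \<sigma>(1)]) (use d \<sigma> in \<open>auto intro!: less_imp_le\<close>)
        finally show ?thesis .
      qed
      have "(LINT z|lborel. ?G z) \<le> 0"
      proof (rule field_le_epsilon)
        fix e :: real assume "0 < e"
        then have "(LINT z|lborel. ?G z) \<le> R\<^sup>2 * (e / (R\<^sup>2 + 1))" by (intro le divide_pos_pos add_nonneg_pos) auto
        also have "\<dots> \<le> e"
        proof -
          have p: "0 < R\<^sup>2 + 1" by (simp add: add_nonneg_pos)
          show ?thesis using \<open>0 < e\<close> by (simp add: pos_divide_le_eq[OF p] distrib_left mult.commute)
        qed
        finally show "(LINT z|lborel. ?G z) \<le> 0 + e" by simp
      qed
      moreover have "0 \<le> (LINT z|lborel. ?G z)"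
        using Pp cp by (intro Bochner_Integration.integral_nonneg) auto
      ultimately have "(LINT z|lborel. ?G z) = 0" by linarith
      then have "AE z in lborel. ?G z = 0"
        by (subst (asm) integral_nonneg_eq_0_iff_AE[OF iG]) (use Pp cp in auto)
      then show ?thesis by eventually_elim (auto simp: indicator_def)
    qed
    have "AE z in lborel. \<forall>n :: nat. 1 / real (Suc n) \<le> fst z \<longrightarrow> P z * cone \<Lambda>' R z = 0"
      unfolding AE_all_countable using zero by simp
    then show ?thesis
    proof eventually_elim
      case (elim z)
      show ?case
      proof
        assume "0 < fst z"
        then obtain n where "inverse (real (Suc n)) < fst z" using reals_Archimedean by blast
        then show "P z * cone \<Lambda>' R z = 0" using elim[rule_format, of n] by (simp add: inverse_eq_divide)
      qed
    qed
  qed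
  then show thesis using that[of \<Lambda>'] \<Lambda>(1) by (simp add: P_def \<Lambda>'_def)
qed

text \<open>The cones with integer \<open>R\<close> exhaust the half plane, and countably many null
  sets form a null set.\<close>

lemma max_principle:
  assumes M: "0 < M" and w0: "\<And>x. \<bar>w 0 x\<bar> \<le> M"
  shows "AE z in lborel. 0 < fst z \<longrightarrow> \<bar>v z\<bar> \<le> M"
proof -
  obtain \<Lambda> where \<Lambda>: "1 \<le> \<Lambda>"
    "\<And>R. 0 \<le> R \<Longrightarrow> AE z in lborel. 0 < fst z \<longrightarrow> max 0 (\<bar>v z\<bar> - M) * cone \<Lambda> R z = 0"
    using max_principle_cone[OF M w0] by blast
  have "AE z in lborel. \<forall>n :: nat. 0 < fst z \<longrightarrow> max 0 (\<bar>v z\<bar> - M) * cone \<Lambda> (real n) z = 0"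
    unfolding AE_all_countable using \<Lambda>(2) by simp
  then show ?thesis
  proof eventually_elim
    case (elim z)
    obtain n :: nat where "\<Lambda> * fst z + sqrt (1 + (snd z)\<^sup>2) < real n" using reals_Archimedean2 by blast
    then have "cone \<Lambda> (real n) z \<noteq> 0" by (simp add: cone_def)
    then show ?case using elim[rule_format, of n] by auto
  qed
qed

end

section \<open>The equation on time slices\<close>

text \<open>One-sided: \<open>ker \<eta> (y - x)\<close> averages over the interval from
  \<open>x\<close> to \<open>x + \<eta>\<close>, so averages in time that start at
  \<open>s > 0\<close> never look back to time 0.\<close>

definition ker :: "real \<Rightarrow> real \<Rightarrow> real" where
  "ker \<eta> x = kern 0 (x / \<eta>) / \<eta>"

lemma ker_nonneg: "0 < \<eta> \<Longrightarrow> 0 \<le> ker \<eta> x"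
  by (simp add: ker_def kern_0_nonneg)

lemma ker_nonzeroD:
  assumes "ker \<eta> x \<noteq> 0" "0 < \<eta>"
  shows "0 < x" "x < \<eta>"
  using assms kern_nonzeroD[of 0 "x / \<eta>"] by (auto simp: ker_def zero_less_divide_iff divide_less_eq)

lemma ker_continuous [continuous_intros]:
  "continuous_on A g \<Longrightarrow> continuous_on A (\<lambda>x. ker \<eta> (g x))"
  unfolding ker_def divide_inverse by (intro continuous_intros)

lemma ker_measurable [measurable]: "ker \<eta> \<in> borel_measurable borel"
  by (intro borel_measurable_continuous_onI continuous_intros)

lemma ker_integrable:
  assumes "0 < \<eta>"
  shows "integrable lborel (\<lambda>y. ker \<eta> (y - x))"
proof -
  have e: "(y - x) / \<eta> = - x / \<eta> + 1 / \<eta> * y" for y using assms by (simp add: field_simps)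
  show ?thesis
    using lborel_integrable_real_affine[OF kern_integrable[of 0], of "1 / \<eta>" "- x / \<eta>"] assms
    unfolding ker_def e by simp
qed

lemma ker_integral:
  assumes "0 < \<eta>"
  shows "(LINT y|lborel. ker \<eta> (y - x)) = 1"
proof -
  have e: "(y - x) / \<eta> = - x / \<eta> + 1 / \<eta> * y" for y using assms by (simp add: field_simps)
  show ?thesis
    using lborel_integral_real_affine[of "1 / \<eta>" "kern 0" "- x / \<eta>"] assms kern_0_integral
    unfolding ker_def e by (simp add: field_simps)
qed

lemma ker_lipschitz:
  assumes "0 < \<eta>"
  obtains L where "0 \<le> L" "\<And>x y. \<bar>ker \<eta> x - ker \<eta> y\<bar> \<le> L * \<bar>x - y\<bar>" "\<And>x. \<bar>ker \<eta> x\<bar> \<le> L"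
proof -
  obtain C where C: "0 \<le> C" "\<And>x. \<bar>kern 1 x\<bar> \<le> C" using kern_bounded by blast
  obtain C' where C': "0 \<le> C'" "\<And>x. \<bar>kern 0 x\<bar> \<le> C'" using kern_bounded by blast
  have d: "(ker \<eta> has_real_derivative kern 1 (x / \<eta>) / \<eta>\<^sup>2) (at x)" for x
    unfolding ker_def using assms by (auto intro!: derivative_eq_intros simp: power2_eq_square)
  define L where "L = max (C / \<eta>\<^sup>2) (C' / \<eta>)"
  show thesis
  proof (rule that[of L])
    show "0 \<le> L" using C assms by (simp add: L_def le_max_iff_disj)
    fix x y
    have "norm (ker \<eta> x - ker \<eta> y) \<le> C / \<eta>\<^sup>2 * norm (x - y)"
      by (rule field_differentiable_bound[of UNIV])
         (use d C assms in \<open>auto simp: abs_mult divide_right_mono\<close>)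
    also have "\<dots> \<le> L * norm (x - y)" by (intro mult_right_mono) (auto simp: L_def)
    finally show "\<bar>ker \<eta> x - ker \<eta> y\<bar> \<le> L * \<bar>x - y\<bar>" by simp
    have "\<bar>ker \<eta> x\<bar> \<le> C' / \<eta>" using C'(2)[of "x / \<eta>"] assms by (simp add: ker_def divide_right_mono)
    then show "\<bar>ker \<eta> x\<bar> \<le> L" by (simp add: L_def)
  qed
qed

lemma ker_average_close:
  assumes \<eta>: "0 < \<eta>" and [measurable]: "g \<in> borel_measurable borel"
    and e: "\<And>y. x < y \<Longrightarrow> y < x + \<eta> \<Longrightarrow> \<bar>g y - c\<bar> \<le> e"
  shows "integrable lborel (\<lambda>y. g y * ker \<eta> (y - x))" "\<bar>(LINT y|lborel. g y * ker \<eta> (y - x)) - c\<bar> \<le> e"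
proof -
  have dom: "norm (g y * ker \<eta> (y - x) - c * ker \<eta> (y - x)) \<le> e * ker \<eta> (y - x)" for y
  proof (cases "ker \<eta> (y - x) = 0")
    case False
    then have "x < y" "y < x + \<eta>" using ker_nonzeroD[OF False \<eta>] by auto
    from mult_right_mono[OF e[OF this] ker_nonneg[OF \<eta>, of "y - x"]]
    show ?thesis using ker_nonneg[OF \<eta>, of "y - x"] by (simp add: left_diff_distrib[symmetric] abs_mult)
  qed simp
  have ie: "integrable lborel (\<lambda>y. e * ker \<eta> (y - x))" using ker_integrable[OF \<eta>] by simp
  have i: "integrable lborel (\<lambda>y. g y * ker \<eta> (y - x) - c * ker \<eta> (y - x))"
  proof (rule Bochner_Integration.integrable_bound[OF ie])
    show "AE y in lborel. norm (g y * ker \<eta> (y - x) - c * ker \<eta> (y - x)) \<le> norm (e * ker \<eta> (y - x))"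
      by (intro AE_I2) (metis dom abs_ge_self order_trans real_norm_def)
  qed measurable
  have ic: "integrable lborel (\<lambda>y. c * ker \<eta> (y - x))" using ker_integrable[OF \<eta>] by simp
  show "integrable lborel (\<lambda>y. g y * ker \<eta> (y - x))"
    using Bochner_Integration.integrable_add[OF i ic] by simp
  have "(LINT y|lborel. g y * ker \<eta> (y - x)) - c = (LINT y|lborel. g y * ker \<eta> (y - x) - c * ker \<eta> (y - x))"
    using Bochner_Integration.integral_diff[OF \<open>integrable lborel (\<lambda>y. g y * ker \<eta> (y - x))\<close> ic] ker_integral[OF \<eta>, of x]
    by simp
  also have "norm \<dots> \<le> (LINT y|lborel. e * ker \<eta> (y - x))"
    by (rule Bochner_Integration.integral_norm_bound_integral[OF i ie]) (rule dom)
  finally show "\<bar>(LINT y|lborel. g y * ker \<eta> (y - x)) - c\<bar> \<le> e"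
    using ker_integral[OF \<eta>] by simp
qed

lemma ker_average_tendsto:
  assumes "continuous_on UNIV (g :: real \<Rightarrow> real)"
  shows "((\<lambda>\<eta>. LINT y|lborel. g y * ker \<eta> (y - x)) \<longlongrightarrow> g x) (at_right 0)"
proof (rule tendstoI)
  fix e :: real assume e: "0 < e"
  obtain d where d: "d > 0" "\<And>y. dist y x < d \<Longrightarrow> dist (g y) (g x) < e / 2"
    using assms e unfolding continuous_on_iff by (metis UNIV_I half_gt_zero)
  have [measurable]: "g \<in> borel_measurable borel" using assms by (rule borel_measurable_continuous_onI)
  show "\<forall>\<^sub>F \<eta> in at_right 0. dist (LINT y|lborel. g y * ker \<eta> (y - x)) (g x) < e"
    unfolding eventually_at_right_field
  proof (intro exI[of _ d] conjI allI impI)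
    fix \<eta> assume "0 < \<eta>" "\<eta> < d"
    then have "\<bar>(LINT y|lborel. g y * ker \<eta> (y - x)) - g x\<bar> \<le> e / 2"
      by (intro ker_average_close(2)) (use d(2) in \<open>auto simp: dist_real_def intro!: less_imp_le\<close>)
    then show "dist (LINT y|lborel. g y * ker \<eta> (y - x)) (g x) < e" using e by (simp add: dist_real_def)
  qed (use d in auto)
qed

text \<open>A smooth indicator of \<open>[s,t]\<close> whose derivative is a difference of two
  \<open>ker\<close>: testing with it compares averages at \<open>s\<close> with averages at
  \<open>t\<close>.\<close>

definition ramp :: "real \<Rightarrow> real \<Rightarrow> real \<Rightarrow> real \<Rightarrow> real" where
  "ramp \<eta> s t x = cum ((x - s) / \<eta>) - cum ((x - t) / \<eta>)"

lemma ramp_nonneg: "0 < \<eta> \<Longrightarrow> s \<le> t \<Longrightarrow> 0 \<le> ramp \<eta> s t x"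
  unfolding ramp_def using cum_mono[of "(x - t) / \<eta>" "(x - s) / \<eta>"] by (simp add: divide_right_mono)

lemma ramp_bounds:
  assumes "0 < \<eta>"
  shows "\<bar>ramp \<eta> s t x\<bar> \<le> 1"
  using cum_bounds[of "(x - s) / \<eta>"] cum_bounds[of "(x - t) / \<eta>"] by (auto simp: ramp_def)

lemma ramp_support:
  assumes "0 < \<eta>" "s \<le> t" "x \<le> s \<or> t + \<eta> \<le> x"
  shows "ramp \<eta> s t x = 0"
proof (cases "x \<le> s")
  case True
  then have "(x - s) / \<eta> \<le> 0" "(x - t) / \<eta> \<le> 0" using assms by (auto simp: divide_le_0_iff)
  then show ?thesis by (simp add: ramp_def cum_eq_0)
next
  case False
  then have "1 \<le> (x - s) / \<eta>" "1 \<le> (x - t) / \<eta>" using assms by (auto simp: le_divide_eq)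
  then show ?thesis by (simp add: ramp_def cum_eq_1)
qed

lemma ramp_has_derivative:
  "0 < \<eta> \<Longrightarrow> (ramp \<eta> s t has_real_derivative ker \<eta> (x - s) - ker \<eta> (x - t)) (at x)"
  unfolding ramp_def ker_def by (auto intro!: derivative_eq_intros)

lemma ramp_continuous [continuous_intros]:
  "0 < \<eta> \<Longrightarrow> continuous_on A g \<Longrightarrow> continuous_on A (\<lambda>x. ramp \<eta> s t (g x))"
  unfolding ramp_def by (intro continuous_intros) auto

text \<open>The hypothesis says that \<open>A' = Q\<close> holds weakly. With a primitive
  \<open>F\<close> of \<open>Q\<close>, the averages of \<open>A - F\<close> to the right of
  \<open>s\<close> and of \<open>t\<close> agree at every scale \<open>\<sigma>\<close>; by
  continuity they tend to the values at \<open>s\<close> and \<open>t\<close>.\<close>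

lemma integral_identity_from_ramps:
  fixes A Q :: "real \<Rightarrow> real"
  assumes A: "continuous_on UNIV A" and Q: "continuous_on UNIV Q" and st: "0 < s" "s \<le> t"
    and eq: "\<And>\<sigma>. 0 < \<sigma> \<Longrightarrow>
      (LINT \<tau>|lborel. (ker \<sigma> (\<tau> - s) - ker \<sigma> (\<tau> - t)) * A \<tau> + ramp \<sigma> s t \<tau> * Q \<tau>) = 0"
  shows "A t - A s = integral {0..t} Q - integral {0..s} Q"
proof -
  \<comment> \<open>Zero at negative times, which makes \<open>F\<close> continuous on the whole
    line; the ramps see only times after \<open>s > 0\<close>.\<close>
  define F where "F \<tau> = integral {0..max 0 \<tau>} Q" for \<tau>
  have Fd: "(F has_real_derivative Q \<tau>) (at \<tau>)" if "0 < \<tau>" for \<tau>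
  proof -
    have "((\<lambda>y. integral {0..y} Q) has_real_derivative Q \<tau>) (at \<tau> within {0..\<tau>+1})"
      by (rule integral_has_real_derivative) (use that continuous_on_subset[OF Q] in auto)
    then have "((\<lambda>y. integral {0..y} Q) has_real_derivative Q \<tau>) (at \<tau>)"
      using that by (subst (asm) at_within_interior) auto
    then show ?thesis
      by (rule has_field_derivative_transform_within_open[where S = "{0<..}"]) (use that in \<open>auto simp: F_def\<close>)
  qed
  have Fc: "continuous_on UNIV F"
  proof -
    have "continuous_on {0..b} (\<lambda>y. integral {0..y} Q)" for b
      by (rule indefinite_integral_continuous_1) (use continuous_on_subset[OF Q] in \<open>auto intro: integrable_continuous_real\<close>)
    then have "continuous_on {a<..<b} F" for a b
      unfolding F_def
      by (rule continuous_on_compose2[where t = "{0..max 0 b}"]) (auto intro!: continuous_intros)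
    then have "isCont F x" for x
      using continuous_on_eq_continuous_at[of "{x - 1<..<x + 1}" F] by force
    then show ?thesis by (simp add: continuous_at_imp_continuous_on)
  qed
  define D where "D \<tau> = A \<tau> - F \<tau>" for \<tau>
  have Dc: "continuous_on UNIV D" unfolding D_def by (intro continuous_intros A Fc)
  have [measurable]: "A \<in> borel_measurable borel" "Q \<in> borel_measurable borel" "F \<in> borel_measurable borel"
    using A Q Fc by (auto intro: borel_measurable_continuous_onI)
  have "(LINT y|lborel. D y * ker \<sigma> (y - s)) = (LINT y|lborel. D y * ker \<sigma> (y - t))" if \<sigma>: "0 < \<sigma>" for \<sigma>
  proof -
    let ?\<theta>' = "\<lambda>\<tau>. ker \<sigma> (\<tau> - s) - ker \<sigma> (\<tau> - t)"
    have \<theta>z: "ramp \<sigma> s t \<tau> = 0 \<and> ?\<theta>' \<tau> = 0" if "\<tau> \<le> s \<or> t + \<sigma> \<le> \<tau>" for \<tau>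
      using ramp_support[OF \<sigma> st(2) that] ker_nonzeroD[OF _ \<sigma>, of "\<tau> - s"] ker_nonzeroD[OF _ \<sigma>, of "\<tau> - t"] that st \<sigma>
      by force
    have d: "((\<lambda>\<tau>. ramp \<sigma> s t \<tau> * F \<tau>) has_real_derivative ?\<theta>' \<tau> * F \<tau> + ramp \<sigma> s t \<tau> * Q \<tau>) (at \<tau>)" for \<tau>
    proof (cases "0 < \<tau>")
      case True
      show ?thesis
        by (rule DERIV_cong[OF DERIV_mult[OF ramp_has_derivative[OF \<sigma>] Fd[OF True]]]) simp
    next
      case False
      have "((\<lambda>\<tau>. 0) has_real_derivative ?\<theta>' \<tau> * F \<tau> + ramp \<sigma> s t \<tau> * Q \<tau>) (at \<tau>)"
        using \<theta>z[of \<tau>] False st by simp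
      then show ?thesis
        by (rule has_field_derivative_transform_within_open[where S = "{..<s}"]) (use False st \<theta>z in auto)
    qed
    have c1: "continuous_on UNIV (\<lambda>\<tau>. ?\<theta>' \<tau> * F \<tau> + ramp \<sigma> s t \<tau> * Q \<tau>)"
      by (intro continuous_intros Fc Q \<sigma>)
    have z: "(LINT \<tau>|lborel. ?\<theta>' \<tau> * F \<tau> + ramp \<sigma> s t \<tau> * Q \<tau>) = 0"
      by (rule integral_derivative_compact_support[OF d c1, of "t + \<sigma>"])
         (use \<theta>z st \<sigma> in \<open>force simp: abs_if split: if_splits\<close>)
    have ci: "integrable lborel h" if "continuous_on UNIV h" "\<And>\<tau>. \<tau> \<le> s \<or> t + \<sigma> \<le> \<tau> \<Longrightarrow> h \<tau> = 0" for h :: "real \<Rightarrow> real"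
      by (rule continuous_vanishing_imp_integrable[OF that(1), of "t + \<sigma>"])
         (use that(2) st \<sigma> in \<open>force simp: abs_if split: if_splits\<close>)
    have iF: "integrable lborel (\<lambda>\<tau>. ?\<theta>' \<tau> * F \<tau> + ramp \<sigma> s t \<tau> * Q \<tau>)"
      by (rule ci[OF c1]) (use \<theta>z in auto)
    have iA: "integrable lborel (\<lambda>\<tau>. ?\<theta>' \<tau> * A \<tau> + ramp \<sigma> s t \<tau> * Q \<tau>)"
      by (rule ci) (use \<theta>z in \<open>auto intro!: continuous_intros A Q \<sigma>\<close>)
    have i1: "integrable lborel (\<lambda>y. D y * ker \<sigma> (y - s))"
      by (rule ci) (use \<theta>z ker_nonzeroD[OF _ \<sigma>] st in \<open>force intro!: continuous_intros Dc\<close>)+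
    have i2: "integrable lborel (\<lambda>y. D y * ker \<sigma> (y - t))"
      by (rule ci) (use \<theta>z ker_nonzeroD[OF _ \<sigma>] st in \<open>force intro!: continuous_intros Dc\<close>)+
    have "0 = (LINT \<tau>|lborel. ?\<theta>' \<tau> * A \<tau> + ramp \<sigma> s t \<tau> * Q \<tau>) - (LINT \<tau>|lborel. ?\<theta>' \<tau> * F \<tau> + ramp \<sigma> s t \<tau> * Q \<tau>)"
      using eq[OF \<sigma>] z by simp
    also have "\<dots> = (LINT \<tau>|lborel. (?\<theta>' \<tau> * A \<tau> + ramp \<sigma> s t \<tau> * Q \<tau>) - (?\<theta>' \<tau> * F \<tau> + ramp \<sigma> s t \<tau> * Q \<tau>))"
      by (rule Bochner_Integration.integral_diff[OF iA iF, symmetric])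
    also have "\<dots> = (LINT y|lborel. D y * ker \<sigma> (y - s) - D y * ker \<sigma> (y - t))"
      by (rule Bochner_Integration.integral_cong) (auto simp: D_def algebra_simps)
    also have "\<dots> = (LINT y|lborel. D y * ker \<sigma> (y - s)) - (LINT y|lborel. D y * ker \<sigma> (y - t))"
      by (rule Bochner_Integration.integral_diff[OF i1 i2])
    finally show ?thesis by simp
  qed
  then have "\<forall>\<^sub>F \<sigma> in at_right 0. (LINT y|lborel. D y * ker \<sigma> (y - s)) = (LINT y|lborel. D y * ker \<sigma> (y - t))"
    using eventually_at_right_less[of 0] by (rule eventually_mono[rotated]) auto
  from Lim_transform_eventually[OF ker_average_tendsto[OF Dc] this]
  have "((\<lambda>\<sigma>. LINT y|lborel. D y * ker \<sigma> (y - t)) \<longlongrightarrow> D s) (at_right 0)" .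
  then have "D s = D t"
    using tendsto_unique[OF _ _ ker_average_tendsto[OF Dc]] trivial_limit_at_right_real by blast
  then show ?thesis using st by (simp add: D_def F_def)
qed

context entropy_flow
begin

text \<open>Between two times the functional moves by at most
  \<open>\<bar>\<Lambda>\<bar> * C\<close> times the local distance of the slices, so
  \<open>w_continuous\<close> applies.\<close>

lemma slice_functional_continuous:
  assumes [measurable]: "\<rho> \<in> borel_measurable borel" and C: "\<And>y. \<bar>\<rho> y\<bar> \<le> C" and supp: "\<And>y. R < \<bar>y\<bar> \<Longrightarrow> \<rho> y = 0"
    and [measurable]: "G \<in> borel_measurable borel"
    and \<Lambda>: "\<And>x y. \<bar>x\<bar> \<le> B \<Longrightarrow> \<bar>y\<bar> \<le> B \<Longrightarrow> \<bar>G x - G y\<bar> \<le> \<Lambda> * \<bar>x - y\<bar>"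
  shows "continuous_on {0..} (\<lambda>t. LINT y|lborel. G (w t y) * \<rho> y)"
    and "\<And>t. integrable lborel (\<lambda>y. G (w t y) * \<rho> y)"
proof -
  have Gb: "\<bar>G x\<bar> \<le> \<bar>G 0\<bar> + \<bar>\<Lambda>\<bar> * B" if x: "\<bar>x\<bar> \<le> B" for x
  proof -
    have "\<bar>G x - G 0\<bar> \<le> \<Lambda> * \<bar>x\<bar>" using \<Lambda>[of x 0] x B_nonneg by simp
    also have "\<dots> \<le> \<bar>\<Lambda>\<bar> * B" using x by (intro mult_mono) auto
    finally show ?thesis by linarith
  qed
  have ind: "integrable lborel (\<lambda>y. indicator {-R..R} y * (c :: real))" for c
    by (intro integrable_mult_left integrable_real_indicator) (auto simp: emeasure_lborel_Icc_eq)
  show i: "integrable lborel (\<lambda>y. G (w t y) * \<rho> y)" for t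
  proof (rule Bochner_Integration.integrable_bound[OF ind[of "(\<bar>G 0\<bar> + \<bar>\<Lambda>\<bar> * B) * C"]])
    show "AE y in lborel. norm (G (w t y) * \<rho> y) \<le> norm (indicator {-R..R} y * ((\<bar>G 0\<bar> + \<bar>\<Lambda>\<bar> * B) * C))"
    proof (rule AE_I2)
      fix y
      show "norm (G (w t y) * \<rho> y) \<le> norm (indicator {-R..R} y * ((\<bar>G 0\<bar> + \<bar>\<Lambda>\<bar> * B) * C))"
      proof (cases "y \<in> {-R..R}")
        case True
        have "\<bar>G (w t y) * \<rho> y\<bar> \<le> (\<bar>G 0\<bar> + \<bar>\<Lambda>\<bar> * B) * C"
          unfolding abs_mult using Gb[OF w_bound] C[of y] B_nonneg by (intro mult_mono) auto
        then show ?thesis using True by simp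
      next
        case False
        then have "\<rho> y = 0" using supp[of y] by (auto simp: abs_if split: if_splits)
        then show ?thesis by simp
      qed
    qed
  qed measurable
  show "continuous_on {0..} (\<lambda>t. LINT y|lborel. G (w t y) * \<rho> y)"
    unfolding continuous_on
  proof (intro ballI)
    fix t :: real assume t: "t \<in> {0..}"
    show "((\<lambda>t. LINT y|lborel. G (w t y) * \<rho> y) \<longlongrightarrow> (LINT y|lborel. G (w t y) * \<rho> y)) (at t within {0..})"
    proof (rule Lim_transform2[OF tendsto_const])
      have lim: "((\<lambda>\<tau>. \<bar>\<Lambda>\<bar> * C * (LINT x:{-R..R}|lborel. \<bar>w \<tau> x - w t x\<bar>)) \<longlongrightarrow> \<bar>\<Lambda>\<bar> * C * 0) (at t within {0..})"
        by (intro tendsto_mult tendsto_const w_continuous) (use t in auto)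
      have le: "norm ((LINT y|lborel. G (w t y) * \<rho> y) - (LINT y|lborel. G (w \<tau> y) * \<rho> y))
          \<le> \<bar>\<Lambda>\<bar> * C * (LINT x:{-R..R}|lborel. \<bar>w \<tau> x - w t x\<bar>)" for \<tau>
      proof -
        have si: "integrable lborel (\<lambda>x. indicator {-R..R} x *\<^sub>R \<bar>w \<tau> x - w t x\<bar>)"
        proof (rule Bochner_Integration.integrable_bound[OF ind[of "2 * B"]])
          show "AE x in lborel. norm (indicator {-R..R} x *\<^sub>R \<bar>w \<tau> x - w t x\<bar>) \<le> norm (indicator {-R..R} x * (2 * B))"
          proof (rule AE_I2)
            fix x show "norm (indicator {-R..R} x *\<^sub>R \<bar>w \<tau> x - w t x\<bar>) \<le> norm (indicator {-R..R} x * (2 * B))"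
              using w_bound[of t x] w_bound[of \<tau> x] by (auto simp: indicator_def)
          qed
        qed measurable
        have "norm ((LINT y|lborel. G (w t y) * \<rho> y) - (LINT y|lborel. G (w \<tau> y) * \<rho> y))
          = norm (LINT y|lborel. G (w t y) * \<rho> y - G (w \<tau> y) * \<rho> y)"
          using i by simp
        also have "\<dots> \<le> (LINT x|lborel. \<bar>\<Lambda>\<bar> * C * (indicator {-R..R} x *\<^sub>R \<bar>w \<tau> x - w t x\<bar>))"
        proof (rule Bochner_Integration.integral_norm_bound_integral)
          fix y
          show "norm (G (w t y) * \<rho> y - G (w \<tau> y) * \<rho> y) \<le> \<bar>\<Lambda>\<bar> * C * (indicator {-R..R} y *\<^sub>R \<bar>w \<tau> y - w t y\<bar>)"
          proof (cases "y \<in> {-R..R}")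
            case True
            have "\<bar>G (w t y) - G (w \<tau> y)\<bar> \<le> \<Lambda> * \<bar>w t y - w \<tau> y\<bar>" by (rule \<Lambda>[OF w_bound w_bound])
            also have "\<dots> \<le> \<bar>\<Lambda>\<bar> * \<bar>w t y - w \<tau> y\<bar>" by (intro mult_right_mono) auto
            finally have "\<bar>G (w t y) - G (w \<tau> y)\<bar> * \<bar>\<rho> y\<bar> \<le> (\<bar>\<Lambda>\<bar> * \<bar>w t y - w \<tau> y\<bar>) * C"
              using C[of y] by (intro mult_mono) auto
            moreover have "G (w t y) * \<rho> y - G (w \<tau> y) * \<rho> y = (G (w t y) - G (w \<tau> y)) * \<rho> y"
              by (rule left_diff_distrib[symmetric])
            ultimately show ?thesis using True
              by (simp add: abs_mult mult_ac abs_minus_commute)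
          next
            case False
            then have "\<rho> y = 0" using supp[of y] by (auto simp: abs_if split: if_splits)
            then show ?thesis using False by simp
          qed
        qed (use i si in auto)
        also have "\<dots> = \<bar>\<Lambda>\<bar> * C * (LINT x:{-R..R}|lborel. \<bar>w \<tau> x - w t x\<bar>)"
          unfolding set_lebesgue_integral_def by simp
        finally show ?thesis .
      qed
      show "((\<lambda>\<tau>. (LINT y|lborel. G (w t y) * \<rho> y) - (LINT y|lborel. G (w \<tau> y) * \<rho> y)) \<longlongrightarrow> 0) (at t within {0..})"
        by (rule Lim_null_comparison[OF _ lim[simplified]]) (use le in auto)
    qed
  qed
qed

text \<open>All values of \<open>v\<close> lie between \<open>- B\<close> and \<open>B\<close>, so
  for \<open>k = B\<close> and \<open>k = - B\<close> the entropies are affine in \<open>v\<close>.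
  The two inequalities have opposite directions, and the constants integrate to 0.\<close>

lemma v_weak_equation:
  assumes T: "C1_test \<psi> \<psi>t \<psi>x"
  shows "(LINT z|lborel. v z * \<psi>t z + f (v z) * \<psi>x z) = 0"
    and "integrable lborel (\<lambda>z. v z * \<psi>t z)" "integrable lborel (\<lambda>z. f (v z) * \<psi>x z)"
proof -
  obtain \<Lambda> where \<Lambda>: "0 \<le> \<Lambda>" "\<And>x y. \<bar>x\<bar> \<le> B \<Longrightarrow> \<bar>y\<bar> \<le> B \<Longrightarrow> \<bar>f x - f y\<bar> \<le> \<Lambda> * \<bar>x - y\<bar>"
    using lipschitz_const by blast
  have fb: "\<bar>f (v z)\<bar> \<le> \<bar>f 0\<bar> + \<Lambda> * B" for z
  proof -
    have "\<bar>f (v z) - f 0\<bar> \<le> \<Lambda> * \<bar>v z\<bar>" using \<Lambda>(2)[OF v_bound, of 0 z] B_nonneg by simp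
    also have "\<dots> \<le> \<Lambda> * B" using v_bound \<Lambda>(1) by (intro mult_left_mono) auto
    finally show ?thesis by linarith
  qed
  show i1: "integrable lborel (\<lambda>z. v z * \<psi>t z)"
    by (rule integrable_C1_test_mult(1)[OF T _ v_bound]) measurable
  show i2: "integrable lborel (\<lambda>z. f (v z) * \<psi>x z)"
    by (rule integrable_C1_test_mult(2)[OF T _ fb]) measurable
  note i0 = C1_test_cont(4,5)[OF T]
  note z0 = C1_test_integral_zero[OF T]
  have "\<bar>v z - B\<bar> * \<psi>t z + sgn (v z - B) * (f (v z) - f B) * \<psi>x z
      = (B * \<psi>t z - v z * \<psi>t z) + (f B * \<psi>x z - f (v z) * \<psi>x z)" for z
  proof -
    have "\<bar>v z - B\<bar> = B - v z" using v_bound[of z] by linarith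
    moreover have "sgn (v z - B) * (f (v z) - f B) = f B - f (v z)"
      using v_bound[of z] by (cases "v z = B") (auto simp: sgn_real_def)
    ultimately show ?thesis by (simp add: left_diff_distrib)
  qed
  then have "0 \<le> (LINT z|lborel. (B * \<psi>t z - v z * \<psi>t z) + (f B * \<psi>x z - f (v z) * \<psi>x z))"
    using entropy[OF T, of B] by simp
  then have 1: "(LINT z|lborel. v z * \<psi>t z) + (LINT z|lborel. f (v z) * \<psi>x z) \<le> 0"
    using i0 i1 i2 z0 by simp
  have "\<bar>v z - (- B)\<bar> * \<psi>t z + sgn (v z - (- B)) * (f (v z) - f (- B)) * \<psi>x z
      = (B * \<psi>t z + v z * \<psi>t z) + (f (v z) * \<psi>x z - f (- B) * \<psi>x z)" for z
  proof -
    have "\<bar>v z - (- B)\<bar> = B + v z" using v_bound[of z] by linarith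
    moreover have "sgn (v z - (- B)) * (f (v z) - f (- B)) = f (v z) - f (- B)"
    proof (cases "v z = - B")
      case False
      then have "0 < v z - (- B)" using v_bound[of z] by linarith
      then show ?thesis by (simp only: sgn_pos mult_1)
    qed simp
    ultimately show ?thesis by (simp only: left_diff_distrib distrib_right)
  qed
  then have "0 \<le> (LINT z|lborel. (B * \<psi>t z + v z * \<psi>t z) + (f (v z) * \<psi>x z - f (- B) * \<psi>x z))"
    using entropy[OF T, of "- B"] by simp
  then have 2: "0 \<le> (LINT z|lborel. v z * \<psi>t z) + (LINT z|lborel. f (v z) * \<psi>x z)"
    using i0 i1 i2 z0 by simp
  show "(LINT z|lborel. v z * \<psi>t z + f (v z) * \<psi>x z) = 0"
    using 1 2 i1 i2 by simp
qed

text \<open>Test the weak equation with a ramp in time multiplied by \<open>\<rho>\<close>. Fubini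
  and \<open>w_eq_v\<close> turn it into a weak equation in time, which
  \<open>integral_identity_from_ramps\<close> integrates between positive times; continuity then
  lets the lower limit go to 0.\<close>

lemma slice_equation:
  assumes d: "\<And>y. (\<rho> has_real_derivative \<rho>' y) (at y)" and c: "continuous_on UNIV \<rho>'"
    and pos: "\<And>y. 0 \<le> \<rho> y" and supp: "\<And>y. R < \<bar>y\<bar> \<Longrightarrow> \<rho> y = 0 \<and> \<rho>' y = 0" and t: "0 \<le> t"
  shows "(LINT y|lborel. w t y * \<rho> y) = (LINT y|lborel. w 0 y * \<rho> y)
      + integral {0..t} (\<lambda>\<tau>. LINT y|lborel. f (w \<tau> y) * \<rho>' y)"
proof -
  obtain \<Lambda> where \<Lambda>: "0 \<le> \<Lambda>" "\<And>x y. \<bar>x\<bar> \<le> B \<Longrightarrow> \<bar>y\<bar> \<le> B \<Longrightarrow> \<bar>f x - f y\<bar> \<le> \<Lambda> * \<bar>x - y\<bar>"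
    using lipschitz_const by blast
  have c0: "continuous_on UNIV \<rho>"
    using d by (meson DERIV_isCont continuous_at_imp_continuous_on)
  have [measurable]: "\<rho> \<in> borel_measurable borel" "\<rho>' \<in> borel_measurable borel"
    using c0 c by (auto intro: borel_measurable_continuous_onI)
  obtain C where C: "\<And>y. \<bar>\<rho> y\<bar> \<le> C"
    by (rule continuous_vanishing_imp_bounded[OF c0, of R]) (use supp in auto)
  obtain C' where C': "\<And>y. \<bar>\<rho>' y\<bar> \<le> C'"
    by (rule continuous_vanishing_imp_bounded[OF c, of R]) (use supp in auto)
  define A where "A \<tau> = (LINT y|lborel. w \<tau> y * \<rho> y)" for \<tau>
  define Q where "Q \<tau> = (LINT y|lborel. f (w \<tau> y) * \<rho>' y)" for \<tau>
  have cA: "continuous_on {0..} A"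
    unfolding A_def
    by (rule slice_functional_continuous(1)[where C = C and R = R and \<Lambda> = 1 and G = "\<lambda>x. x"]) (use C supp in auto)
  have cQ: "continuous_on {0..} Q"
    unfolding Q_def
    by (rule slice_functional_continuous(1)[where C = C' and R = R and \<Lambda> = \<Lambda>]) (use C' supp \<Lambda> in auto)
  \<comment> \<open>Extended by the value at time 0, because the argument with ramps asks for
    continuity on the whole line.\<close>
  define A' where "A' \<tau> = A (max 0 \<tau>)" for \<tau>
  define Q' where "Q' \<tau> = Q (max 0 \<tau>)" for \<tau>
  have cA': "continuous_on UNIV A'" unfolding A'_def
    by (rule continuous_on_compose2[OF cA]) (auto intro!: continuous_intros)
  have cQ': "continuous_on UNIV Q'" unfolding Q'_def
    by (rule continuous_on_compose2[OF cQ]) (auto intro!: continuous_intros)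
  have step: "A' t - A' s = integral {0..t} Q' - integral {0..s} Q'" if st: "0 < s" "s \<le> t" for s t
  proof (rule integral_identity_from_ramps[OF cA' cQ' st])
    fix \<sigma> :: real assume \<sigma>: "0 < \<sigma>"
    let ?\<theta> = "ramp \<sigma> s t" and ?\<theta>' = "\<lambda>\<tau>. ker \<sigma> (\<tau> - s) - ker \<sigma> (\<tau> - t)"
    define \<psi>t where "\<psi>t z = ?\<theta>' (fst z) * \<rho> (snd z)" for z
    define \<psi>x where "\<psi>x z = ?\<theta> (fst z) * \<rho>' (snd z)" for z
    have \<theta>z: "?\<theta> \<tau> = 0 \<and> ?\<theta>' \<tau> = 0" if "\<tau> \<le> s \<or> t + \<sigma> \<le> \<tau>" for \<tau>
      using ramp_support[OF \<sigma> st(2) that] ker_nonzeroD[OF _ \<sigma>, of "\<tau> - s"] ker_nonzeroD[OF _ \<sigma>, of "\<tau> - t"] that st \<sigma>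
      by force
    have T: "C1_test (\<lambda>z. ?\<theta> (fst z) * \<rho> (snd z)) \<psi>t \<psi>x"
      unfolding C1_test_def
    proof (intro conjI allI)
      fix z :: "real \<times> real"
      have "((\<lambda>z. ?\<theta> (fst z) * \<rho> (snd z)) has_derivative
        (\<lambda>h. ?\<theta> (fst z) * (snd h * \<rho>' (snd z)) + (fst h * ?\<theta>' (fst z)) * \<rho> (snd z))) (at z)"
        by (intro has_derivative_mult DERIV_compose_FDERIV[OF ramp_has_derivative[OF \<sigma>]] DERIV_compose_FDERIV[OF d]
            has_derivative_fst has_derivative_snd has_derivative_ident)
      then show "((\<lambda>z. ?\<theta> (fst z) * \<rho> (snd z)) has_derivative (\<lambda>h. fst h * \<psi>t z + snd h * \<psi>x z)) (at z)"
        by (rule has_derivative_eq_rhs) (auto simp: \<psi>t_def \<psi>x_def fun_eq_iff algebra_simps)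
      show "0 \<le> ?\<theta> (fst z) * \<rho> (snd z)" using ramp_nonneg[OF \<sigma> st(2)] pos by simp
    next
      show "continuous_on UNIV \<psi>t" unfolding \<psi>t_def
        by (intro continuous_intros continuous_on_compose2[OF c0]) auto
      show "continuous_on UNIV \<psi>x" unfolding \<psi>x_def
        by (intro continuous_intros continuous_on_compose2[OF c] \<sigma>) auto
      show "\<exists>s>0. \<exists>R'. \<forall>z. ?\<theta> (fst z) * \<rho> (snd z) \<noteq> 0 \<longrightarrow> s \<le> fst z \<and> norm z \<le> R'"
      proof (rule exI[of _ s], rule conjI[OF st(1)], rule exI[of _ "(t + \<sigma>) + R"], intro allI impI)
        fix z :: "real \<times> real" assume nz: "?\<theta> (fst z) * \<rho> (snd z) \<noteq> 0"
        have "\<not> (fst z \<le> s \<or> t + \<sigma> \<le> fst z)" using \<theta>z[of "fst z"] nz by auto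
        moreover have "\<bar>snd z\<bar> \<le> R" using supp[of "snd z"] nz by force
        ultimately show "s \<le> fst z \<and> norm z \<le> (t + \<sigma>) + R"
          using norm_Pair_le[of "fst z" "snd z"] st by auto
      qed
    qed
    note W = v_weak_equation[OF T]
    have P: "integrable (lborel \<Otimes>\<^sub>M lborel) (\<lambda>z. v z * \<psi>t z + f (v z) * \<psi>x z)"
      using W(2,3) by (simp add: lborel_prod)
    have "0 = (LINT \<tau>|lborel. LINT y|lborel. v (\<tau>, y) * \<psi>t (\<tau>, y) + f (v (\<tau>, y)) * \<psi>x (\<tau>, y))"
      using W(1) lborel_pair.integral_fst'[OF P] by (simp add: lborel_prod)
    also have "\<dots> = (LINT \<tau>|lborel. ?\<theta>' \<tau> * A' \<tau> + ?\<theta> \<tau> * Q' \<tau>)"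
    proof (rule integral_cong_AE)
      show "(\<lambda>\<tau>. LINT y|lborel. v (\<tau>, y) * \<psi>t (\<tau>, y) + f (v (\<tau>, y)) * \<psi>x (\<tau>, y)) \<in> borel_measurable lborel"
        using lborel_pair.integrable_fst'[OF P] by (rule borel_measurable_integrable)
      have "continuous_on UNIV (\<lambda>\<tau>. ?\<theta>' \<tau> * A' \<tau> + ?\<theta> \<tau> * Q' \<tau>)"
        by (intro continuous_intros cA' cQ' \<sigma>)
      then show "(\<lambda>\<tau>. ?\<theta>' \<tau> * A' \<tau> + ?\<theta> \<tau> * Q' \<tau>) \<in> borel_measurable lborel"
        by (simp add: borel_measurable_continuous_onI)
      show "AE \<tau> in lborel. (LINT y|lborel. v (\<tau>, y) * \<psi>t (\<tau>, y) + f (v (\<tau>, y)) * \<psi>x (\<tau>, y)) = ?\<theta>' \<tau> * A' \<tau> + ?\<theta> \<tau> * Q' \<tau>"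
        using w_eq_v
      proof eventually_elim
        case (elim \<tau>)
        show ?case
        proof (cases "0 < \<tau>")
          case True
          then have e: "v (\<tau>, y) = w \<tau> y" for y using elim by simp
          have i1: "integrable lborel (\<lambda>y. w \<tau> y * \<rho> y)"
            by (rule slice_functional_continuous(2)[where C = C and R = R and \<Lambda> = 1 and G = "\<lambda>x. x"]) (use C supp in auto)
          have i2: "integrable lborel (\<lambda>y. f (w \<tau> y) * \<rho>' y)"
            by (rule slice_functional_continuous(2)[where C = C' and R = R and \<Lambda> = \<Lambda>]) (use C' supp \<Lambda> in auto)
          have "(LINT y|lborel. v (\<tau>, y) * \<psi>t (\<tau>, y) + f (v (\<tau>, y)) * \<psi>x (\<tau>, y))
              = (LINT y|lborel. ?\<theta>' \<tau> * (w \<tau> y * \<rho> y) + ?\<theta> \<tau> * (f (w \<tau> y) * \<rho>' y))"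
            unfolding e \<psi>t_def \<psi>x_def by (rule Bochner_Integration.integral_cong) (auto simp: mult_ac)
          also have "\<dots> = ?\<theta>' \<tau> * A \<tau> + ?\<theta> \<tau> * Q \<tau>"
            unfolding A_def Q_def using i1 i2 by simp
          finally show ?thesis using True by (simp add: A'_def Q'_def max_def)
        next
          case False
          then have "\<tau> \<le> s \<or> t + \<sigma> \<le> \<tau>" using st by linarith
          from \<theta>z[OF this] show ?thesis by (simp add: \<psi>t_def \<psi>x_def)
        qed
      qed
    qed
    finally show "(LINT \<tau>|lborel. ?\<theta>' \<tau> * A' \<tau> + ?\<theta> \<tau> * Q' \<tau>) = 0" by simp
  qed
  have intQ: "integral {0..t} Q' = integral {0..t} Q"
    by (rule Henstock_Kurzweil_Integration.integral_cong) (simp add: Q'_def)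
  show ?thesis
  proof (cases "t = 0")
    case False
    then have t: "0 < t" using t by simp
    have "continuous_on {0..t} (\<lambda>s. A' s - integral {0..s} Q')"
      by (intro continuous_intros continuous_on_subset[OF cA'] indefinite_integral_continuous_1
          integrable_continuous_real continuous_on_subset[OF cQ']) auto
    then have "((\<lambda>s. A' s - integral {0..s} Q') \<longlongrightarrow> A' 0 - integral {0..0} Q') (at 0 within {0..t})"
      unfolding continuous_on by (rule bspec) (use t in auto)
    then have l1: "((\<lambda>s. A' s - integral {0..s} Q') \<longlongrightarrow> A' 0) (at_right 0)"
      using t by (simp add: at_within_Icc_at_right)
    have "\<forall>\<^sub>F s in at_right 0. A' s - integral {0..s} Q' = A' t - integral {0..t} Q'"
      unfolding eventually_at_right_field
    proof (intro exI[of _ t] conjI allI impI t)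
      fix s :: real assume "0 < s" "s < t"
      then show "A' s - integral {0..s} Q' = A' t - integral {0..t} Q'" using step[of s t] by simp
    qed
    from Lim_transform_eventually[OF l1 this]
    have "((\<lambda>s. A' t - integral {0..t} Q') \<longlongrightarrow> A' 0) (at_right (0 :: real))" .
    then have "A' t - integral {0..t} Q' = A' 0"
      using tendsto_unique[OF _ tendsto_const] trivial_limit_at_right_real by blast
    then show ?thesis using t unfolding intQ by (simp add: A'_def A_def Q_def[abs_def])
  qed simp
qed

end

section \<open>The potential\<close>

text \<open>Two partial derivatives yield a total one as soon as one of them, here
  \<open>gx\<close>, is jointly continuous.\<close>

lemma has_derivative_half_plane_from_partials:
  fixes g gt gx :: "real \<times> real \<Rightarrow> real"
  assumes dt: "\<And>t x. 0 < t \<Longrightarrow> ((\<lambda>\<tau>. g (\<tau>, x)) has_real_derivative gt (t, x)) (at t)"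
    and dx: "\<And>t x. 0 < t \<Longrightarrow> ((\<lambda>\<xi>. g (t, \<xi>)) has_real_derivative gx (t, x)) (at x)"
    and c: "continuous_on ({0<..} \<times> UNIV) gx" and z: "0 < fst z"
  shows "(g has_derivative (\<lambda>h. fst h * gt z + snd h * gx z)) (at z)"
proof -
  obtain t x where tx: "z = (t, x)" by (cases z)
  have t: "0 < t" using z tx by simp
  have "((\<lambda>(t, x). g (t, x)) has_derivative (\<lambda>(ht, hx). ht * gt (t, x) + blinfun_apply (blinfun_scaleR_right (gx (t, x))) hx))
      (at (t, x) within {0<..} \<times> UNIV)"
  proof (rule has_derivative_partialsI[where fy = "\<lambda>t x. blinfun_scaleR_right (gx (t, x))"])
    show "((\<lambda>\<tau>. g (\<tau>, x)) has_derivative (\<lambda>h. h * gt (t, x))) (at t within {0<..})"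
    proof -
      have "((\<lambda>\<tau>. g (\<tau>, x)) has_derivative (*) (gt (t, x))) (at t)"
        using dt[OF t, of x] unfolding has_field_derivative_def .
      moreover have "(*) (gt (t, x)) = (\<lambda>h. h * gt (t, x))" by (auto simp: fun_eq_iff)
      ultimately show ?thesis by (simp only: has_derivative_at_withinI)
    qed
    show "((\<lambda>\<xi>. g (\<tau>, \<xi>)) has_derivative blinfun_apply (blinfun_scaleR_right (gx (\<tau>, y)))) (at y within UNIV)"
      if "\<tau> \<in> {0<..}" for \<tau> y
    proof -
      have "(*\<^sub>R) (gx (\<tau>, y)) = (*) (gx (\<tau>, y))" by (auto simp: fun_eq_iff)
      then show ?thesis using dx[of \<tau> y] that by (simp add: has_field_derivative_def)
    qed
    have "continuous (at (t, x) within {0<..} \<times> UNIV) gx"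
      using c t by (simp add: continuous_on_eq_continuous_within)
    then show "continuous (at (t, x) within {0<..} \<times> UNIV) (\<lambda>(t, x). blinfun_scaleR_right (gx (t, x)))"
      by (auto simp: case_prod_beta' intro!: continuous_intros)
  qed auto
  moreover have "at (t, x) within {0<..} \<times> UNIV = at (t, x)"
    by (rule at_within_open) (use t in \<open>auto intro!: open_Times\<close>)
  ultimately show ?thesis
    unfolding tx by (simp add: case_prod_beta' mult.commute)
qed

lemma has_real_derivative_of_quadratic_remainder:
  fixes g :: "real \<Rightarrow> real"
  assumes "\<And>y. \<bar>y - x\<bar> \<le> 1 \<Longrightarrow> \<bar>g y - g x - (y - x) * m\<bar> \<le> C * (y - x)\<^sup>2"
  shows "(g has_real_derivative m) (at x)"
proof -
  define h where "h y = (if \<bar>y - x\<bar> \<le> 1 then g y - g x - (y - x) * m else 0)" for y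
  have "\<bar>h y\<bar> \<le> \<bar>C\<bar> * (y - x)\<^sup>2" for y
  proof (cases "\<bar>y - x\<bar> \<le> 1")
    case True
    have "\<bar>h y\<bar> \<le> C * (y - x)\<^sup>2" using assms[OF True] True by (simp add: h_def)
    also have "\<dots> \<le> \<bar>C\<bar> * (y - x)\<^sup>2" by (intro mult_right_mono) auto
    finally show ?thesis .
  qed (simp add: h_def)
  then have "(h has_real_derivative 0) (at x)" by (rule has_derivative_zero_of_quadratic_bound)
  then have "((\<lambda>y. g y - g x - (y - x) * m) has_real_derivative 0) (at x)"
    by (rule has_field_derivative_transform_within_open[where S = "ball x 1"])
       (auto simp: h_def dist_real_def abs_minus_commute)
  moreover have "((\<lambda>y. g x + (y - x) * m) has_real_derivative m) (at x)"
    by (auto intro!: derivative_eq_intros)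
  ultimately have "((\<lambda>y. (g y - g x - (y - x) * m) + (g x + (y - x) * m)) has_real_derivative 0 + m) (at x)"
    by (rule DERIV_add)
  then show ?thesis by simp
qed

lemma cum_scaled_has_derivative:
  "0 < \<eta> \<Longrightarrow> ((\<lambda>x. cum (x / \<eta>)) has_real_derivative ker \<eta> x) (at x)"
  unfolding ker_def by (auto intro!: derivative_eq_intros)

context entropy_flow
begin

lemma f_bounds:
  obtains \<Lambda> F where "0 \<le> \<Lambda>" "0 \<le> F"
    "\<And>x y. \<bar>x\<bar> \<le> B \<Longrightarrow> \<bar>y\<bar> \<le> B \<Longrightarrow> \<bar>f x - f y\<bar> \<le> \<Lambda> * \<bar>x - y\<bar>" "\<And>x. \<bar>x\<bar> \<le> B \<Longrightarrow> \<bar>f x\<bar> \<le> F"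
proof -
  obtain \<Lambda> where \<Lambda>: "0 \<le> \<Lambda>" "\<And>x y. \<bar>x\<bar> \<le> B \<Longrightarrow> \<bar>y\<bar> \<le> B \<Longrightarrow> \<bar>f x - f y\<bar> \<le> \<Lambda> * \<bar>x - y\<bar>"
    using lipschitz_const by blast
  show thesis
  proof (rule that[of \<Lambda> "\<bar>f 0\<bar> + \<Lambda> * B"])
    fix x assume x: "\<bar>x\<bar> \<le> B"
    have "\<bar>f x - f 0\<bar> \<le> \<Lambda> * \<bar>x\<bar>" using \<Lambda>(2)[OF x, of 0] B_nonneg by simp
    also have "\<dots> \<le> \<Lambda> * B" using x \<Lambda>(1) by (intro mult_left_mono) auto
    finally show "\<bar>f x\<bar> \<le> \<bar>f 0\<bar> + \<Lambda> * B" by linarith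
  qed (use \<Lambda> B_nonneg in auto)
qed

text \<open>\<open>G\<close> will be \<open>f\<close> or the identity, which gives the smoothed flux
  and the smoothed solution.\<close>

definition slice_avg :: "(real \<Rightarrow> real) \<Rightarrow> real \<Rightarrow> real \<Rightarrow> real \<Rightarrow> real" where
  "slice_avg G \<eta> t x = (LINT y|lborel. G (w t y) * ker \<eta> (y - x))"

lemma slice_avg_integrable:
  assumes "0 < \<eta>" "G \<in> borel_measurable borel" "\<And>x. \<bar>x\<bar> \<le> B \<Longrightarrow> \<bar>G x\<bar> \<le> F"
  shows "integrable lborel (\<lambda>y. G (w t y) * ker \<eta> (y - x))"
proof (rule integrable_bounded_mult[OF ker_integrable[OF assms(1)], where C = F])
  show "(\<lambda>y. G (w t y)) \<in> borel_measurable lborel" using assms(2) by simp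
qed (rule assms(3)[OF w_bound])

lemma slice_avg_bound:
  assumes \<eta>: "0 < \<eta>" and G [measurable]: "G \<in> borel_measurable borel" "\<And>x. \<bar>x\<bar> \<le> B \<Longrightarrow> \<bar>G x\<bar> \<le> F"
  shows "\<bar>slice_avg G \<eta> t x\<bar> \<le> F"
  using ker_average_close(2)[OF \<eta>, of "\<lambda>y. G (w t y)" x 0 F] G(2)[OF w_bound] by (simp add: slice_avg_def)

text \<open>The constant depends on \<open>\<eta>\<close> only: the two kernels live on intervals of
  total length \<open>2 * \<eta>\<close>. Uniformity in \<open>t\<close> is what upgrades separate
  continuity to joint continuity in \<open>slice_avg_continuous\<close>.\<close>

lemma slice_avg_lipschitz:
  assumes \<eta>: "0 < \<eta>"
  obtains L where "0 \<le> L" "\<And>G F t x x'. G \<in> borel_measurable borel \<Longrightarrow> (\<And>x. \<bar>x\<bar> \<le> B \<Longrightarrow> \<bar>G x\<bar> \<le> F) \<Longrightarrow>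
    \<bar>slice_avg G \<eta> t x' - slice_avg G \<eta> t x\<bar> \<le> F * L * \<bar>x' - x\<bar>"
proof -
  obtain L where L: "0 \<le> L" "\<And>x y. \<bar>ker \<eta> x - ker \<eta> y\<bar> \<le> L * \<bar>x - y\<bar>" "\<And>x. \<bar>ker \<eta> x\<bar> \<le> L"
    by (rule ker_lipschitz[OF \<eta>]) (rule that; blast)
  show thesis
  proof (rule that[of "L * (2 * \<eta>)"])
    show "0 \<le> L * (2 * \<eta>)" using L \<eta> by simp
    fix G :: "real \<Rightarrow> real" and F t x x'
    assume G [measurable]: "G \<in> borel_measurable borel" and F: "\<And>x. \<bar>x\<bar> \<le> B \<Longrightarrow> \<bar>G x\<bar> \<le> F"
    have F0: "0 \<le> F" using F[of 0] B_nonneg by force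
    note i = slice_avg_integrable[OF \<eta> G F, of t]
    have ind: "integrable lborel (\<lambda>y. (indicator {x..x + \<eta>} y + indicator {x'..x' + \<eta>} y) * c :: real)" for c
      by (intro integrable_mult_left Bochner_Integration.integrable_add integrable_real_indicator)
         (auto simp: emeasure_lborel_Icc_eq)
    have eq: "slice_avg G \<eta> t x' - slice_avg G \<eta> t x = (LINT y|lborel. G (w t y) * ker \<eta> (y - x') - G (w t y) * ker \<eta> (y - x))"
      unfolding slice_avg_def using i by simp
    have "norm (LINT y|lborel. G (w t y) * ker \<eta> (y - x') - G (w t y) * ker \<eta> (y - x)) \<le> (LINT y|lborel. (indicator {x..x + \<eta>} y + indicator {x'..x' + \<eta>} y) * (F * (L * \<bar>x' - x\<bar>)))"
    proof (rule Bochner_Integration.integral_norm_bound_integral[OF _ ind])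
      fix y
      have "norm (G (w t y) * ker \<eta> (y - x') - G (w t y) * ker \<eta> (y - x)) = \<bar>G (w t y)\<bar> * \<bar>ker \<eta> (y - x') - ker \<eta> (y - x)\<bar>"
        by (simp add: right_diff_distrib[symmetric] abs_mult)
      also have "\<dots> \<le> (indicator {x..x + \<eta>} y + indicator {x'..x' + \<eta>} y) * (F * (L * \<bar>x' - x\<bar>))"
      proof (cases "y \<in> {x..x + \<eta>} \<or> y \<in> {x'..x' + \<eta>}")
        case True
        have "\<bar>G (w t y)\<bar> * \<bar>ker \<eta> (y - x') - ker \<eta> (y - x)\<bar> \<le> F * (L * \<bar>x' - x\<bar>)"
          using F[OF w_bound] L(2)[of "y - x'" "y - x"] F0 by (intro mult_mono) (auto simp: abs_minus_commute)
        also have "\<dots> \<le> (indicator {x..x + \<eta>} y + indicator {x'..x' + \<eta>} y) * (F * (L * \<bar>x' - x\<bar>))"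
          using True F0 L(1) mult_right_mono[of 1 "indicator {x..x + \<eta>} y + indicator {x'..x' + \<eta>} y :: real" "F * (L * \<bar>x' - x\<bar>)"]
          by (auto simp: indicator_def)
        finally show ?thesis .
      next
        case False
        then have "ker \<eta> (y - x') = 0" "ker \<eta> (y - x) = 0"
          using ker_nonzeroD[OF _ \<eta>, of "y - x"] ker_nonzeroD[OF _ \<eta>, of "y - x'"] by force+
        then show ?thesis using False by simp
      qed
      finally show "norm (G (w t y) * ker \<eta> (y - x') - G (w t y) * ker \<eta> (y - x))
          \<le> (indicator {x..x + \<eta>} y + indicator {x'..x' + \<eta>} y) * (F * (L * \<bar>x' - x\<bar>))" .
    qed (use i in simp)
    also have "\<dots> = 2 * \<eta> * (F * (L * \<bar>x' - x\<bar>))"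
      using \<eta> by (simp add: Bochner_Integration.integral_add integrable_real_indicator emeasure_lborel_Icc_eq)
    finally show "\<bar>slice_avg G \<eta> t x' - slice_avg G \<eta> t x\<bar> \<le> F * (L * (2 * \<eta>)) * \<bar>x' - x\<bar>"
      unfolding eq by (simp add: mult_ac)
  qed
qed

lemma slice_avg_continuous_time:
  assumes \<eta>: "0 < \<eta>" and G [measurable]: "G \<in> borel_measurable borel"
    and \<Lambda>: "\<And>x y. \<bar>x\<bar> \<le> B \<Longrightarrow> \<bar>y\<bar> \<le> B \<Longrightarrow> \<bar>G x - G y\<bar> \<le> \<Lambda> * \<bar>x - y\<bar>"
  shows "continuous_on {0..} (\<lambda>t. slice_avg G \<eta> t x)"
proof -
  obtain L where "0 \<le> L" "\<And>x y. \<bar>ker \<eta> x - ker \<eta> y\<bar> \<le> L * \<bar>x - y\<bar>" and L: "\<And>x. \<bar>ker \<eta> x\<bar> \<le> L"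
    by (rule ker_lipschitz[OF \<eta>]) (rule that; blast)
  show ?thesis
    unfolding slice_avg_def
  proof (rule slice_functional_continuous(1)[where C = L and R = "\<bar>x\<bar> + \<eta>" and \<Lambda> = \<Lambda>])
    show "ker \<eta> (y - x) = 0" if "\<bar>x\<bar> + \<eta> < \<bar>y\<bar>" for y
      using ker_nonzeroD[OF _ \<eta>, of "y - x"] that by (force simp: abs_if split: if_splits)
  qed (use L \<Lambda> in auto)
qed

lemma slice_avg_continuous:
  assumes \<eta>: "0 < \<eta>" and G [measurable]: "G \<in> borel_measurable borel"
    and \<Lambda>: "\<And>x y. \<bar>x\<bar> \<le> B \<Longrightarrow> \<bar>y\<bar> \<le> B \<Longrightarrow> \<bar>G x - G y\<bar> \<le> \<Lambda> * \<bar>x - y\<bar>"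
    and F: "\<And>x. \<bar>x\<bar> \<le> B \<Longrightarrow> \<bar>G x\<bar> \<le> F"
  shows "continuous_on ({0..} \<times> UNIV) (\<lambda>z. slice_avg G \<eta> (fst z) (snd z))"
  unfolding continuous_on
proof (intro ballI)
  fix z :: "real \<times> real" assume z: "z \<in> {0..} \<times> UNIV"
  obtain L where "0 \<le> L" and L': "\<And>G F t x x'. G \<in> borel_measurable borel \<Longrightarrow> (\<And>x. \<bar>x\<bar> \<le> B \<Longrightarrow> \<bar>G x\<bar> \<le> F) \<Longrightarrow>
    \<bar>slice_avg G \<eta> t x' - slice_avg G \<eta> t x\<bar> \<le> F * L * \<bar>x' - x\<bar>"
    by (rule slice_avg_lipschitz[OF \<eta>]) (rule that; blast)
  note L = L'[OF G F]
  let ?F = "at z within {0..} \<times> UNIV"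
  have "continuous_on ({0..} \<times> UNIV) (\<lambda>y :: real \<times> real. slice_avg G \<eta> (fst y) (snd z))"
    by (rule continuous_on_compose2[OF slice_avg_continuous_time[OF \<eta> G \<Lambda>]]) (auto intro!: continuous_intros)
  then have 1: "((\<lambda>y. slice_avg G \<eta> (fst y) (snd z)) \<longlongrightarrow> slice_avg G \<eta> (fst z) (snd z)) ?F"
    using z unfolding continuous_on by blast
  have 2: "((\<lambda>y. slice_avg G \<eta> (fst y) (snd y) - slice_avg G \<eta> (fst y) (snd z)) \<longlongrightarrow> 0) ?F"
  proof (rule Lim_null_comparison)
    show "\<forall>\<^sub>F y in ?F. norm (slice_avg G \<eta> (fst y) (snd y) - slice_avg G \<eta> (fst y) (snd z)) \<le> F * L * \<bar>snd y - snd z\<bar>"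
      using L by simp
    have "((\<lambda>y. F * L * \<bar>snd y - snd z\<bar>) \<longlongrightarrow> F * L * \<bar>snd z - snd z\<bar>) ?F"
      by (intro tendsto_intros)
    then show "((\<lambda>y. F * L * \<bar>snd y - snd z\<bar>) \<longlongrightarrow> 0) ?F" by simp
  qed
  show "((\<lambda>y. slice_avg G \<eta> (fst y) (snd y)) \<longlongrightarrow> slice_avg G \<eta> (fst z) (snd z)) ?F"
    using tendsto_add[OF 1 2] by simp
qed

lemma slice_avg_f:
  assumes "0 < \<eta>"
  shows "continuous_on ({0..} \<times> UNIV) (\<lambda>z. slice_avg f \<eta> (fst z) (snd z))"
    "continuous_on {0..} (\<lambda>t. slice_avg f \<eta> t x)"
    "integrable lborel (\<lambda>y. f (w t y) * ker \<eta> (y - x))"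
proof -
  obtain \<Lambda> F where "0 \<le> \<Lambda>" "0 \<le> F"
    and f: "\<And>x y. \<bar>x\<bar> \<le> B \<Longrightarrow> \<bar>y\<bar> \<le> B \<Longrightarrow> \<bar>f x - f y\<bar> \<le> \<Lambda> * \<bar>x - y\<bar>" "\<And>x. \<bar>x\<bar> \<le> B \<Longrightarrow> \<bar>f x\<bar> \<le> F"
    by (rule f_bounds) (rule that; blast)
  show "continuous_on ({0..} \<times> UNIV) (\<lambda>z. slice_avg f \<eta> (fst z) (snd z))" "continuous_on {0..} (\<lambda>t. slice_avg f \<eta> t x)"
    "integrable lborel (\<lambda>y. f (w t y) * ker \<eta> (y - x))"
    by (rule slice_avg_continuous[OF assms f_measurable f] slice_avg_continuous_time[OF assms f_measurable f(1)]
        slice_avg_integrable[OF assms f_measurable f(2)]; assumption)+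
qed

lemma slice_avg_id:
  assumes "0 < \<eta>"
  shows "continuous_on ({0..} \<times> UNIV) (\<lambda>z. slice_avg (\<lambda>x. x) \<eta> (fst z) (snd z))"
    "\<bar>slice_avg (\<lambda>x. x) \<eta> t x\<bar> \<le> B"
  using slice_avg_continuous[OF assms, of "\<lambda>x. x" 1 B] slice_avg_bound[OF assms, of "\<lambda>x. x" B] by auto

end

locale integrable_entropy_flow = entropy_flow +
  assumes w0_integrable: "integrable lborel (w 0)"
begin

text \<open>
  A mollification in \<open>x\<close> of a potential \<open>potential\<close> with \<open>\<partial>\<^sub>x potential = u\<close>, \<open>\<partial>\<^sub>t potential = - f(u)\<close>. It is defined before
  \<open>potential\<close> because the traces of \<open>f(u)\<close> on vertical lines, which \<open>potential\<close> would need, are not available.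
\<close>

definition smoothed_potential :: "real \<Rightarrow> real \<Rightarrow> real \<Rightarrow> real" where
  "smoothed_potential \<eta> t x = (LINT y|lborel. w 0 y * (1 - cum ((y - x) / \<eta>))) - integral {0..t} (\<lambda>\<tau>. slice_avg f \<eta> \<tau> x)"

definition mass :: real where
  "mass = (LINT y|lborel. \<bar>w 0 y\<bar>)"

lemma smoothed_potential_initial_integrable: "integrable lborel (\<lambda>y. w 0 y * (1 - cum ((y - x) / \<eta>)))"
  and smoothed_potential_initial_bound: "\<bar>LINT y|lborel. w 0 y * (1 - cum ((y - x) / \<eta>))\<bar> \<le> mass"
proof -
  have b: "\<bar>w 0 y * (1 - cum ((y - x) / \<eta>))\<bar> \<le> \<bar>w 0 y\<bar>" for y
    using cum_bounds[of "(y - x) / \<eta>"] by (simp add: abs_mult mult_left_le)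
  show i: "integrable lborel (\<lambda>y. w 0 y * (1 - cum ((y - x) / \<eta>)))"
    by (rule Bochner_Integration.integrable_bound[OF w0_integrable]) (use b in auto)
  have "norm (LINT y|lborel. w 0 y * (1 - cum ((y - x) / \<eta>))) \<le> mass"
    unfolding mass_def
    by (rule Bochner_Integration.integral_norm_bound_integral[OF i]) (use w0_integrable b in auto)
  then show "\<bar>LINT y|lborel. w 0 y * (1 - cum ((y - x) / \<eta>))\<bar> \<le> mass" by simp
qed

lemma slice_avg_f_integrable: "0 < \<eta> \<Longrightarrow> (\<lambda>\<tau>. slice_avg f \<eta> \<tau> x) integrable_on {0..t}"
  by (intro integrable_continuous_real continuous_on_subset[OF slice_avg_f(2)]) auto

text \<open>This is \<open>slice_equation\<close> for the ramp: its derivative produces the flux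
  averages at \<open>x\<close> and \<open>x'\<close> that occur in the two potentials, and the datum
  term splits into the two initial primitives.\<close>

lemma smoothed_potential_increment:
  assumes \<eta>: "0 < \<eta>" and t: "0 \<le> t"
  shows "smoothed_potential \<eta> t x' - smoothed_potential \<eta> t x = (LINT y|lborel. w t y * ramp \<eta> x x' y)"
proof -
  have main: "smoothed_potential \<eta> t x' - smoothed_potential \<eta> t x = (LINT y|lborel. w t y * ramp \<eta> x x' y)" if le: "x \<le> x'" for x x'
  proof -
    have "(LINT y|lborel. w t y * ramp \<eta> x x' y) = (LINT y|lborel. w 0 y * ramp \<eta> x x' y)
      + integral {0..t} (\<lambda>\<tau>. LINT y|lborel. f (w \<tau> y) * (ker \<eta> (y - x) - ker \<eta> (y - x')))"
    proof (rule slice_equation[OF ramp_has_derivative[OF \<eta>] _ ramp_nonneg[OF \<eta> le] _ t])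
      show "continuous_on UNIV (\<lambda>y. ker \<eta> (y - x) - ker \<eta> (y - x'))" by (intro continuous_intros)
      fix y assume y: "\<bar>x\<bar> + \<bar>x'\<bar> + \<eta> < \<bar>y\<bar>"
      then have "y \<le> x \<or> x' + \<eta> \<le> y" using \<eta> by linarith
      moreover have "ker \<eta> (y - x) = 0" "ker \<eta> (y - x') = 0"
        using ker_nonzeroD[OF _ \<eta>, of "y - x"] ker_nonzeroD[OF _ \<eta>, of "y - x'"] y by force+
      ultimately show "ramp \<eta> x x' y = 0 \<and> ker \<eta> (y - x) - ker \<eta> (y - x') = 0"
        using ramp_support[OF \<eta> le] by simp
    qed
    also have "(LINT y|lborel. w 0 y * ramp \<eta> x x' y)
        = (LINT y|lborel. w 0 y * (1 - cum ((y - x') / \<eta>)) - w 0 y * (1 - cum ((y - x) / \<eta>)))"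
      by (rule Bochner_Integration.integral_cong) (auto simp: ramp_def algebra_simps)
    also have "\<dots> = (LINT y|lborel. w 0 y * (1 - cum ((y - x') / \<eta>))) - (LINT y|lborel. w 0 y * (1 - cum ((y - x) / \<eta>)))"
      by (rule Bochner_Integration.integral_diff[OF smoothed_potential_initial_integrable smoothed_potential_initial_integrable])
    also have "(\<lambda>\<tau>. LINT y|lborel. f (w \<tau> y) * (ker \<eta> (y - x) - ker \<eta> (y - x'))) = (\<lambda>\<tau>. slice_avg f \<eta> \<tau> x - slice_avg f \<eta> \<tau> x')"
      unfolding slice_avg_def using slice_avg_f(3)[OF \<eta>] by (simp add: right_diff_distrib)
    also have "integral {0..t} \<dots> = integral {0..t} (\<lambda>\<tau>. slice_avg f \<eta> \<tau> x) - integral {0..t} (\<lambda>\<tau>. slice_avg f \<eta> \<tau> x')"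
      by (rule Henstock_Kurzweil_Integration.integral_diff[OF slice_avg_f_integrable[OF \<eta>] slice_avg_f_integrable[OF \<eta>]])
    finally show ?thesis by (simp add: smoothed_potential_def)
  qed
  show ?thesis
  proof (cases "x \<le> x'")
    case False
    have "(LINT y|lborel. w t y * ramp \<eta> x x' y) = (LINT y|lborel. - (w t y * ramp \<eta> x' x y))"
      by (rule Bochner_Integration.integral_cong) (auto simp: ramp_def algebra_simps)
    also have "\<dots> = - (LINT y|lborel. w t y * ramp \<eta> x' x y)" by simp
    finally show ?thesis using main[of x' x] False by simp
  qed (rule main)
qed

text \<open>Use \<open>slice_equation\<close> with the difference of the smoothed steps of widths
  \<open>\<eta>'\<close> and \<open>\<eta>\<close>, which lies between 0 and 1 and is supported in
  \<open>[x,x + \<eta>]\<close>. The flux terms match those of the two potentials, so a single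
  integral of size \<open>B * \<eta>\<close> is left.\<close>

lemma smoothed_potential_scale_increment:
  assumes \<eta>: "0 < \<eta>'" "\<eta>' \<le> \<eta>" and t: "0 \<le> t"
  shows "\<bar>smoothed_potential \<eta>' t x - smoothed_potential \<eta> t x\<bar> \<le> B * \<eta>"
proof -
  have \<eta>0: "0 < \<eta>" using \<eta> by simp
  define \<rho> where "\<rho> y = cum ((y - x) / \<eta>') - cum ((y - x) / \<eta>)" for y
  define \<rho>' where "\<rho>' y = ker \<eta>' (y - x) - ker \<eta> (y - x)" for y
  have d: "(\<rho> has_real_derivative \<rho>' y) (at y)" for y
    unfolding \<rho>_def \<rho>'_def ker_def using \<eta> \<eta>0 by (auto intro!: derivative_eq_intros)
  have pos: "0 \<le> \<rho> y" for y
  proof (cases "y \<le> x")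
    case True
    then show ?thesis using \<eta> \<eta>0 by (simp add: \<rho>_def cum_eq_0 divide_le_0_iff)
  next
    case False
    then have "(y - x) / \<eta> \<le> (y - x) / \<eta>'" using \<eta> by (intro divide_left_mono) auto
    then show ?thesis using cum_mono by (simp add: \<rho>_def)
  qed
  have supp: "\<rho> y = 0 \<and> \<rho>' y = 0" if "y \<le> x \<or> x + \<eta> \<le> y" for y
  proof (cases "y \<le> x")
    case True
    then show ?thesis
      using \<eta> \<eta>0 ker_nonzeroD(1)[OF _ \<eta>0, of "y - x"] ker_nonzeroD(1)[OF _ \<eta>(1), of "y - x"]
      by (force simp: \<rho>_def \<rho>'_def cum_eq_0 divide_le_0_iff)
  next
    case False
    then have "1 \<le> (y - x) / \<eta>" "1 \<le> (y - x) / \<eta>'" using that \<eta> \<eta>0 by (auto simp: le_divide_eq)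
    then have "\<rho> y = 0" by (simp add: \<rho>_def cum_eq_1)
    moreover have "\<rho>' y = 0"
      using ker_nonzeroD(2)[OF _ \<eta>0, of "y - x"] ker_nonzeroD(2)[OF _ \<eta>(1), of "y - x"] that False \<eta>
      by (force simp: \<rho>'_def)
    ultimately show ?thesis by simp
  qed
  have c': "continuous_on UNIV \<rho>'" unfolding \<rho>'_def by (intro continuous_intros)
  have eq: "(LINT y|lborel. w t y * \<rho> y) = (LINT y|lborel. w 0 y * \<rho> y)
      + integral {0..t} (\<lambda>\<tau>. LINT y|lborel. f (w \<tau> y) * \<rho>' y)"
    by (rule slice_equation[OF d c' pos _ t, of "\<bar>x\<bar> + \<eta>"]) (use supp \<eta>0 in \<open>force simp: abs_if split: if_splits\<close>)
  have "(LINT y|lborel. w 0 y * \<rho> y)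
      = (LINT y|lborel. w 0 y * (1 - cum ((y - x) / \<eta>)) - w 0 y * (1 - cum ((y - x) / \<eta>')))"
    by (rule Bochner_Integration.integral_cong) (auto simp: \<rho>_def algebra_simps)
  also have "\<dots> = (LINT y|lborel. w 0 y * (1 - cum ((y - x) / \<eta>))) - (LINT y|lborel. w 0 y * (1 - cum ((y - x) / \<eta>')))"
    by (rule Bochner_Integration.integral_diff[OF smoothed_potential_initial_integrable smoothed_potential_initial_integrable])
  finally have e0: "(LINT y|lborel. w 0 y * \<rho> y) = \<dots>" .
  have "(\<lambda>\<tau>. LINT y|lborel. f (w \<tau> y) * \<rho>' y) = (\<lambda>\<tau>. slice_avg f \<eta>' \<tau> x - slice_avg f \<eta> \<tau> x)"
    unfolding slice_avg_def \<rho>'_def using slice_avg_f(3)[OF \<eta>0] slice_avg_f(3)[OF \<eta>(1)] by (simp add: right_diff_distrib)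
  then have e1: "integral {0..t} (\<lambda>\<tau>. LINT y|lborel. f (w \<tau> y) * \<rho>' y)
     = integral {0..t} (\<lambda>\<tau>. slice_avg f \<eta>' \<tau> x) - integral {0..t} (\<lambda>\<tau>. slice_avg f \<eta> \<tau> x)"
    using Henstock_Kurzweil_Integration.integral_diff[OF slice_avg_f_integrable[OF \<eta>(1)] slice_avg_f_integrable[OF \<eta>0]] by simp
  have "smoothed_potential \<eta>' t x - smoothed_potential \<eta> t x = - (LINT y|lborel. w t y * \<rho> y)"
    unfolding eq e0 e1 by (simp add: smoothed_potential_def)
  moreover have "norm (LINT y|lborel. w t y * \<rho> y) \<le> (LINT y|lborel. indicator {x..x + \<eta>} y * B)"
  proof (rule Bochner_Integration.integral_norm_bound_integral)
    show ii: "integrable lborel (\<lambda>y. indicator {x..x + \<eta>} y * B)"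
      by (intro integrable_mult_left integrable_real_indicator) (auto simp: emeasure_lborel_Icc_eq)
    have b: "norm (w t y * \<rho> y) \<le> indicator {x..x + \<eta>} y * B" for y
    proof (cases "y \<in> {x..x + \<eta>}")
      case True
      have "\<bar>\<rho> y\<bar> \<le> 1" using cum_bounds[of "(y - x) / \<eta>'"] cum_bounds[of "(y - x) / \<eta>"] by (auto simp: \<rho>_def)
      then have "\<bar>w t y\<bar> * \<bar>\<rho> y\<bar> \<le> B * 1" using w_bound B_nonneg by (intro mult_mono) auto
      then show ?thesis using True by (simp add: abs_mult)
    next
      case False
      then show ?thesis using supp[of y] by auto
    qed
    then show "\<And>y. norm (w t y * \<rho> y) \<le> indicator {x..x + \<eta>} y * B" .
    have [measurable]: "\<rho> \<in> borel_measurable borel" unfolding \<rho>_def by measurable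
    show "integrable lborel (\<lambda>y. w t y * \<rho> y)"
    proof (rule Bochner_Integration.integrable_bound[OF ii])
      show "AE y in lborel. norm (w t y * \<rho> y) \<le> norm (indicator {x..x + \<eta>} y * B)"
        by (intro AE_I2) (metis b abs_ge_self order_trans real_norm_def)
    qed measurable
  qed
  ultimately show ?thesis using \<eta>0 by (simp add: mult.commute)
qed

text \<open>The preceding estimate makes the sequence Cauchy for \<open>0 \<le> t\<close>, and by
  \<open>smoothed_potential_close\<close> every other choice of vanishing scales leads to the same
  limit.\<close>

definition potential :: "real \<Rightarrow> real \<Rightarrow> real" where
  "potential t x = lim (\<lambda>n. smoothed_potential (1 / real (Suc n)) t x)"

lemma smoothed_potential_tendsto:
  assumes t: "0 \<le> t"
  shows "(\<lambda>n. smoothed_potential (1 / real (Suc n)) t x) \<longlonglongrightarrow> potential t x"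
proof -
  have "Cauchy (\<lambda>n. smoothed_potential (1 / real (Suc n)) t x)"
  proof (rule CauchyI')
    fix e :: real assume e: "0 < e"
    obtain N where N: "B / e < real N" using reals_Archimedean2 by blast
    show "\<exists>M. \<forall>m\<ge>M. \<forall>n>m. dist (smoothed_potential (1 / real (Suc m)) t x) (smoothed_potential (1 / real (Suc n)) t x) < e"
    proof (intro exI[of _ N] allI impI)
      fix m n assume mn: "N \<le> m" "m < n"
      have "\<bar>smoothed_potential (1 / real (Suc n)) t x - smoothed_potential (1 / real (Suc m)) t x\<bar> \<le> B * (1 / real (Suc m))"
        by (rule smoothed_potential_scale_increment[OF _ _ t]) (use mn in \<open>auto simp: frac_le\<close>)
      also have "\<dots> < e"
      proof -
        have "B / e < real (Suc m)" using N mn by linarith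
        then show ?thesis using e by (simp add: divide_less_eq mult.commute)
      qed
      finally show "dist (smoothed_potential (1 / real (Suc m)) t x) (smoothed_potential (1 / real (Suc n)) t x) < e"
        by (simp add: dist_real_def abs_minus_commute)
    qed
  qed
  then show ?thesis
    unfolding potential_def by (simp add: Cauchy_convergent_iff convergent_LIMSEQ_iff)
qed

lemma smoothed_potential_close:
  assumes \<eta>: "0 < \<eta>" and t: "0 \<le> t"
  shows "\<bar>potential t x - smoothed_potential \<eta> t x\<bar> \<le> B * \<eta>"
proof -
  have l: "(\<lambda>n. \<bar>smoothed_potential (1 / real (Suc n)) t x - smoothed_potential \<eta> t x\<bar>) \<longlonglongrightarrow> \<bar>potential t x - smoothed_potential \<eta> t x\<bar>"
    by (intro tendsto_intros smoothed_potential_tendsto[OF t])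
  obtain N where N: "inverse (real (Suc N)) < \<eta>" using reals_Archimedean[OF \<eta>] by blast
  have "\<forall>\<^sub>F n in sequentially. \<bar>smoothed_potential (1 / real (Suc n)) t x - smoothed_potential \<eta> t x\<bar> \<le> B * \<eta>"
    using eventually_ge_at_top[of N]
  proof eventually_elim
    case (elim n)
    have "1 / real (Suc n) \<le> 1 / real (Suc N)" using elim by (intro divide_left_mono) auto
    then have "1 / real (Suc n) \<le> \<eta>" using N by (simp add: inverse_eq_divide)
    then show ?case by (intro smoothed_potential_scale_increment t) auto
  qed
  then show ?thesis by (rule tendsto_upperbound[OF l]) simp
qed

lemma smoothed_potential_time_derivative:
  assumes \<eta>: "0 < \<eta>" and t: "0 < t"
  shows "((\<lambda>\<tau>. smoothed_potential \<eta> \<tau> x) has_real_derivative - slice_avg f \<eta> t x) (at t)"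
proof -
  have "((\<lambda>y. integral {0..y} (\<lambda>\<tau>. slice_avg f \<eta> \<tau> x)) has_real_derivative slice_avg f \<eta> t x) (at t within {0..t+1})"
    by (rule integral_has_real_derivative) (use t continuous_on_subset[OF slice_avg_f(2)[OF \<eta>]] in auto)
  then have "((\<lambda>y. integral {0..y} (\<lambda>\<tau>. slice_avg f \<eta> \<tau> x)) has_real_derivative slice_avg f \<eta> t x) (at t)"
    using t by (subst (asm) at_within_interior) auto
  then show ?thesis
    unfolding smoothed_potential_def by (auto intro!: derivative_eq_intros)
qed

lemma w_ramp_integrable:
  assumes \<eta>: "0 < \<eta>"
  shows "integrable lborel (\<lambda>y. w t y * ramp \<eta> x x' y)"
proof -
  have rv: "ramp \<eta> x x' y = 0" if "\<bar>x\<bar> + \<bar>x'\<bar> + \<eta> < norm y" for y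
  proof (cases "x \<le> x'")
    case True
    then show ?thesis using that \<eta> by (intro ramp_support) auto
  next
    case False
    then have "ramp \<eta> x' x y = 0" using that \<eta> by (intro ramp_support) auto
    then show ?thesis by (simp add: ramp_def)
  qed
  have "integrable lborel (ramp \<eta> x x')"
    by (rule continuous_vanishing_imp_integrable[OF _ rv]) (use \<eta> in \<open>auto intro!: continuous_intros\<close>)
  then show ?thesis
    by (rule integrable_bounded_mult) (use w_bound in auto)
qed

text \<open>The ramp and the indicator of \<open>[x,x']\<close> differ on two intervals of length
  \<open>\<eta>\<close> only, and by at most 1.\<close>

lemma smoothed_potential_increment_approx:
  assumes \<eta>: "0 < \<eta>" and t: "0 \<le> t" and that: "x \<le> x'"
  shows "\<bar>smoothed_potential \<eta> t x' - smoothed_potential \<eta> t x - (LINT y|lborel. indicator {x..x'} y * w t y)\<bar> \<le> 2 * B * \<eta>"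
proof -
  have ind: "integrable lborel (\<lambda>y. indicator {a..b} y * (c :: real))" for a b c :: real
    by (intro integrable_mult_left integrable_real_indicator) (auto simp: emeasure_lborel_Icc_eq)
  have iw: "integrable lborel (\<lambda>y. indicator {x..x'} y * w t y)"
  proof (rule Bochner_Integration.integrable_bound[OF ind[of x x' B]])
    show "AE y in lborel. norm (indicator {x..x'} y * w t y) \<le> norm (indicator {x..x'} y * B)"
      using w_bound[of t] B_nonneg by (intro AE_I2) (auto simp: indicator_def)
  qed measurable
  have eq: "smoothed_potential \<eta> t x' - smoothed_potential \<eta> t x - (LINT y|lborel. indicator {x..x'} y * w t y)
      = (LINT y|lborel. w t y * ramp \<eta> x x' y - indicator {x..x'} y * w t y)"
    unfolding smoothed_potential_increment[OF \<eta> t] using w_ramp_integrable[OF \<eta>] iw by simp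
  have "norm (LINT y|lborel. w t y * ramp \<eta> x x' y - indicator {x..x'} y * w t y)
      \<le> (LINT y|lborel. indicator {x..x + \<eta>} y * B + indicator {x'..x' + \<eta>} y * B)"
  proof (rule Bochner_Integration.integral_norm_bound_integral)
    fix y
    have e: "norm (w t y * ramp \<eta> x x' y - indicator {x..x'} y * w t y) = \<bar>w t y\<bar> * \<bar>ramp \<eta> x x' y - indicator {x..x'} y\<bar>"
      by (simp add: abs_mult[symmetric] algebra_simps)
    have "\<bar>ramp \<eta> x x' y - indicator {x..x'} y\<bar> \<le> indicator {x..x + \<eta>} y + indicator {x'..x' + \<eta>} y"
    proof (cases "y \<in> {x..x + \<eta>} \<or> y \<in> {x'..x' + \<eta>}")
      case True
      have "\<bar>ramp \<eta> x x' y - indicator {x..x'} y\<bar> \<le> 1"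
        using ramp_bounds[OF \<eta>, of x x' y] ramp_nonneg[OF \<eta> that, of y] by (auto simp: indicator_def)
      also have "\<dots> \<le> indicator {x..x + \<eta>} y + indicator {x'..x' + \<eta>} y" using True by (auto simp: indicator_def)
      finally show ?thesis .
    next
      case False
      show ?thesis
      proof (cases "y \<in> {x..x'}")
        case True
        then have "x + \<eta> < y" "y < x'" using False \<eta> by auto
        then have "1 \<le> (y - x) / \<eta>" "(y - x') / \<eta> \<le> 0" using \<eta> by (auto simp: le_divide_eq divide_le_0_iff)
        then show ?thesis using True by (simp add: ramp_def cum_eq_0 cum_eq_1)
      next
        case F2: False
        then have "y \<le> x \<or> x' + \<eta> \<le> y" using False by auto
        from ramp_support[OF \<eta> that this] show ?thesis using F2 by simp
      qed
    qed
    then have "\<bar>w t y\<bar> * \<bar>ramp \<eta> x x' y - indicator {x..x'} y\<bar> \<le> B * (indicator {x..x + \<eta>} y + indicator {x'..x' + \<eta>} y)"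
      using w_bound B_nonneg by (intro mult_mono) auto
    then show "norm (w t y * ramp \<eta> x x' y - indicator {x..x'} y * w t y) \<le> indicator {x..x + \<eta>} y * B + indicator {x'..x' + \<eta>} y * B"
      unfolding e by (simp add: algebra_simps)
  qed (use w_ramp_integrable[OF \<eta>] iw ind in \<open>auto intro!: Bochner_Integration.integrable_add\<close>)
  also have "\<dots> = 2 * B * \<eta>" using ind \<eta> by simp
  finally show ?thesis unfolding eq by simp
qed

lemma potential_increment:
  assumes t: "0 \<le> t" and le: "x \<le> x'"
  shows "potential t x' - potential t x = (LINT y|lborel. indicator {x..x'} y * w t y)"
proof -
  have l: "(\<lambda>n. \<bar>smoothed_potential (1 / real (Suc n)) t x' - smoothed_potential (1 / real (Suc n)) t x - (LINT y|lborel. indicator {x..x'} y * w t y)\<bar>)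
      \<longlonglongrightarrow> \<bar>potential t x' - potential t x - (LINT y|lborel. indicator {x..x'} y * w t y)\<bar>"
    by (intro tendsto_intros smoothed_potential_tendsto[OF t])
  have z: "(\<lambda>n. 2 * B * (1 / real (Suc n))) \<longlonglongrightarrow> 2 * B * 0"
    using LIMSEQ_inverse_real_of_nat by (intro tendsto_intros) (simp add: inverse_eq_divide)
  have "\<bar>potential t x' - potential t x - (LINT y|lborel. indicator {x..x'} y * w t y)\<bar> \<le> 2 * B * 0"
    by (rule tendsto_le[OF _ z l]) (simp, intro always_eventually allI smoothed_potential_increment_approx t le, simp)
  then show ?thesis by simp
qed

lemma potential_space_lipschitz:
  assumes t: "0 \<le> t"
  shows "\<bar>potential t x' - potential t x\<bar> \<le> B * \<bar>x' - x\<bar>"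
proof -
  have main: "\<bar>potential t x' - potential t x\<bar> \<le> B * \<bar>x' - x\<bar>" if le: "x \<le> x'" for x x'
  proof -
    have ind: "integrable lborel (\<lambda>y. indicator {x..x'} y * B)"
      by (intro integrable_mult_left integrable_real_indicator) (auto simp: emeasure_lborel_Icc_eq)
    have "norm (LINT y|lborel. indicator {x..x'} y * w t y) \<le> (LINT y|lborel. indicator {x..x'} y * B)"
    proof (rule Bochner_Integration.integral_norm_bound_integral[OF _ ind])
      show b: "norm (indicator {x..x'} y * w t y) \<le> indicator {x..x'} y * B" for y
        using w_bound by (auto simp: indicator_def)
      show "integrable lborel (\<lambda>y. indicator {x..x'} y * w t y)"
        by (rule Bochner_Integration.integrable_bound[OF ind])
           (use w_bound[of t] B_nonneg in \<open>auto intro!: AE_I2 simp: indicator_def\<close>)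
    qed
    then show ?thesis using potential_increment[OF t le] le by (simp add: mult.commute)
  qed
  show ?thesis
    using main[of x x'] main[of x' x] by (cases "x \<le> x'") (auto simp: abs_minus_commute)
qed

lemma potential_time_lipschitz:
  obtains F where "0 \<le> F" "\<And>t t' x. 0 \<le> t \<Longrightarrow> 0 \<le> t' \<Longrightarrow> \<bar>potential t' x - potential t x\<bar> \<le> F * \<bar>t' - t\<bar>"
    "\<And>x. \<bar>x\<bar> \<le> B \<Longrightarrow> \<bar>f x\<bar> \<le> F"
proof -
  obtain \<Lambda> F where "0 \<le> \<Lambda>" and "0 \<le> F"
    and "\<And>x y. \<bar>x\<bar> \<le> B \<Longrightarrow> \<bar>y\<bar> \<le> B \<Longrightarrow> \<bar>f x - f y\<bar> \<le> \<Lambda> * \<bar>x - y\<bar>"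
    and "\<And>x. \<bar>x\<bar> \<le> B \<Longrightarrow> \<bar>f x\<bar> \<le> F"
    by (rule f_bounds) (rule that; blast)
  note F = this(2,4)
  have main: "\<bar>potential t' x - potential t x\<bar> \<le> F * \<bar>t' - t\<bar>" if tt: "0 \<le> t" "t \<le> t'" for t t' x
  proof -
    have b: "\<bar>smoothed_potential \<eta> t' x - smoothed_potential \<eta> t x\<bar> \<le> F * \<bar>t' - t\<bar>" if \<eta>: "0 < \<eta>" for \<eta>
    proof -
      have "integral {0..t} (\<lambda>\<tau>. slice_avg f \<eta> \<tau> x) + integral {t..t'} (\<lambda>\<tau>. slice_avg f \<eta> \<tau> x) = integral {0..t'} (\<lambda>\<tau>. slice_avg f \<eta> \<tau> x)"
        by (rule Henstock_Kurzweil_Integration.integral_combine) (use tt slice_avg_f_integrable[OF \<eta>] in auto)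
      then have "smoothed_potential \<eta> t' x - smoothed_potential \<eta> t x = - integral {t..t'} (\<lambda>\<tau>. slice_avg f \<eta> \<tau> x)" by (simp add: smoothed_potential_def)
      moreover have "norm (integral {t..t'} (\<lambda>\<tau>. slice_avg f \<eta> \<tau> x)) \<le> F * (t' - t)"
        by (rule integral_bound) (use tt slice_avg_bound[OF \<eta> f_measurable F(2)] continuous_on_subset[OF slice_avg_f(2)[OF \<eta>]] in auto)
      ultimately show ?thesis using tt by simp
    qed
    have t': "0 \<le> t'" using tt by simp
    have "(\<lambda>n. \<bar>smoothed_potential (1 / real (Suc n)) t' x - smoothed_potential (1 / real (Suc n)) t x\<bar>) \<longlonglongrightarrow> \<bar>potential t' x - potential t x\<bar>"
      by (intro tendsto_intros smoothed_potential_tendsto tt t')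
    then show ?thesis by (rule tendsto_upperbound) (use b in auto)
  qed
  show thesis
  proof (rule that[OF F(1) _ F(2)])
    fix t t' x :: real assume "0 \<le> t" "0 \<le> t'"
    then show "\<bar>potential t' x - potential t x\<bar> \<le> F * \<bar>t' - t\<bar>"
      using main[of t t' x] main[of t' t x] by (cases "t \<le> t'") (auto simp: abs_minus_commute)
  qed
qed

lemma potential_continuous: "continuous_on ({0..} \<times> UNIV) (\<lambda>z. potential (fst z) (snd z))"
proof -
  obtain F where F: "0 \<le> F" "\<And>t t' x. 0 \<le> t \<Longrightarrow> 0 \<le> t' \<Longrightarrow> \<bar>potential t' x - potential t x\<bar> \<le> F * \<bar>t' - t\<bar>"
    "\<And>x. \<bar>x\<bar> \<le> B \<Longrightarrow> \<bar>f x\<bar> \<le> F"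
    by (rule potential_time_lipschitz) (rule that; blast)
  show ?thesis
    unfolding continuous_on
  proof (intro ballI)
    fix z :: "real \<times> real" assume z: "z \<in> {0..} \<times> UNIV"
    let ?F = "at z within {0..} \<times> UNIV"
    have lim: "((\<lambda>y. F * \<bar>fst y - fst z\<bar> + B * \<bar>snd y - snd z\<bar>) \<longlongrightarrow> F * \<bar>fst z - fst z\<bar> + B * \<bar>snd z - snd z\<bar>) ?F"
      by (intro tendsto_intros)
    have "((\<lambda>y. potential (fst y) (snd y) - potential (fst z) (snd z)) \<longlongrightarrow> 0) ?F"
    proof (rule Lim_null_comparison[OF _ lim[simplified]])
      have "\<forall>\<^sub>F y in ?F. y \<in> {0..} \<times> UNIV" by (simp add: eventually_at_topological) blast
      then show "\<forall>\<^sub>F y in ?F. norm (potential (fst y) (snd y) - potential (fst z) (snd z)) \<le> F * \<bar>fst y - fst z\<bar> + B * \<bar>snd y - snd z\<bar>"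
      proof eventually_elim
        case (elim y)
        have "\<bar>potential (fst y) (snd z) - potential (fst z) (snd z)\<bar> \<le> F * \<bar>fst y - fst z\<bar>" using elim z by (intro F) auto
        moreover have "\<bar>potential (fst y) (snd y) - potential (fst y) (snd z)\<bar> \<le> B * \<bar>snd y - snd z\<bar>" using elim by (intro potential_space_lipschitz) auto
        ultimately show ?case by simp
      qed
    qed
    then show "((\<lambda>y. potential (fst y) (snd y)) \<longlongrightarrow> potential (fst z) (snd z)) ?F" by (simp add: LIM_zero_iff)
  qed
qed

lemma potential_initial_bound: "\<bar>potential 0 x\<bar> \<le> mass"
proof -
  have "(\<lambda>n. \<bar>smoothed_potential (1 / real (Suc n)) 0 x\<bar>) \<longlonglongrightarrow> \<bar>potential 0 x\<bar>"
    by (intro tendsto_intros smoothed_potential_tendsto) simp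
  moreover have "\<bar>smoothed_potential \<eta> 0 x\<bar> \<le> mass" for \<eta>
    using smoothed_potential_initial_bound[of x \<eta>] by (simp add: smoothed_potential_def)
  ultimately show ?thesis
    by (intro tendsto_upperbound[of _ "\<bar>potential 0 x\<bar>"] always_eventually allI) auto
qed

text \<open>By the mean value theorem the ramp equals \<open>(x' - x) * ker \<eta> (y - x)\<close>
  up to a quadratic error, because \<open>ker \<eta>\<close> is Lipschitz; integration against the
  bounded \<open>w t\<close> keeps the error quadratic.\<close>

lemma smoothed_potential_space_derivative:
  assumes \<eta>: "0 < \<eta>" and t: "0 \<le> t"
  shows "(smoothed_potential \<eta> t has_real_derivative slice_avg (\<lambda>x. x) \<eta> t x) (at x)"
proof -
  obtain L where L: "0 \<le> L" "\<And>x y. \<bar>ker \<eta> x - ker \<eta> y\<bar> \<le> L * \<bar>x - y\<bar>" "\<And>x. \<bar>ker \<eta> x\<bar> \<le> L"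
    by (rule ker_lipschitz[OF \<eta>]) (rule that; blast)
  let ?m = "slice_avg (\<lambda>x. x) \<eta> t x"
  have taylor: "\<bar>ramp \<eta> x x' y - (x' - x) * ker \<eta> (y - x)\<bar> \<le> L * (x' - x)\<^sup>2" for x' y
  proof -
    have ex: "\<exists>\<xi>. \<bar>\<xi> - a\<bar> \<le> \<bar>b - a\<bar> \<and> cum (b / \<eta>) - cum (a / \<eta>) = (b - a) * ker \<eta> \<xi>" for a b
    proof -
      consider "a < b" | "b < a" | "a = b" by linarith
      then show ?thesis
      proof cases
        case 1
        then obtain \<xi> where "a < \<xi>" "\<xi> < b" "cum (b / \<eta>) - cum (a / \<eta>) = (b - a) * ker \<eta> \<xi>"
          using MVT2[of a b "\<lambda>x. cum (x / \<eta>)" "ker \<eta>"] cum_scaled_has_derivative[OF \<eta>] by auto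
        then show ?thesis by (intro exI[of _ \<xi>]) auto
      next
        case 2
        then obtain \<xi> where "b < \<xi>" "\<xi> < a" "cum (a / \<eta>) - cum (b / \<eta>) = (a - b) * ker \<eta> \<xi>"
          using MVT2[of b a "\<lambda>x. cum (x / \<eta>)" "ker \<eta>"] cum_scaled_has_derivative[OF \<eta>] by auto
        then show ?thesis by (intro exI[of _ \<xi>]) (auto simp: algebra_simps)
      qed auto
    qed
    obtain \<xi> where \<xi>: "\<bar>\<xi> - (y - x)\<bar> \<le> \<bar>(y - x') - (y - x)\<bar>"
      "cum ((y - x') / \<eta>) - cum ((y - x) / \<eta>) = ((y - x') - (y - x)) * ker \<eta> \<xi>"
      using ex[of "y - x" "y - x'"] by blast
    have "ramp \<eta> x x' y - (x' - x) * ker \<eta> (y - x) = (x' - x) * (ker \<eta> \<xi> - ker \<eta> (y - x))"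
      using \<xi>(2) by (simp add: ramp_def algebra_simps)
    also have "\<bar>\<dots>\<bar> \<le> \<bar>x' - x\<bar> * (L * \<bar>x' - x\<bar>)"
      unfolding abs_mult
    proof (rule mult_left_mono)
      have "\<bar>ker \<eta> \<xi> - ker \<eta> (y - x)\<bar> \<le> L * \<bar>\<xi> - (y - x)\<bar>" by (rule L)
      also have "\<dots> \<le> L * \<bar>x' - x\<bar>" using \<xi>(1) L(1) by (intro mult_left_mono) auto
      finally show "\<bar>ker \<eta> \<xi> - ker \<eta> (y - x)\<bar> \<le> L * \<bar>x' - x\<bar>" .
    qed simp
    also have "\<dots> = L * (x' - x)\<^sup>2" by (simp add: power2_eq_square mult.left_commute[of _ L])
    finally show ?thesis .
  qed
  show ?thesis
  \<comment> \<open>Here \<open>2 + \<eta>\<close> is the length of an interval that contains all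
    supports as long as \<open>\<bar>x' - x\<bar> \<le> 1\<close>.\<close>
  proof (rule has_real_derivative_of_quadratic_remainder[where C = "B * L * (2 + \<eta>)"])
    fix x' assume True: "\<bar>x' - x\<bar> \<le> 1"
    let ?E = "\<lambda>y. ramp \<eta> x x' y - (x' - x) * ker \<eta> (y - x)"
    have ind: "integrable lborel (\<lambda>y. indicator {x - 1..x + 1 + \<eta>} y * c :: real)" for c
      by (intro integrable_mult_left integrable_real_indicator) (auto simp: emeasure_lborel_Icc_eq)
    have i1: "integrable lborel (\<lambda>y. w t y * ramp \<eta> x x' y)" by (rule w_ramp_integrable[OF \<eta>])
    have i2: "integrable lborel (\<lambda>y. (x' - x) * (w t y * ker \<eta> (y - x)))"
      using slice_avg_integrable[OF \<eta>, of "\<lambda>x. x" B t x] by simp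
    have "smoothed_potential \<eta> t x' - smoothed_potential \<eta> t x - (x' - x) * ?m = (LINT y|lborel. w t y * ramp \<eta> x x' y) - (LINT y|lborel. (x' - x) * (w t y * ker \<eta> (y - x)))"
      unfolding smoothed_potential_increment[OF \<eta> t] slice_avg_def by simp
    also have "\<dots> = (LINT y|lborel. w t y * ramp \<eta> x x' y - (x' - x) * (w t y * ker \<eta> (y - x)))"
      by (rule Bochner_Integration.integral_diff[OF i1 i2, symmetric])
    finally have eq: "smoothed_potential \<eta> t x' - smoothed_potential \<eta> t x - (x' - x) * ?m = \<dots>" .
    have "norm (LINT y|lborel. w t y * ramp \<eta> x x' y - (x' - x) * (w t y * ker \<eta> (y - x))) \<le> (LINT y|lborel. indicator {x - 1..x + 1 + \<eta>} y * (B * (L * (x' - x)\<^sup>2)))"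
    proof (rule Bochner_Integration.integral_norm_bound_integral[OF _ ind])
      show "integrable lborel (\<lambda>y. w t y * ramp \<eta> x x' y - (x' - x) * (w t y * ker \<eta> (y - x)))"
        by (rule Bochner_Integration.integrable_diff[OF i1 i2])
      fix y
      have "norm (w t y * ramp \<eta> x x' y - (x' - x) * (w t y * ker \<eta> (y - x))) = \<bar>w t y\<bar> * \<bar>?E y\<bar>"
        by (simp add: abs_mult[symmetric] algebra_simps)
      also have "\<dots> \<le> indicator {x - 1..x + 1 + \<eta>} y * (B * (L * (x' - x)\<^sup>2))"
      proof (cases "y \<in> {x - 1..x + 1 + \<eta>}")
        case True
        then show ?thesis using mult_mono[OF w_bound[of t y] taylor[of x' y] B_nonneg] by simp
      next
        case False
        have "ramp \<eta> x x' y = 0"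
        proof (cases "x \<le> x'")
          case True
          then show ?thesis using False \<open>\<bar>x' - x\<bar> \<le> 1\<close> \<eta> by (intro ramp_support) auto
        next
          case F2: False
          then have "ramp \<eta> x' x y = 0" using False \<open>\<bar>x' - x\<bar> \<le> 1\<close> \<eta> by (intro ramp_support) auto
          then show ?thesis by (simp add: ramp_def)
        qed
        moreover have "ker \<eta> (y - x) = 0" using ker_nonzeroD[OF _ \<eta>, of "y - x"] False by force
        ultimately show ?thesis using False by simp
      qed
      finally show "norm (w t y * ramp \<eta> x x' y - (x' - x) * (w t y * ker \<eta> (y - x))) \<le> indicator {x - 1..x + 1 + \<eta>} y * (B * (L * (x' - x)\<^sup>2))" .
    qed
    also have "\<dots> = B * L * (2 + \<eta>) * (x' - x)\<^sup>2" using \<eta> by (simp add: mult_ac)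
    finally show "\<bar>smoothed_potential \<eta> t x' - smoothed_potential \<eta> t x - (x' - x) * ?m\<bar> \<le> B * L * (2 + \<eta>) * (x' - x)\<^sup>2" unfolding eq by simp
  qed
qed

lemma smoothed_potential_has_derivative:
  assumes \<eta>: "0 < \<eta>" and z: "0 < fst z"
  shows "((\<lambda>z. smoothed_potential \<eta> (fst z) (snd z)) has_derivative
     (\<lambda>h. fst h * (- slice_avg f \<eta> (fst z) (snd z)) + snd h * slice_avg (\<lambda>x. x) \<eta> (fst z) (snd z))) (at z)"
  by (rule has_derivative_half_plane_from_partials[OF _ _ _ z])
     (use smoothed_potential_time_derivative[OF \<eta>] smoothed_potential_space_derivative[OF \<eta>] in
       \<open>auto intro: continuous_on_subset[OF slice_avg_id(1)[OF \<eta>]]\<close>)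

end

section \<open>Translations and averages in the mean\<close>

lemma cball_measurable [measurable]: "cball a R \<in> sets borel"
  by (rule borel_closed) (rule closed_cball)

lemma integrable_indicator_cball:
  "integrable lborel (\<lambda>z :: 'a::euclidean_space. indicator (cball a R) z * (c :: real))"
  using emeasure_lborel_cball_finite[of a R, unfolded infinity_ennreal_def]
  by (intro integrable_mult_left integrable_real_indicator) auto

lemma integrable_indicator_cball_mult:
  fixes g :: "'a::euclidean_space \<Rightarrow> real"
  assumes [measurable]: "g \<in> borel_measurable borel" and C: "\<And>z. \<bar>g z\<bar> \<le> C"
  shows "integrable lborel (\<lambda>z. indicator (cball a R) z * g z)"
proof (rule Bochner_Integration.integrable_bound[OF integrable_indicator_cball[of a R C]])
  show "AE z in lborel. norm (indicator (cball a R) z * g z) \<le> norm (indicator (cball a R) z * C)"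
    using C by (intro AE_I2) (auto simp: indicator_def intro: order_trans[OF _ abs_ge_self])
qed measurable

lemma integral_lborel_shift:
  fixes g :: "'a::euclidean_space \<Rightarrow> real"
  assumes [measurable]: "g \<in> borel_measurable borel"
  shows "(LINT z|lborel. g (z + h)) = (LINT z|lborel. g z)"
proof -
  have "(LINT z|lborel. g z) = (LINT z|distr lborel borel ((+) h). g z)"
    using lborel_distr_plus[of h] by simp
  also have "\<dots> = (LINT z|lborel. g (h + z))"
    by (rule integral_distr) auto
  finally show ?thesis by (simp add: add.commute)
qed

text \<open>A measurable function is an almost everywhere limit of continuous ones; clipping these
  keeps the bound \<open>C\<close> and supplies a dominating function.\<close>

lemma L1_approximation_by_continuous:
  fixes g :: "'a::euclidean_space \<Rightarrow> real"
  assumes [measurable]: "g \<in> borel_measurable borel" and C: "\<And>z. \<bar>g z\<bar> \<le> C" and e: "0 < e"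
  obtains k where "continuous_on UNIV k" "\<And>z. \<bar>k z\<bar> \<le> C"
    "(LINT z|lborel. indicator (cball 0 R) z * \<bar>k z - g z\<bar>) < e"
proof -
  have C0: "0 \<le> C" using C[of 0] by linarith
  have "g \<in> borel_measurable lebesgue" by (rule measurable_completion) simp
  then have "g measurable_on UNIV" by (rule lebesgue_measurable_imp_measurable_on_real) simp
  then obtain N h where N: "negligible N" and h: "\<And>n. continuous_on UNIV (h n)"
    and lim: "\<And>x. x \<notin> N \<Longrightarrow> (\<lambda>n. h n x) \<longlonglongrightarrow> g x"
    unfolding measurable_on_def by auto
  define k where "k n z = clip C (h n z)" for n :: nat and z
  have kc: "continuous_on UNIV (k n)" for n
    unfolding k_def clip_def by (intro continuous_intros h)
  have [measurable]: "k n \<in> borel_measurable borel" for n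
    using kc by (rule borel_measurable_continuous_onI)
  have kb: "\<bar>k n z\<bar> \<le> C" for n z by (simp add: k_def clip_bound C0)
  have "(\<lambda>n. LINT z|lborel. indicator (cball 0 R) z * \<bar>k n z - g z\<bar>) \<longlonglongrightarrow> (LINT z|(lborel :: 'a measure). (0 :: real))"
  proof (rule integral_dominated_convergence[where w = "\<lambda>z. indicator (cball 0 R) z * (2 * C)"])
    show "integrable lborel (\<lambda>z :: 'a. indicator (cball 0 R) z * (2 * C))" by (rule integrable_indicator_cball)
    have "AE x in lborel. x \<notin> N"
      using AE_not_in[of N lebesgue] N unfolding negligible_iff_null_sets AE_completion_iff by blast
    then show "AE x in lborel. (\<lambda>n. indicator (cball 0 R) x * \<bar>k n x - g x\<bar>) \<longlonglongrightarrow> 0"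
    proof eventually_elim
      case (elim x)
      have "(\<lambda>n. indicator (cball 0 R) x * \<bar>h n x - g x\<bar>) \<longlonglongrightarrow> indicator (cball 0 R) x * \<bar>g x - g x\<bar>"
        by (intro tendsto_intros lim elim)
      then have l: "(\<lambda>n. indicator (cball 0 R) x * \<bar>h n x - g x\<bar>) \<longlonglongrightarrow> 0" by simp
      have "\<bar>k n x - g x\<bar> \<le> \<bar>h n x - g x\<bar>" for n
        using clip_nonexpansive[of C "h n x" "g x"] clip_id[OF C, of x] by (simp add: k_def)
      then have "norm (indicator (cball 0 R) x * \<bar>k n x - g x\<bar>) \<le> indicator (cball 0 R) x * \<bar>h n x - g x\<bar>" for n
        by (simp add: abs_mult mult_left_mono)
      then show ?case by (intro Lim_null_comparison[OF _ l] always_eventually allI)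
    qed
    show "AE x in lborel. norm (indicator (cball 0 R) x * \<bar>k n x - g x\<bar>) \<le> indicator (cball 0 R) x * (2 * C)" for n
    proof (rule AE_I2)
      fix x
      have "\<bar>k n x - g x\<bar> \<le> 2 * C" using kb[of n x] C[of x] by linarith
      then show "norm (indicator (cball 0 R) x * \<bar>k n x - g x\<bar>) \<le> indicator (cball 0 R) x * (2 * C)"
        by (simp add: abs_mult mult_left_mono)
    qed
  qed measurable
  then have "\<forall>\<^sub>F n in sequentially. (LINT z|lborel. indicator (cball 0 R) z * \<bar>k n z - g z\<bar>) < e"
    by (intro order_tendstoD(2)) (use e in auto)
  then obtain n where "(LINT z|lborel. indicator (cball 0 R) z * \<bar>k n z - g z\<bar>) < e"
    using eventually_happens'[OF sequentially_bot] by blast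
  then show thesis using that[of "k n"] kc kb by blast
qed

lemma L1_translation_continuous:
  fixes g :: "'a::euclidean_space \<Rightarrow> real"
  assumes [measurable]: "g \<in> borel_measurable borel" and C: "\<And>z. \<bar>g z\<bar> \<le> C" and e: "0 < e"
  obtains d where "0 < d" "\<And>h. norm h < d \<Longrightarrow> (LINT z|lborel. indicator (cball 0 R) z * \<bar>g (z + h) - g z\<bar>) \<le> e"
proof -
  have C0: "0 \<le> C" using C[of 0] by linarith
  define m where "m = measure lborel (cball (0 :: 'a) R)"
  have m: "0 \<le> m" by (simp add: m_def)
  \<comment> \<open>The larger radius is taken because translations by less than 1 carry the ball of
    radius \<open>R\<close> into it.\<close>
  obtain k where kc: "continuous_on UNIV k" and kb: "\<And>z. \<bar>k z\<bar> \<le> C"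
    and k: "(LINT z|lborel. indicator (cball 0 (R + 1)) z * \<bar>k z - g z\<bar>) < e / 3"
    using L1_approximation_by_continuous[OF assms(1) C, of "e / 3" "R + 1"] e by auto
  have [measurable]: "k \<in> borel_measurable borel" using kc by (rule borel_measurable_continuous_onI)
  have "uniformly_continuous_on (cball 0 (R + 1)) k"
    by (rule compact_uniformly_continuous) (use kc continuous_on_subset in auto)
  moreover have "0 < e / (3 * (m + 1))" using e m by simp
  ultimately obtain d where d: "d > 0"
    "\<And>x y. x \<in> cball 0 (R + 1) \<Longrightarrow> y \<in> cball 0 (R + 1) \<Longrightarrow> dist y x < d \<Longrightarrow> dist (k y) (k x) < e / (3 * (m + 1))"
    unfolding uniformly_continuous_on_def by metis
  show thesis
  proof (rule that[of "min d 1"])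
    show "0 < min d 1" using d by simp
    fix h :: 'a assume h: "norm h < min d 1"
    have sub: "z + h \<in> cball 0 (R + 1)" if "z \<in> cball 0 R" for z
      using that h norm_triangle_ineq[of z h] by simp
    let ?I = "indicator (cball 0 R) :: 'a \<Rightarrow> real" and ?J = "indicator (cball 0 (R + 1)) :: 'a \<Rightarrow> real"
    let ?D = "\<lambda>z. \<bar>k z - g z\<bar>"
    have Db: "\<bar>?D z\<bar> \<le> 2 * C" for z using kb[of z] C[of z] by linarith
    have Db': "\<bar>?D (z + h)\<bar> \<le> 2 * C" for z using Db .
    have dom: "indicator (cball 0 R) z * \<bar>g (z + h) - g z\<bar> \<le> ?I z * ?D (z + h) + ?I z * (e / (3 * (m + 1))) + ?I z * ?D z" for z
    proof (cases "z \<in> cball 0 R")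
      case True
      have "z \<in> cball 0 (R + 1)" using True by simp
      then have "\<bar>k (z + h) - k z\<bar> \<le> e / (3 * (m + 1))"
        using d(2)[of z "z + h"] sub[OF True] h by (simp add: dist_norm)
      then have "\<bar>g (z + h) - g z\<bar> \<le> ?D (z + h) + e / (3 * (m + 1)) + ?D z" by linarith
      then show ?thesis using True by simp
    qed simp
    have i1: "integrable lborel (\<lambda>z. ?I z * ?D (z + h))"
      by (rule integrable_indicator_cball_mult[OF _ Db']) measurable
    have i2: "integrable lborel (\<lambda>z. ?I z * ?D z)" "integrable lborel (\<lambda>z. ?J z * ?D z)"
      by (rule integrable_indicator_cball_mult[OF _ Db], measurable)+
    have i3: "integrable lborel (\<lambda>z. ?I z * (e / (3 * (m + 1))))" by (rule integrable_indicator_cball)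
    have gb: "\<bar>\<bar>g (z + h) - g z\<bar>\<bar> \<le> 2 * C" for z using C[of z] C[of "z + h"] by linarith
    have i4: "integrable lborel (\<lambda>z. indicator (cball 0 R) z * \<bar>g (z + h) - g z\<bar>)"
      by (rule integrable_indicator_cball_mult[OF _ gb]) measurable
    have i5: "integrable lborel (\<lambda>z. ?J (z + h) * ?D (z + h))"
    proof -
      have "integrable lborel (\<lambda>z. indicator (cball 0 (R + 2)) z * (?J (z + h) * ?D (z + h)))"
        by (rule integrable_indicator_cball_mult[of _ "2 * C"]) (use Db' C0 in \<open>auto simp: indicator_def\<close>)
      moreover have "(\<lambda>z. indicator (cball 0 (R + 2)) z * (?J (z + h) * ?D (z + h))) = (\<lambda>z. ?J (z + h) * ?D (z + h))"
      proof (rule ext)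
        fix z
        have "z \<in> cball 0 (R + 2)" if "z + h \<in> cball 0 (R + 1)"
          using that h norm_triangle_ineq4[of "z + h" h] by simp
        then show "indicator (cball 0 (R + 2)) z * (?J (z + h) * ?D (z + h)) = ?J (z + h) * ?D (z + h)"
          by (auto simp: indicator_def)
      qed
      ultimately show ?thesis by simp
    qed
    have a: "(LINT z|lborel. ?I z * ?D (z + h)) < e / 3"
    proof -
      have "(LINT z|lborel. ?I z * ?D (z + h)) \<le> (LINT z|lborel. ?J (z + h) * ?D (z + h))"
        by (rule integral_mono[OF i1 i5]) (use sub in \<open>auto simp: indicator_def\<close>)
      also have "\<dots> = (LINT z|lborel. ?J z * ?D z)"
        using integral_lborel_shift[of "\<lambda>z. ?J z * ?D z" h] by simp
      finally show ?thesis using k by simp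
    qed
    have b: "(LINT z|lborel. ?I z * ?D z) < e / 3"
    proof -
      have "(LINT z|lborel. ?I z * ?D z) \<le> (LINT z|lborel. ?J z * ?D z)"
        by (rule integral_mono[OF i2]) (auto simp: indicator_def)
      then show ?thesis using k by simp
    qed
    have c: "(LINT z|lborel. ?I z * (e / (3 * (m + 1)))) \<le> e / 3"
    proof -
      have "(LINT z|lborel. ?I z * (e / (3 * (m + 1)))) = m * (e / (3 * (m + 1)))" by (simp add: m_def)
      also have "\<dots> \<le> e / 3" using e m by (simp add: field_simps)
      finally show ?thesis .
    qed
    have "(LINT z|lborel. indicator (cball 0 R) z * \<bar>g (z + h) - g z\<bar>)
        \<le> (LINT z|lborel. ?I z * ?D (z + h) + ?I z * (e / (3 * (m + 1))) + ?I z * ?D z)"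
      by (rule integral_mono[OF i4 _ dom]) (intro Bochner_Integration.integrable_add i1 i2 i3)
    also have "\<dots> = (LINT z|lborel. ?I z * ?D (z + h)) + (LINT z|lborel. ?I z * (e / (3 * (m + 1)))) + (LINT z|lborel. ?I z * ?D z)"
      by (simp only: Bochner_Integration.integral_add[OF Bochner_Integration.integrable_add[OF i1 i3] i2(1)]
          Bochner_Integration.integral_add[OF i1 i3])
    also have "\<dots> \<le> e" using a b c by linarith
    finally show "(LINT z|lborel. indicator (cball 0 R) z * \<bar>g (z + h) - g z\<bar>) \<le> e" .
  qed
qed

text \<open>Wide enough for the smooth \<open>ker\<close> as well as for the normalised indicator of
  \<open>[0,\<eta>]\<close>, which occurs in \<open>AE_bound_of_short_averages\<close>.\<close>

definition averaging_kernel :: "real \<Rightarrow> (real \<Rightarrow> real) \<Rightarrow> bool" where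
  "averaging_kernel \<eta> k \<longleftrightarrow> integrable lborel k \<and> (\<forall>s. 0 \<le> k s) \<and> integral\<^sup>L lborel k = 1 \<and>
     (\<forall>s. k s \<noteq> 0 \<longrightarrow> 0 \<le> s \<and> s \<le> \<eta>)"

lemma averaging_kernel_ker: "0 < \<eta> \<Longrightarrow> averaging_kernel \<eta> (ker \<eta>)"
  unfolding averaging_kernel_def
  using ker_integrable[of \<eta> 0] ker_nonneg[of \<eta>] ker_integral[of \<eta> 0] ker_nonzeroD[of \<eta>]
  by (auto intro: less_imp_le)

text \<open>An average is a superposition of translations, so Fubini reduces the claim to
  \<open>L1_translation_continuous\<close>; the threshold \<open>d\<close> is the same for all
  kernels. The direction \<open>u\<close> makes it possible to average in \<open>x\<close> alone on
  the plane.\<close>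

lemma L1_averages_close:
  fixes g :: "'a::euclidean_space \<Rightarrow> real" and u :: 'a
  assumes g [measurable]: "g \<in> borel_measurable borel" and C: "\<And>z. \<bar>g z\<bar> \<le> C" and e: "0 < e" and u: "norm u \<le> 1"
  obtains d where "0 < d"
    "\<And>k \<eta>. 0 < \<eta> \<Longrightarrow> \<eta> < d \<Longrightarrow> averaging_kernel \<eta> k \<Longrightarrow>
      integrable lborel (\<lambda>z. indicator (cball 0 R) z * \<bar>(LINT s|lborel. g (z + s *\<^sub>R u) * k s) - g z\<bar>) \<and>
      (LINT z|lborel. indicator (cball 0 R) z * \<bar>(LINT s|lborel. g (z + s *\<^sub>R u) * k s) - g z\<bar>) \<le> e"
proof -
  obtain d where d: "0 < d" "\<And>h. norm h < d \<Longrightarrow> (LINT z|lborel. indicator (cball 0 R) z * \<bar>g (z + h) - g z\<bar>) \<le> e"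
    using L1_translation_continuous[OF g C e] by blast
  have C0: "0 \<le> C" using C[of 0] by linarith
  show thesis
  proof (rule that[OF d(1)])
    fix k :: "real \<Rightarrow> real" and \<eta> :: real
    assume \<eta>: "0 < \<eta>" "\<eta> < d" and ak: "averaging_kernel \<eta> k"
    have ki: "integrable lborel k" and kp: "\<And>s. 0 \<le> k s" and k1: "integral\<^sup>L lborel k = 1"
      and ks: "\<And>s. k s \<noteq> 0 \<Longrightarrow> 0 \<le> s \<and> s \<le> \<eta>"
      using ak unfolding averaging_kernel_def by auto
    have [measurable]: "k \<in> borel_measurable borel" using ki by auto
    let ?I = "indicator (cball 0 R) :: 'a \<Rightarrow> real"
    let ?H = "\<lambda>(z, s). ?I z * \<bar>g (z + s *\<^sub>R u) - g z\<bar> * k s"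
    have gb: "\<bar>g (z + h) - g z\<bar> \<le> 2 * C" for z h using C[of z] C[of "z + h"] by linarith
    have Hm: "?H \<in> borel_measurable (lborel \<Otimes>\<^sub>M lborel)" by measurable
    have i0: "integrable (lborel \<Otimes>\<^sub>M lborel) (\<lambda>(z, s). (?I z * (2 * C)) * k s)"
    proof (rule lborel_pair.Fubini_integrable)
      show "integrable lborel (\<lambda>z :: 'a. LINT s|lborel. norm (case (z, s) of (z, s) \<Rightarrow> (?I z * (2 * C)) * k s))"
      proof -
        have "(LINT s|lborel. norm (case (z, s) of (z, s) \<Rightarrow> (?I z * (2 * C)) * k s)) = ?I z * (2 * C)" for z
          using kp k1 C0 by (simp add: abs_mult)
        then show ?thesis using integrable_indicator_cball[of 0 R "2 * C"] by simp
      qed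
      show "AE z in lborel. integrable lborel (\<lambda>s. case (z :: 'a, s) of (z, s) \<Rightarrow> (?I z * (2 * C)) * k s)"
        using ki by (intro AE_I2) simp
    qed measurable
    have iH: "integrable (lborel \<Otimes>\<^sub>M lborel) ?H"
    proof (rule Bochner_Integration.integrable_bound[OF i0 Hm])
      have "\<bar>?I z * \<bar>g (z + s *\<^sub>R u) - g z\<bar> * k s\<bar> \<le> \<bar>(?I z * (2 * C)) * k s\<bar>" for z s
        unfolding abs_mult using gb[of z "s *\<^sub>R u"] C0 by (intro mult_right_mono mult_left_mono) auto
      then show "AE p in lborel \<Otimes>\<^sub>M lborel. norm (?H p) \<le> norm (case p of (z, s) \<Rightarrow> (?I z * (2 * C)) * k s)"
        by (intro AE_I2) (auto simp: case_prod_beta')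
    qed
    have gk: "integrable lborel (\<lambda>s. g (z + s *\<^sub>R u) * k s)" for z
      by (rule integrable_bounded_mult[OF ki]) (use C in auto)
    have gk': "integrable lborel (\<lambda>s. \<bar>g (z + s *\<^sub>R u) - g z\<bar> * k s)" for z
      by (rule integrable_bounded_mult[OF ki, where C = "2 * C"]) (use gb in auto)
    have pt: "\<bar>(LINT s|lborel. g (z + s *\<^sub>R u) * k s) - g z\<bar> \<le> (LINT s|lborel. \<bar>g (z + s *\<^sub>R u) - g z\<bar> * k s)" for z
    proof -
      have "(LINT s|lborel. g (z + s *\<^sub>R u) * k s) - g z = (LINT s|lborel. g (z + s *\<^sub>R u) * k s) - (LINT s|lborel. g z * k s)"
        using k1 by simp
      also have "\<dots> = (LINT s|lborel. g (z + s *\<^sub>R u) * k s - g z * k s)"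
        by (rule Bochner_Integration.integral_diff[symmetric]) (use gk ki in auto)
      finally have eq: "(LINT s|lborel. g (z + s *\<^sub>R u) * k s) - g z = \<dots>" .
      have igk: "integrable lborel (\<lambda>s. g (z + s *\<^sub>R u) * k s - g z * k s)" using gk ki by simp
      have "norm (LINT s|lborel. g (z + s *\<^sub>R u) * k s - g z * k s) \<le> (LINT s|lborel. \<bar>g (z + s *\<^sub>R u) - g z\<bar> * k s)"
        by (rule Bochner_Integration.integral_norm_bound_integral[OF igk gk'])
           (use kp in \<open>auto simp: left_diff_distrib[symmetric] abs_mult\<close>)
      then show ?thesis unfolding eq by simp
    qed
    have iI: "integrable lborel (\<lambda>z. LINT s|lborel. ?H (z, s))"
      using lborel_pair.integrable_fst'[OF iH] .
    have He: "(LINT s|lborel. ?H (z, s)) = ?I z * (LINT s|lborel. \<bar>g (z + s *\<^sub>R u) - g z\<bar> * k s)" for z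
      by (simp add: mult.assoc)
    have le: "norm (?I z * \<bar>(LINT s|lborel. g (z + s *\<^sub>R u) * k s) - g z\<bar>) \<le> (LINT s|lborel. ?H (z, s))" for z
      unfolding He using pt[of z] by (simp add: abs_mult mult_left_mono)
    have iA: "integrable lborel (\<lambda>z. ?I z * \<bar>(LINT s|lborel. g (z + s *\<^sub>R u) * k s) - g z\<bar>)"
    proof (rule Bochner_Integration.integrable_bound[OF iI])
      show "AE z in lborel. norm (?I z * \<bar>(LINT s|lborel. g (z + s *\<^sub>R u) * k s) - g z\<bar>) \<le> norm (LINT s|lborel. ?H (z, s))"
        by (intro AE_I2 order_trans[OF le]) simp
    qed measurable
    have "(LINT z|lborel. ?I z * \<bar>(LINT s|lborel. g (z + s *\<^sub>R u) * k s) - g z\<bar>) \<le> (LINT z|lborel. LINT s|lborel. ?H (z, s))"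
      by (rule integral_mono[OF iA iI]) (use le in auto)
    also have "\<dots> = (LINT s|lborel. LINT z|lborel. ?H (z, s))"
    proof -
      have "integrable (lborel \<Otimes>\<^sub>M lborel) (case_prod (\<lambda>z s. ?H (z, s)))"
        using iH by (simp add: case_prod_beta')
      from lborel_pair.Fubini_integral[OF this] show ?thesis by simp
    qed
    also have "\<dots> \<le> (LINT s|lborel. e * k s)"
    proof (rule integral_mono')
      show "integrable lborel (\<lambda>s. e * k s)" using ki by simp
      fix s
      show "0 \<le> e * k s" using e kp by simp
      show "(LINT z|lborel. ?H (z, s)) \<le> e * k s"
      proof (cases "k s = 0")
        case False
        have "norm (s *\<^sub>R u) \<le> \<eta> * 1"
          unfolding norm_scaleR using ks[OF False] u by (intro mult_mono) auto
        then have "(LINT z|lborel. indicator (cball 0 R) z * \<bar>g (z + s *\<^sub>R u) - g z\<bar>) \<le> e"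
          using \<eta> by (intro d(2)) auto
        then show ?thesis using kp[of s] by (simp add: mult_right_mono)
      qed simp
    qed
    also have "\<dots> = e" using k1 by simp
    finally show "integrable lborel (\<lambda>z. ?I z * \<bar>(LINT s|lborel. g (z + s *\<^sub>R u) * k s) - g z\<bar>) \<and>
      (LINT z|lborel. ?I z * \<bar>(LINT s|lborel. g (z + s *\<^sub>R u) * k s) - g z\<bar>) \<le> e"
      using iA by simp
  qed
qed

context entropy_flow
begin

lemma AE_plane_slice: "AE z in (lborel :: (real \<times> real) measure). 0 < fst z \<longrightarrow> w (fst z) = (\<lambda>y. v (fst z, y))"
proof -
  obtain N where N: "N \<in> null_sets lborel" "{t \<in> space lborel. \<not> (0 < t \<longrightarrow> w t = (\<lambda>x. v (t, x)))} \<subseteq> N"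
    using w_eq_v unfolding eventually_ae_filter by blast
  have [measurable]: "N \<in> sets borel" using N by auto
  have "AE t in lborel. t \<notin> N" by (rule AE_not_in[OF N(1)])
  then have "AE t in lborel. AE x in lborel :: real measure. fst (t, x) \<notin> N"
    by eventually_elim simp
  then have "AE z in lborel \<Otimes>\<^sub>M (lborel :: real measure). fst z \<notin> N"
    by (rule lborel_pair.AE_pair_measure[rotated]) measurable
  then have "AE z in (lborel :: (real \<times> real) measure). fst z \<notin> N" by (simp only: lborel_prod)
  then show ?thesis by eventually_elim (use N in auto)
qed

lemma slice_avg_eq_translate:
  assumes \<eta>: "0 < \<eta>" and [measurable]: "G \<in> borel_measurable borel"
    and e: "w t = (\<lambda>y. v (t, y))"
  shows "slice_avg G \<eta> t x = (LINT s|lborel. G (v ((t, x) + s *\<^sub>R (0, 1))) * ker \<eta> s)"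
proof -
  have "(LINT y|lborel. G (w t y) * ker \<eta> (y - x)) = (LINT s|lborel. G (w t (s + x)) * ker \<eta> (s + x - x))"
    by (rule integral_lborel_shift[symmetric]) measurable
  then show ?thesis by (simp add: slice_avg_def e add.commute)
qed

text \<open>This is \<open>L1_averages_close\<close> in the direction \<open>(0, 1)\<close>, once
  for \<open>f (v z)\<close> and once for \<open>v z\<close>; \<open>AE_plane_slice\<close> replaces
  the slices \<open>w\<close> by those of \<open>v\<close>.\<close>

lemma slice_avg_close:
  assumes e: "0 < e"
  obtains d where "0 < d" "\<And>\<eta>. 0 < \<eta> \<Longrightarrow> \<eta> < d \<Longrightarrow>
     (LINT z|lborel. indicator (cball 0 R \<inter> {z. 0 < fst z}) z *
        (\<bar>slice_avg f \<eta> (fst z) (snd z) - f (v z)\<bar> + \<bar>slice_avg (\<lambda>x. x) \<eta> (fst z) (snd z) - v z\<bar>)) \<le> e"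
proof -
  obtain \<Lambda> F where "0 \<le> \<Lambda>" and "0 \<le> F"
    and "\<And>x y. \<bar>x\<bar> \<le> B \<Longrightarrow> \<bar>y\<bar> \<le> B \<Longrightarrow> \<bar>f x - f y\<bar> \<le> \<Lambda> * \<bar>x - y\<bar>"
    and "\<And>x. \<bar>x\<bar> \<le> B \<Longrightarrow> \<bar>f x\<bar> \<le> F"
    by (rule f_bounds) (rule that; blast)
  note F = this(4)
  let ?I = "indicator (cball 0 R) :: real \<times> real \<Rightarrow> real"
  let ?D = "cball 0 R \<inter> {z :: real \<times> real. 0 < fst z}"
  let ?a = "\<lambda>G \<eta> z. LINT s|lborel. G (v (z + s *\<^sub>R (0, 1))) * ker \<eta> s"
  have fm: "(\<lambda>z. f (v z)) \<in> borel_measurable borel" by measurable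
  have fb: "\<bar>f (v z)\<bar> \<le> F" for z by (rule F[OF v_bound])
  have e2: "0 < e / 2" using e by simp
  have n1: "norm (0 :: real, 1 :: real) \<le> 1" by (simp add: norm_Pair)
  obtain d1 where d1: "0 < d1" and D1: "\<And>k \<eta>. 0 < \<eta> \<Longrightarrow> \<eta> < d1 \<Longrightarrow> averaging_kernel \<eta> k \<Longrightarrow>
      integrable lborel (\<lambda>z. ?I z * \<bar>(LINT s|lborel. f (v (z + s *\<^sub>R (0, 1))) * k s) - f (v z)\<bar>) \<and>
      (LINT z|lborel. ?I z * \<bar>(LINT s|lborel. f (v (z + s *\<^sub>R (0, 1))) * k s) - f (v z)\<bar>) \<le> e / 2"
    by (rule L1_averages_close[OF fm fb e2 n1, where R = R]) (rule that; blast)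
  obtain d2 where d2: "0 < d2" and D2: "\<And>k \<eta>. 0 < \<eta> \<Longrightarrow> \<eta> < d2 \<Longrightarrow> averaging_kernel \<eta> k \<Longrightarrow>
      integrable lborel (\<lambda>z. ?I z * \<bar>(LINT s|lborel. v (z + s *\<^sub>R (0, 1)) * k s) - v z\<bar>) \<and>
      (LINT z|lborel. ?I z * \<bar>(LINT s|lborel. v (z + s *\<^sub>R (0, 1)) * k s) - v z\<bar>) \<le> e / 2"
    by (rule L1_averages_close[OF v_measurable v_bound e2 n1, where R = R]) (rule that; blast)
  show thesis
  proof (rule that[of "min d1 d2"])
    show "0 < min d1 d2" using d1 d2 by simp
    fix \<eta> :: real assume \<eta>: "0 < \<eta>" "\<eta> < min d1 d2"
    note k = averaging_kernel_ker[OF \<eta>(1)]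
    note E1 = D1[OF \<eta>(1) _ k] and E2 = D2[OF \<eta>(1) _ k]
    let ?A = "\<lambda>z. ?I z * \<bar>?a f \<eta> z - f (v z)\<bar>" and ?B = "\<lambda>z. ?I z * \<bar>?a (\<lambda>x. x) \<eta> z - v z\<bar>"
    have i: "integrable lborel ?A" "integrable lborel ?B" and l: "integral\<^sup>L lborel ?A \<le> e / 2" "integral\<^sup>L lborel ?B \<le> e / 2"
      using E1 E2 \<eta> by auto
    have "(LINT z|lborel. indicator ?D z * (\<bar>slice_avg f \<eta> (fst z) (snd z) - f (v z)\<bar> + \<bar>slice_avg (\<lambda>x. x) \<eta> (fst z) (snd z) - v z\<bar>))
        \<le> (LINT z|lborel. ?A z + ?B z)"
    proof (rule integral_mono_AE')
      show "integrable lborel (\<lambda>z. ?A z + ?B z)" using i by (rule Bochner_Integration.integrable_add)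
      show "AE z in lborel. indicator ?D z * (\<bar>slice_avg f \<eta> (fst z) (snd z) - f (v z)\<bar> + \<bar>slice_avg (\<lambda>x. x) \<eta> (fst z) (snd z) - v z\<bar>) \<le> ?A z + ?B z"
        using AE_plane_slice
      proof eventually_elim
        case (elim z)
        show ?case
        proof (cases "z \<in> ?D")
          case True
          then have "w (fst z) = (\<lambda>y. v (fst z, y))" using elim by auto
          then have "slice_avg f \<eta> (fst z) (snd z) = ?a f \<eta> z" "slice_avg (\<lambda>x. x) \<eta> (fst z) (snd z) = ?a (\<lambda>x. x) \<eta> z"
            using slice_avg_eq_translate[OF \<eta>(1), of _ "fst z" "snd z"] by auto
          then show ?thesis using True by simp
        qed simp
      qed
    qed simp
    also have "\<dots> = integral\<^sup>L lborel ?A + integral\<^sup>L lborel ?B" using i by (rule Bochner_Integration.integral_add)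
    also have "\<dots> \<le> e" using l by simp
    finally show "(LINT z|lborel. indicator ?D z * (\<bar>slice_avg f \<eta> (fst z) (snd z) - f (v z)\<bar> + \<bar>slice_avg (\<lambda>x. x) \<eta> (fst z) (snd z) - v z\<bar>)) \<le> e" .
  qed
qed

end

section \<open>The supersolution property\<close>

context entropy_flow
begin

definition slice_avg_error :: "real \<Rightarrow> real \<times> real \<Rightarrow> real" where
  "slice_avg_error \<eta> z = \<bar>slice_avg f \<eta> (fst z) (snd z) - f (v z)\<bar> + \<bar>slice_avg (\<lambda>x. x) \<eta> (fst z) (snd z) - v z\<bar>"

text \<open>Continuity of the averages is available at nonnegative times; the indicator restricts to
  a region where it yields measurability.\<close>

lemma slice_avg_error_integrable:
  assumes \<eta>: "0 < \<eta>"
  shows "integrable lborel (\<lambda>z. indicator (cball 0 R \<inter> {z. 0 < fst z}) z * slice_avg_error \<eta> z)"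
proof -
  let ?D = "cball 0 R \<inter> {z :: real \<times> real. 0 < fst z}"
  obtain \<Lambda> F where "0 \<le> \<Lambda>" and "0 \<le> F"
    and "\<And>x y. \<bar>x\<bar> \<le> B \<Longrightarrow> \<bar>y\<bar> \<le> B \<Longrightarrow> \<bar>f x - f y\<bar> \<le> \<Lambda> * \<bar>x - y\<bar>"
    and "\<And>x. \<bar>x\<bar> \<le> B \<Longrightarrow> \<bar>f x\<bar> \<le> F"
    by (rule f_bounds) (rule that; blast)
  note F = this(2,4)
  have D [measurable]: "?D \<in> sets borel" by measurable
  have sub: "?D \<subseteq> {0..} \<times> UNIV" by (auto simp: mem_Times_iff)
  have m1: "(\<lambda>z. indicator ?D z *\<^sub>R slice_avg f \<eta> (fst z) (snd z)) \<in> borel_measurable borel"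
    by (rule borel_measurable_continuous_on_indicator[OF D continuous_on_subset[OF slice_avg_f(1)[OF \<eta>] sub]])
  have m2: "(\<lambda>z. indicator ?D z *\<^sub>R slice_avg (\<lambda>x. x) \<eta> (fst z) (snd z)) \<in> borel_measurable borel"
    by (rule borel_measurable_continuous_on_indicator[OF D continuous_on_subset[OF slice_avg_id(1)[OF \<eta>] sub]])
  have eq: "indicator ?D z * slice_avg_error \<eta> z = \<bar>indicator ?D z *\<^sub>R slice_avg f \<eta> (fst z) (snd z) - indicator ?D z * f (v z)\<bar>
      + \<bar>indicator ?D z *\<^sub>R slice_avg (\<lambda>x. x) \<eta> (fst z) (snd z) - indicator ?D z * v z\<bar>" for z
    by (simp add: slice_avg_error_def indicator_def)
  have m: "(\<lambda>z. indicator ?D z * slice_avg_error \<eta> z) \<in> borel_measurable lborel"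
    unfolding eq using m1 m2 by simp
  have b: "0 \<le> slice_avg_error \<eta> z" "slice_avg_error \<eta> z \<le> 2 * F + 2 * B" for z
    using slice_avg_bound[OF \<eta> f_measurable F(2), of "fst z" "snd z"] slice_avg_id(2)[OF \<eta>, of "fst z" "snd z"]
      F(2)[OF v_bound[of z]] v_bound[of z] by (auto simp: slice_avg_error_def)
  show ?thesis
  proof (rule Bochner_Integration.integrable_bound[OF integrable_indicator_cball[of 0 R "2 * F + 2 * B"] m])
    show "AE z in lborel. norm (indicator ?D z * slice_avg_error \<eta> z) \<le> norm (indicator (cball 0 R) z * (2 * F + 2 * B))"
    proof (rule AE_I2)
      fix z :: "real \<times> real"
      show "norm (indicator ?D z * slice_avg_error \<eta> z) \<le> norm (indicator (cball 0 R) z * (2 * F + 2 * B))"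
        using b[of z] by (auto simp: indicator_def)
    qed
  qed
qed

lemma slice_avg_error_nonneg: "0 \<le> slice_avg_error \<eta> z"
  by (simp add: slice_avg_error_def)

end

context integrable_entropy_flow
begin

text \<open>
  Otherwise, with \<open>k = \<phi>x z0\<close>, use \<open>\<psi> = (m + \<delta> - (potential - \<phi>))\<^sub>+\<^sup>2\<close> as a test function, \<open>\<phi>\<close> being made
  strict by a quadratic term. Since \<open>\<nabla>potential = (- f(u), u)\<close>, the leading terms \<open>\<bar>u - k\<bar> (f(u) - f(k))\<close> of
  Kruzhkov's inequality cancel as in the div-curl lemma. The remainder forces \<open>u = k\<close> on the
  support of \<open>\<psi>\<close>, where then \<open>\<partial>\<^sub>t \<psi> < 0\<close>, which contradicts \<open>\<integral> \<partial>\<^sub>t \<psi> = 0\<close>. The gradient of \<open>potential\<close> is only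
  available after mollification, whence the error term \<open>slice_avg_error\<close>.
\<close>

lemma potential_supersolution:
  fixes \<phi> \<phi>t \<phi>x :: "real \<times> real \<Rightarrow> real"
  assumes r: "0 < r" and z0: "0 < fst z0"
    and D: "\<And>z. z \<in> ball z0 r \<Longrightarrow> (\<phi> has_derivative (\<lambda>h. fst h * \<phi>t z + snd h * \<phi>x z)) (at z)"
    and ct: "continuous_on (ball z0 r) \<phi>t" and cx: "continuous_on (ball z0 r) \<phi>x"
    and min: "\<And>z. z \<in> ball z0 r \<Longrightarrow> potential (fst z0) (snd z0) - \<phi> z0 \<le> potential (fst z) (snd z) - \<phi> z"
  shows "0 \<le> \<phi>t z0 + f (\<phi>x z0)"
proof (rule ccontr)
  assume neg: "\<not> 0 \<le> \<phi>t z0 + f (\<phi>x z0)"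
  define k where "k = \<phi>x z0"
  \<comment> \<open>A quarter of the defect, so that \<open>\<phi>t z0 + f k = - 4 * e\<close>: half
    of this is spent on the variation of \<open>\<phi>t\<close>, another quarter on that of
    \<open>\<phi>x\<close>.\<close>
  define e where "e = - (\<phi>t z0 + f k) / 4"
  have e: "0 < e" using neg by (simp add: e_def k_def)
  obtain \<Lambda> where \<Lambda>: "0 \<le> \<Lambda>" "\<And>x y. \<bar>x\<bar> \<le> max B \<bar>k\<bar> \<Longrightarrow> \<bar>y\<bar> \<le> max B \<bar>k\<bar> \<Longrightarrow> \<bar>f x - f y\<bar> \<le> \<Lambda> * \<bar>x - y\<bar>"
    using lipschitz_const by blast
  have \<Lambda>v: "\<bar>f (v z) - f k\<bar> \<le> \<Lambda> * \<bar>v z - k\<bar>" for z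
    by (rule \<Lambda>(2)) (use v_bound[of z] in auto)
  define \<phi>' where "\<phi>' z = \<phi> z - ((fst z - fst z0)\<^sup>2 + (snd z - snd z0)\<^sup>2)" for z
  define \<phi>t' where "\<phi>t' z = \<phi>t z - 2 * (fst z - fst z0)" for z
  define \<phi>x' where "\<phi>x' z = \<phi>x z - 2 * (snd z - snd z0)" for z
  have sq: "(fst z - fst z0)\<^sup>2 + (snd z - snd z0)\<^sup>2 = (dist z z0)\<^sup>2" for z
    by (simp add: dist_prod_def dist_real_def)
  have D': "(\<phi>' has_derivative (\<lambda>h. fst h * \<phi>t' z + snd h * \<phi>x' z)) (at z)" if "z \<in> ball z0 r" for z
  proof -
    have "(\<phi>' has_derivative (\<lambda>h. (fst h * \<phi>t z + snd h * \<phi>x z) - (2 * (fst h * (fst z - fst z0)) + 2 * (snd h * (snd z - snd z0))))) (at z)"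
      unfolding \<phi>'_def by (auto intro!: derivative_eq_intros D[OF that])
    then show ?thesis
      by (rule has_derivative_eq_rhs) (auto simp: \<phi>t'_def \<phi>x'_def fun_eq_iff algebra_simps)
  qed
  have ct': "continuous_on (ball z0 r) \<phi>t'" and cx': "continuous_on (ball z0 r) \<phi>x'"
    unfolding \<phi>t'_def \<phi>x'_def by (intro continuous_intros ct cx)+
  obtain r1 where r1: "0 < r1" "r1 < r" "r1 < fst z0"
    and near: "\<And>z. z \<in> ball z0 r1 \<Longrightarrow> f k + \<phi>t' z \<le> - 2 * e" "\<And>z. z \<in> ball z0 r1 \<Longrightarrow> \<Lambda> * \<bar>\<phi>x' z - k\<bar> \<le> e"
  proof -
    have z0b: "z0 \<in> ball z0 r" using r by simp
    have pos: "0 < 2 * e" "0 < e / (\<Lambda> + 1)" using e \<Lambda>(1) by auto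
    from ct'[unfolded continuous_on_iff, rule_format, OF z0b pos(1)]
    obtain d1 where d1: "d1 > 0" "\<And>z. z \<in> ball z0 r \<Longrightarrow> dist z z0 < d1 \<Longrightarrow> dist (\<phi>t' z) (\<phi>t' z0) < 2 * e"
      by blast
    from cx'[unfolded continuous_on_iff, rule_format, OF z0b pos(2)]
    obtain d2 where d2: "d2 > 0" "\<And>z. z \<in> ball z0 r \<Longrightarrow> dist z z0 < d2 \<Longrightarrow> dist (\<phi>x' z) (\<phi>x' z0) < e / (\<Lambda> + 1)"
      by blast
    define r1 where "r1 = min (min d1 d2) (min r (fst z0)) / 2"
    show thesis
    proof (rule that[of r1])
      show "0 < r1" "r1 < r" "r1 < fst z0" using d1 d2 r z0 by (auto simp: r1_def)
      fix z assume z: "z \<in> ball z0 r1"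
      have rr: "r1 \<le> d1 \<and> r1 \<le> d2 \<and> r1 \<le> r"
        using d1(1) d2(1) r z0 by (auto simp: r1_def min_def)
      then have zz: "z \<in> ball z0 r" "dist z z0 < d1" "dist z z0 < d2"
        using z by (auto simp: dist_commute)
      have "\<phi>t' z0 = \<phi>t z0" "\<phi>x' z0 = k" by (auto simp: \<phi>t'_def \<phi>x'_def k_def)
      then have "\<bar>\<phi>t' z - \<phi>t z0\<bar> < 2 * e" and x: "\<bar>\<phi>x' z - k\<bar> < e / (\<Lambda> + 1)"
        using d1(2)[OF zz(1,2)] d2(2)[OF zz(1,3)] by (auto simp: dist_real_def)
      moreover have "\<phi>t z0 + f k = - 4 * e" by (simp add: e_def)
      ultimately show "f k + \<phi>t' z \<le> - 2 * e" by linarith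
      have "\<Lambda> * \<bar>\<phi>x' z - k\<bar> \<le> (\<Lambda> + 1) * (e / (\<Lambda> + 1))"
        using x \<Lambda>(1) by (intro mult_mono) auto
      also have "\<dots> = e" using \<Lambda>(1) by simp
      finally show "\<Lambda> * \<bar>\<phi>x' z - k\<bar> \<le> e" .
    qed
  qed
  let ?u = "\<lambda>z :: real \<times> real. potential (fst z) (snd z)"
  define m where "m = ?u z0 - \<phi> z0"
  \<comment> \<open>Chosen so that the bound \<open>5 / 4 * \<delta> - (dist z z0)\<^sup>2\<close>
    below is negative from distance \<open>7 / 8 * r1\<close> on, because 5/8 < 49/64. The extra
    quarter of \<open>\<delta>\<close> is reserved for mollifying the potential.\<close>
  define \<delta> where "\<delta> = r1\<^sup>2 / 2"
  have \<delta>: "0 < \<delta>" using r1 by (simp add: \<delta>_def)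
  let ?O = "ball z0 r1"
  have Or: "z \<in> ball z0 r" if "z \<in> ?O" for z using that r1 by auto
  have Opos: "0 < fst z" if "z \<in> ?O" for z
  proof -
    have "\<bar>fst z - fst z0\<bar> \<le> dist z z0" by (metis dist_fst_le dist_real_def)
    then show ?thesis using that r1 by (auto simp: dist_commute)
  qed
  have strict: "m + (dist z z0)\<^sup>2 \<le> ?u z - \<phi>' z" if "z \<in> ?O" for z
    using min[OF Or[OF that]] by (simp add: m_def \<phi>'_def sq)
  define R where "R = norm z0 + r1"
  let ?D = "cball 0 R \<inter> {z :: real \<times> real. 0 < fst z}"
  have OD: "z \<in> ?D" if "z \<in> ?O" for z
    using Opos[OF that] that norm_triangle_sub[of z z0] by (auto simp: R_def dist_norm norm_minus_commute)
  obtain r2 where r2: "0 < r2" "r2 \<le> r1" "\<And>z. z \<in> ball z0 r2 \<Longrightarrow> ?u z - \<phi>' z \<le> m + \<delta> / 4"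
  proof -
    have "continuous_on ?O \<phi>'"
      by (rule has_derivative_continuous_on[of _ _ "\<lambda>z h. fst h * \<phi>t' z + snd h * \<phi>x' z"])
         (use D' Or in \<open>auto intro: has_derivative_at_withinI\<close>)
    moreover have "continuous_on ?O ?u"
      by (rule continuous_on_subset[OF potential_continuous]) (use Opos in \<open>auto simp: mem_Times_iff less_imp_le\<close>)
    ultimately have c: "continuous_on ?O (\<lambda>z. ?u z - \<phi>' z)" by (intro continuous_intros)
    have zd: "z0 \<in> ?O" "0 < \<delta> / 4" using r1 \<delta> by auto
    from c[unfolded continuous_on_iff, rule_format, OF zd]
    obtain d where d: "d > 0"
      "\<And>z. z \<in> ?O \<Longrightarrow> dist z z0 < d \<Longrightarrow> dist (?u z - \<phi>' z) (?u z0 - \<phi>' z0) < \<delta> / 4"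
      by blast
    show thesis
    proof (rule that[of "min d r1"])
      fix z assume "z \<in> ball z0 (min d r1)"
      then have "dist (?u z - \<phi>' z) (?u z0 - \<phi>' z0) < \<delta> / 4" by (intro d(2)) (auto simp: dist_commute)
      moreover have "?u z0 - \<phi>' z0 = m" by (simp add: m_def \<phi>'_def)
      ultimately show "?u z - \<phi>' z \<le> m + \<delta> / 4" unfolding dist_real_def by linarith
    qed (use d r1 in auto)
  qed
  \<comment> \<open>A lower bound, independent of the scale \<open>\<eta>\<close>, for the integral
    of the truncated function \<open>G\<close> below.\<close>
  define c0 where "c0 = \<delta> / 2 * measure lborel (ball z0 r2)"
  have c0: "0 < c0"
    using \<delta> r2(1) content_ball_pos[of r2 z0] by (simp add: c0_def)
  define C1 where "C1 = (1 + \<Lambda>) * (B + \<bar>k\<bar>)"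
  have C1: "0 \<le> C1" using \<Lambda>(1) B_nonneg by (simp add: C1_def)
  \<comment> \<open>The total factor of the error integral: one part enters directly through
    \<open>I\<close>, the other through the bound \<open>J\<close> for the weighted distance of
    \<open>v\<close> from \<open>k\<close>.\<close>
  define K where "K = 4 * \<delta> + 2 * \<Lambda> * (2 * \<delta> * C1 / e)"
  have K: "0 \<le> K" using \<delta> \<Lambda>(1) C1 e by (simp add: K_def)
  \<comment> \<open>The left side is fixed and positive, whereas the error integral tends to 0 with
    \<open>\<eta>\<close>; this is where the contradiction comes from.\<close>
  have est: "4 * e * c0 \<le> K * (LINT z|lborel. indicator ?D z * slice_avg_error \<eta> z)"
    if \<eta>: "0 < \<eta>" and B\<eta>: "B * \<eta> \<le> \<delta> / 4" for \<eta>
  proof -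
    let ?p = "\<lambda>z :: real \<times> real. smoothed_potential \<eta> (fst z) (snd z)"
    let ?P = "\<lambda>z :: real \<times> real. slice_avg f \<eta> (fst z) (snd z)" and ?m = "\<lambda>z :: real \<times> real. slice_avg (\<lambda>x. x) \<eta> (fst z) (snd z)"
    let ?E = "slice_avg_error \<eta>"
    define s where "s z = m + \<delta> - ?p z + \<phi>' z" for z
    define g where "g z = max 0 (s z)" for z
    have pU: "\<bar>?u z - ?p z\<bar> \<le> \<delta> / 4" if "z \<in> ?O" for z
      using smoothed_potential_close[OF \<eta>, of "fst z" "snd z"] Opos[OF that] B\<eta> by simp
    have s_up: "s z \<le> 5 / 4 * \<delta> - (dist z z0)\<^sup>2" if "z \<in> ?O" for z
      using pU[OF that] strict[OF that] unfolding s_def by linarith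
    have g_up: "g z \<le> 2 * \<delta>" if "z \<in> ?O" for z
      using s_up[OF that] \<delta> zero_le_power2[of "dist z z0"] unfolding g_def by (intro max.boundedI) linarith+
    have g0: "0 \<le> g z" for z by (simp add: g_def)
    have g_van: "g z = 0" if "z \<in> ?O" "7 / 8 * r1 \<le> dist z z0" for z
    proof -
      have "(7 / 8 * r1)\<^sup>2 \<le> (dist z z0)\<^sup>2" using that r1 by (intro power_mono) auto
      then have "s z \<le> 5 / 4 * \<delta> - (7 / 8 * r1)\<^sup>2" using s_up[OF that(1)] by linarith
      also have "\<dots> \<le> 0" by (simp add: \<delta>_def power2_eq_square)
      finally show ?thesis by (simp add: g_def)
    qed
    define \<psi> where "\<psi> z = (if z \<in> ?O then (g z)\<^sup>2 else 0)" for z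
    define G where "G z = (if z \<in> ?O then g z else 0)" for z
    define \<psi>t where "\<psi>t z = 2 * G z * (?P z + \<phi>t' z)" for z
    define \<psi>x where "\<psi>x z = 2 * G z * (\<phi>x' z - ?m z)" for z
    \<comment> \<open>Together with the ball \<open>?O\<close> this open set covers the plane, and
      \<open>G\<close> vanishes on it; regularity of the truncated functions is checked on each of
      the two.\<close>
    let ?V = "- cball z0 (7 / 8 * r1)"
    have cover: "?O \<union> ?V = UNIV" using r1 by (auto simp: not_less)
    have GV: "G z = 0" if "z \<in> ?V" for z
      using that g_van[of z] by (cases "z \<in> ?O") (auto simp: G_def dist_commute)
    have \<psi>G: "\<psi> z = (G z)\<^sup>2" for z by (simp add: \<psi>_def G_def)
    have ds: "(s has_derivative (\<lambda>h. fst h * (?P z + \<phi>t' z) + snd h * (\<phi>x' z - ?m z))) (at z)" if "z \<in> ?O" for z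
    proof -
      have "(s has_derivative (\<lambda>h. (0 - (fst h * (- ?P z) + snd h * ?m z)) + (fst h * \<phi>t' z + snd h * \<phi>x' z))) (at z)"
        unfolding s_def
        by (intro has_derivative_add has_derivative_diff has_derivative_const smoothed_potential_has_derivative[OF \<eta> Opos[OF that]] D'[OF Or[OF that]])
      then show ?thesis by (rule has_derivative_eq_rhs) (auto simp: fun_eq_iff algebra_simps)
    qed
    have sc: "continuous_on ?O s"
      by (rule has_derivative_continuous_on[of _ _ "\<lambda>z h. fst h * (?P z + \<phi>t' z) + snd h * (\<phi>x' z - ?m z)"])
         (use ds in \<open>auto intro: has_derivative_at_withinI\<close>)
    have glue: "continuous_on UNIV (\<lambda>z. G z * h z)" if h: "continuous_on ?O h" for h
    proof -
      have "continuous_on ?O (\<lambda>z. g z * h z)" unfolding g_def by (intro continuous_intros sc h)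
      then have 1: "continuous_on ?O (\<lambda>z. G z * h z)"
        by (rule continuous_on_eq) (simp add: G_def)
      have 2: "continuous_on ?V (\<lambda>z. G z * h z)"
        by (rule continuous_on_eq[of _ "\<lambda>_. 0"]) (use GV in auto)
      have "continuous_on (?O \<union> ?V) (\<lambda>z. G z * h z)"
        by (rule continuous_on_open_Un[OF _ _ 1 2]) auto
      then show ?thesis by (simp only: cover)
    qed
    have subO: "?O \<subseteq> {0..} \<times> UNIV" using Opos by (auto simp: mem_Times_iff less_imp_le)
    have cP: "continuous_on ?O ?P" by (rule continuous_on_subset[OF slice_avg_f(1)[OF \<eta>] subO])
    have cm: "continuous_on ?O ?m" by (rule continuous_on_subset[OF slice_avg_id(1)[OF \<eta>] subO])
    have ctO: "continuous_on ?O \<phi>t'" "continuous_on ?O \<phi>x'"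
      using ct' cx' Or by (auto intro: continuous_on_subset)
    have c\<psi>t: "continuous_on UNIV \<psi>t" unfolding \<psi>t_def mult.assoc
      by (intro continuous_on_mult_left glue continuous_on_add cP ctO)
    have c\<psi>x: "continuous_on UNIV \<psi>x" unfolding \<psi>x_def mult.assoc
      by (intro continuous_on_mult_left glue continuous_on_diff cm ctO)
    have T: "C1_test \<psi> \<psi>t \<psi>x"
      unfolding C1_test_def
    proof (intro conjI allI c\<psi>t c\<psi>x)
      fix z
      show "0 \<le> \<psi> z" by (simp add: \<psi>_def)
      show "(\<psi> has_derivative (\<lambda>h. fst h * \<psi>t z + snd h * \<psi>x z)) (at z)"
      proof (cases "z \<in> ?O")
        case True
        have "((\<lambda>z. (max 0 (s z))\<^sup>2) has_derivative (\<lambda>h. (fst h * (?P z + \<phi>t' z) + snd h * (\<phi>x' z - ?m z)) * (2 * max 0 (s z)))) (at z)"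
          by (rule DERIV_compose_FDERIV[OF pos_part_square_has_derivative ds[OF True]])
        then have "(\<psi> has_derivative (\<lambda>h. (fst h * (?P z + \<phi>t' z) + snd h * (\<phi>x' z - ?m z)) * (2 * max 0 (s z)))) (at z)"
          by (rule has_derivative_transform_within_open[where s = ?O]) (use True in \<open>auto simp: \<psi>_def g_def\<close>)
        then show ?thesis
          by (rule has_derivative_eq_rhs) (use True in \<open>auto simp: \<psi>t_def \<psi>x_def G_def g_def fun_eq_iff algebra_simps\<close>)
      next
        case False
        then have zV: "z \<in> ?V" using cover by blast
        have "((\<lambda>z. 0) has_derivative (\<lambda>h. 0)) (at z)" by simp
        then have "(\<psi> has_derivative (\<lambda>h. 0)) (at z)"
          by (rule has_derivative_transform_within_open[where s = ?V]) (use zV GV in \<open>auto simp: \<psi>G\<close>)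
        then show ?thesis using GV[OF zV] by (simp add: \<psi>t_def \<psi>x_def)
      qed
    next
      show "\<exists>s>0. \<exists>R. \<forall>z. \<psi> z \<noteq> 0 \<longrightarrow> s \<le> fst z \<and> norm z \<le> R"
      proof (rule exI[of _ "fst z0 - r1"], rule conjI, use r1 in simp, rule exI[of _ R], intro allI impI)
        fix z assume "\<psi> z \<noteq> 0"
        then have z: "z \<in> ?O" by (auto simp: \<psi>_def split: if_splits)
        have "\<bar>fst z - fst z0\<bar> \<le> dist z z0" by (metis dist_fst_le dist_real_def)
        then show "fst z0 - r1 \<le> fst z \<and> norm z \<le> R" using z OD[OF z] by (auto simp: dist_commute)
      qed
    qed
    have Gc: "continuous_on UNIV G" using glue[of "\<lambda>_. 1"] by simp
    have Gi: "integrable lborel G"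
      by (rule continuous_vanishing_imp_integrable[OF Gc, of R]) (use OD in \<open>force simp: G_def\<close>)
    have vk: "\<bar>\<bar>v z - k\<bar>\<bar> \<le> B + \<bar>k\<bar>" for z using v_bound[of z] by linarith
    have Gv: "integrable lborel (\<lambda>z. \<bar>v z - k\<bar> * G z)"
      by (rule integrable_bounded_mult[OF Gi _ vk]) measurable
    have iE: "integrable lborel (\<lambda>z. indicator ?D z * ?E z)" by (rule slice_avg_error_integrable[OF \<eta>])
    have Gp: "0 \<le> G z" for z by (simp add: G_def g0)
    have GE: "G z * ?E z \<le> 2 * \<delta> * (indicator ?D z * ?E z)" for z
    proof (cases "z \<in> ?O")
      case True
      have "G z * ?E z \<le> 2 * \<delta> * ?E z" using g_up[OF True] True slice_avg_error_nonneg by (simp add: G_def mult_right_mono)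
      then show ?thesis using OD[OF True] by simp
    next
      case False
      then show ?thesis using \<delta> slice_avg_error_nonneg[of \<eta> z] by (simp add: G_def)
    qed
    have P_le: "\<bar>?P z - f (v z)\<bar> \<le> ?E z" for z
      by (auto simp: slice_avg_error_def)
    note i0 = C1_test_cont(4,5)[OF T]
    \<comment> \<open>First use of the test function, in Kruzhkov's inequality: with weight
      \<open>G\<close>, the values of \<open>v\<close> are close to \<open>k\<close> in the
      mean.\<close>
    have J: "2 * e * (LINT z|lborel. \<bar>v z - k\<bar> * G z) \<le> 4 * \<delta> * C1 * (LINT z|lborel. indicator ?D z * ?E z)"
    proof -
      let ?q = "\<lambda>z. sgn (v z - k) * (f (v z) - f k)"
      have qb: "\<bar>?q z\<bar> \<le> \<Lambda> * \<bar>v z - k\<bar>" for z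
      proof -
        have "\<bar>?q z\<bar> \<le> \<bar>f (v z) - f k\<bar>" by (auto simp: abs_mult sgn_real_def)
        then show ?thesis using \<Lambda>v[of z] by linarith
      qed
      have qb': "\<bar>?q z\<bar> \<le> C1" for z
      proof -
        have "\<Lambda> * \<bar>v z - k\<bar> \<le> (1 + \<Lambda>) * (B + \<bar>k\<bar>)" using vk[of z] \<Lambda>(1) B_nonneg by (intro mult_mono) auto
        then show ?thesis using qb[of z] by (simp add: C1_def)
      qed
      have vb': "\<bar>v z - k\<bar> \<le> C1" for z
      proof -
        have "1 * \<bar>v z - k\<bar> \<le> (1 + \<Lambda>) * (B + \<bar>k\<bar>)" using vk[of z] \<Lambda>(1) B_nonneg by (intro mult_mono) auto
        then show ?thesis by (simp add: C1_def)
      qed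
      have pt: "\<bar>v z - k\<bar> * \<psi>t z + ?q z * \<psi>x z \<le> 4 * \<delta> * C1 * (indicator ?D z * ?E z) - 2 * e * (\<bar>v z - k\<bar> * G z)" for z
      proof (cases "z \<in> ?O")
        case False
        then show ?thesis using \<delta> C1 slice_avg_error_nonneg[of \<eta> z] by (simp add: \<psi>t_def \<psi>x_def G_def)
      next
        case True
        \<comment> \<open>The cancellation: entropy flux times \<open>v - k\<close> equals entropy
          times flux difference. What is left consists of mollification errors and of multiples of
          \<open>\<bar>v z - k\<bar>\<close> whose sum has the factor \<open>- e\<close>.\<close>
        have qv: "?q z * (v z - k) = \<bar>v z - k\<bar> * (f (v z) - f k)" by (simp add: sgn_real_def abs_if)
        have "\<bar>v z - k\<bar> * (?P z + \<phi>t' z) + ?q z * (\<phi>x' z - ?m z)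
          = \<bar>v z - k\<bar> * (f k + \<phi>t' z) + ?q z * (\<phi>x' z - k) + \<bar>v z - k\<bar> * (?P z - f (v z)) + ?q z * (v z - ?m z)
            + (\<bar>v z - k\<bar> * (f (v z) - f k) - ?q z * (v z - k))"
          by (simp add: algebra_simps)
        also have "\<dots> = \<bar>v z - k\<bar> * (f k + \<phi>t' z) + ?q z * (\<phi>x' z - k) + \<bar>v z - k\<bar> * (?P z - f (v z)) + ?q z * (v z - ?m z)"
          unfolding qv by simp
        also have "\<dots> \<le> \<bar>v z - k\<bar> * (- 2 * e) + \<bar>v z - k\<bar> * e + C1 * \<bar>?P z - f (v z)\<bar> + C1 * \<bar>?m z - v z\<bar>"
        proof (intro add_mono)
          show "\<bar>v z - k\<bar> * (f k + \<phi>t' z) \<le> \<bar>v z - k\<bar> * (- 2 * e)"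
            using near(1)[OF True] by (intro mult_left_mono) auto
          have "?q z * (\<phi>x' z - k) \<le> \<bar>?q z\<bar> * \<bar>\<phi>x' z - k\<bar>" by (metis abs_ge_self abs_mult)
          also have "\<dots> \<le> (\<Lambda> * \<bar>v z - k\<bar>) * \<bar>\<phi>x' z - k\<bar>" using qb by (intro mult_right_mono) auto
          also have "\<dots> = \<bar>v z - k\<bar> * (\<Lambda> * \<bar>\<phi>x' z - k\<bar>)" by (simp add: mult_ac)
          also have "\<dots> \<le> \<bar>v z - k\<bar> * e" using near(2)[OF True] by (intro mult_left_mono) auto
          finally show "?q z * (\<phi>x' z - k) \<le> \<bar>v z - k\<bar> * e" .
          have "\<bar>v z - k\<bar> * (?P z - f (v z)) \<le> \<bar>v z - k\<bar> * \<bar>?P z - f (v z)\<bar>" by (intro mult_left_mono) auto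
          also have "\<dots> \<le> C1 * \<bar>?P z - f (v z)\<bar>" using vb' by (intro mult_right_mono) auto
          finally show "\<bar>v z - k\<bar> * (?P z - f (v z)) \<le> C1 * \<bar>?P z - f (v z)\<bar>" .
          have "?q z * (v z - ?m z) \<le> \<bar>?q z\<bar> * \<bar>v z - ?m z\<bar>" by (metis abs_ge_self abs_mult)
          also have "\<dots> \<le> C1 * \<bar>v z - ?m z\<bar>" using qb' by (intro mult_right_mono) auto
          finally show "?q z * (v z - ?m z) \<le> C1 * \<bar>?m z - v z\<bar>" by (simp add: abs_minus_commute)
        qed
        also have "\<dots> = C1 * ?E z - e * \<bar>v z - k\<bar>" by (simp add: slice_avg_error_def algebra_simps)
        finally have main: "\<bar>v z - k\<bar> * (?P z + \<phi>t' z) + ?q z * (\<phi>x' z - ?m z) \<le> C1 * ?E z - e * \<bar>v z - k\<bar>" .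
        have "\<bar>v z - k\<bar> * \<psi>t z + ?q z * \<psi>x z = 2 * G z * (\<bar>v z - k\<bar> * (?P z + \<phi>t' z) + ?q z * (\<phi>x' z - ?m z))"
          by (simp add: \<psi>t_def \<psi>x_def distrib_left mult_ac)
        also have "\<dots> \<le> 2 * G z * (C1 * ?E z - e * \<bar>v z - k\<bar>)"
          using Gp by (intro mult_left_mono[OF main]) simp
        also have "\<dots> = 2 * C1 * (G z * ?E z) - 2 * e * (\<bar>v z - k\<bar> * G z)" by (simp add: algebra_simps)
        also have "\<dots> \<le> 2 * C1 * (2 * \<delta> * (indicator ?D z * ?E z)) - 2 * e * (\<bar>v z - k\<bar> * G z)"
          using GE[of z] C1 by (intro diff_right_mono mult_left_mono) auto
        finally show ?thesis by (simp add: mult_ac)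
      qed
      have iq: "integrable lborel (\<lambda>z. \<bar>v z - k\<bar> * \<psi>t z)" "integrable lborel (\<lambda>z. ?q z * \<psi>x z)"
        by (rule integrable_C1_test_mult(1)[OF T _ vk] integrable_C1_test_mult(2)[OF T _ qb']; measurable)+
      have "0 \<le> (LINT z|lborel. \<bar>v z - k\<bar> * \<psi>t z + ?q z * \<psi>x z)" by (rule entropy[OF T])
      also have "\<dots> \<le> (LINT z|lborel. 4 * \<delta> * C1 * (indicator ?D z * ?E z) - 2 * e * (\<bar>v z - k\<bar> * G z))"
        by (rule integral_mono[OF Bochner_Integration.integrable_add[OF iq] _ pt])
           (intro Bochner_Integration.integrable_diff integrable_mult_right iE Gv)
      also have "\<dots> = 4 * \<delta> * C1 * (LINT z|lborel. indicator ?D z * ?E z) - 2 * e * (LINT z|lborel. \<bar>v z - k\<bar> * G z)"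
        by (subst Bochner_Integration.integral_diff[OF integrable_mult_right[OF iE] integrable_mult_right[OF Gv]]) simp
      finally show ?thesis by simp
    qed
    \<comment> \<open>Second use: \<open>\<psi>t\<close> integrates to 0, yet it is at most
      \<open>- 4 * e * G\<close> up to the error and the weight that \<open>J\<close>
      controls.\<close>
    have I: "4 * e * (LINT z|lborel. G z) \<le> 4 * \<delta> * (LINT z|lborel. indicator ?D z * ?E z) + 2 * \<Lambda> * (LINT z|lborel. \<bar>v z - k\<bar> * G z)"
    proof -
      have pt: "\<psi>t z \<le> 4 * \<delta> * (indicator ?D z * ?E z) + 2 * \<Lambda> * (\<bar>v z - k\<bar> * G z) - 4 * e * G z" for z
      proof (cases "z \<in> ?O")
        case False
        then show ?thesis using \<delta> slice_avg_error_nonneg[of \<eta> z] by (simp add: \<psi>t_def G_def)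
      next
        case True
        have "?P z + \<phi>t' z \<le> ?E z + \<Lambda> * \<bar>v z - k\<bar> - 2 * e"
          using P_le[of z] \<Lambda>v[of z] near(1)[OF True] by linarith
        then have "\<psi>t z \<le> 2 * G z * (?E z + \<Lambda> * \<bar>v z - k\<bar> - 2 * e)"
          unfolding \<psi>t_def using Gp by (intro mult_left_mono) auto
        also have "\<dots> = 2 * (G z * ?E z) + 2 * \<Lambda> * (\<bar>v z - k\<bar> * G z) - 4 * e * G z" by (simp add: algebra_simps)
        also have "\<dots> \<le> 2 * (2 * \<delta> * (indicator ?D z * ?E z)) + 2 * \<Lambda> * (\<bar>v z - k\<bar> * G z) - 4 * e * G z"
          using GE[of z] by (intro diff_right_mono add_right_mono mult_left_mono) auto
        finally show ?thesis by simp
      qed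
      have "0 = (LINT z|lborel. \<psi>t z)" using C1_test_integral_zero(1)[OF T] by simp
      also have "\<dots> \<le> (LINT z|lborel. 4 * \<delta> * (indicator ?D z * ?E z) + 2 * \<Lambda> * (\<bar>v z - k\<bar> * G z) - 4 * e * G z)"
        by (rule integral_mono[OF i0(1) _ pt])
           (intro Bochner_Integration.integrable_diff Bochner_Integration.integrable_add integrable_mult_right iE Gv Gi)
      also have "\<dots> = 4 * \<delta> * (LINT z|lborel. indicator ?D z * ?E z) + 2 * \<Lambda> * (LINT z|lborel. \<bar>v z - k\<bar> * G z) - 4 * e * (LINT z|lborel. G z)"
        by (subst Bochner_Integration.integral_diff[OF Bochner_Integration.integrable_add[OF integrable_mult_right[OF iE] integrable_mult_right[OF Gv]] integrable_mult_right[OF Gi]],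
            subst Bochner_Integration.integral_add[OF integrable_mult_right[OF iE] integrable_mult_right[OF Gv]]) simp
      finally show ?thesis by simp
    qed
    have low: "c0 \<le> (LINT z|lborel. G z)"
    proof -
      have fin: "emeasure lborel (ball z0 r2) < \<infinity>" by (rule emeasure_bounded_finite) simp
      have "c0 = (LINT z|lborel. indicator (ball z0 r2) z * (\<delta> / 2))" by (simp add: c0_def)
      also have "\<dots> \<le> (LINT z|lborel. G z)"
      proof (rule integral_mono[OF _ Gi])
        show "integrable lborel (\<lambda>z. indicator (ball z0 r2) z * (\<delta> / 2))"
          by (intro integrable_mult_left integrable_real_indicator) (use fin in \<open>auto simp: infinity_ennreal_def\<close>)
        fix z
        show "indicator (ball z0 r2) z * (\<delta> / 2) \<le> G z"
        proof (cases "z \<in> ball z0 r2")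
          case True
          then have zO: "z \<in> ?O" using r2 by auto
          have "\<delta> / 2 \<le> s z" using r2(3)[OF True] pU[OF zO] unfolding s_def by linarith
          then show ?thesis using True zO by (simp add: G_def g_def)
        qed (simp add: Gp)
      qed
      finally show ?thesis .
    qed
    have "(LINT z|lborel. \<bar>v z - k\<bar> * G z) \<le> 2 * \<delta> * C1 / e * (LINT z|lborel. indicator ?D z * ?E z)"
      using J e by (simp add: field_simps)
    then have "2 * \<Lambda> * (LINT z|lborel. \<bar>v z - k\<bar> * G z) \<le> 2 * \<Lambda> * (2 * \<delta> * C1 / e * (LINT z|lborel. indicator ?D z * ?E z))"
      using \<Lambda>(1) by (intro mult_left_mono) auto
    then have "4 * e * (LINT z|lborel. G z) \<le> K * (LINT z|lborel. indicator ?D z * ?E z)"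
      using I by (simp add: K_def distrib_right mult.assoc)
    moreover have "4 * e * c0 \<le> 4 * e * (LINT z|lborel. G z)" using low e by (intro mult_left_mono) auto
    ultimately show ?thesis by linarith
  qed
  have "0 < 2 * e * c0 / (K + 1)" using e c0 K by (intro divide_pos_pos) auto
  then obtain d where d: "0 < d" "\<And>\<eta>. 0 < \<eta> \<Longrightarrow> \<eta> < d \<Longrightarrow>
     (LINT z|lborel. indicator (cball 0 R \<inter> {z. 0 < fst z}) z *
        (\<bar>slice_avg f \<eta> (fst z) (snd z) - f (v z)\<bar> + \<bar>slice_avg (\<lambda>x. x) \<eta> (fst z) (snd z) - v z\<bar>)) \<le> 2 * e * c0 / (K + 1)"
    using slice_avg_close by blast
  \<comment> \<open>The first entry makes the error integral small, the second makes the mollified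
    potential accurate to \<open>\<delta> / 4\<close>.\<close>
  define \<eta> where "\<eta> = min (d / 2) (\<delta> / (4 * (B + 1)))"
  have \<eta>: "0 < \<eta>" "\<eta> < d" using d(1) \<delta> B_nonneg by (auto simp: \<eta>_def)
  have "B * \<eta> \<le> (B + 1) * (\<delta> / (4 * (B + 1)))"
    using B_nonneg \<eta>(1) by (intro mult_mono) (auto simp: \<eta>_def)
  also have "\<dots> = \<delta> / 4"
  proof -
    have "D * (\<delta> / (4 * D)) = \<delta> / 4" if "D \<noteq> 0" for D :: real using that by simp
    moreover have "B + 1 \<noteq> 0" using B_nonneg by linarith
    ultimately show ?thesis by blast
  qed
  finally have "4 * e * c0 \<le> K * (LINT z|lborel. indicator ?D z * slice_avg_error \<eta> z)" by (rule est[OF \<eta>(1)])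
  also have "\<dots> \<le> K * (2 * e * c0 / (K + 1))"
    using d(2)[OF \<eta>] K unfolding slice_avg_error_def by (intro mult_left_mono)
  also have "\<dots> \<le> (K + 1) * (2 * e * c0 / (K + 1))"
    using K e c0 by (intro mult_right_mono) auto
  also have "\<dots> = 2 * e * c0" using K by simp
  finally show False using e c0 by simp
qed

end

section \<open>Hopf-Lax formula for convex fluxes\<close>

text \<open>Normalised indicators are averaging kernels, so short averages converge to
  \<open>g\<close> in the mean on balls. The excess of \<open>\<bar>g\<bar>\<close> over
  \<open>N\<close> is at most the distance of \<open>g\<close> from such an average, hence its
  integral is 0.\<close>

lemma AE_bound_of_short_averages:
  fixes g :: "real \<Rightarrow> real"
  assumes [measurable]: "g \<in> borel_measurable borel" and C: "\<And>x. \<bar>g x\<bar> \<le> C" and h0: "0 < h0"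
    and avg: "\<And>x h. 0 < h \<Longrightarrow> h \<le> h0 \<Longrightarrow> \<bar>LINT y|lborel. indicator {x..x + h} y * g y\<bar> \<le> N * h"
  shows "AE x in lborel. \<bar>g x\<bar> \<le> N"
proof -
  define p where "p x = max 0 (\<bar>g x\<bar> - N)" for x
  have [measurable]: "p \<in> borel_measurable borel" unfolding p_def by measurable
  have N0: "0 \<le> N"
    using order_trans[OF abs_ge_zero avg[OF h0 order_refl]] h0 by (simp add: zero_le_mult_iff)
  have pb: "\<bar>p x\<bar> \<le> C" for x using C[of x] N0 by (simp add: p_def)
  have zero: "AE x in lborel. x \<in> cball 0 R \<longrightarrow> p x = 0" for R
  proof -
    have ip: "integrable lborel (\<lambda>x. indicator (cball 0 R) x * p x)"
      by (rule integrable_indicator_cball_mult[OF _ pb]) measurable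
    have "(LINT x|lborel. indicator (cball 0 R) x * p x) \<le> 0 + e" if e: "0 < e" for e
    proof -
      have n1: "norm (1 :: real) \<le> 1" by simp
      obtain d where d: "0 < d" "\<And>k \<eta>. 0 < \<eta> \<Longrightarrow> \<eta> < d \<Longrightarrow> averaging_kernel \<eta> k \<Longrightarrow>
        integrable lborel (\<lambda>z. indicator (cball 0 R) z * \<bar>(LINT s|lborel. g (z + s *\<^sub>R 1) * k s) - g z\<bar>) \<and>
        (LINT z|lborel. indicator (cball 0 R) z * \<bar>(LINT s|lborel. g (z + s *\<^sub>R 1) * k s) - g z\<bar>) \<le> e"
        by (rule L1_averages_close[OF assms(1) C e n1, where R = R]) (rule that; blast)
      define \<eta> where "\<eta> = min (d / 2) h0"
      have \<eta>: "0 < \<eta>" "\<eta> < d" "\<eta> \<le> h0" using d(1) h0 by (auto simp: \<eta>_def)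
      define k where "k s = indicator {0..\<eta>} s / \<eta>" for s :: real
      have "averaging_kernel \<eta> k"
        unfolding averaging_kernel_def k_def
      proof (intro conjI allI impI)
        show "integrable lborel (\<lambda>s. indicator {0..\<eta>} s / \<eta>)"
          by (intro integrable_divide integrable_real_indicator) (auto simp: emeasure_lborel_Icc_eq)
        show "(LINT s|lborel. indicator {0..\<eta>} s / \<eta>) = 1" using \<eta> by simp
      qed (use \<eta> in \<open>auto simp: indicator_def split: if_splits\<close>)
      note K = d(2)[OF \<eta>(1,2) this]
      have av: "\<bar>LINT s|lborel. g (x + s *\<^sub>R 1) * k s\<bar> \<le> N" for x
      proof -
        have "(LINT s|lborel. g (x + s *\<^sub>R 1) * k s) = (LINT s|lborel. (\<lambda>y. indicator {x..x + \<eta>} y * g y) (s + x) / \<eta>)"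
          by (rule Bochner_Integration.integral_cong) (auto simp: k_def indicator_def add.commute)
        also have "\<dots> = (LINT s|lborel. (\<lambda>y. indicator {x..x + \<eta>} y * g y) (s + x)) / \<eta>"
          by simp
        also have "\<dots> = (LINT y|lborel. indicator {x..x + \<eta>} y * g y) / \<eta>"
          by (subst integral_lborel_shift) measurable
        finally show ?thesis using avg[OF \<eta>(1,3), of x] \<eta>(1) by (simp add: divide_le_eq)
      qed
      have "(LINT x|lborel. indicator (cball 0 R) x * p x)
          \<le> (LINT z|lborel. indicator (cball 0 R) z * \<bar>(LINT s|lborel. g (z + s *\<^sub>R 1) * k s) - g z\<bar>)"
      proof (rule integral_mono[OF ip])
        fix x
        have "p x \<le> \<bar>(LINT s|lborel. g (x + s *\<^sub>R 1) * k s) - g x\<bar>"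
          using av[of x] unfolding p_def by (intro max.boundedI) linarith+
        then show "indicator (cball 0 R) x * p x \<le> indicator (cball 0 R) x * \<bar>(LINT s|lborel. g (x + s *\<^sub>R 1) * k s) - g x\<bar>"
          by (rule mult_left_mono) simp
      qed (use K in blast)
      then show ?thesis using K by simp
    qed
    then have "(LINT x|lborel. indicator (cball 0 R) x * p x) \<le> 0" by (rule field_le_epsilon)
    moreover have "0 \<le> (LINT x|lborel. indicator (cball 0 R) x * p x)"
      by (rule Bochner_Integration.integral_nonneg) (simp add: p_def)
    ultimately have "(LINT x|lborel. indicator (cball 0 R) x * p x) = 0" by linarith
    then have "AE x in lborel. indicator (cball 0 R) x * p x = 0"
      by (subst (asm) integral_nonneg_eq_0_iff_AE[OF ip]) (auto simp: p_def)
    then show ?thesis by eventually_elim (auto simp: indicator_def)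
  qed
  have "AE x in lborel. \<forall>n :: nat. x \<in> cball 0 (real n) \<longrightarrow> p x = 0"
    unfolding AE_all_countable using zero by blast
  then show ?thesis
  proof eventually_elim
    case (elim x)
    obtain n :: nat where "\<bar>x\<bar> \<le> real n" using real_arch_simple by blast
    then have "p x = 0" using elim[rule_format, of n] by simp
    then show ?case by (simp add: p_def max_def split: if_splits)
  qed
qed

text \<open>Monotonicity is demanded on \<open>[-B,B]\<close>, the interval of the values of the
  flow; in the application \<open>B\<close> is \<open>M\<close>, after clipping.\<close>

locale convex_flow = integrable_entropy_flow +
  fixes a :: "real \<Rightarrow> real"
  assumes B_pos: "0 < B"
    and f_deriv: "\<And>x. (f has_real_derivative a x) (at x)"
    and a_continuous: "continuous_on UNIV a"
    and a_strict: "\<And>x y. x \<in> {-B..B} \<Longrightarrow> y \<in> {-B..B} \<Longrightarrow> x < y \<Longrightarrow> a x < a y"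
begin

text \<open>
  \<open>\<beta>\<close> extends the inverse of \<open>a\<close> by constants, and \<open>H\<close> is the convex conjugate of \<open>f\<close> restricted to
  \<open>[-B,B]\<close>, with \<open>H' = \<beta>\<close>.
\<close>

definition clamp :: "real \<Rightarrow> real" where
  "clamp V = max (a (- B)) (min (a B) V)"

definition \<beta> :: "real \<Rightarrow> real" where
  "\<beta> V = the_inv_into {-B..B} a (clamp V)"

definition H :: "real \<Rightarrow> real" where
  "H V = V * \<beta> V - f (\<beta> V)"

section \<open>The conjugate of the flux\<close>

lemma a_inj: "inj_on a {-B..B}"
  by (rule linorder_inj_onI) (use a_strict in \<open>force+\<close>)

lemma a_ends: "a (- B) < a B"
  using a_strict[of "- B" B] B_pos by simp

lemma clamp_range: "clamp V \<in> {a (- B)..a B}"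
  using a_ends by (auto simp: clamp_def)

lemma a_mono: "x \<in> {-B..B} \<Longrightarrow> y \<in> {-B..B} \<Longrightarrow> x \<le> y \<Longrightarrow> a x \<le> a y"
  using a_strict[of x y] by (cases "x = y") auto

lemma a_image: "a ` {-B..B} = {a (- B)..a B}"
proof
  show "a ` {-B..B} \<subseteq> {a (- B)..a B}" using a_mono B_pos by auto
  show "{a (- B)..a B} \<subseteq> a ` {-B..B}"
  proof
    fix V assume "V \<in> {a (- B)..a B}"
    then obtain x where "- B \<le> x" "x \<le> B" "a x = V"
      using IVT'[of a "- B" V B] B_pos continuous_on_subset[OF a_continuous] by auto
    then show "V \<in> a ` {-B..B}" by auto
  qed
qed

lemma \<beta>_range: "\<beta> V \<in> {-B..B}" and a_\<beta>: "a (\<beta> V) = clamp V"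
  unfolding \<beta>_def using the_inv_into_into[OF a_inj, of "clamp V" "{-B..B}"] f_the_inv_into_f[OF a_inj, of "clamp V"]
    clamp_range[of V] a_image by auto

lemma \<beta>_abs: "\<bar>\<beta> V\<bar> \<le> B"
  using \<beta>_range[of V] by auto

lemma \<beta>_continuous [continuous_intros]: "continuous_on S g \<Longrightarrow> continuous_on S (\<lambda>x. \<beta> (g x))"
proof -
  have inv: "continuous_on {a (- B)..a B} (the_inv_into {-B..B} a)"
    unfolding a_image[symmetric]
    by (rule continuous_on_inv[OF continuous_on_subset[OF a_continuous]]) (use the_inv_into_f_f[OF a_inj] in auto)
  have "continuous_on UNIV clamp" unfolding clamp_def by (intro continuous_intros)
  then have "continuous_on UNIV \<beta>"
    unfolding \<beta>_def by (rule continuous_on_compose2[OF inv]) (use clamp_range in auto)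
  then show "continuous_on S g \<Longrightarrow> continuous_on S (\<lambda>x. \<beta> (g x))"
    by (rule continuous_on_compose2) auto
qed

lemma f_tangent:
  assumes "x \<in> {-B..B}" "y \<in> {-B..B}"
  shows "f x + a x * (y - x) \<le> f y"
proof -
  consider "x < y" | "y < x" | "x = y" by linarith
  then show ?thesis
  proof cases
    case 1
    then obtain z where z: "x < z" "z < y" "f y - f x = (y - x) * a z"
      using MVT2[of x y f a] f_deriv by blast
    have "a x * (y - x) \<le> a z * (y - x)"
      using a_mono[of x z] z assms 1 by (intro mult_right_mono) auto
    moreover have "f y - f x = a z * (y - x)" using z by (simp add: mult.commute)
    ultimately show ?thesis by linarith
  next
    case 2
    then obtain z where z: "y < z" "z < x" "f x - f y = (x - y) * a z"
      using MVT2[of y x f a] f_deriv by blast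
    have "a z * (x - y) \<le> a x * (x - y)"
      using a_mono[of z x] z assms 2 by (intro mult_right_mono) auto
    then show ?thesis using z by (simp add: algebra_simps)
  qed simp
qed

lemma clamp_cases: "V = clamp V \<or> (clamp V < V \<and> \<beta> V = B) \<or> (V < clamp V \<and> \<beta> V = - B)"
proof -
  have "\<beta> V = x" if "clamp V = a x" "x \<in> {-B..B}" for x
    using inj_onD[OF a_inj, of "\<beta> V" x] \<beta>_range[of V] a_\<beta>[of V] that by auto
  then show ?thesis
    using a_ends B_pos by (auto simp: clamp_def max_def min_def split: if_splits)
qed

text \<open>For \<open>V\<close> in the range of \<open>a\<close> this is the tangent inequality at
  \<open>\<beta> V\<close>. Otherwise \<open>\<beta> V\<close> is an endpoint of
  \<open>[-B,B]\<close>, and the sign of \<open>V - clamp V\<close> is such that moving from there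
  to \<open>k\<close> only loses.\<close>

lemma fenchel:
  assumes "\<bar>k\<bar> \<le> B"
  shows "V * k - f k \<le> H V"
proof -
  have k: "k \<in> {-B..B}" using assms by auto
  have "f (\<beta> V) + clamp V * (k - \<beta> V) \<le> f k"
    using f_tangent[OF \<beta>_range k, of V] by (simp add: a_\<beta>)
  moreover have "(V - clamp V) * (k - \<beta> V) \<le> 0"
    using clamp_cases[of V] k by (auto simp: mult_le_0_iff)
  ultimately show ?thesis by (simp add: H_def algebra_simps)
qed

text \<open>\<open>\<beta> V\<close> attains the supremum that defines the conjugate at
  \<open>V\<close> and is a competitor at \<open>V'\<close>; likewise with the roles
  exchanged.\<close>

lemma H_increment: "(V' - V) * \<beta> V \<le> H V' - H V" "H V' - H V \<le> (V' - V) * \<beta> V'"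
  using fenchel[OF \<beta>_abs, of V' V] fenchel[OF \<beta>_abs, of V V'] by (auto simp: H_def algebra_simps)

text \<open>\<open>H_increment\<close> traps the difference quotient between
  \<open>\<beta> V\<close> and \<open>\<beta> (V + h)\<close>.\<close>

lemma H_has_derivative: "(H has_real_derivative \<beta> V) (at V)"
proof -
  have c: "isCont \<beta> V"
    using \<beta>_continuous[of UNIV "\<lambda>x. x"] by (simp add: continuous_on_eq_continuous_at)
  have "((\<lambda>h. (H (V + h) - H V) / h - \<beta> V) \<longlongrightarrow> 0) (at 0)"
  proof (rule Lim_null_comparison)
    show "\<forall>\<^sub>F h in at 0. norm ((H (V + h) - H V) / h - \<beta> V) \<le> \<bar>\<beta> (V + h) - \<beta> V\<bar>"
      unfolding eventually_at
    proof (intro exI[of _ 1] conjI ballI impI)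
      fix h :: real assume "h \<noteq> 0 \<and> dist h 0 < 1"
      then have h: "h \<noteq> 0" by simp
      have "h * \<beta> V \<le> H (V + h) - H V" "H (V + h) - H V \<le> h * \<beta> (V + h)"
        using H_increment[where V = V and V' = "V + h"] by auto
      then have "\<bar>(H (V + h) - H V) - h * \<beta> V\<bar> \<le> \<bar>h * (\<beta> (V + h) - \<beta> V)\<bar>"
        by (simp add: right_diff_distrib)
      then have "\<bar>(H (V + h) - H V) - h * \<beta> V\<bar> / \<bar>h\<bar> \<le> \<bar>\<beta> (V + h) - \<beta> V\<bar>"
        using h by (simp add: abs_mult divide_le_eq mult.commute)
      moreover have "(H (V + h) - H V) / h - \<beta> V = ((H (V + h) - H V) - h * \<beta> V) / h"
        using h by (simp add: diff_divide_distrib)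
      ultimately show "norm ((H (V + h) - H V) / h - \<beta> V) \<le> \<bar>\<beta> (V + h) - \<beta> V\<bar>" by simp
    qed auto
    have "((\<lambda>h. \<bar>\<beta> (V + h) - \<beta> V\<bar>) \<longlongrightarrow> \<bar>\<beta> V - \<beta> V\<bar>) (at 0)"
      using c unfolding isCont_iff by (intro tendsto_intros)
    then show "((\<lambda>h. \<bar>\<beta> (V + h) - \<beta> V\<bar>) \<longlongrightarrow> 0) (at 0)" by simp
  qed
  then show ?thesis unfolding DERIV_def by (simp add: LIM_zero_iff)
qed

lemma H_continuous [continuous_intros]: "continuous_on S g \<Longrightarrow> continuous_on S (\<lambda>x. H (g x))"
  by (rule continuous_on_compose2[of UNIV H])
     (auto intro!: continuous_at_imp_continuous_on DERIV_isCont H_has_derivative)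

text \<open>Along the line from \<open>(0, y)\<close> to \<open>(T, X)\<close> with slope
  \<open>V\<close>, the derivative of the smoothed potential is an average of
  \<open>V * u - f u\<close>, which \<open>fenchel\<close> bounds by \<open>H V\<close>. This
  derivative is known at positive times, so the line starts at \<open>\<sigma> > 0\<close> and
  continuity closes the gap.\<close>

lemma hopf_lax_upper:
  assumes T: "0 < T"
  shows "potential T X \<le> potential 0 y + T * H ((X - y) / T)"
proof -
  define V where "V = (X - y) / T"
  have X: "X = y + T * V" using T by (simp add: V_def)
  have pos: "potential T X \<le> potential \<sigma> (y + \<sigma> * V) + (T - \<sigma>) * H V" if \<sigma>: "0 < \<sigma>" "\<sigma> < T" for \<sigma>
  proof (rule field_le_epsilon)
    fix e :: real assume e: "0 < e"
    \<comment> \<open>Small enough that replacing the potential by the smoothed one at both ends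
      costs at most \<open>e\<close>.\<close>
    define \<eta> where "\<eta> = e / (2 * (B + 1))"
    have \<eta>: "0 < \<eta>" using e B_pos by (simp add: \<eta>_def)
    have B\<eta>: "2 * (B * \<eta>) \<le> e"
    proof -
      have "2 * (B * (e / (2 * D))) = e * (B / D)" for D by simp
      from this[of "B + 1"] have "2 * (B * \<eta>) = e * (B / (B + 1))" unfolding \<eta>_def .
      also have "\<dots> \<le> e * 1" using e B_pos by (intro mult_left_mono) (auto simp: divide_le_eq)
      finally show ?thesis by simp
    qed
    let ?h = "\<lambda>t. smoothed_potential \<eta> t (y + t * V)"
    let ?h' = "\<lambda>t. - slice_avg f \<eta> t (y + t * V) + V * slice_avg (\<lambda>x. x) \<eta> t (y + t * V)"
    have d: "(?h has_real_derivative ?h' t) (at t)" if "0 < t" for t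
    proof -
      have 1: "((\<lambda>t. (t, y + t * V)) has_derivative (\<lambda>h. (h, h * V))) (at t)"
        by (auto intro!: derivative_eq_intros)
      have "((\<lambda>t. (\<lambda>z. smoothed_potential \<eta> (fst z) (snd z)) (t, y + t * V)) has_derivative
          (\<lambda>h. fst (h, h * V) * (- slice_avg f \<eta> t (y + t * V)) + snd (h, h * V) * slice_avg (\<lambda>x. x) \<eta> t (y + t * V))) (at t)"
        using has_derivative_compose[OF 1 smoothed_potential_has_derivative[OF \<eta>, of "(t, y + t * V)"]] that by simp
      from this[unfolded fst_conv snd_conv] show ?thesis
        unfolding has_field_derivative_def by (rule has_derivative_eq_rhs) (auto simp: fun_eq_iff algebra_simps)
    qed
    have le: "?h' t \<le> H V" for t
    proof -
      let ?x = "y + t * V"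
      obtain \<Lambda> F where "0 \<le> \<Lambda>" and "0 \<le> F"
        and "\<And>x y. \<bar>x\<bar> \<le> B \<Longrightarrow> \<bar>y\<bar> \<le> B \<Longrightarrow> \<bar>f x - f y\<bar> \<le> \<Lambda> * \<bar>x - y\<bar>"
        and "\<And>x. \<bar>x\<bar> \<le> B \<Longrightarrow> \<bar>f x\<bar> \<le> F"
        by (rule f_bounds) (rule that; blast)
      have i1: "integrable lborel (\<lambda>z. w t z * ker \<eta> (z - ?x))"
        using slice_avg_integrable[OF \<eta>, of "\<lambda>x. x" B] by simp
      have i2: "integrable lborel (\<lambda>z. f (w t z) * ker \<eta> (z - ?x))" by (rule slice_avg_f(3)[OF \<eta>])
      have "?h' t = (LINT z|lborel. V * (w t z * ker \<eta> (z - ?x)) - f (w t z) * ker \<eta> (z - ?x))"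
        unfolding slice_avg_def using i1 i2 by simp
      also have "\<dots> \<le> (LINT z|lborel. H V * ker \<eta> (z - ?x))"
      proof (rule integral_mono)
        show "integrable lborel (\<lambda>z. V * (w t z * ker \<eta> (z - ?x)) - f (w t z) * ker \<eta> (z - ?x))" using i1 i2 by simp
        show "integrable lborel (\<lambda>z. H V * ker \<eta> (z - ?x))" using ker_integrable[OF \<eta>] by simp
        fix z
        have "(V * w t z - f (w t z)) * ker \<eta> (z - ?x) \<le> H V * ker \<eta> (z - ?x)"
          by (rule mult_right_mono[OF fenchel[OF w_bound] ker_nonneg[OF \<eta>]])
        then show "V * (w t z * ker \<eta> (z - ?x)) - f (w t z) * ker \<eta> (z - ?x) \<le> H V * ker \<eta> (z - ?x)"
          by (simp add: left_diff_distrib mult.assoc)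
      qed
      also have "\<dots> = H V" using ker_integral[OF \<eta>] by simp
      finally show ?thesis .
    qed
    obtain \<xi> where "?h T - ?h \<sigma> = (T - \<sigma>) * ?h' \<xi>"
      using MVT2[OF \<sigma>(2), of ?h ?h'] d \<sigma> by auto
    also have "\<dots> \<le> (T - \<sigma>) * H V" using le \<sigma> by (intro mult_left_mono) auto
    finally have "?h T - ?h \<sigma> \<le> (T - \<sigma>) * H V" .
    moreover have "\<bar>potential T X - ?h T\<bar> \<le> B * \<eta>" unfolding X using smoothed_potential_close[OF \<eta>] T by simp
    moreover have "\<bar>potential \<sigma> (y + \<sigma> * V) - ?h \<sigma>\<bar> \<le> B * \<eta>" using smoothed_potential_close[OF \<eta>] \<sigma> by simp
    ultimately show "potential T X \<le> potential \<sigma> (y + \<sigma> * V) + (T - \<sigma>) * H V + e" using B\<eta> by linarith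
  qed
  have "continuous_on {0..} (\<lambda>\<sigma>. potential \<sigma> (y + \<sigma> * V) + (T - \<sigma>) * H V)"
  proof -
    have "continuous_on {0..} (\<lambda>\<sigma>. (\<lambda>z. potential (fst z) (snd z)) (\<sigma>, y + \<sigma> * V))"
      by (rule continuous_on_compose2[OF potential_continuous]) (auto intro!: continuous_intros)
    then show ?thesis by (intro continuous_intros) simp_all
  qed
  then have "((\<lambda>\<sigma>. potential \<sigma> (y + \<sigma> * V) + (T - \<sigma>) * H V) \<longlongrightarrow> potential 0 (y + 0 * V) + (T - 0) * H V) (at 0 within {0..})"
    unfolding continuous_on by (rule bspec) simp
  then have lim: "((\<lambda>\<sigma>. potential \<sigma> (y + \<sigma> * V) + (T - \<sigma>) * H V) \<longlongrightarrow> potential 0 y + T * H V) (at_right 0)"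
    by (rule tendsto_within_subset[where S = "{0..}", THEN tendsto_eq_rhs]) auto
  have "\<forall>\<^sub>F \<sigma> in at_right 0. potential T X \<le> potential \<sigma> (y + \<sigma> * V) + (T - \<sigma>) * H V"
    unfolding eventually_at_right_field using pos T by blast
  then have "potential T X \<le> potential 0 y + T * H V"
    by (rule tendsto_lowerbound[OF lim]) simp
  then show ?thesis by (simp add: V_def)
qed

text \<open>
  The backward fan \<open>- (T - t) H ((X - y) / (T - t))\<close> focusing at \<open>(T,X)\<close> solves the Hamilton-Jacobi
  equation. The term \<open>\<epsilon> t\<close> makes it a strict subsolution and \<open>\<iota> / (T - t)\<close> keeps the minimum of the
  difference away from \<open>t = T\<close>, so the minimum can only be attained at \<open>t = 0\<close>.
\<close>

lemma hopf_lax_lower: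
  assumes T: "0 < T" and \<nu>: "0 < \<nu>"
  obtains y where "potential 0 y + T * H ((X - y) / T) \<le> potential T X + \<nu>"
proof (rule ccontr)
  assume "\<not> thesis"
  then have far: "potential T X + \<nu> < potential 0 y + T * H ((X - y) / T)" for y
    using that[of y] by (cases "potential 0 y + T * H ((X - y) / T) \<le> potential T X + \<nu>") auto
  obtain F where F: "0 \<le> F" and UF: "\<And>t t' x. 0 \<le> t \<Longrightarrow> 0 \<le> t' \<Longrightarrow> \<bar>potential t' x - potential t x\<bar> \<le> F * \<bar>t' - t\<bar>"
    and fF: "\<And>x. \<bar>x\<bar> \<le> B \<Longrightarrow> \<bar>f x\<bar> \<le> F"
    by (rule potential_time_lipschitz) (rule that; blast)
  \<comment> \<open>So near to \<open>T\<close> that the time variation of the potential and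
    \<open>(T - t1) * \<bar>H 0\<bar>\<close> together cost at most
    \<open>\<nu> / 8\<close>.\<close>
  define t1 where "t1 = T - min (T / 2) (\<nu> / (8 * (F + \<bar>H 0\<bar> + 1)))"
  have t1: "0 < t1" "t1 < T" "(T - t1) * (F + \<bar>H 0\<bar>) \<le> \<nu> / 8"
  proof -
    have p: "0 < F + \<bar>H 0\<bar> + 1" using F by linarith
    show "0 < t1" "t1 < T" using T \<nu> p by (auto simp: t1_def)
    have "(T - t1) * (F + \<bar>H 0\<bar>) \<le> (\<nu> / (8 * (F + \<bar>H 0\<bar> + 1))) * (F + \<bar>H 0\<bar> + 1)"
      using F \<nu> T p by (intro mult_mono) (auto simp: t1_def)
    also have "\<dots> = \<nu> / 8"
    proof -
      have "\<nu> / (8 * D) * D = \<nu> / 8" if "0 < D" for D using that by simp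
      then show ?thesis using p by blast
    qed
    finally show "(T - t1) * (F + \<bar>H 0\<bar>) \<le> \<nu> / 8" .
  qed
  \<comment> \<open>Each of the two perturbations costs at most \<open>\<nu> / 4\<close> at
    \<open>(t1, X)\<close>. With the \<open>\<nu> / 8\<close> from \<open>t1\<close> the total stays
    below the \<open>3 / 4 * \<nu>\<close> in \<open>c\<close>, which is itself below the gap
    \<open>\<nu>\<close> assumed at time 0.\<close>
  define \<epsilon> where "\<epsilon> = \<nu> / (4 * T)"
  define \<iota> where "\<iota> = \<nu> * (T - t1) / 4"
  have \<epsilon>: "0 < \<epsilon>" and \<iota>: "0 < \<iota>" using \<nu> T t1 by (auto simp: \<epsilon>_def \<iota>_def)
  define \<phi> where "\<phi> z = - ((T - fst z) * H ((X - snd z) / (T - fst z))) - \<epsilon> * fst z - \<iota> / (T - fst z)" for z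
  define G where "G z = potential (fst z) (snd z) - \<phi> z" for z
  define c where "c = potential T X + 3 / 4 * \<nu>"
  have Gt1: "G (t1, X) < c"
  proof -
    have "potential t1 X \<le> potential T X + F * (T - t1)" using UF[of t1 T X] t1 by simp
    moreover have "(T - t1) * H 0 \<le> (T - t1) * \<bar>H 0\<bar>" using t1 by (intro mult_left_mono) auto
    moreover have "\<epsilon> * t1 \<le> \<nu> / 4"
      using t1 T \<nu> by (simp add: \<epsilon>_def field_simps)
    moreover have "\<iota> / (T - t1) = \<nu> / 4"
    proof -
      have e: "\<nu> * D / 4 / D = \<nu> / 4" if "0 < D" for D using that by simp
      show ?thesis unfolding \<iota>_def by (rule e) (use t1 in simp)
    qed
    moreover have "F * (T - t1) + (T - t1) * \<bar>H 0\<bar> \<le> \<nu> / 8" using t1(3) by (simp add: algebra_simps)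
    ultimately have "potential t1 X + (T - t1) * H 0 + \<epsilon> * t1 + \<iota> / (T - t1) < c"
      using \<nu> unfolding c_def by linarith
    then show ?thesis by (simp add: G_def \<phi>_def)
  qed
  define A where "A = mass + 2 * (T * F)"
  \<comment> \<open>Coercivity: \<open>H V\<close> is at least \<open>\<bar>V\<bar> * B - F\<close>,
    so the difference grows with \<open>\<bar>X - y\<bar>\<close>, while the singular term makes it
    grow near \<open>t = T\<close>.\<close>
  have G_low: "B * \<bar>X - y\<bar> - A + \<iota> / (T - t) \<le> G (t, y)" if t: "0 \<le> t" "t < T" for t y
  proof -
    have u: "- mass - T * F \<le> potential t y"
    proof -
      have "\<bar>potential t y - potential 0 y\<bar> \<le> F * t" using UF[of 0 t y] t by simp
      moreover have "F * t \<le> T * F" using t F by (simp add: mult.commute mult_left_mono)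
      ultimately show ?thesis using potential_initial_bound[of y] by linarith
    qed
    let ?V = "(X - y) / (T - t)"
    have hv: "\<bar>V\<bar> * B - F \<le> H V" for V
    proof (cases "0 \<le> V")
      case True
      have "V * B - f B \<le> H V" by (rule fenchel) (use B_pos in simp)
      moreover have "f B \<le> F" using fF[of B] B_pos by simp
      ultimately show ?thesis using True by simp
    next
      case False
      have "V * (- B) - f (- B) \<le> H V" by (rule fenchel) (use B_pos in simp)
      moreover have "f (- B) \<le> F" using fF[of "- B"] B_pos by simp
      ultimately show ?thesis using False by simp
    qed
    have "(T - t) * (\<bar>?V\<bar> * B - F) \<le> (T - t) * H ?V" using t by (intro mult_left_mono hv) auto
    moreover have "(T - t) * (\<bar>?V\<bar> * B - F) = B * \<bar>X - y\<bar> - (T - t) * F"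
      using t by (simp add: right_diff_distrib)
    moreover have "(T - t) * F \<le> T * F" using t F by (intro mult_right_mono) auto
    moreover have "0 \<le> \<epsilon> * t" using \<epsilon> t by simp
    ultimately show ?thesis using u unfolding G_def \<phi>_def A_def fst_conv snd_conv by linarith
  qed
  have mass0: "0 \<le> mass" by (simp add: mass_def)
  have A0: "0 \<le> A" using mass0 T F by (simp add: A_def)
  \<comment> \<open>A size at which either growth term alone pushes \<open>G\<close> above
    \<open>c\<close>; \<open>\<sigma>\<close> and \<open>\<rho>\<close> are the resulting margins in
    time and in space.\<close>
  define Q where "Q = \<bar>c\<bar> + A + 1"
  have Q: "0 < Q" using A0 by (simp add: Q_def)
  define \<sigma> where "\<sigma> = min (T - t1) (\<iota> / Q)"
  have \<sigma>: "0 < \<sigma>" "\<sigma> \<le> T - t1" "\<sigma> \<le> \<iota> / Q" using t1 \<iota> Q by (auto simp: \<sigma>_def)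
  define \<rho> where "\<rho> = Q / B"
  let ?K = "{0..T - \<sigma>} \<times> {X - \<rho>..X + \<rho>}"
  have outside: "c < G (t, y)" if t: "0 \<le> t" "t < T" and nK: "(t, y) \<notin> ?K" for t y
  proof -
    have "T - \<sigma> < t \<or> \<rho> < \<bar>X - y\<bar>" using nK t by auto
    then show ?thesis
    proof
      assume "T - \<sigma> < t"
      then have "T - t < \<iota> / Q" using \<sigma> by linarith
      then have "Q < \<iota> / (T - t)" using t Q by (simp add: less_divide_eq mult.commute)
      moreover have "0 \<le> B * \<bar>X - y\<bar>" using B_pos by simp
      ultimately show ?thesis using G_low[OF t, of y] unfolding Q_def by linarith
    next
      assume "\<rho> < \<bar>X - y\<bar>"
      then have "Q < B * \<bar>X - y\<bar>" using B_pos by (simp add: \<rho>_def divide_less_eq mult.commute)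
      moreover have "0 \<le> \<iota> / (T - t)" using t \<iota> by simp
      ultimately show ?thesis using G_low[OF t, of y] unfolding Q_def by linarith
    qed
  qed
  have KT: "fst z < T \<and> 0 \<le> fst z" if "z \<in> ?K" for z using that \<sigma> by (auto simp: mem_Times_iff)
  have Gc: "continuous_on ?K G"
  proof -
    have "continuous_on ?K (\<lambda>z. potential (fst z) (snd z))"
      by (rule continuous_on_subset[OF potential_continuous]) (auto simp: mem_Times_iff)
    then show ?thesis
      unfolding G_def \<phi>_def by (intro continuous_intros) (use KT in force)+
  qed
  have rho0: "0 \<le> \<rho>" using Q B_pos by (simp add: \<rho>_def)
  have in1: "(t1, X) \<in> ?K" using t1 \<sigma> rho0 by auto
  have Kne: "?K \<noteq> {}" using in1 by blast
  have "compact ?K" by (intro compact_Times compact_Icc)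
  from continuous_attains_inf[OF this Kne Gc]
  obtain z0 where z0: "z0 \<in> ?K" "\<And>z. z \<in> ?K \<Longrightarrow> G z0 \<le> G z" by blast
  have z0c: "G z0 < c" using z0(2)[OF in1] Gt1 by simp
  have glob: "G z0 \<le> G z" if "0 \<le> fst z" "fst z < T" for z
    using outside[of "fst z" "snd z"] z0(2)[of z] z0c that by (cases "z \<in> ?K") auto
  have z0T: "fst z0 < T" using KT[OF z0(1)] by simp
  have z0pos: "0 < fst z0"
  proof (rule ccontr)
    assume "\<not> 0 < fst z0"
    then have "fst z0 = 0" using KT[OF z0(1)] by simp
    then have "G z0 = potential 0 (snd z0) + T * H ((X - snd z0) / T) + \<iota> / T" by (simp add: G_def \<phi>_def)
    moreover have "0 < \<iota> / T" using \<iota> T by simp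
    ultimately have "potential T X + \<nu> < G z0" using far[of "snd z0"] by linarith
    then show False using z0c \<nu> unfolding c_def by linarith
  qed
  define r where "r = min (fst z0) (T - fst z0)"
  have r: "0 < r" using z0pos z0T by (simp add: r_def)
  have ballT: "0 < fst z \<and> fst z < T" if "z \<in> ball z0 r" for z
  proof -
    have "\<bar>fst z0 - fst z\<bar> \<le> dist z0 z" by (metis dist_fst_le dist_real_def)
    then have "\<bar>fst z0 - fst z\<bar> < r" using that by simp
    then show ?thesis by (auto simp: r_def)
  qed
  let ?V = "\<lambda>z. (X - snd z) / (T - fst z)"
  define \<phi>t where "\<phi>t z = H (?V z) - ?V z * \<beta> (?V z) - \<epsilon> - \<iota> / (T - fst z)\<^sup>2" for z
  define \<phi>x where "\<phi>x z = \<beta> (?V z)" for z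
  have "0 \<le> \<phi>t z0 + f (\<phi>x z0)"
  proof (rule potential_supersolution[OF r z0pos])
    fix z assume z: "z \<in> ball z0 r"
    have ne: "T - fst z \<noteq> 0" using ballT[OF z] by simp
    have dV: "(?V has_derivative (\<lambda>h. (fst h * ?V z - snd h) / (T - fst z))) (at z)"
      using ne by (auto intro!: derivative_eq_intros simp: fun_eq_iff power2_eq_square divide_simps)
    have dT: "((\<lambda>z. T - fst z) has_derivative (\<lambda>h. - fst h)) (at z)"
      by (auto intro!: derivative_eq_intros)
    have dI: "((\<lambda>z. \<iota> / (T - fst z)) has_derivative (\<lambda>h. fst h * (\<iota> / (T - fst z)\<^sup>2))) (at z)"
      using ne by (auto intro!: derivative_eq_intros simp: fun_eq_iff power2_eq_square divide_simps)
    have dH: "((\<lambda>z. H (?V z)) has_derivative (\<lambda>h. ((fst h * ?V z - snd h) / (T - fst z)) * \<beta> (?V z))) (at z)"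
      by (rule DERIV_compose_FDERIV[OF H_has_derivative dV])
    have d\<epsilon>: "((\<lambda>z. \<epsilon> * fst z) has_derivative (\<lambda>h. \<epsilon> * fst h)) (at z)"
      by (auto intro!: derivative_eq_intros)
    have "(\<phi> has_derivative (\<lambda>h. - ((T - fst z) * (((fst h * ?V z - snd h) / (T - fst z)) * \<beta> (?V z)) + - fst h * H (?V z))
        - \<epsilon> * fst h - fst h * (\<iota> / (T - fst z)\<^sup>2))) (at z)"
      unfolding \<phi>_def by (intro has_derivative_diff has_derivative_minus has_derivative_mult dT dH d\<epsilon> dI)
    then show "(\<phi> has_derivative (\<lambda>h. fst h * \<phi>t z + snd h * \<phi>x z)) (at z)"
    proof (rule has_derivative_eq_rhs)
      have "(T - fst z) * (((fst h * ?V z - snd h) / (T - fst z)) * \<beta> (?V z)) = (fst h * ?V z - snd h) * \<beta> (?V z)" for h :: "real \<times> real"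
        using ne by simp
      then show "(\<lambda>h. - ((T - fst z) * (((fst h * ?V z - snd h) / (T - fst z)) * \<beta> (?V z)) + - fst h * H (?V z))
        - \<epsilon> * fst h - fst h * (\<iota> / (T - fst z)\<^sup>2)) = (\<lambda>h. fst h * \<phi>t z + snd h * \<phi>x z)"
        by (simp only: \<phi>t_def \<phi>x_def) (simp add: fun_eq_iff algebra_simps)
    qed
    show "potential (fst z0) (snd z0) - \<phi> z0 \<le> potential (fst z) (snd z) - \<phi> z"
      using glob[of z] ballT[OF z] by (simp add: G_def)
  next
    show "continuous_on (ball z0 r) \<phi>t" unfolding \<phi>t_def
      by (intro continuous_intros) (use ballT in force)+
    show "continuous_on (ball z0 r) \<phi>x" unfolding \<phi>x_def
      by (intro continuous_intros) (use ballT in force)+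
  qed
  \<comment> \<open>By the definition of \<open>H\<close> the fan solves the equation exactly; only
    the two perturbations remain, and both are of the wrong sign for a supersolution.\<close>
  moreover have "\<phi>t z0 + f (\<phi>x z0) = - \<epsilon> - \<iota> / (T - fst z0)\<^sup>2"
    by (simp add: \<phi>t_def \<phi>x_def H_def)
  moreover have "0 \<le> \<iota> / (T - fst z0)\<^sup>2" using \<iota> by simp
  ultimately show False using \<epsilon> by linarith
qed

section \<open>Growth of the conjugate and the decay rate\<close>

lemma clamp_nonexpansive: "\<bar>clamp V - clamp V'\<bar> \<le> \<bar>V - V'\<bar>"
  by (auto simp: clamp_def max_def min_def)

lemma clamp_id: "V \<in> {a (- B)..a B} \<Longrightarrow> clamp V = V"
  by (auto simp: clamp_def)

lemma a0_range: "a 0 \<in> {a (- B)..a B}"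
  using a_mono[of "- B" 0] a_mono[of 0 B] B_pos by auto

lemma \<beta>_a:
  assumes "x \<in> {-B..B}"
  shows "\<beta> (a x) = x"
proof (rule inj_onD[OF a_inj _ \<beta>_range assms])
  have "a x \<in> {a (- B)..a B}" using assms a_image by blast
  then show "a (\<beta> (a x)) = a x" by (simp only: a_\<beta> clamp_id)
qed

text \<open>\<open>H\<close> is smallest at \<open>a 0\<close>, where its derivative
  \<open>\<beta>\<close> vanishes. By convexity, its value at \<open>C = clamp V\<close> exceeds
  this minimum by at least the slope at the midpoint \<open>W\<close> of \<open>a 0\<close> and
  \<open>C\<close> times \<open>C - W\<close>. The slope contributes the power \<open>q\<close>, the
  distance the additional 1, and the midpoint the factors 1/2.\<close>

lemma conjugate_growth:
  assumes q: "0 < q" and c: "0 < c"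
    and lower: "\<And>V. V \<in> {a (- B)..a B} \<Longrightarrow> V \<noteq> a 0 \<Longrightarrow> c * \<bar>V - a 0\<bar> powr q \<le> \<bar>\<beta> V\<bar>"
  shows "c * (\<bar>clamp V - a 0\<bar> / 2) powr (1 + q) \<le> H V - H (a 0)"
proof -
  define C where "C = clamp V"
  define W where "W = (a 0 + C) / 2"
  have b0: "\<beta> (a 0) = 0" using \<beta>_a[of 0] B_pos by simp
  have C: "C \<in> {a (- B)..a B}" unfolding C_def by (rule clamp_range)
  have W: "W \<in> {a (- B)..a B}" using C a0_range by (auto simp: W_def)
  have bC: "\<beta> C = \<beta> V" using clamp_id[OF C] by (simp add: \<beta>_def C_def)
  \<comment> \<open>Beyond the range of \<open>a\<close> the slope of \<open>H\<close> is
    \<open>B\<close> or \<open>- B\<close> and points outwards, so clamping \<open>V\<close> can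
    only lower \<open>H\<close>.\<close>
  have s1: "0 \<le> (V - C) * \<beta> C"
    unfolding bC using clamp_cases[of V] B_pos by (auto simp: C_def zero_le_mult_iff mult_le_0_iff)
  have h1: "H C \<le> H V" using H_increment(1)[where V = C and V' = V] s1 by linarith
  have h2: "(C - W) * \<beta> W \<le> H C - H W" by (rule H_increment)
  have h3: "H (a 0) \<le> H W" using H_increment(1)[where V = "a 0" and V' = W] b0 by simp
  have CW: "C - W = (C - a 0) / 2" "W - a 0 = (C - a 0) / 2" by (auto simp: W_def field_simps)
  show ?thesis
  proof (cases "C = a 0")
    case True
    then show ?thesis using h1 q by (simp add: C_def)
  next
    case False
    have Wne: "W \<noteq> a 0" using False by (simp add: W_def)
    have sgn: "(C - a 0) * \<beta> W = \<bar>C - a 0\<bar> * \<bar>\<beta> W\<bar>"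
    proof -
      have aW: "a (\<beta> W) = W" using a_\<beta>[of W] clamp_id[OF W] by simp
      have "0 < \<beta> W" if "a 0 < W"
      proof (rule ccontr)
        assume "\<not> 0 < \<beta> W"
        then have "a (\<beta> W) \<le> a 0" using \<beta>_range[of W] B_pos by (intro a_mono) auto
        then show False using aW that by simp
      qed
      moreover have "\<beta> W < 0" if "W < a 0"
      proof (rule ccontr)
        assume "\<not> \<beta> W < 0"
        then have "a 0 \<le> a (\<beta> W)" using \<beta>_range[of W] B_pos by (intro a_mono) auto
        then show False using aW that by simp
      qed
      moreover have "(a 0 < W \<longleftrightarrow> a 0 < C)" "(W < a 0 \<longleftrightarrow> C < a 0)" by (auto simp: W_def)
      ultimately show ?thesis using False by (cases "a 0 < C") (auto simp: abs_if algebra_simps)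
    qed
    have "c * (\<bar>C - a 0\<bar> / 2) powr (1 + q) = (\<bar>C - a 0\<bar> / 2) * (c * \<bar>W - a 0\<bar> powr q)"
      using False by (simp add: CW powr_add)
    also have "\<dots> \<le> (\<bar>C - a 0\<bar> / 2) * \<bar>\<beta> W\<bar>" by (intro mult_left_mono lower[OF W Wne]) simp
    also have "\<dots> = (C - W) * \<beta> W" using sgn by (simp add: CW)
    finally show ?thesis using h1 h2 h3 by (simp add: C_def)
  qed
qed

text \<open>An almost optimal \<open>y\<close> for \<open>X\<close> is kept for
  \<open>X + h\<close>: \<open>hopf_lax_upper\<close> at \<open>X + h\<close> minus the almost
  equality at \<open>X\<close> bounds the increment of the potential by
  \<open>T * (H V' - H V)\<close> and a tolerance. Since the clamped \<open>V'\<close> is within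
  \<open>3 * \<rho>\<close> of \<open>a 0\<close>, \<open>upper\<close> bounds the slope by
  \<open>N\<close>.\<close>

lemma decay:
  assumes q: "0 < q" and s: "0 < s" and c: "0 < c" and C': "0 < C'"
    and lower: "\<And>V. V \<in> {a (- B)..a B} \<Longrightarrow> V \<noteq> a 0 \<Longrightarrow> c * \<bar>V - a 0\<bar> powr q \<le> \<bar>\<beta> V\<bar>"
    and upper: "\<And>V. V \<in> {a (- B)..a B} \<Longrightarrow> \<bar>\<beta> V\<bar> \<le> C' * \<bar>V - a 0\<bar> powr s"
  obtains C where "0 < C" "\<And>T. 0 < T \<Longrightarrow> AE x in lborel. \<bar>w T x\<bar> \<le> C / T powr (s / (1 + q))"
proof -
  have mass0: "0 \<le> mass" by (simp add: mass_def)
  \<comment> \<open>Two values of the initial potential, each at most \<open>mass\<close> in size,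
    and the tolerance \<open>\<nu> \<le> 1\<close>.\<close>
  define m where "m = 2 * mass + 1"
  have m: "0 < m" using mass0 by (simp add: m_def)
  define C where "C = C' * 3 powr s * (m / c) powr (s / (1 + q))"
  have C: "0 < C" using C' m c by (simp add: C_def)
  show thesis
  proof (rule that[OF C])
    fix T :: real assume T: "0 < T"
    \<comment> \<open>The radius at which the growth \<open>c * \<rho> powr (1 + q)\<close> equals
      \<open>m / T\<close>.\<close>
    define \<rho> where "\<rho> = (m / (c * T)) powr (1 / (1 + q))"
    have \<rho>: "0 < \<rho>" using m c T by (simp add: \<rho>_def)
    define N where "N = C / T powr (s / (1 + q))"
    have N: "C' * (3 * \<rho>) powr s = N"
    proof -
      have "(3 * \<rho>) powr s = 3 powr s * (m / c / T) powr (s / (1 + q))"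
        using \<rho> by (simp add: powr_mult \<rho>_def powr_powr)
      also have "(m / c / T) powr (s / (1 + q)) = (m / c) powr (s / (1 + q)) / T powr (s / (1 + q))"
        by (rule powr_divide)
      finally show ?thesis by (simp add: N_def C_def)
    qed
    \<comment> \<open>This window for \<open>h\<close> moves the slope by at most
      \<open>\<rho>\<close>; added to the distance \<open>2 * \<rho>\<close> of the clamped
      \<open>V\<close> from \<open>a 0\<close>, it explains the factor 3 in
      \<open>N\<close>.\<close>
    have slope: "potential T (X + h) - potential T X \<le> N * \<bar>h\<bar>" if h: "\<bar>h\<bar> \<le> \<rho> * T" for X h
    proof (rule field_le_epsilon)
      fix e :: real assume e: "0 < e"
      define \<nu> where "\<nu> = min e 1"
      have \<nu>: "0 < \<nu>" "\<nu> \<le> e" "\<nu> \<le> 1" using e by (auto simp: \<nu>_def)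
      obtain y where y: "potential 0 y + T * H ((X - y) / T) \<le> potential T X + \<nu>"
        using hopf_lax_lower[OF T \<nu>(1)] by blast
      define V where "V = (X - y) / T"
      \<comment> \<open>The competitor whose connecting line has slope exactly \<open>a 0\<close>,
        where \<open>H\<close> is minimal.\<close>
      have "potential T X \<le> potential 0 (X - a 0 * T) + T * H (a 0)"
        using hopf_lax_upper[OF T, of X "X - a 0 * T"] T by simp
      then have "T * (H V - H (a 0)) \<le> m"
        using y potential_initial_bound[of y] potential_initial_bound[of "X - a 0 * T"] \<nu>(3)
        unfolding V_def[symmetric] m_def right_diff_distrib by linarith
      then have g: "H V - H (a 0) \<le> m / T" using T by (simp add: le_divide_eq mult.commute)
      have "(\<bar>clamp V - a 0\<bar> / 2) powr (1 + q) \<le> m / (c * T)"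
        using order_trans[OF conjugate_growth[OF q c lower, of V] g] c T by (simp add: field_simps)
      then have "((\<bar>clamp V - a 0\<bar> / 2) powr (1 + q)) powr (1 / (1 + q)) \<le> \<rho>"
        unfolding \<rho>_def using q by (intro powr_mono2) auto
      then have cl: "\<bar>clamp V - a 0\<bar> \<le> 2 * \<rho>"
        using q by (simp add: powr_powr)
      define V' where "V' = V + h / T"
      have V': "(X + h - y) / T = V'" by (simp add: V'_def V_def add_divide_distrib diff_divide_distrib)
      have "\<bar>clamp V' - clamp V\<bar> \<le> \<bar>h / T\<bar>" using clamp_nonexpansive[of V' V] by (simp add: V'_def)
      also have "\<dots> \<le> \<rho>" using h T by (simp add: divide_le_eq)
      finally have "\<bar>clamp V' - a 0\<bar> \<le> 3 * \<rho>" using cl by linarith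
      then have "\<bar>clamp V' - a 0\<bar> powr s \<le> (3 * \<rho>) powr s" using s by (intro powr_mono2) auto
      then have "C' * \<bar>clamp V' - a 0\<bar> powr s \<le> N" unfolding N[symmetric] using C' by (intro mult_left_mono) auto
      moreover have "\<beta> V' = \<beta> (clamp V')" using clamp_id[OF clamp_range, of V'] by (simp add: \<beta>_def)
      ultimately have bN: "\<bar>\<beta> V'\<bar> \<le> N" using upper[OF clamp_range, of V'] by simp
      have "T * (H V' - H V) \<le> T * ((V' - V) * \<beta> V')" using H_increment(2)[of V' V] T by (intro mult_left_mono) auto
      also have "\<dots> = h * \<beta> V'" using T by (simp add: V'_def)
      also have "\<dots> \<le> \<bar>h\<bar> * \<bar>\<beta> V'\<bar>" by (metis abs_ge_self abs_mult)
      also have "\<dots> \<le> \<bar>h\<bar> * N" using bN by (intro mult_left_mono) auto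
      finally have "T * H V' - T * H V \<le> N * \<bar>h\<bar>" by (simp add: right_diff_distrib mult.commute)
      moreover have "potential T (X + h) \<le> potential 0 y + T * H V'" using hopf_lax_upper[OF T, of "X + h" y] unfolding V' .
      ultimately show "potential T (X + h) - potential T X \<le> N * \<bar>h\<bar> + e" using y \<nu>(2) unfolding V_def[symmetric] by linarith
    qed
    have "AE x in lborel. \<bar>w T x\<bar> \<le> N"
    proof (rule AE_bound_of_short_averages[OF w_measurable w_bound])
      show "0 < \<rho> * T" using \<rho> T by simp
      fix x h :: real assume h: "0 < h" "h \<le> \<rho> * T"
      have "(LINT y|lborel. indicator {x..x + h} y * w T y) = potential T (x + h) - potential T x"
        using potential_increment[of T x "x + h"] T h by simp
      \<comment> \<open>The lower estimate is the upper one for \<open>- h\<close> at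
        \<open>x + h\<close>.\<close>
      then show "\<bar>LINT y|lborel. indicator {x..x + h} y * w T y\<bar> \<le> N * h"
        using slope[of h x] slope[of "- h" "x + h"] h by simp
    qed
    then show "AE x in lborel. \<bar>w T x\<bar> \<le> C / T powr (s / (1 + q))" by (simp add: N_def)
  qed
qed

end

section \<open>Decay\<close>

text \<open>By \<open>max_principle\<close> clipping changes \<open>v\<close> on a null set of the
  half plane only, so the entropy inequalities persist. It does not increase distances between
  slices, so continuity in time persists too.\<close>

lemma (in entropy_flow) clip_flow:
  assumes M: "0 < M" and w0: "\<And>x. \<bar>w 0 x\<bar> \<le> M"
  shows "entropy_flow f (\<lambda>z. clip M (v z)) (\<lambda>t x. clip M (w t x)) M"
proof
  show "AE t in lborel. 0 < t \<longrightarrow> (\<lambda>x. clip M (w t x)) = (\<lambda>x. clip M (v (t, x)))"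
    using w_eq_v by eventually_elim (auto simp: fun_eq_iff)
  show "\<bar>clip M (v z)\<bar> \<le> M" "\<bar>clip M (w t x)\<bar> \<le> M" for z t x
    using M by (auto intro: clip_bound)
  fix t R :: real assume t: "0 \<le> t"
  have ind: "integrable lborel (\<lambda>x. indicator {-R..R} x * (2 * B))"
    by (intro integrable_mult_left integrable_real_indicator) (auto simp: emeasure_lborel_Icc_eq)
  show "((\<lambda>\<tau>. LINT x:{-R..R}|lborel. \<bar>clip M (w \<tau> x) - clip M (w t x)\<bar>) \<longlongrightarrow> 0) (at t within {0..})"
  proof (rule Lim_null_comparison[OF always_eventually w_continuous[OF t, of R]], intro allI)
    fix \<tau>
    have i: "integrable lborel (\<lambda>x. indicator {-R..R} x *\<^sub>R \<bar>w \<tau> x - w t x\<bar>)"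
    proof (rule Bochner_Integration.integrable_bound[OF ind])
      show "AE x in lborel. norm (indicator {-R..R} x *\<^sub>R \<bar>w \<tau> x - w t x\<bar>) \<le> norm (indicator {-R..R} x * (2 * B))"
      proof (rule AE_I2)
        fix x show "norm (indicator {-R..R} x *\<^sub>R \<bar>w \<tau> x - w t x\<bar>) \<le> norm (indicator {-R..R} x * (2 * B))"
          using w_bound[of t x] w_bound[of \<tau> x] by (auto simp: indicator_def)
      qed
    qed measurable
    have "norm (LINT x:{-R..R}|lborel. \<bar>clip M (w \<tau> x) - clip M (w t x)\<bar>)
        = (LINT x|lborel. indicator {-R..R} x *\<^sub>R \<bar>clip M (w \<tau> x) - clip M (w t x)\<bar>)"
      unfolding set_lebesgue_integral_def real_norm_def
      by (intro abs_of_nonneg Bochner_Integration.integral_nonneg) simp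
    also have "\<dots> \<le> (LINT x|lborel. indicator {-R..R} x *\<^sub>R \<bar>w \<tau> x - w t x\<bar>)"
      by (rule integral_mono'[OF i]) (auto simp: clip_nonexpansive mult_left_mono)
    finally show "norm (LINT x:{-R..R}|lborel. \<bar>clip M (w \<tau> x) - clip M (w t x)\<bar>) \<le> (LINT x:{-R..R}|lborel. \<bar>w \<tau> x - w t x\<bar>)"
      unfolding set_lebesgue_integral_def .
  qed
next
  fix k \<psi> \<psi>t \<psi>x assume T: "C1_test \<psi> \<psi>t \<psi>x"
  note [measurable] = borel_measurable_continuous_onI[OF C1_test_cont(2)[OF T]] borel_measurable_continuous_onI[OF C1_test_cont(3)[OF T]]
  obtain s R where "0 < s" and supp: "\<And>z. \<not> (s \<le> fst z \<and> norm z \<le> R) \<Longrightarrow> \<psi> z = 0 \<and> \<psi>t z = 0 \<and> \<psi>x z = 0"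
    using C1_test_support[OF T] by blast
  have "0 \<le> (LINT z|lborel. \<bar>v z - k\<bar> * \<psi>t z + sgn (v z - k) * (f (v z) - f k) * \<psi>x z)"
    by (rule entropy[OF T])
  also have "\<dots> = (LINT z|lborel. \<bar>clip M (v z) - k\<bar> * \<psi>t z + sgn (clip M (v z) - k) * (f (clip M (v z)) - f k) * \<psi>x z)"
  proof (rule integral_cong_AE)
    show "AE z in lborel. \<bar>v z - k\<bar> * \<psi>t z + sgn (v z - k) * (f (v z) - f k) * \<psi>x z
      = \<bar>clip M (v z) - k\<bar> * \<psi>t z + sgn (clip M (v z) - k) * (f (clip M (v z)) - f k) * \<psi>x z"
      using max_principle[OF M w0]
    proof eventually_elim
      case (elim z)
      show ?case
      proof (cases "0 < fst z")
        case True
        then show ?thesis using elim clip_id by simp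
      next
        case False
        then show ?thesis using supp[of z] \<open>0 < s\<close> by simp
      qed
    qed
  qed measurable
  finally show "0 \<le> (LINT z|lborel. \<bar>clip M (v z) - k\<bar> * \<psi>t z + sgn (clip M (v z) - k) * (f (clip M (v z)) - f k) * \<psi>x z)" .
qed (use f_lipschitz f_continuous in \<open>auto intro!: measurable_compose[OF _ clip_measurable]\<close>)

section \<open>Increasing \<open>a\<close>, and the reduction to this case\<close>

lemma C1_imp_locally_lipschitz:
  fixes f a :: "real \<Rightarrow> real"
  assumes d: "\<And>x. (f has_real_derivative a x) (at x)" and c: "continuous_on UNIV a"
  shows "\<exists>\<Lambda>\<ge>0. \<forall>x y. \<bar>x\<bar> \<le> R \<longrightarrow> \<bar>y\<bar> \<le> R \<longrightarrow> \<bar>f x - f y\<bar> \<le> \<Lambda> * \<bar>x - y\<bar>"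
proof -
  have "compact (a ` {-R..R})"
    by (intro compact_continuous_image continuous_on_subset[OF c]) auto
  then obtain A where A: "\<And>x. x \<in> {-R..R} \<Longrightarrow> \<bar>a x\<bar> \<le> A"
    using bounded_iff compact_imp_bounded by (metis image_eqI real_norm_def)
  show ?thesis
  proof (intro exI[of _ "max A 0"] conjI allI impI)
    fix x y :: real assume "\<bar>x\<bar> \<le> R" "\<bar>y\<bar> \<le> R"
    then have xy: "x \<in> {-R..R}" "y \<in> {-R..R}" by auto
    have "norm (f x - f y) \<le> max A 0 * norm (x - y)"
      by (rule field_differentiable_bound[of "{-R..R}" f a])
         (use xy A in \<open>auto intro: has_field_derivative_at_within d simp: le_max_iff_disj\<close>)
    then show "\<bar>f x - f y\<bar> \<le> max A 0 * \<bar>x - y\<bar>" by simp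
  qed simp
qed

text \<open>\<open>upper\<close> is the degeneracy condition for pairs with one point 0,
  \<open>lower\<close> the condition on the inverse at \<open>a x\<close>. Substituting
  \<open>V = a x\<close> and \<open>\<beta> V = x\<close> turns them into the bounds that
  \<open>decay\<close> asks for, with \<open>s = 1 / p\<close>.\<close>

lemma entropy_solution_decay_increasing:
  fixes f a u0 :: "real \<Rightarrow> real"
  assumes u: "entropy_solution f u0 u" and M: "0 < M"
    and u0: "integrable lebesgue u0" "AE x in lebesgue. \<bar>u0 x\<bar> \<le> M"
    and f: "\<And>x. (f has_real_derivative a x) (at x)" and a: "continuous_on UNIV a"
    and strict: "\<And>x y. x \<in> {-M..M} \<Longrightarrow> y \<in> {-M..M} \<Longrightarrow> x < y \<Longrightarrow> a x < a y"
    and pq: "0 < p" "0 < q" and c0: "0 < c0" and c: "0 < c"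
    and upper: "\<And>x. x \<in> {-M..M} \<Longrightarrow> c0 * \<bar>x\<bar> powr p \<le> \<bar>a x - a 0\<bar>"
    and lower: "\<And>x. x \<in> {-M..M} \<Longrightarrow> x \<noteq> 0 \<Longrightarrow> c * \<bar>a x - a 0\<bar> powr q \<le> \<bar>x\<bar>"
  shows "\<exists>C>0. \<forall>t>0. AE x in lebesgue. \<bar>u t x\<bar> \<le> C / t powr (1 / p / (1 + q))"
proof -
  have fl: "\<exists>\<Lambda>\<ge>0. \<forall>x y. \<bar>x\<bar> \<le> R \<longrightarrow> \<bar>y\<bar> \<le> R \<longrightarrow> \<bar>f x - f y\<bar> \<le> \<Lambda> * \<bar>x - y\<bar>" for R
    by (rule C1_imp_locally_lipschitz[OF f a])
  have fc: "continuous_on UNIV f" using f by (meson DERIV_isCont continuous_at_imp_continuous_on)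
  have u0m: "u0 \<in> borel_measurable lebesgue" using u0(1) by (rule borel_measurable_integrable)
  have M0: "0 \<le> M" using M by simp
  obtain v w B where flow: "entropy_flow f v w B" and uw: "\<And>t. 0 < t \<Longrightarrow> AE x in lborel. u t x = w t x"
    and u0w: "AE x in lborel. u0 x = w 0 x" and w0: "\<And>x. \<bar>w 0 x\<bar> \<le> M"
    using entropy_solution_imp_entropy_flow[OF u fl fc u0m u0(2) M0] by blast
  interpret E: entropy_flow f v w B by (rule flow)
  \<comment> \<open>Needed at every positive time, so that the clipping can be removed at the
    end.\<close>
  have uM: "AE x in lborel. \<bar>u t x\<bar> \<le> M" if "0 < t" for t
  proof (rule entropy_solution_slice_bound[OF u _ that M0])
    have "AE z in lborel \<Otimes>\<^sub>M lborel. 0 < fst z \<longrightarrow> \<bar>v z\<bar> \<le> M"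
      using E.max_principle[OF M w0] by (simp only: lborel_prod)
    then have "AE t in lborel. AE x in lborel. 0 < fst (t, x) \<longrightarrow> \<bar>v (t, x)\<bar> \<le> M"
      by (rule lborel_pair.AE_pair)
    then show "AE \<tau> in lborel. 0 < \<tau> \<longrightarrow> (AE x in lborel. \<bar>u \<tau> x\<bar> \<le> M)"
      using E.w_eq_v
    proof eventually_elim
      case (elim \<tau>)
      show ?case
      proof
        assume \<tau>: "0 < \<tau>"
        have "AE x in lborel. \<bar>v (\<tau>, x)\<bar> \<le> M" using elim(1) \<tau> by simp
        then show "AE x in lborel. \<bar>u \<tau> x\<bar> \<le> M"
          using uw[OF \<tau>] by eventually_elim (use elim(2) \<tau> in auto)
      qed
    qed
  qed
  let ?v = "\<lambda>z. clip M (v z)" and ?w = "\<lambda>t x. clip M (w t x)"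
  have u0i: "integrable lborel (?w 0)"
  proof -
    have wl: "w 0 \<in> borel_measurable lebesgue" by (rule measurable_completion) simp
    have "integrable lebesgue (w 0)"
      using u0(1) integrable_cong_AE[OF u0m wl AE_completion[OF u0w]] by simp
    then have "integrable lborel (w 0)" by (subst (asm) integrable_completion) auto
    then show ?thesis using w0 by (simp add: clip_id)
  qed
  interpret C: convex_flow f ?v ?w M a
  proof (intro convex_flow.intro integrable_entropy_flow.intro)
    show "entropy_flow f ?v ?w M" by (rule E.clip_flow[OF M w0])
    show "integrable_entropy_flow_axioms ?w" by unfold_locales (rule u0i)
    show "convex_flow_axioms f M a"
      by unfold_locales (use M f a strict in auto)
  qed
  have \<beta>x: "\<exists>x\<in>{-M..M}. V = a x \<and> C.\<beta> V = x" if V: "V \<in> {a (- M)..a M}" for V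
  proof -
    obtain x where x: "x \<in> {-M..M}" "V = a x" using V C.a_image by blast
    then show ?thesis using C.\<beta>_a by blast
  qed
  have s: "0 < 1 / p" using pq by simp
  \<comment> \<open>The constant that results from solving
    \<open>c0 * \<bar>x\<bar> powr p \<le> \<bar>a x - a 0\<bar>\<close> for
    \<open>\<bar>x\<bar>\<close>.\<close>
  define C' where "C' = (1 / c0) powr (1 / p)"
  have C': "0 < C'" using c0 by (simp add: C'_def)
  obtain C where C: "0 < C" "\<And>T. 0 < T \<Longrightarrow> AE x in lborel. \<bar>?w T x\<bar> \<le> C / T powr (1 / p / (1 + q))"
  proof (rule C.decay[OF pq(2) s c C'])
    fix V assume V: "V \<in> {a (- M)..a M}"
    obtain x where x: "x \<in> {-M..M}" "V = a x" "C.\<beta> V = x" using \<beta>x[OF V] by blast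
    show "c * \<bar>V - a 0\<bar> powr q \<le> \<bar>C.\<beta> V\<bar>" if "V \<noteq> a 0"
    proof -
      have "x \<noteq> 0" using that x by auto
      then show ?thesis using lower[OF x(1)] x by simp
    qed
    have "\<bar>x\<bar> powr p \<le> \<bar>a x - a 0\<bar> / c0" using upper[OF x(1)] c0 by (simp add: le_divide_eq mult.commute)
    then have "(\<bar>x\<bar> powr p) powr (1 / p) \<le> (\<bar>a x - a 0\<bar> / c0) powr (1 / p)"
      using pq by (intro powr_mono2) auto
    also have "(\<bar>a x - a 0\<bar> / c0) powr (1 / p) = C' * \<bar>a x - a 0\<bar> powr (1 / p)"
      using powr_mult[of "1 / c0" "\<bar>a x - a 0\<bar>" "1 / p"] by (simp add: C'_def)
    finally show "\<bar>C.\<beta> V\<bar> \<le> C' * \<bar>V - a 0\<bar> powr (1 / p)" using pq x by (simp add: powr_powr)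
  qed blast
  have "AE x in lebesgue. \<bar>u t x\<bar> \<le> C / t powr (1 / p / (1 + q))" if t: "0 < t" for t
    unfolding AE_completion_iff using C(2)[OF t] uw[OF t] uM[OF t]
    by eventually_elim (simp add: clip_id)
  then show ?thesis using C(1) by blast
qed

text \<open>The reflection sends Kruzhkov's constant \<open>k\<close> to \<open>- k\<close> and
  preserves entropies and entropy fluxes. It exchanges concave and convex fluxes.\<close>

lemma entropy_solution_uminus:
  assumes u: "entropy_solution f u0 u"
  shows "entropy_solution (\<lambda>y. - f (- y)) (\<lambda>x. - u0 x) (\<lambda>t x. - u t x)"
  unfolding entropy_solution_def
proof (intro conjI allI impI)
  have "(\<lambda>(t, x). u t x) \<in> borel_measurable (lebesgue_on ({0<..} \<times> UNIV))"
    using u unfolding entropy_solution_def by blast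
  then have "(\<lambda>z. - (case z of (t, x) \<Rightarrow> u t x)) \<in> borel_measurable (lebesgue_on ({0<..} \<times> UNIV))"
    by (rule borel_measurable_uminus)
  then show "(\<lambda>(t, x). - u t x) \<in> borel_measurable (lebesgue_on ({0<..} \<times> UNIV))"
    by (simp add: case_prod_beta')
  show "\<exists>B. AE (t, x) in lebesgue_on ({0<..} \<times> UNIV). \<bar>- u t x\<bar> \<le> B"
    using u unfolding entropy_solution_def by simp
next
  fix t R :: real assume t: "0 < t"
  have "set_integrable lebesgue {-R..R} (u t)" using u t unfolding entropy_solution_def by blast
  then show "set_integrable lebesgue {-R..R} (\<lambda>x. - u t x)"
    unfolding set_integrable_def by simp
  have "((\<lambda>\<tau>. LINT x:{-R..R}|lebesgue. \<bar>u \<tau> x - u t x\<bar>) \<longlongrightarrow> 0) (at t)"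
    using u t unfolding entropy_solution_def by blast
  then show "((\<lambda>\<tau>. LINT x:{-R..R}|lebesgue. \<bar>- u \<tau> x - - u t x\<bar>) \<longlongrightarrow> 0) (at t)"
    by (simp add: abs_minus_commute)
next
  fix R :: real
  have "((\<lambda>\<tau>. LINT x:{-R..R}|lebesgue. \<bar>u \<tau> x - u0 x\<bar>) \<longlongrightarrow> 0) (at_right 0)"
    using u unfolding entropy_solution_def by blast
  then show "((\<lambda>\<tau>. LINT x:{-R..R}|lebesgue. \<bar>- u \<tau> x - - u0 x\<bar>) \<longlongrightarrow> 0) (at_right 0)"
    by (simp add: abs_minus_commute)
next
  fix k \<phi> assume "test_function ({0<..} \<times> UNIV) \<phi> \<and> (\<forall>z. 0 \<le> \<phi> z)"
  then have "kruzhkov_inequality f u (- k) \<phi>" using u unfolding entropy_solution_def by blast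
  moreover have "\<bar>- y - k\<bar> = \<bar>y - - k\<bar>" "sgn (- y - k) * (- f (- (- y)) - - f (- k)) = sgn (y - - k) * (f y - f (- k))" for y :: real
    by (auto simp: sgn_real_def abs_if)
  ultimately show "kruzhkov_inequality (\<lambda>y. - f (- y)) (\<lambda>t x. - u t x) k \<phi>"
    unfolding kruzhkov_inequality_def by simp
qed

text \<open>On the reals \<open>INF\<close> is known to be a lower bound for families bounded below,
  which nonnegativity provides; the infimum itself then serves as \<open>c\<close>.\<close>

lemma pos_INF_E:
  fixes g :: "'a \<Rightarrow> real"
  assumes "0 < (INF x \<in> A. g x)" "A \<noteq> {}" "\<And>x. x \<in> A \<Longrightarrow> 0 \<le> g x"
  obtains c where "0 < c" "\<And>x. x \<in> A \<Longrightarrow> c \<le> g x"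
proof (rule that[OF assms(1)])
  have "bdd_below (g ` A)" using assms(3) by (intro bdd_belowI[of _ 0]) auto
  then show "(INF x \<in> A. g x) \<le> g x" if "x \<in> A" for x by (rule cINF_lower[OF _ that])
qed

theorem theorem4p2:
  fixes M p q s d :: real
    and K :: "real set"
    and f a b u0 :: "real \<Rightarrow> real"
    and u :: "real \<Rightarrow> real \<Rightarrow> real"
  assumes "M > 0"
    and "K = {-M..M}"
    and "integrable lebesgue u0"
    and "AE x in lebesgue. \<bar>u0 x\<bar> \<le> M"
    and "f C1_differentiable_on UNIV"
    and "a = deriv f"
    and "degeneracy f K = ereal p"
    and "0 < (INF (v, w) \<in> {(v, w). v \<in> K \<and> w \<in> K \<and> v \<noteq> w}. \<bar>a v - a w\<bar> / \<bar>v - w\<bar> powr p)"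
    and "s = 1 / p"
    and "entropy_solution f u0 u"
    and "b = the_inv_into K a"
    and "q > 0"
    and "0 < (INF U \<in> a ` K - {a 0}. \<bar>b U\<bar> / \<bar>U - a 0\<bar> powr q)"
    and "d = s / (1 + q)"
  shows "\<exists>C>0. \<forall>t>0. AE x in lebesgue. \<bar>u t x\<bar> \<le> C / t powr d"
proof -
  note M = assms(1) and K = assms(2) and q = assms(12)
  have f: "(f has_real_derivative a x) (at x)" for x
    using assms(5,6) unfolding C1_differentiable_on_eq
    by (metis DERIV_deriv_iff_real_differentiable UNIV_I)
  have ac: "continuous_on UNIV a"
  proof -
    have "vector_derivative f (at x) = a x" for x
      using f[of x] by (simp add: has_real_derivative_iff_has_vector_derivative vector_derivative_at)
    then show ?thesis using assms(5) unfolding C1_differentiable_on_eq by simp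
  qed
  let ?P = "{(v, w). v \<in> K \<and> w \<in> K \<and> v \<noteq> w}"
  have "(M, - M) \<in> ?P" using M by (simp add: K)
  then have ne: "?P \<noteq> {}" by blast
  obtain c0 where c0: "0 < c0" and c0': "\<And>z. z \<in> ?P \<Longrightarrow> c0 \<le> (case z of (v, w) \<Rightarrow> \<bar>a v - a w\<bar> / \<bar>v - w\<bar> powr p)"
    by (rule pos_INF_E[OF assms(8) ne]) auto
  have deg: "c0 * \<bar>v - w\<bar> powr p \<le> \<bar>a v - a w\<bar>" if "v \<in> K" "w \<in> K" "v \<noteq> w" for v w
    using c0'[of "(v, w)"] that by (simp add: le_divide_eq)
  have inj: "inj_on a K"
  proof (rule inj_onI, rule ccontr)
    fix v w assume vw: "v \<in> K" "w \<in> K" "a v = a w" "v \<noteq> w"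
    then have "0 < c0 * \<bar>v - w\<bar> powr p" using c0 by simp
    then show False using deg[OF vw(1,2,4)] vw(3) by simp
  qed
  \<comment> \<open>If \<open>p \<le> 0\<close>, then \<open>\<bar>x\<bar> powr p\<close> is at
    least 1 for small \<open>x\<close>, so \<open>a x\<close> would stay at distance
    \<open>c0\<close> from \<open>a 0\<close>, against continuity.\<close>
  have p: "0 < p"
  proof (rule ccontr)
    assume p: "\<not> 0 < p"
    have "isCont a 0" using ac by (simp add: continuous_on_eq_continuous_at)
    then obtain e where e: "0 < e" "\<And>x. dist x 0 < e \<Longrightarrow> dist (a x) (a 0) < c0"
      using c0 unfolding continuous_at_eps_delta by (auto simp: dist_real_def)
    define x where "x = min (min (e / 2) M) 1"
    have x: "0 < x" "x < e" "x \<le> M" "x \<le> 1" using e M by (auto simp: x_def)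
    have "1 powr p \<le> x powr p" using x p by (intro powr_mono2') auto
    then have "c0 * 1 \<le> c0 * \<bar>x - 0\<bar> powr p" using c0 x by (intro mult_left_mono) auto
    also have "\<dots> \<le> \<bar>a x - a 0\<bar>" using x M by (intro deg) (auto simp: K)
    finally show False using e(2)[of x] x by (simp add: dist_real_def)
  qed
  have zK: "0 \<in> K" using M by (simp add: K)
  have "a M \<noteq> a 0" using inj_onD[OF inj, of M 0] M by (auto simp: K)
  then have ne2: "a ` K - {a 0} \<noteq> {}" using M by (auto simp: K intro!: image_eqI[of _ a M])
  obtain c where c: "0 < c" and c': "\<And>V. V \<in> a ` K - {a 0} \<Longrightarrow> c \<le> \<bar>b V\<bar> / \<bar>V - a 0\<bar> powr q"
    by (rule pos_INF_E[OF assms(13) ne2]) auto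
  have upper: "c0 * \<bar>x\<bar> powr p \<le> \<bar>a x - a 0\<bar>" if "x \<in> K" for x
    using deg[OF that zK] by (cases "x = 0") auto
  have lower: "c * \<bar>a x - a 0\<bar> powr q \<le> \<bar>x\<bar>" if x: "x \<in> K" "x \<noteq> 0" for x
  proof -
    have ne: "a x \<noteq> a 0" using inj_onD[OF inj _ x(1) zK] x(2) by auto
    have "b (a x) = x" unfolding assms(11) by (rule the_inv_into_f_f[OF inj x(1)])
    then show ?thesis using c'[of "a x"] ne x(1) by (simp add: le_divide_eq)
  qed
  \<comment> \<open>A continuous injective function on an interval is strictly monotone; the
    degeneracy condition does not tell in which direction.\<close>
  have "is_interval K" by (simp add: K is_interval_cc)
  from injective_eq_monotone_map[OF this continuous_on_subset[OF ac subset_UNIV]]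
  have mono: "strict_mono_on K a \<or> strict_antimono_on K a" using inj by simp
  have d: "d = 1 / p / (1 + q)" by (simp add: assms(9,14))
  from mono show ?thesis
  proof
    assume "strict_mono_on K a"
    then have st: "\<And>x y. x \<in> {-M..M} \<Longrightarrow> y \<in> {-M..M} \<Longrightarrow> x < y \<Longrightarrow> a x < a y"
      unfolding K by (auto simp: monotone_on_def)
    show ?thesis
      unfolding d
      by (rule entropy_solution_decay_increasing[OF assms(10) M assms(3,4) f ac st p q c0 c])
         (use upper lower in \<open>auto simp: K\<close>)
  next
    \<comment> \<open>The increasing case is applied to \<open>- u\<close>, whose flux has the
      derivative \<open>a (- x)\<close>; both quantitative conditions carry over because
      \<open>K\<close> is symmetric.\<close>
    assume "strict_antimono_on K a"
    then have st: "a (- x) < a (- y)" if "x \<in> {-M..M}" "y \<in> {-M..M}" "x < y" for x y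
      using that unfolding K by (auto simp: monotone_on_def)
    have f': "((\<lambda>y. - f (- y)) has_real_derivative a (- x)) (at x)" for x
      by (auto intro!: derivative_eq_intros DERIV_chain2[OF f])
    have ac': "continuous_on UNIV (\<lambda>x. a (- x))"
      by (rule continuous_on_compose2[OF ac]) (auto intro!: continuous_intros)
    have "\<exists>C>0. \<forall>t>0. AE x in lebesgue. \<bar>- u t x\<bar> \<le> C / t powr (1 / p / (1 + q))"
      by (rule entropy_solution_decay_increasing[OF entropy_solution_uminus[OF assms(10)] M _ _ f' ac' st p q c0 c])
         (use assms(3,4) upper[of "- _"] lower[of "- _"] in \<open>force simp: K\<close>)+
    then show ?thesis unfolding d by simp
  qed
qed

end
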